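(* Let $L>0$ and let $g\in L^2((0,L)\times(0,L);\mathbb{C})$ satisfy $g\in H^1(\mathcal{T}_-)\cap H^1(\mathcal{T}_+)$. Then the control system $$u_t(t,x)-u_x(t,x)=\int_0^L g(x,y)u(t,y)\,dy,\quad u(t,L)=U(t),\quad u(0,x)=u^0(x)$$ is stabilizable in finite time $L$ if and only if it is exactly controllable at time $L$.
   Context: $\mathcal{T}_-=\{(x,y)\in(0,L)^2: x>y\}$, $\mathcal{T}_+=\{(x,y)\in(0,L)^2: x<y\}$; $g\in H^1(\mathcal{T}_-)\cap H^1(\mathcal{T}_+)$ means the restrictions of $g$ to $\mathcal{T}_-$ and to $\mathcal{T}_+$ belong to $H^1$ of these triangles (a jump across the diagonal is allowed). For $T>0$, $u^0\in L^2(0,L)$, $U\in L^2(0,T)$, a (weak) solution of the system on $(0,T)\times(0,L)$ is a function $u\in C^0([0,T];L^2(0,L))$ such that for every $\tau\in[0,T]$ and every $\phi\in C^1([0,\tau]\times[0,L])$ with $\phi(\cdot,0)=0$, $$\int_0^\tau\!\!\int_0^L u(t,x)\overline{\Big(-\phi_t+\phi_x-\int_0^L\overline{g(y,x)}\phi(t,y)dy\Big)}\,dx\,dt+\int_0^L u(\tau,x)\overline{\phi(\tau,x)}dx-\int_0^L u^0\overline{\phi(0,x)}dx-\int_0^\tau U(t)\overline{\phi(t,L)}dt=0;$$ it exists and is unique. The system is exactly controllable at time $T$ if for all $u^0,u^1\in L^2(0,L)$ there is $U\in L^2(0,T)$ whose solution satisfies $u(T)=u^1$. It is stabilizable in finite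 time $T$ if there exists a bounded linear map $\Gamma:L^2(0,L)\to\mathbb{C}$ such that for every $u^0\in L^2(0,L)$ the (unique, well-posed) solution $u\in C^0([0,+\infty);L^2(0,L))$ of the closed-loop system (same equation for $t\in(0,\infty)$ with boundary condition $u(t,L)=\Gamma u(t)$, understood in the same weak sense on every $[0,\tau]$ with $U(t)=\Gamma u(t)$) satisfies $u(t)=0$ for all $t\ge T$. *)

theory Defs
  imports "HOL-Analysis.Analysis"
begin

text \<open>f belongs to L2(S; C): Lebesgue measurable on S and |f|^2 integrable on S.
  Elements of L2 are represented by (pointwise) representatives.\<close>
definition L2_on :: "'a::euclidean_space set \<Rightarrow> ('a \<Rightarrow> complex) \<Rightarrow> bool" where
  "L2_on S f \<longleftrightarrow> f \<in> borel_measurable (lebesgue_on S)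
      \<and> integrable (lebesgue_on S) (\<lambda>x. (cmod (f x))\<^sup>2)"

definition L2_norm_on :: "'a::euclidean_space set \<Rightarrow> ('a \<Rightarrow> complex) \<Rightarrow> real" where
  "L2_norm_on S f = sqrt (integral\<^sup>L (lebesgue_on S) (\<lambda>x. (cmod (f x))\<^sup>2))"

definition pdx :: "(real \<times> real \<Rightarrow> real) \<Rightarrow> real \<times> real \<Rightarrow> real" where
  "pdx f = (\<lambda>p. deriv (\<lambda>s. f (s, snd p)) (fst p))"

definition pdy :: "(real \<times> real \<Rightarrow> real) \<Rightarrow> real \<times> real \<Rightarrow> real" where
  "pdy f = (\<lambda>p. deriv (\<lambda>s. f (fst p, s)) (snd p))"

fun iter_pd :: "bool list \<Rightarrow> (real \<times> real \<Rightarrow> real) \<Rightarrow> real \<times> real \<Rightarrow> real" where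
  "iter_pd [] f = f"
| "iter_pd (b # bs) f = (if b then pdx else pdy) (iter_pd bs f)"

definition smooth2 :: "(real \<times> real \<Rightarrow> real) \<Rightarrow> bool" where
  "smooth2 f \<longleftrightarrow> (\<forall>bs. continuous_on UNIV (iter_pd bs f)
      \<and> (\<forall>p. (\<lambda>s. iter_pd bs f (s, snd p)) differentiable (at (fst p))
            \<and> (\<lambda>s. iter_pd bs f (fst p, s)) differentiable (at (snd p))))"

definition test_fn :: "(real \<times> real) set \<Rightarrow> (real \<times> real \<Rightarrow> real) \<Rightarrow> bool" where
  "test_fn T \<psi> \<longleftrightarrow> smooth2 \<psi> \<and> (\<exists>K. compact K \<and> K \<subseteq> T \<and> (\<forall>p. p \<notin> K \<longrightarrow> \<psi> p = 0))"

definition H1_on :: "(real \<times> real) set \<Rightarrow> (real \<times> real \<Rightarrow> complex) \<Rightarrow> bool" where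
  "H1_on T f \<longleftrightarrow> L2_on T f \<and>
    (\<exists>h1 h2. L2_on T h1 \<and> L2_on T h2 \<and>
      (\<forall>\<psi>. test_fn T \<psi> \<longrightarrow>
         integral\<^sup>L (lebesgue_on T) (\<lambda>p. f p * of_real (pdx \<psi> p))
           = - integral\<^sup>L (lebesgue_on T) (\<lambda>p. h1 p * of_real (\<psi> p))
       \<and> integral\<^sup>L (lebesgue_on T) (\<lambda>p. f p * of_real (pdy \<psi> p))
           = - integral\<^sup>L (lebesgue_on T) (\<lambda>p. h2 p * of_real (\<psi> p))))"

definition tri_minus :: "real \<Rightarrow> (real \<times> real) set" where
  "tri_minus L = {(x, y). 0 < x \<and> x < L \<and> 0 < y \<and> y < L \<and> x > y}"

definition tri_plus :: "real \<Rightarrow> (real \<times> real) set" where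
  "tri_plus L = {(x, y). 0 < x \<and> x < L \<and> 0 < y \<and> y < L \<and> x < y}"

definition C0_L2 :: "real \<Rightarrow> real \<Rightarrow> (real \<Rightarrow> real \<Rightarrow> complex) \<Rightarrow> bool" where
  "C0_L2 L T u \<longleftrightarrow> (\<forall>t\<in>{0..T}. L2_on {0..L} (u t)) \<and>
     (\<forall>t\<in>{0..T}. ((\<lambda>s. integral\<^sup>L (lebesgue_on {0..L}) (\<lambda>x. (cmod (u s x - u t x))\<^sup>2)) \<longlongrightarrow> 0)
                    (at t within {0..T}))"

definition C1_rect :: "real \<Rightarrow> real \<Rightarrow> (real \<Rightarrow> real \<Rightarrow> complex) \<Rightarrow> (real \<Rightarrow> real \<Rightarrow> complex)
    \<Rightarrow> (real \<Rightarrow> real \<Rightarrow> complex) \<Rightarrow> bool" where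
  "C1_rect \<tau> L \<phi> \<phi>t \<phi>x \<longleftrightarrow>
     continuous_on ({0..\<tau>} \<times> {0..L}) (\<lambda>(t, x). \<phi> t x) \<and>
     continuous_on ({0..\<tau>} \<times> {0..L}) (\<lambda>(t, x). \<phi>t t x) \<and>
     continuous_on ({0..\<tau>} \<times> {0..L}) (\<lambda>(t, x). \<phi>x t x) \<and>
     (\<forall>t\<in>{0..\<tau>}. \<forall>x\<in>{0..L}.
        ((\<lambda>s. \<phi> s x) has_vector_derivative \<phi>t t x) (at t within {0..\<tau>}) \<and>
        ((\<lambda>y. \<phi> t y) has_vector_derivative \<phi>x t x) (at x within {0..L}))"

text \<open>Weak solution on (0,T) x (0,L) of u_t - u_x = int_0^L g(x,y) u(t,y) dy,
  u(t,L) = U(t), u(0) = u0.\<close>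
definition weak_sol :: "real \<Rightarrow> (real \<Rightarrow> real \<Rightarrow> complex) \<Rightarrow> real \<Rightarrow> (real \<Rightarrow> complex)
    \<Rightarrow> (real \<Rightarrow> complex) \<Rightarrow> (real \<Rightarrow> real \<Rightarrow> complex) \<Rightarrow> bool" where
  "weak_sol L g T u0 U u \<longleftrightarrow> C0_L2 L T u \<and>
    (\<forall>\<tau>\<in>{0..T}. \<forall>\<phi> \<phi>t \<phi>x. C1_rect \<tau> L \<phi> \<phi>t \<phi>x \<and> (\<forall>t\<in>{0..\<tau>}. \<phi> t 0 = 0) \<longrightarrow>
       integral\<^sup>L (lebesgue_on {0..\<tau>}) (\<lambda>t. integral\<^sup>L (lebesgue_on {0..L}) (\<lambda>x.
           u t x * cnj (- \<phi>t t x + \<phi>x t x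
              - integral\<^sup>L (lebesgue_on {0..L}) (\<lambda>y. cnj (g y x) * \<phi> t y))))
       + integral\<^sup>L (lebesgue_on {0..L}) (\<lambda>x. u \<tau> x * cnj (\<phi> \<tau> x))
       - integral\<^sup>L (lebesgue_on {0..L}) (\<lambda>x. u0 x * cnj (\<phi> 0 x))
       - integral\<^sup>L (lebesgue_on {0..\<tau>}) (\<lambda>t. U t * cnj (\<phi> t L)) = 0)"

definition exactly_controllable :: "real \<Rightarrow> (real \<Rightarrow> real \<Rightarrow> complex) \<Rightarrow> real \<Rightarrow> bool" where
  "exactly_controllable L g T \<longleftrightarrow>
    (\<forall>u0 u1. L2_on {0..L} u0 \<and> L2_on {0..L} u1 \<longrightarrow>
       (\<exists>U u. L2_on {0..T} U \<and> weak_sol L g T u0 U u \<and>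
              (AE x in lebesgue_on {0..L}. u T x = u1 x)))"

definition bdd_lin_L2 :: "real \<Rightarrow> ((real \<Rightarrow> complex) \<Rightarrow> complex) \<Rightarrow> bool" where
  "bdd_lin_L2 L \<Gamma> \<longleftrightarrow>
    (\<forall>f h. L2_on {0..L} f \<and> L2_on {0..L} h \<longrightarrow> \<Gamma> (\<lambda>x. f x + h x) = \<Gamma> f + \<Gamma> h) \<and>
    (\<forall>c f. L2_on {0..L} f \<longrightarrow> \<Gamma> (\<lambda>x. c * f x) = c * \<Gamma> f) \<and>
    (\<exists>C. \<forall>f. L2_on {0..L} f \<longrightarrow> cmod (\<Gamma> f) \<le> C * L2_norm_on {0..L} f)"

definition closed_loop_sol :: "real \<Rightarrow> (real \<Rightarrow> real \<Rightarrow> complex) \<Rightarrow> ((real \<Rightarrow> complex) \<Rightarrow> complex)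
    \<Rightarrow> (real \<Rightarrow> complex) \<Rightarrow> (real \<Rightarrow> real \<Rightarrow> complex) \<Rightarrow> bool" where
  "closed_loop_sol L g \<Gamma> u0 u \<longleftrightarrow> (\<forall>T\<ge>0. weak_sol L g T u0 (\<lambda>t. \<Gamma> (u t)) u)"

definition stabilizable_finite_time :: "real \<Rightarrow> (real \<Rightarrow> real \<Rightarrow> complex) \<Rightarrow> real \<Rightarrow> bool" where
  "stabilizable_finite_time L g T \<longleftrightarrow>
    (\<exists>\<Gamma>. bdd_lin_L2 L \<Gamma> \<and>
      (\<forall>u0. L2_on {0..L} u0 \<longrightarrow>
         (\<exists>u. closed_loop_sol L g \<Gamma> u0 u) \<and>
         (\<forall>u. closed_loop_sol L g \<Gamma> u0 u \<longrightarrow>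
               (\<forall>t\<ge>T. AE x in lebesgue_on {0..L}. u t x = 0))))"

end

theory Submission
  imports Defs
begin

text \<open>Write $F(t,x) = \int_0^L g(x,y) u(t,y)\,dy$. Integrating along the characteristics $t + x = c$
  expresses $u$ through $F$ and the boundary data, so that $F$ solves a fixed point equation
  $F = H + KF$ with a Hilbert-Schmidt operator $K$ on $L^2((0,L)^2)$.

  If the system is stabilizable, a trajectory ending at a given $u^1$ is obtained by solving backwards
  in time (a Volterra equation), and its initial value is corrected by a closed-loop trajectory, which
  vanishes at time $L$.

  Conversely, eliminate the control through the final condition $u(L) = 0$. Exact controllability
  says that $I - K$ is surjective for the resulting $K$, hence, by the Fredholm alternative, invertible.
  So the control steering $u^0$ to $0$ in time $L$ is unique and depends boundedly on $u^0$. Its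
  value at time $0$ is a bounded functional $\Gamma u^0$, because $g(L - s, y)$ is paired with a
  function of $(s,y)$ that is dominated by a square integrable function of $s + y$. Restarting a steered
  trajectory at time $t$ and continuing it by zero gives the steered trajectory from $u(t)$;
  therefore $U(t) = \Gamma u(t)$ and the closed loop vanishes after time $L$. Closed-loop solutions are
  unique by Gronwall's lemma.\<close>

section \<open>Finite rank perturbations of invertible operators\<close>

text \<open>The feedback needs the control at single times, whereas a control is only an L2 class.
  With final state zero the control at time t is minus the integral of F over the line s + x = L +
  t, a null set of the plane, so a representative of F has to be singled out. The fixed point
  equation does this: imposed at every point, it makes F(s, .) the integral of g against the state
  at time s, and \<open>Phi\<close> rewrites the line integral at t = 0 as a double integral that is
  controlled by L2 norms. The equation therefore occurs in two forms: almost everywhere, where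
  linear combinations and operator theory are at work (\<open>admissible\<close>), and everywhere,
  where lines are evaluated (\<open>Phi_exact\<close>, \<open>shift_exact\<close>). All functions
  are extended by zero from the interval or the square. Translations and the shear (s, c) \<mapsto>
  (s, c - s) then preserve the measure, and no domains have to be tracked. The forward, backward and
  controlled problems share one family of line integral operators. They differ only in a weight
  bounded by 1, so a single kernel estimate serves all of them.\<close>

definition bd_invertible :: "('a::real_normed_vector \<Rightarrow> 'a) \<Rightarrow> bool" where
  "bd_invertible T \<longleftrightarrow> bounded_linear T \<and>
     (\<exists>S. bounded_linear S \<and> (\<forall>x. T (S x) = x) \<and> (\<forall>x. S (T x) = x))"

text \<open>The Sherman-Morrison formula: with \<alpha> the preimage of \<open>a\<close>, the
  inverse is S y + b (S y) / (1 - b \<alpha>) \<alpha>.\<close>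

lemma bd_invertible_rank_one_update:
  assumes B: "bd_invertible B" and b: "bounded_linear b" and \<alpha>: "B \<alpha> = a" and ne: "b \<alpha> \<noteq> 1"
  shows "bd_invertible (\<lambda>x. B x - b x *\<^sub>R a)"
proof -
  from B obtain S where S: "bounded_linear S" "\<And>x. B (S x) = x" "\<And>x. S (B x) = x"
    and B': "bounded_linear B" by (auto simp: bd_invertible_def)
  interpret b: bounded_linear b by fact
  interpret S: bounded_linear S by fact
  interpret B: bounded_linear B by fact
  have 1: "bounded_linear (\<lambda>x. B x - b x *\<^sub>R a)"
    by (intro bounded_linear_sub B' bounded_linear_scaleR_const b)
  have bS: "bounded_linear (\<lambda>y. b (S y))"
    using bounded_linear_compose[OF b S(1)] .
  have 2: "bounded_linear (\<lambda>y. S y + (b (S y) / (1 - b \<alpha>)) *\<^sub>R \<alpha>)"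
    by (intro bounded_linear_add S bounded_linear_scaleR_const
        bounded_linear_compose[OF bounded_linear_divide bS])
  have \<alpha>': "S a = \<alpha>" using \<alpha> S by auto
  show ?thesis unfolding bd_invertible_def
  proof (intro conjI 1 exI[of _ "\<lambda>y. S y + (b (S y) / (1 - b \<alpha>)) *\<^sub>R \<alpha>"] 2 allI)
    fix x
    \<comment> \<open>\<open>k\<close> is the value of \<open>b\<close> at the proposed preimage S x
      + k \<alpha>; applying \<open>b\<close> to that expression and solving for \<open>k\<close>
      gives the quotient.\<close>
    define k where "k = b (S x) / (1 - b \<alpha>)"
    have k: "b (S x) + k * b \<alpha> = k"
      using ne by (simp add: k_def field_simps)
    have "b (S x + k *\<^sub>R \<alpha>) = k" by (simp only: b.add b.scaleR real_scaleR_def k)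
    moreover have "B (S x + k *\<^sub>R \<alpha>) = x + k *\<^sub>R a" by (simp only: B.add B.scaleR S \<alpha>)
    ultimately show "B (S x + (b (S x) / (1 - b \<alpha>)) *\<^sub>R \<alpha>)
        - b (S x + (b (S x) / (1 - b \<alpha>)) *\<^sub>R \<alpha>) *\<^sub>R a = x"
      by (simp add: k_def[symmetric])
    have 3: "S (B x - b x *\<^sub>R a) = x - b x *\<^sub>R \<alpha>" by (simp only: S.diff S.scaleR S \<alpha>')
    have "b (x - b x *\<^sub>R \<alpha>) / (1 - b \<alpha>) = b x"
      using ne by (simp add: b.diff b.scaleR field_simps)
    then show "S (B x - b x *\<^sub>R a) + (b (S (B x - b x *\<^sub>R a)) / (1 - b \<alpha>)) *\<^sub>R \<alpha> = x"
      by (simp add: 3)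
  qed
qed

text \<open>Induction on the rank. A rank one term with $b_i(B^{-1}a_i) \neq 1$ can be absorbed into $B$,
  possibly after replacing $b_i$ by $b_i + b_j$ and $a_j$ by $a_j - a_i$. If no term can be
  absorbed, then $b_j(B^{-1}a_i) = \delta_{ij}$, so every $b_j \circ B^{-1}$ vanishes on the range.\<close>
lemma surj_finite_rank_update_imp_bd_invertible:
  fixes B :: "'a::real_normed_vector \<Rightarrow> 'a" and b :: "'i \<Rightarrow> 'a \<Rightarrow> real"
  assumes "finite I" "bd_invertible B" "\<And>i. i \<in> I \<Longrightarrow> bounded_linear (b i)"
    and "surj (\<lambda>x. B x - (\<Sum>i\<in>I. b i x *\<^sub>R a i))"
  shows "bd_invertible (\<lambda>x. B x - (\<Sum>i\<in>I. b i x *\<^sub>R a i))"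
  using assms
proof (induction "card I" arbitrary: I B a b)
  case 0
  then show ?case by simp
next
  case (Suc n)
  from Suc.prems(2) obtain S where S: "bounded_linear S" "\<And>x. B (S x) = x" "\<And>x. S (B x) = x"
    by (auto simp: bd_invertible_def)
  have absorb: "bd_invertible (\<lambda>x. B x - (\<Sum>i\<in>I. b i x *\<^sub>R a i))"
    if i: "i \<in> I" and b': "\<And>i. i \<in> I \<Longrightarrow> bounded_linear (b' i)" and ne: "b' i (S (a' i)) \<noteq> 1"
      and eq: "\<And>x. (\<Sum>i\<in>I. b i x *\<^sub>R a i) = (\<Sum>i\<in>I. b' i x *\<^sub>R a' i)" for i a' b'
  proof -
    have I: "finite (I - {i})" "card (I - {i}) = n" using Suc.hyps Suc.prems i by auto
    have split: "B x - (\<Sum>i\<in>I. b i x *\<^sub>R a i)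
        = (B x - b' i x *\<^sub>R a' i) - (\<Sum>i\<in>I-{i}. b' i x *\<^sub>R a' i)" for x
      unfolding eq by (subst sum.remove[OF Suc.prems(1) i]) simp
    show ?thesis
      unfolding split
      by (rule Suc.hyps(1))
        (use I b' i ne Suc.prems(4) S in
          \<open>auto simp: split intro!: bd_invertible_rank_one_update[OF Suc.prems(2)]\<close>)
  qed
  show ?case
  proof (cases "\<exists>i\<in>I. b i (S (a i)) \<noteq> 1")
    case True
    then show ?thesis using absorb[of _ b a] Suc.prems by blast
  next
    case False
    then have one: "\<And>i. i \<in> I \<Longrightarrow> b i (S (a i)) = 1" by auto
    show ?thesis
    proof (cases "\<exists>i\<in>I. \<exists>j\<in>I. i \<noteq> j \<and> b j (S (a i)) \<noteq> 0")
      case True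
      then obtain i j where ij: "i \<in> I" "j \<in> I" "i \<noteq> j" "b j (S (a i)) \<noteq> 0" by auto
      \<comment> \<open>The value of the i-th functional at S (a i) becomes 1 + b j (S (a i)), which
        differs from 1, and the extra term b j x a i is compensated by the change of
        \<open>a j\<close>.\<close>
      define b' where "b' = b(i := (\<lambda>x. b i x + b j x))"
      define a' where "a' = a(j := a j - a i)"
      have "(\<Sum>i\<in>I. b i x *\<^sub>R a i) = (\<Sum>i\<in>I. b' i x *\<^sub>R a' i)" for x
      proof -
        have rem: "(\<Sum>k\<in>I. h k) = h i + (h j + (\<Sum>k\<in>I-{i}-{j}. h k))" for h :: "'i \<Rightarrow> 'a"
          using ij Suc.prems(1) by (simp add: sum.remove)
        have rest: "(\<Sum>k\<in>I-{i}-{j}. b k x *\<^sub>R a k) = (\<Sum>k\<in>I-{i}-{j}. b' k x *\<^sub>R a' k)"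
          by (intro sum.cong) (auto simp: a'_def b'_def)
        show ?thesis
          using ij by (subst (1 2) rem) (simp add: rest, simp add: a'_def b'_def algebra_simps)
      qed
      moreover have "b' i (S (a' i)) \<noteq> 1"
        using ij one by (auto simp: a'_def b'_def)
      moreover have "\<And>k. k \<in> I \<Longrightarrow> bounded_linear (b' k)"
        using Suc.prems ij by (auto simp: b'_def intro: bounded_linear_add)
      ultimately show ?thesis using absorb[of i b' a'] ij by blast
    next
      case False
      from Suc.hyps(2) obtain j where j: "j \<in> I" by (metis card.empty ex_in_conv nat.distinct(1))
      interpret bj: bounded_linear "b j" using Suc.prems j by auto
      interpret S: bounded_linear S by fact
      have "b j (S (B x - (\<Sum>i\<in>I. b i x *\<^sub>R a i))) = 0" for x
      proof -
        have "b j (S (B x - (\<Sum>i\<in>I. b i x *\<^sub>R a i))) = b j x - (\<Sum>i\<in>I. b i x * b j (S (a i)))"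
          by (simp add: S.diff S.sum S.scaleR S bj.diff bj.sum bj.scaleR)
        also have "(\<Sum>i\<in>I. b i x * b j (S (a i))) = (\<Sum>i\<in>I. if i = j then b j x else 0)"
          using one False j by (intro sum.cong) auto
        also have "\<dots> = b j x" using j Suc.prems(1) by simp
        finally show ?thesis by simp
      qed
      \<comment> \<open>Surjectivity enters here: \<open>a j\<close> lies in the range, on which b j
        \<circ> S vanishes, although b j (S (a j)) = 1.\<close>
      moreover obtain x where "a j = B x - (\<Sum>i\<in>I. b i x *\<^sub>R a i)"
        using surjD[OF Suc.prems(4), of "a j"] by auto
      ultimately have "b j (S (a j)) = 0" by auto
      with one[OF j] show ?thesis by simp
    qed
  qed
qed

text \<open>The fixed point of x \<mapsto> h + E x is the value of the inverse at h. Its uniqueness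
  makes the solution map linear, and 1 / (1 - q) bounds it.\<close>

lemma bd_invertible_contraction:
  fixes E :: "'a::banach \<Rightarrow> 'a"
  assumes E: "bounded_linear E" and q: "0 \<le> q" "q < 1" and le: "\<And>x. norm (E x) \<le> q * norm x"
  shows "bd_invertible (\<lambda>x. x - E x)"
proof -
  interpret E: bounded_linear E by fact
  have ex: "\<exists>!x. h + E x = x" for h
    by (rule banach_fix_type[OF q]) (auto simp: dist_norm E.diff[symmetric] le)
  define S where "S h = (THE x. h + E x = x)" for h
  have S: "h + E (S h) = S h" for h
    unfolding S_def by (rule theI'[OF ex])
  have Suniq: "x = S h" if "h + E x = x" for x h
    using ex[of h] S[of h] that by auto
  have nS: "norm (S h) \<le> norm h * (1 / (1 - q))" for h
  proof -
    have "norm (S h) \<le> norm h + q * norm (S h)"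
      using norm_triangle_ineq[of h "E (S h)"] le[of "S h"] by (simp add: S)
    then show ?thesis using q by (simp add: field_simps)
  qed
  have "bounded_linear S"
  proof (rule bounded_linear_intro)
    show "S (x + y) = S x + S y" for x y
      by (rule Suniq[symmetric]) (metis S E.add add.assoc add.left_commute)
    show "S (r *\<^sub>R x) = r *\<^sub>R S x" for r x
      by (rule Suniq[symmetric]) (metis S E.scaleR scaleR_add_right)
  qed (rule nS)
  moreover have "S h - E (S h) = h" for h using S[of h] by (simp add: algebra_simps)
  moreover have "S (x - E x) = x" for x by (rule Suniq[symmetric]) simp
  moreover have "bounded_linear (\<lambda>x. x - E x)"
    by (intro bounded_linear_sub bounded_linear_ident E)
  ultimately show ?thesis unfolding bd_invertible_def by blast
qed

section \<open>Square integrable functions\<close>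

text \<open>The squared L2 seminorm with values in [0, \<infinity>], so that estimates can be
  chained before finiteness is known; finiteness and measurability are what \<open>sqint\<close>
  adds.\<close>

definition sqn :: "'a measure \<Rightarrow> ('a \<Rightarrow> complex) \<Rightarrow> ennreal" where
  "sqn M f = (\<integral>\<^sup>+x. (ennreal (cmod (f x)))\<^sup>2 \<partial>M)"

definition sqint :: "'a measure \<Rightarrow> ('a \<Rightarrow> complex) \<Rightarrow> bool" where
  "sqint M f \<longleftrightarrow> f \<in> borel_measurable M \<and> sqn M f < top"

definition l2n :: "'a measure \<Rightarrow> ('a \<Rightarrow> complex) \<Rightarrow> real" where
  "l2n M f = sqrt (enn2real (sqn M f))"

lemma ennreal_power2_le_imp_le:
  fixes a b :: ennreal
  shows "a\<^sup>2 \<le> b\<^sup>2 \<Longrightarrow> a \<le> b"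
  by (cases a; cases b) (auto simp: ennreal_power top_unique abs_le_square_iff power_mono_iff)

lemma sqint_measurable[measurable_dest]: "sqint M f \<Longrightarrow> f \<in> borel_measurable M"
  by (simp add: sqint_def)

lemma sqn_cong_AE: "AE x in M. f x = g x \<Longrightarrow> sqn M f = sqn M g"
  unfolding sqn_def by (rule nn_integral_cong_AE) auto

lemma l2n_nonneg[simp]: "0 \<le> l2n M f" by (simp add: l2n_def)

lemma sqn_l2n: "sqint M f \<Longrightarrow> sqn M f = ennreal ((l2n M f)\<^sup>2)"
  by (simp add: l2n_def sqint_def ennreal_enn2real)

lemma l2n_leI: "sqn M f \<le> ennreal (c\<^sup>2) \<Longrightarrow> 0 \<le> c \<Longrightarrow> l2n M f \<le> c"
  unfolding l2n_def by (metis enn2real_leI real_sqrt_le_iff real_sqrt_unique zero_le_power2)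

lemma cauchy_schwarz_cmod:
  assumes [measurable]: "f \<in> borel_measurable M" "g \<in> borel_measurable M"
  shows "(\<integral>\<^sup>+x. ennreal (cmod (f x * g x)) \<partial>M)\<^sup>2 \<le> sqn M f * sqn M g"
  using Cauchy_Schwarz_nn_integral[of "\<lambda>x. ennreal (cmod (f x))" M "\<lambda>x. ennreal (cmod (g x))"]
  by (simp add: sqn_def norm_mult ennreal_mult)

lemma integrable_mult_sqint:
  assumes "sqint M f" "sqint M g"
  shows "integrable M (\<lambda>x. f x * g x)"
proof (rule integrableI_bounded)
  show "(\<lambda>x. f x * g x) \<in> borel_measurable M" using assms by measurable
  have "sqn M f * sqn M g < top" using assms by (auto simp: sqint_def ennreal_mult_less_top)
  then have "(\<integral>\<^sup>+x. ennreal (cmod (f x * g x)) \<partial>M)\<^sup>2 < top"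
    using cauchy_schwarz_cmod[of f M g] assms by (auto simp: sqint_def intro: le_less_trans)
  then show "(\<integral>\<^sup>+x. ennreal (cmod (f x * g x)) \<partial>M) < \<infinity>"
    by (auto simp: power_less_top_ennreal)
qed

text \<open>The Bochner integral of a non-integrable function is 0 by convention, so the bound is
  unconditional. This keeps the operator estimates below free of integrability side
  conditions.\<close>

lemma norm_integral_le_nn:
  "ennreal (cmod (\<integral>x. f x \<partial>M)) \<le> (\<integral>\<^sup>+x. ennreal (cmod (f x)) \<partial>M)"
  by (cases "integrable M f") (auto intro: integral_norm_bound_ennreal simp: not_integrable_integral_eq)

lemma integral_mult_sq_le:
  assumes "f \<in> borel_measurable M" "g \<in> borel_measurable M"
  shows "(ennreal (cmod (\<integral>x. f x * g x \<partial>M)))\<^sup>2 \<le> sqn M f * sqn M g"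
proof -
  have "(ennreal (cmod (\<integral>x. f x * g x \<partial>M)))\<^sup>2 \<le> (\<integral>\<^sup>+x. ennreal (cmod (f x * g x)) \<partial>M)\<^sup>2"
    by (intro power_mono norm_integral_le_nn) simp
  then show ?thesis using cauchy_schwarz_cmod[OF assms] by (rule order_trans)
qed

lemma sqn_scale: "f \<in> borel_measurable M \<Longrightarrow> sqn M (\<lambda>x. c * f x) = ennreal ((cmod c)\<^sup>2) * sqn M f"
  by (simp add: sqn_def norm_mult ennreal_mult power_mult_distrib nn_integral_cmult ennreal_power)

lemma sqint_scale: "sqint M f \<Longrightarrow> sqint M (\<lambda>x. c * f x)"
  using sqn_scale[of f M c] by (auto simp: sqint_def ennreal_mult_less_top)

lemma sqn_zero[simp]: "sqn M (\<lambda>x. 0) = 0" by (simp add: sqn_def)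

lemma sqint_zero[simp]: "sqint M (\<lambda>x. 0)" by (simp add: sqint_def)

lemma sqn_minus[simp]: "sqn M (\<lambda>x. - f x) = sqn M f" by (simp add: sqn_def)

lemma sqint_minus: "sqint M f \<Longrightarrow> sqint M (\<lambda>x. - f x)" by (simp add: sqint_def)

lemma sqn_mono:
  "(\<And>x. cmod (f x) \<le> cmod (g x)) \<Longrightarrow> sqn M f \<le> sqn M g"
  unfolding sqn_def by (intro nn_integral_mono power_mono ennreal_leI) auto

lemma sqint_mono:
  "f \<in> borel_measurable M \<Longrightarrow> sqint M g \<Longrightarrow> (\<And>x. cmod (f x) \<le> cmod (g x)) \<Longrightarrow> sqint M f"
  using sqn_mono[of f g M] by (auto simp: sqint_def intro: le_less_trans)

lemma ennreal_cmod_add_sq: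
  "(ennreal (cmod (a + b)))\<^sup>2 \<le> 2 * (ennreal (cmod a))\<^sup>2 + 2 * (ennreal (cmod b))\<^sup>2"
proof -
  have "(cmod (a + b))\<^sup>2 \<le> (cmod a + cmod b)\<^sup>2"
    by (intro power_mono norm_triangle_ineq) auto
  also have "\<dots> \<le> 2 * (cmod a)\<^sup>2 + 2 * (cmod b)\<^sup>2"
    using sum_squares_bound[of "cmod a" "cmod b"] by (simp add: power2_sum)
  finally have "ennreal ((cmod (a + b))\<^sup>2) \<le> ennreal (2 * (cmod a)\<^sup>2 + 2 * (cmod b)\<^sup>2)"
    by (rule ennreal_leI)
  then show ?thesis by (simp add: ennreal_power ennreal_mult ennreal_plus)
qed

lemma sqn_add_le:
  assumes [measurable]: "f \<in> borel_measurable M" "g \<in> borel_measurable M"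
  shows "sqn M (\<lambda>x. f x + g x) \<le> 2 * sqn M f + 2 * sqn M g"
proof -
  have "sqn M (\<lambda>x. f x + g x)
      \<le> (\<integral>\<^sup>+x. 2 * (ennreal (cmod (f x)))\<^sup>2 + 2 * (ennreal (cmod (g x)))\<^sup>2 \<partial>M)"
    unfolding sqn_def by (intro nn_integral_mono ennreal_cmod_add_sq)
  then show ?thesis by (simp add: sqn_def nn_integral_add nn_integral_cmult)
qed

lemma sqn_diff_le:
  assumes [measurable]: "f \<in> borel_measurable M" "g \<in> borel_measurable M"
  shows "sqn M (\<lambda>x. f x - g x) \<le> 2 * sqn M f + 2 * sqn M g"
  using sqn_add_le[of f M "\<lambda>x. - g x"] by simp

lemma sqint_add:
  assumes "sqint M f" "sqint M g" shows "sqint M (\<lambda>x. f x + g x)"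
proof -
  have "2 * sqn M f + 2 * sqn M g < top" using assms by (auto simp: sqint_def ennreal_mult_less_top)
  with sqn_add_le[of f M g] assms show ?thesis by (auto simp: sqint_def intro: le_less_trans)
qed

lemma sqint_diff: "sqint M f \<Longrightarrow> sqint M g \<Longrightarrow> sqint M (\<lambda>x. f x - g x)"
  using sqint_add[of M f "\<lambda>x. - g x"] sqint_minus[of M g] by simp

lemma l2n_triangle:
  assumes f: "sqint M f" and g: "sqint M g"
  shows "l2n M (\<lambda>x. f x + g x) \<le> l2n M f + l2n M g"
proof (rule l2n_leI)
  have [measurable]: "f \<in> borel_measurable M" "g \<in> borel_measurable M" using f g by (auto simp: sqint_def)
  have CS: "(\<integral>\<^sup>+x. ennreal (cmod (f x * g x)) \<partial>M) \<le> ennreal (l2n M f * l2n M g)"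
  proof -
    have "(\<integral>\<^sup>+x. ennreal (cmod (f x * g x)) \<partial>M)\<^sup>2 \<le> (ennreal (l2n M f * l2n M g))\<^sup>2"
      using cauchy_schwarz_cmod[of f M g] f g
      by (simp add: sqn_l2n ennreal_power power_mult_distrib ennreal_mult)
    then show ?thesis by (rule ennreal_power2_le_imp_le)
  qed
  have "sqn M (\<lambda>x. f x + g x) \<le> (\<integral>\<^sup>+x. (ennreal (cmod (f x)))\<^sup>2 + 2 * ennreal (cmod (f x * g x)) + (ennreal (cmod (g x)))\<^sup>2 \<partial>M)"
    unfolding sqn_def
  proof (intro nn_integral_mono)
    fix x
    have "(cmod (f x + g x))\<^sup>2 \<le> (cmod (f x) + cmod (g x))\<^sup>2"
      by (intro power_mono norm_triangle_ineq) auto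
    also have "\<dots> = (cmod (f x))\<^sup>2 + 2 * cmod (f x * g x) + (cmod (g x))\<^sup>2"
      by (simp add: power2_sum norm_mult)
    finally have "ennreal ((cmod (f x + g x))\<^sup>2) \<le> ennreal ((cmod (f x))\<^sup>2 + 2 * cmod (f x * g x) + (cmod (g x))\<^sup>2)"
      by (rule ennreal_leI)
    then show "(ennreal (cmod (f x + g x)))\<^sup>2 \<le> (ennreal (cmod (f x)))\<^sup>2 + 2 * ennreal (cmod (f x * g x)) + (ennreal (cmod (g x)))\<^sup>2"
      by (simp add: ennreal_power ennreal_mult ennreal_plus)
  qed
  also have "\<dots> = sqn M f + 2 * (\<integral>\<^sup>+x. ennreal (cmod (f x * g x)) \<partial>M) + sqn M g"
    by (simp add: sqn_def nn_integral_add nn_integral_cmult)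
  also have "\<dots> \<le> sqn M f + 2 * ennreal (l2n M f * l2n M g) + sqn M g"
    using CS by (intro add_mono mult_left_mono) auto
  also have "\<dots> = ennreal ((l2n M f + l2n M g)\<^sup>2)"
    using f g by (simp add: sqn_l2n power2_sum ennreal_plus ennreal_mult mult.assoc)
  finally show "sqn M (\<lambda>x. f x + g x) \<le> ennreal ((l2n M f + l2n M g)\<^sup>2)" .
qed simp

text \<open>The weights 4^n are chosen against the decay 8^-n: the sum of 4^n |d_n|^2 has a finite
  integral, so it has a finite value c almost everywhere. There |d_n| is at most sqrt c 2^-n, and
  the telescoping series converges.\<close>

lemma AE_convergent_of_fast_L2_Cauchy:
  fixes f :: "nat \<Rightarrow> 'a \<Rightarrow> complex"
  assumes [measurable]: "\<And>n. f n \<in> borel_measurable M"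
    and fast: "\<And>n. sqn M (\<lambda>x. f (Suc n) x - f n x) \<le> ennreal ((1/8)^n)"
  shows "AE x in M. convergent (\<lambda>n. f n x)"
proof -
  define d where "d n x = f (Suc n) x - f n x" for n x
  have [measurable]: "\<And>n. d n \<in> borel_measurable M" unfolding d_def[abs_def] by measurable
  have "(\<integral>\<^sup>+x. (\<Sum>n. ennreal (4^n) * (ennreal (cmod (d n x)))\<^sup>2) \<partial>M)
      = (\<Sum>n. ennreal (4^n) * sqn M (d n))"
    by (subst nn_integral_suminf) (simp_all add: nn_integral_cmult sqn_def)
  also have "\<dots> \<le> (\<Sum>n. ennreal ((1/2)^n))"
  proof (intro suminf_le)
    fix n
    have "ennreal (4^n) * sqn M (d n) \<le> ennreal (4^n) * ennreal ((1/8)^n)"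
      using fast[of n] unfolding d_def by (intro mult_left_mono) auto
    also have "\<dots> = ennreal ((4 * (1/8))^n)"
      by (simp only: ennreal_mult[symmetric] power_mult_distrib zero_le_power zero_le_numeral zero_le_divide_1_iff)
    finally show "ennreal (4^n) * sqn M (d n) \<le> ennreal ((1/2)^n)" by simp
  qed auto
  also have "\<dots> = ennreal (\<Sum>n. (1/2)^n)"
    by (rule suminf_ennreal2) (auto intro: summable_geometric)
  also have "\<dots> < \<infinity>" by simp
  finally have "AE x in M. (\<Sum>n. ennreal (4^n) * (ennreal (cmod (d n x)))\<^sup>2) \<noteq> \<infinity>"
    by (intro nn_integral_noteq_infinite) auto
  then show ?thesis
  proof eventually_elim
    case (elim x)
    define C where "C = (\<Sum>n. ennreal (4^n) * (ennreal (cmod (d n x)))\<^sup>2)"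
    obtain c where c: "C = ennreal c" "0 \<le> c" using elim unfolding C_def[symmetric] by (cases C) auto
    have "cmod (d n x) \<le> sqrt c * (1/2)^n" for n
    proof -
      have "ennreal (4^n) * (ennreal (cmod (d n x)))\<^sup>2 \<le> C"
        unfolding C_def using sum_le_suminf[of "\<lambda>n. ennreal (4^n) * (ennreal (cmod (d n x)))\<^sup>2" "{n}"] by simp
      then have "ennreal (4^n * (cmod (d n x))\<^sup>2) \<le> ennreal c"
        by (simp add: c ennreal_mult ennreal_power)
      then have "4^n * (cmod (d n x))\<^sup>2 \<le> c" using c by simp
      then have "(2^n * cmod (d n x))\<^sup>2 \<le> c"
        by (simp add: power_mult_distrib power_mult[symmetric] mult.commute[of n] power_mult)
      then have "2^n * cmod (d n x) \<le> sqrt c" by (rule real_le_rsqrt)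
      then show ?thesis by (simp add: field_simps)
    qed
    then have "summable (\<lambda>n. d n x)"
      by (intro summable_comparison_test[OF _ summable_mult[OF summable_geometric[of "1/2::real"], of "sqrt c"]]) auto
    then have "convergent (\<lambda>n. f 0 x + (\<Sum>k<n. d k x))"
      by (intro convergent_add convergent_const) (simp add: summable_iff_convergent)
    moreover have "f 0 x + (\<Sum>k<n. d k x) = f n x" for n
      unfolding d_def by (subst sum_lessThan_telescope) simp
    ultimately show ?case by simp
  qed
qed

lemma sqn_Fatou:
  assumes [measurable]: "\<And>n. f n \<in> borel_measurable M" "h \<in> borel_measurable M"
    and lim: "AE x in M. (\<lambda>n. f n x) \<longlonglongrightarrow> h x"
    and le: "\<And>n. n \<ge> N \<Longrightarrow> sqn M (f n) \<le> C"
  shows "sqn M h \<le> C"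
proof -
  have "sqn M h = (\<integral>\<^sup>+x. liminf (\<lambda>n. (ennreal (cmod (f n x)))\<^sup>2) \<partial>M)"
    unfolding sqn_def
  proof (rule nn_integral_cong_AE, use lim in eventually_elim)
    case (elim x)
    then have "(\<lambda>n. ennreal ((cmod (f n x))\<^sup>2)) \<longlonglongrightarrow> ennreal ((cmod (h x))\<^sup>2)"
      by (intro tendsto_intros tendsto_ennrealI)
    then have "liminf (\<lambda>n. ennreal ((cmod (f n x))\<^sup>2)) = ennreal ((cmod (h x))\<^sup>2)"
      by (intro lim_imp_Liminf) auto
    then show ?case by (simp add: ennreal_power)
  qed
  also have "\<dots> \<le> liminf (\<lambda>n. sqn M (f n))"
    unfolding sqn_def by (rule nn_integral_liminf) measurable
  also have "\<dots> \<le> C"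
    by (intro Liminf_le) (auto intro!: eventually_sequentiallyI[of N] le)
  finally show ?thesis .
qed

text \<open>Riesz-Fischer for sequences with a prescribed rate. Fatou carries the rate over to the
  limit; a general Cauchy sequence is reduced to this case by passing to a subsequence.\<close>

lemma L2_complete:
  fixes f :: "nat \<Rightarrow> 'a \<Rightarrow> complex"
  assumes f: "\<And>n. sqint M (f n)"
    and cau: "\<And>n m. n \<le> m \<Longrightarrow> sqn M (\<lambda>x. f m x - f n x) \<le> ennreal ((1/8)^n)"
  shows "\<exists>h. sqint M h \<and> (\<forall>n. sqn M (\<lambda>x. h x - f n x) \<le> ennreal ((1/8)^n))"
proof -
  have [measurable]: "f n \<in> borel_measurable M" for n using f by measurable
  define h where "h x = lim (\<lambda>n. f n x)" for x
  have [measurable]: "h \<in> borel_measurable M"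
    unfolding h_def[abs_def] by measurable
  have "AE x in M. convergent (\<lambda>n. f n x)"
    by (rule AE_convergent_of_fast_L2_Cauchy) (auto intro: cau)
  then have lim: "AE x in M. (\<lambda>n. f n x) \<longlonglongrightarrow> h x"
    by eventually_elim (simp add: h_def convergent_LIMSEQ_iff)
  have *: "sqn M (\<lambda>x. h x - f n x) \<le> ennreal ((1/8)^n)" for n
  proof (rule sqn_Fatou[where f="\<lambda>m x. f m x - f n x" and N=n])
    show "AE x in M. (\<lambda>m. f m x - f n x) \<longlonglongrightarrow> h x - f n x"
      using lim by eventually_elim (intro tendsto_intros)
  qed (auto intro: cau)
  have "sqint M (\<lambda>x. h x - f 0 x)" using *[of 0] by (auto simp: sqint_def intro: le_less_trans)
  from sqint_add[OF this f[of 0]] * show ?thesis by auto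
qed

lemma sqn_dominated_tendsto:
  assumes [measurable]: "\<And>n. f n \<in> borel_measurable M" and h: "sqint M h"
    and lim: "\<And>x. x \<in> space M \<Longrightarrow> (\<lambda>n. f n x) \<longlonglongrightarrow> 0"
    and le: "\<And>n x. x \<in> space M \<Longrightarrow> cmod (f n x) \<le> cmod (h x)"
  shows "(\<lambda>n. sqn M (f n)) \<longlonglongrightarrow> 0"
proof -
  have [measurable]: "h \<in> borel_measurable M" using h by measurable
  have "(\<lambda>n. \<integral>\<^sup>+x. (ennreal (cmod (f n x)))\<^sup>2 \<partial>M) \<longlonglongrightarrow> (\<integral>\<^sup>+x. 0 \<partial>M)"
  proof (rule nn_integral_dominated_convergence[where w="\<lambda>x. (ennreal (cmod (h x)))\<^sup>2"])
    show "(\<integral>\<^sup>+x. (ennreal (cmod (h x)))\<^sup>2 \<partial>M) < \<infinity>" using h by (simp add: sqint_def sqn_def)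
    show "AE x in M. (\<lambda>n. (ennreal (cmod (f n x)))\<^sup>2) \<longlonglongrightarrow> 0"
    proof (intro AE_I2)
      fix x assume "x \<in> space M"
      then have "(\<lambda>n. ennreal ((cmod (f n x))\<^sup>2)) \<longlonglongrightarrow> ennreal ((cmod 0)\<^sup>2)"
        by (intro tendsto_intros tendsto_ennrealI lim)
      then show "(\<lambda>n. (ennreal (cmod (f n x)))\<^sup>2) \<longlonglongrightarrow> 0" by (simp add: ennreal_power)
    qed
  qed (auto intro!: AE_I2 power_mono ennreal_leI le)
  then show ?thesis by (simp add: sqn_def)
qed

lemma sqint_indicator:
  "A \<in> sets M \<Longrightarrow> emeasure M A < \<infinity> \<Longrightarrow> sqint M (\<lambda>x. indicator A x)"
proof -
  assume A: "A \<in> sets M" "emeasure M A < \<infinity>"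
  have "sqn M (\<lambda>x. indicator A x) = (\<integral>\<^sup>+x. indicator A x \<partial>M)"
    unfolding sqn_def by (intro nn_integral_cong) (auto split: split_indicator)
  with A show ?thesis by (auto simp: sqint_def)
qed

text \<open>Dynkin's lemma for $L^2$: linear combinations of indicators of sets in a generating
  $\cap$-stable family are dense.\<close>
lemma sqint_induct:
  fixes P :: "('a \<Rightarrow> complex) \<Rightarrow> bool"
  assumes E: "Int_stable E" "E \<subseteq> Pow (space M)" "sets M = sigma_sets (space M) E"
    and A: "\<And>n. A n \<in> E" "incseq A" "(\<Union>n. A n) = space M" "\<And>n. emeasure M (A n) < \<infinity>"
    and ind: "\<And>B. B \<in> E \<Longrightarrow> emeasure M B < \<infinity> \<Longrightarrow> P (\<lambda>x. indicator B x)"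
    and add: "\<And>f g. sqint M f \<Longrightarrow> sqint M g \<Longrightarrow> P f \<Longrightarrow> P g \<Longrightarrow> P (\<lambda>x. f x + g x)"
    and scale: "\<And>c f. sqint M f \<Longrightarrow> P f \<Longrightarrow> P (\<lambda>x. c * f x)"
    and lim: "\<And>f. sqint M f \<Longrightarrow>
        (\<And>\<epsilon>. \<epsilon> > 0 \<Longrightarrow> \<exists>h. sqint M h \<and> P h \<and> sqn M (\<lambda>x. f x - h x) < \<epsilon>) \<Longrightarrow> P f"
    and f: "sqint M f"
  shows "P f"
proof -
  \<comment> \<open>Dominated pointwise convergence implies convergence in L2, so closedness of
    \<open>P\<close> can be applied to pointwise limits.\<close>
  have lim': "P f" if f: "sqint M f" and h: "\<And>n. sqint M (h n)" "\<And>n. P (h n)"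
    and dom: "\<And>n x. x \<in> space M \<Longrightarrow> cmod (f x - h n x) \<le> cmod (k x)" "sqint M k"
    and conv: "\<And>x. x \<in> space M \<Longrightarrow> (\<lambda>n. h n x) \<longlonglongrightarrow> f x" for f h k
  proof (rule lim[OF f])
    fix \<epsilon> :: ennreal assume \<epsilon>: "\<epsilon> > 0"
    have "(\<lambda>n. sqn M (\<lambda>x. f x - h n x)) \<longlonglongrightarrow> 0"
    proof (rule sqn_dominated_tendsto[OF _ dom(2)])
      show "(\<lambda>x. f x - h n x) \<in> borel_measurable M" for n
        using f h by (intro borel_measurable_diff sqint_measurable)
      show "(\<lambda>n. f x - h n x) \<longlonglongrightarrow> 0" if "x \<in> space M" for x
        using tendsto_diff[OF tendsto_const[of "f x"] conv[OF that]] by simp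
    qed (rule dom)
    then have "\<forall>\<^sub>F n in sequentially. sqn M (\<lambda>x. f x - h n x) < \<epsilon>"
      using \<epsilon> by (rule order_tendstoD)
    then obtain n where "sqn M (\<lambda>x. f x - h n x) < \<epsilon>"
      by (auto simp: eventually_sequentially)
    with h show "\<exists>h. sqint M h \<and> P h \<and> sqn M (\<lambda>x. f x - h x) < \<epsilon>" by blast
  qed
  have P0: "P (\<lambda>x. 0)"
    using scale[OF sqint_indicator[of "A 0"] ind[of "A 0"], of 0] A E(3) by auto
  have Asets[measurable]: "A n \<in> sets M" for n using A(1) E(3) by auto
  have fin: "sqint M (\<lambda>x. indicator (B \<inter> A n) x)" if "B \<in> sets M" for B n
    using that A(4)[of n]
    by (intro sqint_indicator) (auto intro: le_less_trans[OF emeasure_mono])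
  \<comment> \<open>The Dynkin argument is run for the traces on a fixed \<open>A n\<close>, because
    a measurable set may have infinite measure and then no square integrable indicator.\<close>
  have sets: "P (\<lambda>x. indicator (B \<inter> A n) x)" if B: "B \<in> sets M" for B n
  proof -
    have "B \<in> sigma_sets (space M) E" using B E by simp
    from E(1,2) this show ?thesis
    proof (induction rule: sigma_sets_induct_disjoint)
      case (basic B)
      then have "B \<inter> A n \<in> E" using E(1) A(1) by (auto simp: Int_stable_def)
      moreover have "emeasure M (B \<inter> A n) < \<infinity>"
        by (rule le_less_trans[OF emeasure_mono A(4)[of n]]) auto
      ultimately show ?case by (rule ind)
    next
      case empty
      then show ?case using P0 by simp
    next
      case (compl B)
      have B: "B \<in> sets M" using compl E by simp
      have "P (\<lambda>x. indicator (A n) x + (-1) * indicator (B \<inter> A n) x)"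
        by (rule add[OF sqint_indicator[OF Asets A(4)] sqint_scale[OF fin[OF B]]
              ind[OF A(1) A(4)] scale[OF fin[OF B] compl.IH]])
      also have "(\<lambda>x. indicator (A n) x + (-1) * indicator (B \<inter> A n) x)
          = (\<lambda>x. indicator ((space M - B) \<inter> A n) x :: complex)"
        using sets.sets_into_space[OF Asets, of n] by (auto simp: fun_eq_iff split: split_indicator)
      finally show ?case .
    next
      case (union F)
      have F[measurable]: "F i \<in> sets M" for i using union E by auto
      define h :: "nat \<Rightarrow> 'a \<Rightarrow> complex" where "h m x = (\<Sum>i<m. indicator (F i \<inter> A n) x)" for m x
      have hs: "sqint M (h m) \<and> P (h m)" for m
      proof (induction m)
        case 0 then show ?case by (simp add: h_def[abs_def] P0)
      next
        case (Suc m)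
        have "h (Suc m) = (\<lambda>x. h m x + indicator (F m \<inter> A n) x)" by (auto simp: h_def)
        then show ?case using Suc union.IH fin[OF F] by (auto intro!: sqint_add add)
      qed
      have heq: "h m x = indicator ((\<Union>i<m. F i) \<inter> A n) x" for m x
      proof -
        have "h m x = (\<Sum>i<m. indicator (F i) x) * indicator (A n) x"
          by (simp add: h_def sum_distrib_right indicator_inter_arith)
        also have "(\<Sum>i<m. indicator (F i) x) = (indicator (\<Union>i<m. F i) x :: complex)"
          using union.hyps by (intro indicator_UN_disjoint[symmetric])
            (auto simp: disjoint_family_on_def)
        finally show ?thesis by (simp add: indicator_inter_arith)
      qed
      show ?case
      proof (rule lim'[of _ h "indicator (A n)"])
        show "sqint M (\<lambda>x. indicator ((\<Union>i. F i) \<inter> A n) x)" by (rule fin) auto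
        show "sqint M (h m)" "P (h m)" for m using hs by auto
        show "cmod (indicator ((\<Union>i. F i) \<inter> A n) x - h m x) \<le> cmod (indicator (A n) x)" for m x
          unfolding heq by (auto split: split_indicator)
        show "sqint M (indicator (A n))" using A by (intro sqint_indicator) auto
        show "(\<lambda>m. h m x) \<longlonglongrightarrow> indicator ((\<Union>i. F i) \<inter> A n) x" for x
          unfolding heq
          using LIMSEQ_indicator_UN[of "\<lambda>i. F i \<inter> A n" x] by (simp add: Int_UN_distrib2 )
      qed
    qed
  qed
  have simple: "sqint M (\<lambda>x. s x * indicator (A n) x) \<and> P (\<lambda>x. s x * indicator (A n) x)"
    if s: "simple_function M s" for s n
  proof -
    define D where "D c x = (indicator ((s -` {c} \<inter> space M) \<inter> A n) x :: complex)" for c x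
    have D: "sqint M (D c)" "P (D c)" for c
      unfolding D_def[abs_def] using simple_functionD(2)[OF s, of "{c}"] by (blast intro: fin sets)+
    have *: "sqint M (\<lambda>x. \<Sum>c\<in>S. c * D c x) \<and> P (\<lambda>x. \<Sum>c\<in>S. c * D c x)" if "finite S" for S
      using that
    proof (induction S)
      case empty
      then show ?case using P0 by simp
    next
      case (insert c S)
      have "(\<lambda>x. \<Sum>c\<in>insert c S. c * D c x) = (\<lambda>x. c * D c x + (\<Sum>c\<in>S. c * D c x))"
        by (simp only: sum.insert[OF insert.hyps])
      then show ?case
        using sqint_add[OF sqint_scale[OF D(1)] conjunct1[OF insert.IH], of c c]
          add[OF sqint_scale[OF D(1)] conjunct1[OF insert.IH] scale[OF D] conjunct2[OF insert.IH], of c c]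
        by (simp only:)
    qed
    have "(\<Sum>c\<in>s ` space M. c * D c x) = s x * indicator (A n) x" for x
    proof (cases "x \<in> A n")
      case True
      then have x: "x \<in> space M" using sets.sets_into_space[OF Asets] by auto
      then have "(\<Sum>c\<in>s ` space M. c * D c x) = (\<Sum>c\<in>s ` space M. if c = s x then s x else 0)"
        using True by (intro sum.cong) (auto simp: D_def split: split_indicator)
      also have "\<dots> = s x" using x simple_functionD(1)[OF s] by simp
      finally show ?thesis using True by simp
    qed (simp add: D_def)
    then have "(\<lambda>x. \<Sum>c\<in>s ` space M. c * D c x) = (\<lambda>x. s x * indicator (A n) x)" by auto
    with *[OF simple_functionD(1)[OF s]] show ?thesis by (simp only:)
  qed
  have fm: "f \<in> borel_measurable M" using f by measurable
  obtain s where s: "\<forall>i. simple_function M (s i)"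
    and slim: "\<forall>x\<in>space M. (\<lambda>i. s i x) \<longlonglongrightarrow> f x"
    and sle: "\<forall>i. \<forall>x\<in>space M. dist (s i x) 0 \<le> 2 * dist (f x) 0"
    using borel_measurable_implies_sequence_metric[OF fm, of 0] by blast
  \<comment> \<open>The approximating simple functions satisfy |s| \<le> 2 |f|, so 3 |f| dominates
    the error.\<close>
  show "P f"
  proof (rule lim'[OF f, of "\<lambda>n x. s n x * indicator (A n) x" "\<lambda>x. 3 * f x"])
    show "sqint M (\<lambda>x. s n x * indicator (A n) x)" "P (\<lambda>x. s n x * indicator (A n) x)" for n
      using simple[OF spec[OF s]] by blast+
    show "cmod (f x - s n x * indicator (A n) x) \<le> cmod (3 * f x)" if "x \<in> space M" for n x
    proof -
      have "cmod (s n x) \<le> 2 * cmod (f x)" using sle that by simp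
      moreover have "cmod (f x - s n x) \<le> cmod (f x) + cmod (s n x)" by (rule norm_triangle_ineq4)
      ultimately show ?thesis by (auto split: split_indicator simp: norm_mult)
    qed
    show "sqint M (\<lambda>x. 3 * f x)" using f by (rule sqint_scale)
    show "(\<lambda>n. s n x * indicator (A n) x) \<longlonglongrightarrow> f x" if x: "x \<in> space M" for x
    proof -
      have "(\<lambda>n. indicator (A n) x :: complex) \<longlonglongrightarrow> indicator (\<Union>n. A n) x"
        by (rule LIMSEQ_indicator_incseq[OF A(2)])
      from tendsto_mult[OF bspec[OF slim x] this] show ?thesis using x A(3) by simp
    qed
  qed
qed

section \<open>The Hilbert space of square integrable functions\<close>

\<comment> \<open>The functions are complex-valued but the space is treated as a real vector space,
  since the finite rank argument above is about real scalars. A complex rank one operator then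
  counts as two real ones, see \<open>Kop_tensor\<close>.\<close>
quotient_type (overloaded) 'a l2 = "'a::euclidean_space \<Rightarrow> complex" /
  partial: "\<lambda>f g. sqint lborel f \<and> sqint lborel g \<and> (AE x in lborel. f x = g x)"
proof (rule part_equivpI)
  show "\<exists>f :: 'a \<Rightarrow> complex. sqint lborel f \<and> sqint lborel f \<and> (AE x in lborel. f x = f x)"
    by (auto intro!: exI[of _ "\<lambda>x. 0"])
qed (auto simp: symp_def transp_def elim: AE_mp)

lemma sqint_rep_l2: "sqint lborel (rep_l2 F)"
  using Quotient3_rep_reflp[OF Quotient3_l2, of F] by simp

lemma abs_rep_l2[simp]: "abs_l2 (rep_l2 F) = F"
  by (rule Quotient3_abs_rep[OF Quotient3_l2])

lemma abs_l2_eq_iff: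
  "sqint lborel f \<Longrightarrow> sqint lborel g \<Longrightarrow> abs_l2 f = abs_l2 g \<longleftrightarrow> (AE x in lborel. f x = g x)"
  using Quotient3_rel[OF Quotient3_l2, of f g] by auto

lemma rep_abs_l2: "sqint lborel f \<Longrightarrow> AE x in lborel. rep_l2 (abs_l2 f) x = f x"
  using Quotient3_rep_abs[OF Quotient3_l2, of f] by simp

instantiation l2 :: (euclidean_space) real_vector
begin

lift_definition zero_l2 :: "'a l2" is "\<lambda>x. 0" by simp

lift_definition plus_l2 :: "'a l2 \<Rightarrow> 'a l2 \<Rightarrow> 'a l2" is "\<lambda>f g x. f x + g x"
  by (auto intro: sqint_add)

lift_definition minus_l2 :: "'a l2 \<Rightarrow> 'a l2 \<Rightarrow> 'a l2" is "\<lambda>f g x. f x - g x"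
  by (auto intro: sqint_diff)

lift_definition uminus_l2 :: "'a l2 \<Rightarrow> 'a l2" is "\<lambda>f x. - f x"
  by (auto intro: sqint_minus)

lift_definition scaleR_l2 :: "real \<Rightarrow> 'a l2 \<Rightarrow> 'a l2" is "\<lambda>r f x. of_real r * f x"
  by (auto intro: sqint_scale)

instance
proof
  fix a b c :: "'a l2" and r s :: real
  show "a + b + c = a + (b + c)" by transfer (auto intro: sqint_add simp: add.assoc)
  show "a + b = b + a" by transfer (auto intro: sqint_add simp: add.commute)
  show "0 + a = a" by transfer auto
  show "- a + a = 0" by transfer auto
  show "a - b = a + - b" by transfer (auto intro: sqint_diff)
  show "r *\<^sub>R (a + b) = r *\<^sub>R a + r *\<^sub>R b"
    by transfer (auto intro!: sqint_scale sqint_add simp: distrib_left)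
  show "(r + s) *\<^sub>R a = r *\<^sub>R a + s *\<^sub>R a"
    by transfer (auto intro!: sqint_scale sqint_add simp: distrib_right)
  show "r *\<^sub>R s *\<^sub>R a = (r * s) *\<^sub>R a"
    by transfer (auto intro!: sqint_scale simp: mult.assoc)
  show "1 *\<^sub>R a = a" by transfer auto
qed

end

instantiation l2 :: (euclidean_space) real_normed_vector
begin

lift_definition norm_l2 :: "'a l2 \<Rightarrow> real" is "\<lambda>f. l2n lborel f"
  by (auto simp: l2n_def cong: sqn_cong_AE)

definition dist_l2 :: "'a l2 \<Rightarrow> 'a l2 \<Rightarrow> real" where "dist_l2 F G = norm (F - G)"

definition sgn_l2 :: "'a l2 \<Rightarrow> 'a l2" where "sgn_l2 F = scaleR (inverse (norm F)) F"

definition uniformity_l2 :: "('a l2 \<times> 'a l2) filter" where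
  "uniformity_l2 = (INF e\<in>{0 <..}. principal {(F, G). dist F G < e})"

definition open_l2 :: "'a l2 set \<Rightarrow> bool" where
  "open_l2 U \<longleftrightarrow> (\<forall>F\<in>U. \<forall>\<^sub>F (F', G) in uniformity. F' = F \<longrightarrow> G \<in> U)"

instance
proof
  fix a b :: "'a l2" and r :: real
  show "dist a b = norm (a - b)" by (rule dist_l2_def)
  show "sgn a = a /\<^sub>R norm a" by (rule sgn_l2_def)
  show "uniformity = (INF e\<in>{0 <..}. principal {(x, y). dist (x :: 'a l2) y < e})"
    by (rule uniformity_l2_def)
  show "open U = (\<forall>x\<in>U. \<forall>\<^sub>F (x', y) in uniformity. x' = x \<longrightarrow> y \<in> U)" for U :: "'a l2 set"
    by (rule open_l2_def)
  show "norm a = 0 \<longleftrightarrow> a = 0"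
  proof transfer
    fix f :: "'a \<Rightarrow> complex"
    assume "sqint lborel f \<and> sqint lborel f \<and> (AE x in lborel. f x = f x)"
    then have f: "sqint lborel f" and [measurable]: "f \<in> borel_measurable borel" by (auto simp: sqint_def)
    have "l2n lborel f = 0 \<longleftrightarrow> sqn lborel f = 0"
      using f by (auto simp: l2n_def sqint_def enn2real_eq_0_iff)
    also have "\<dots> \<longleftrightarrow> (AE x in lborel. f x = 0)"
      unfolding sqn_def by (subst nn_integral_0_iff_AE) (auto simp: ennreal_eq_0_iff)
    finally show "(l2n lborel f = 0) = (sqint lborel f \<and> sqint lborel (\<lambda>x::'a. 0) \<and> (AE x in lborel. f x = 0))"
      using f by simp
  qed
  show "norm (a + b) \<le> norm a + norm b" by transfer (auto intro: l2n_triangle)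
  show "norm (r *\<^sub>R a) = \<bar>r\<bar> * norm a"
    by transfer (auto simp: l2n_def sqn_scale sqint_def enn2real_mult real_sqrt_mult)
qed

end

lemma norm_abs_l2: "sqint lborel f \<Longrightarrow> norm (abs_l2 f) = l2n lborel f"
  by (rule norm_l2.abs_eq) simp

lemma abs_l2_add: "sqint lborel f \<Longrightarrow> sqint lborel g \<Longrightarrow> abs_l2 f + abs_l2 g = abs_l2 (\<lambda>x. f x + g x)"
  by (rule plus_l2.abs_eq) auto

lemma abs_l2_diff: "sqint lborel f \<Longrightarrow> sqint lborel g \<Longrightarrow> abs_l2 f - abs_l2 g = abs_l2 (\<lambda>x. f x - g x)"
  by (rule minus_l2.abs_eq) auto

lemma abs_l2_scaleR: "sqint lborel f \<Longrightarrow> r *\<^sub>R abs_l2 f = abs_l2 (\<lambda>x. of_real r * f x)"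
  by (rule scaleR_l2.abs_eq) auto

lemma norm_l2_rep: "norm F = l2n lborel (rep_l2 F)"
  using norm_abs_l2[OF sqint_rep_l2, of F] by simp

lemma sqn_rep_diff: "sqn lborel (\<lambda>x. rep_l2 F x - rep_l2 G x) = ennreal ((norm (F - G))\<^sup>2)"
proof -
  have "F - G = abs_l2 (\<lambda>x. rep_l2 F x - rep_l2 G x)"
    using abs_l2_diff[OF sqint_rep_l2 sqint_rep_l2, of F G] by simp
  then show ?thesis
    by (simp add: norm_abs_l2 sqint_diff sqint_rep_l2 sqn_l2n)
qed

text \<open>A subsequence with distances at most (1/8)^n has squared distances at most (1/8)^n as
  well, because these numbers are at most 1. \<open>L2_complete\<close> gives its limit, and a
  Cauchy sequence converges along with any subsequence.\<close>

instance l2 :: (euclidean_space) banach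
proof
  fix X :: "nat \<Rightarrow> 'a l2" assume X: "Cauchy X"
  then have "\<forall>k. \<exists>N. \<forall>m\<ge>N. \<forall>n\<ge>N. norm (X m - X n) < (1/8)^k"
    by (auto simp: Cauchy_def dist_norm)
  then obtain N where N: "\<And>k m n. m \<ge> N k \<Longrightarrow> n \<ge> N k \<Longrightarrow> norm (X m - X n) < (1/8)^k" by metis
  \<comment> \<open>Summing \<open>Suc (N i)\<close> makes \<open>r\<close> strictly increasing and
    keeps it above \<open>N\<close>.\<close>
  define r where "r k = (\<Sum>i\<le>k. Suc (N i))" for k
  have r: "strict_mono r" by (rule strict_monoI_Suc) (simp add: r_def)
  have rN: "r k \<ge> N k" for k by (cases k) (auto simp: r_def)
  have small: "sqn lborel (\<lambda>x. rep_l2 (X (r m)) x - rep_l2 (X (r n)) x) \<le> ennreal ((1/8)^n)" if "n \<le> m" for m n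
  proof -
    have "r n \<le> r m" using r that by (simp add: strict_mono_less_eq)
    then have "norm (X (r m) - X (r n)) \<le> (1/8)^n"
      using N[of n "r m" "r n"] rN[of n] by auto
    moreover have "(1/8)^n \<le> (1::real)" by (simp add: power_le_one)
    ultimately have "(norm (X (r m) - X (r n)))\<^sup>2 \<le> (1/8)^n"
      by (smt (verit) mult_left_le mult_mono norm_ge_zero power2_eq_square)
    then show ?thesis unfolding sqn_rep_diff by (rule ennreal_leI)
  qed
  obtain h where h: "sqint lborel h"
    and hn: "\<And>n. sqn lborel (\<lambda>x. h x - rep_l2 (X (r n)) x) \<le> ennreal ((1/8)^n)"
    using L2_complete[OF sqint_rep_l2 small] by blast
  have le: "norm (X (r n) - abs_l2 h) \<le> sqrt ((1/8)^n)" for n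
  proof -
    have "norm (abs_l2 h - X (r n)) = l2n lborel (\<lambda>x. h x - rep_l2 (X (r n)) x)"
      using abs_l2_diff[OF h sqint_rep_l2, of "X (r n)"]
      by (simp add: norm_abs_l2 sqint_diff h sqint_rep_l2)
    also have "\<dots> \<le> sqrt ((1/8)^n)" using hn[of n] by (intro l2n_leI) auto
    finally show ?thesis by (simp add: norm_minus_commute)
  qed
  have "(\<lambda>n. sqrt ((1/8)^n)) \<longlonglongrightarrow> sqrt 0"
    by (intro tendsto_intros LIMSEQ_power_zero) simp
  then have "(\<lambda>n. X (r n) - abs_l2 h) \<longlonglongrightarrow> 0"
    by (intro Lim_null_comparison[OF always_eventually[OF allI[OF le]]]) simp
  then have "(X \<circ> r) \<longlonglongrightarrow> abs_l2 h" by (simp add: LIM_zero_iff o_def)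
  with Cauchy_converges_subseq[OF X r] show "convergent X" by (auto simp: convergent_def)
qed

section \<open>Hilbert-Schmidt integral operators\<close>

definition kop :: "('a \<times> 'a \<Rightarrow> complex) \<Rightarrow> ('a \<Rightarrow> complex) \<Rightarrow> 'a::euclidean_space \<Rightarrow> complex" where
  "kop k f p = (\<integral>q. k (p, q) * f q \<partial>lborel)"

lemma sqn_pair:
  assumes [measurable]: "k \<in> borel_measurable (M \<Otimes>\<^sub>M N)" and "sigma_finite_measure N"
  shows "sqn (M \<Otimes>\<^sub>M N) k = (\<integral>\<^sup>+p. sqn N (\<lambda>q. k (p, q)) \<partial>M)"
proof -
  interpret N: sigma_finite_measure N by fact
  show ?thesis unfolding sqn_def by (rule N.nn_integral_fst[symmetric]) measurable
qed

lemma kop_measurable[measurable]: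
  assumes [measurable]: "k \<in> borel_measurable (lborel \<Otimes>\<^sub>M lborel)" "f \<in> borel_measurable borel"
  shows "kop k f \<in> borel_measurable borel"
proof -
  have "(\<lambda>p. \<integral>q. k (p, q) * f q \<partial>lborel) \<in> borel_measurable lborel" by measurable
  then show ?thesis by (simp add: kop_def[abs_def])
qed

text \<open>Cauchy-Schwarz on each section of the kernel: the Hilbert-Schmidt norm bounds the
  operator norm.\<close>

lemma sqn_kop_le:
  assumes k: "k \<in> borel_measurable (lborel \<Otimes>\<^sub>M lborel)" and f: "f \<in> borel_measurable borel"
  shows "sqn lborel (kop k f) \<le> sqn (lborel \<Otimes>\<^sub>M lborel) k * sqn lborel f"
proof -
  note [measurable] = k f
  have "sqn lborel (kop k f) \<le> (\<integral>\<^sup>+p. sqn lborel (\<lambda>q. k (p, q)) * sqn lborel f \<partial>lborel)"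
    unfolding sqn_def[of lborel "kop k f"] kop_def
    by (intro nn_integral_mono integral_mult_sq_le) measurable
  also have "\<dots> = (\<integral>\<^sup>+p. sqn lborel (\<lambda>q. k (p, q)) \<partial>lborel) * sqn lborel f"
    by (intro nn_integral_multc) (simp add: sqn_def)
  finally show ?thesis by (simp add: sqn_pair sigma_finite_lborel)
qed

lemma sqint_kop:
  assumes "sqint (lborel \<Otimes>\<^sub>M lborel) k" "sqint lborel f"
  shows "sqint lborel (kop k f)"
proof -
  have m: "k \<in> borel_measurable (lborel \<Otimes>\<^sub>M lborel)" "f \<in> borel_measurable borel"
    using assms by (auto simp: sqint_def)
  have "sqn (lborel \<Otimes>\<^sub>M lborel) k * sqn lborel f < top"
    using assms by (simp add: sqint_def ennreal_mult_less_top)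
  from le_less_trans[OF sqn_kop_le[OF m] this] kop_measurable[OF m] show ?thesis
    by (simp add: sqint_def)
qed

lemma AE_sqint_section:
  assumes k: "sqint (M \<Otimes>\<^sub>M N) k" and N: "sigma_finite_measure N"
  shows "AE p in M. sqint N (\<lambda>q. k (p, q))"
proof -
  interpret N: sigma_finite_measure N by fact
  have [measurable]: "k \<in> borel_measurable (M \<Otimes>\<^sub>M N)" using k by (simp add: sqint_def)
  have "(\<integral>\<^sup>+p. sqn N (\<lambda>q. k (p, q)) \<partial>M) \<noteq> \<infinity>"
    using k sqn_pair[of k M N] N by (auto simp: sqint_def)
  then have "AE p in M. sqn N (\<lambda>q. k (p, q)) \<noteq> \<infinity>"
    by (intro nn_integral_noteq_infinite) (auto simp: sqn_def)
  with AE_space show ?thesis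
  proof eventually_elim
    case (elim p)
    then show ?case by (auto simp: sqint_def less_top)
  qed
qed

text \<open>Changing the argument on a null set affects none of the integrals, so the two images
  agree at every point. This makes \<open>Kop\<close> well defined on classes.\<close>

lemma kop_cong:
  assumes "AE q in lborel. f q = f' q" "k \<in> borel_measurable (lborel \<Otimes>\<^sub>M lborel)"
    "f \<in> borel_measurable borel" "f' \<in> borel_measurable borel"
  shows "kop k f = kop k f'"
proof
  fix p
  note [measurable] = assms(2-4)
  show "kop k f p = kop k f' p" unfolding kop_def
    by (rule integral_cong_AE) (use assms(1) in auto)
qed

text \<open>On the null set of points whose kernel section is not square integrable the integrals
  take default values, and additivity can fail there.\<close>

lemma kop_add:
  assumes "sqint (lborel \<Otimes>\<^sub>M lborel) k" "sqint lborel f" "sqint lborel f'"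
  shows "AE p in lborel. kop k (\<lambda>q. f q + f' q) p = kop k f p + kop k f' p"
  using AE_sqint_section[OF assms(1) sigma_finite_lborel]
proof eventually_elim
  case (elim p)
  then show ?case unfolding kop_def using assms
    by (simp add: distrib_left integrable_mult_sqint)
qed

lemma kop_add_kernel:
  assumes "sqint (lborel \<Otimes>\<^sub>M lborel) k" "sqint (lborel \<Otimes>\<^sub>M lborel) k'" "sqint lborel f"
  shows "AE p in lborel. kop (\<lambda>z. k z + k' z) f p = kop k f p + kop k' f p"
  using AE_sqint_section[OF assms(1) sigma_finite_lborel] AE_sqint_section[OF assms(2) sigma_finite_lborel]
proof eventually_elim
  case (elim p)
  then show ?case unfolding kop_def using assms
    by (simp add: distrib_right integrable_mult_sqint)
qed

lemma kop_scale: "kop k (\<lambda>q. c * f q) p = c * kop k f p"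
  unfolding kop_def by (simp add: mult.left_commute)

definition Kop :: "('a \<times> 'a \<Rightarrow> complex) \<Rightarrow> 'a::euclidean_space l2 \<Rightarrow> 'a l2" where
  "Kop k F = abs_l2 (kop k (rep_l2 F))"

lemma Kop_abs:
  assumes k: "sqint (lborel \<Otimes>\<^sub>M lborel) k" and f: "sqint lborel f"
  shows "Kop k (abs_l2 f) = abs_l2 (kop k f)"
proof -
  have "kop k (rep_l2 (abs_l2 f)) = kop k f"
    using k f sqint_rep_l2[of "abs_l2 f"]
    by (intro kop_cong rep_abs_l2) (auto simp: sqint_def)
  then show ?thesis by (simp add: Kop_def)
qed

lemma norm_Kop_le:
  assumes k: "sqint (lborel \<Otimes>\<^sub>M lborel) k"
  shows "norm (Kop k F) \<le> norm F * l2n (lborel \<Otimes>\<^sub>M lborel) k"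
proof -
  have "sqn lborel (kop k (rep_l2 F)) \<le> sqn (lborel \<Otimes>\<^sub>M lborel) k * sqn lborel (rep_l2 F)"
    using k sqint_rep_l2[of F] by (intro sqn_kop_le) (auto simp: sqint_def)
  also have "\<dots> = ennreal ((norm F * l2n (lborel \<Otimes>\<^sub>M lborel) k)\<^sup>2)"
    using k sqint_rep_l2[of F]
    by (simp add: sqn_l2n norm_l2_rep power_mult_distrib ennreal_mult mult.commute)
  finally show ?thesis
    unfolding Kop_def by (subst norm_abs_l2) (auto intro!: l2n_leI sqint_kop k sqint_rep_l2)
qed

lemma bounded_linear_Kop:
  assumes k: "sqint (lborel \<Otimes>\<^sub>M lborel) k"
  shows "bounded_linear (Kop k)"
proof (rule bounded_linear_intro)
  show "Kop k (F + G) = Kop k F + Kop k G" for F G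
  proof -
    have "Kop k (abs_l2 (\<lambda>x. rep_l2 F x + rep_l2 G x)) = Kop k (abs_l2 (rep_l2 F)) + Kop k (abs_l2 (rep_l2 G))"
      using k by (simp add: Kop_abs abs_l2_add sqint_add sqint_rep_l2 sqint_kop abs_l2_eq_iff kop_add
          del: abs_rep_l2)
    then show ?thesis by (simp add: abs_l2_add[symmetric] sqint_rep_l2)
  qed
  show "Kop k (r *\<^sub>R F) = r *\<^sub>R Kop k F" for r F
  proof -
    have "Kop k (abs_l2 (\<lambda>x. of_real r * rep_l2 F x)) = r *\<^sub>R Kop k (abs_l2 (rep_l2 F))"
      using k by (simp add: Kop_abs abs_l2_scaleR sqint_scale sqint_rep_l2 sqint_kop abs_l2_eq_iff kop_scale
          del: abs_rep_l2)
    then show ?thesis by (simp add: abs_l2_scaleR[symmetric] sqint_rep_l2)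
  qed
qed (rule norm_Kop_le[OF k])

section \<open>Approximation of square integrable kernels by finite rank kernels\<close>

definition rk :: "(('a \<Rightarrow> complex) \<times> ('a \<Rightarrow> complex)) list \<Rightarrow> 'a \<times> 'a \<Rightarrow> complex" where
  "rk xs z = (\<Sum>(a, b)\<leftarrow>xs. a (fst z) * b (snd z))"

lemma rk_simps[simp]: "rk [] z = 0" "rk (ab # xs) z = fst ab (fst z) * snd ab (snd z) + rk xs z"
  "rk (xs @ ys) z = rk xs z + rk ys z"
  by (auto simp: rk_def case_prod_beta)

lemma sqint_tensor:
  fixes a b :: "'a::euclidean_space \<Rightarrow> complex"
  assumes a: "sqint lborel a" and b: "sqint lborel b"
  shows "sqint (lborel \<Otimes>\<^sub>M lborel) (\<lambda>z. a (fst z) * b (snd z))"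
proof -
  have [measurable]: "a \<in> borel_measurable borel" "b \<in> borel_measurable borel"
    using a b by (auto simp: sqint_def)
  have "sqn (lborel \<Otimes>\<^sub>M lborel) (\<lambda>z. a (fst z) * b (snd z)) = sqn lborel b * sqn lborel a"
    by (subst sqn_pair) (simp_all add: sigma_finite_lborel sqn_scale,
      simp add: nn_integral_multc ennreal_power[symmetric] sqn_def mult.commute)
  then show ?thesis using a b by (simp add: sqint_def ennreal_mult_less_top)
qed

lemma sqint_rk:
  fixes xs :: "(('a::euclidean_space \<Rightarrow> complex) \<times> ('a \<Rightarrow> complex)) list"
  assumes "\<And>a b. (a, b) \<in> set xs \<Longrightarrow> sqint lborel a \<and> sqint lborel b"
  shows "sqint (lborel \<Otimes>\<^sub>M lborel) (rk xs)"
  using assms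
proof (induction xs)
  case Nil
  have "rk [] = (\<lambda>z::'a \<times> 'a. 0)" by auto
  then show ?case by simp
next
  case (Cons ab xs)
  have "rk (ab # xs) = (\<lambda>z. fst ab (fst z) * snd ab (snd z) + rk xs z)" by auto
  moreover have "sqint lborel (fst ab)" "sqint lborel (snd ab)" using Cons.prems[of "fst ab" "snd ab"] by auto
  ultimately show ?case using Cons by (auto intro!: sqint_add sqint_tensor)
qed

definition approx_rk :: "('a::euclidean_space \<times> 'a \<Rightarrow> complex) \<Rightarrow> bool" where
  "approx_rk k \<longleftrightarrow> (\<forall>e>0. \<exists>xs. (\<forall>(a, b)\<in>set xs. sqint lborel a \<and> sqint lborel b) \<and>
      sqn (lborel \<Otimes>\<^sub>M lborel) (\<lambda>z. k z - rk xs z) \<le> ennreal e)"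

lemma approx_rkD:
  assumes "approx_rk k" "e > 0"
  obtains xs where "\<And>a b. (a, b) \<in> set xs \<Longrightarrow> sqint lborel a \<and> sqint lborel b"
    "sqn (lborel \<Otimes>\<^sub>M lborel) (\<lambda>z. k z - rk xs z) \<le> ennreal e"
  using assms by (fastforce simp: approx_rk_def)

text \<open>The error budget for \<open>sqn_add_le\<close>, which doubles each squared norm: a share
  of e/4 for either summand gives e in total.\<close>

lemma ennreal_half_split: "e \<ge> 0 \<Longrightarrow> 2 * ennreal (e / 4) + 2 * ennreal (e / 4) = ennreal e"
proof -
  assume e: "e \<ge> 0"
  have "2 * ennreal (e / 4) + 2 * ennreal (e / 4) = ennreal 2 * ennreal (e/4) + ennreal 2 * ennreal (e/4)" by simp
  also have "\<dots> = ennreal (2 * (e/4) + 2 * (e/4))"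
    using e by (simp only: ennreal_mult[symmetric] ennreal_plus[symmetric] zero_le_numeral
        zero_le_divide_iff mult_nonneg_nonneg simp_thms)
  finally show ?thesis by simp
qed

text \<open>Indicators of measurable rectangles are products, and rectangles form an
  intersection-stable generator of the product sigma-algebra, so \<open>sqint_induct\<close> gives
  density.\<close>

lemma approx_rk_sqint:
  fixes k :: "'a::euclidean_space \<times> 'a \<Rightarrow> complex"
  assumes k: "sqint (lborel \<Otimes>\<^sub>M lborel) k"
  shows "approx_rk k"
proof -
  define E where "E = {a \<times> b | a b. a \<in> sets (lborel :: 'a measure) \<and> b \<in> sets (lborel :: 'a measure)}"
  define A where "A n = cball (0::'a) (real n) \<times> cball (0::'a) (real n)" for n
  let ?M = "lborel \<Otimes>\<^sub>M lborel :: ('a \<times> 'a) measure"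
  have cover: "(\<Union>n. A n) = UNIV"
  proof (intro equalityI subsetI)
    fix z :: "'a \<times> 'a"
    obtain n where "real n \<ge> max (norm (fst z)) (norm (snd z))" using real_arch_simple by blast
    then have "z \<in> A n" by (auto simp: A_def mem_Times_iff)
    then show "z \<in> (\<Union>n. A n)" by blast
  qed simp
  show ?thesis
  proof (rule sqint_induct[where M="?M" and E=E and A=A and P=approx_rk and f=k])
    show "Int_stable E" unfolding E_def by (rule Int_stable_pair_measure_generator)
    show "E \<subseteq> Pow (space ?M)" by (auto simp: E_def space_pair_measure)
    show "sets ?M = sigma_sets (space ?M) E" by (simp add: sets_pair_measure E_def space_pair_measure)
    show "A n \<in> E" for n unfolding A_def E_def by (intro CollectI exI conjI refl) auto
    show "incseq A" by (auto simp: A_def incseq_def)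
    show "(\<Union>n. A n) = space ?M" using cover by (simp add: space_pair_measure)
    show "emeasure ?M (A n) < \<infinity>" for n
    proof -
      have "emeasure (lborel :: 'a measure) (cball 0 (real n)) < \<infinity>"
        using emeasure_lborel_cball_finite by blast
      then show ?thesis unfolding A_def
        by (subst lborel.emeasure_pair_measure_Times) (auto simp: ennreal_mult_less_top)
    qed
    show "approx_rk (\<lambda>x. indicator B x)" if B: "B \<in> E" "emeasure ?M B < \<infinity>" for B
      unfolding approx_rk_def
    proof (intro allI impI)
      fix e :: real assume "e > 0"
      obtain a b where ab: "B = a \<times> b" "a \<in> sets lborel" "b \<in> sets lborel" using B by (auto simp: E_def)
      have [measurable]: "B \<in> sets ?M" using ab by auto
      have em: "emeasure ?M B = emeasure lborel a * emeasure lborel b"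
        using ab by (simp add: lborel.emeasure_pair_measure_Times)
      show "\<exists>xs. (\<forall>(a, b)\<in>set xs. sqint lborel a \<and> sqint lborel b) \<and>
          sqn ?M (\<lambda>z. indicator B z - rk xs z) \<le> ennreal e"
      \<comment> \<open>A rectangle of measure zero may have one side of infinite measure, whose
        indicator is not square integrable. The empty sum approximates it exactly.\<close>
      proof (cases "emeasure ?M B = 0")
        case True
        have "sqn ?M (\<lambda>z. indicator B z) = (\<integral>\<^sup>+z. indicator B z \<partial>?M)"
          unfolding sqn_def by (intro nn_integral_cong) (auto split: split_indicator)
        also have "\<dots> = 0" using True \<open>B \<in> sets ?M\<close> by (simp only: nn_integral_indicator)
        finally show ?thesis by (intro exI[of _ "[]"]) simp
      next
        case False
        then have "emeasure lborel a < \<infinity>" "emeasure lborel b < \<infinity>"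
          using B(2) em by (auto simp: ennreal_mult_less_top)
        moreover have "indicator B z - rk [(indicator a, indicator b)] z = 0" for z
          by (auto simp: ab indicator_times)
        ultimately show ?thesis
          using ab by (intro exI[of _ "[(indicator a, indicator b)]"]) (auto intro!: sqint_indicator simp del: rk_simps)
      qed
    qed
    show "approx_rk (\<lambda>x. f x + g x)" if f: "sqint ?M f" "approx_rk f" and g: "sqint ?M g" "approx_rk g" for f g
      unfolding approx_rk_def
    proof (intro allI impI)
      fix e :: real assume e: "e > 0"
      obtain xs where xs: "\<And>a b. (a, b) \<in> set xs \<Longrightarrow> sqint lborel a \<and> sqint lborel b"
        "sqn ?M (\<lambda>z. f z - rk xs z) \<le> ennreal (e/4)"
        using approx_rkD[OF f(2), of "e/4"] e by auto
      obtain ys where ys: "\<And>a b. (a, b) \<in> set ys \<Longrightarrow> sqint lborel a \<and> sqint lborel b"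
        "sqn ?M (\<lambda>z. g z - rk ys z) \<le> ennreal (e/4)"
        using approx_rkD[OF g(2), of "e/4"] e by auto
      have "sqn ?M (\<lambda>z. (f z - rk xs z) + (g z - rk ys z)) \<le> 2 * sqn ?M (\<lambda>z. f z - rk xs z) + 2 * sqn ?M (\<lambda>z. g z - rk ys z)"
        by (intro sqn_add_le borel_measurable_diff sqint_measurable f g sqint_rk xs ys)
      also have "\<dots> \<le> 2 * ennreal (e/4) + 2 * ennreal (e/4)"
        using xs ys by (intro add_mono mult_left_mono) auto
      also have "\<dots> = ennreal e" using e by (intro ennreal_half_split) simp
      also have "(\<lambda>z. (f z - rk xs z) + (g z - rk ys z)) = (\<lambda>z. f z + g z - rk (xs @ ys) z)"
        by (auto simp: algebra_simps)
      finally show "\<exists>xs. (\<forall>(a, b)\<in>set xs. sqint lborel a \<and> sqint lborel b) \<and>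
          sqn ?M (\<lambda>z. f z + g z - rk xs z) \<le> ennreal e"
        using xs(1) ys(1) by (intro exI[of _ "xs @ ys"]) auto
    qed
    show "approx_rk (\<lambda>x. c * f x)" if f: "sqint ?M f" "approx_rk f" for c f
      unfolding approx_rk_def
    proof (intro allI impI)
      fix e :: real assume e: "e > 0"
      \<comment> \<open>The summand 1 in the denominator covers c = 0.\<close>
      define d where "d = e / ((cmod c)\<^sup>2 + 1)"
      have d: "d > 0" "(cmod c)\<^sup>2 * d \<le> e"
        using e by (auto simp: d_def divide_simps add_pos_nonneg add_nonneg_pos intro!: mult_left_mono)
      obtain xs where xs: "\<And>a b. (a, b) \<in> set xs \<Longrightarrow> sqint lborel a \<and> sqint lborel b"
        "sqn ?M (\<lambda>z. f z - rk xs z) \<le> ennreal d"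
        using approx_rkD[OF f(2) d(1)] by auto
      define ys where "ys = map (\<lambda>(a, b). (\<lambda>x. c * a x, b)) xs"
      have rk: "rk ys z = c * rk xs z" for z
        unfolding ys_def by (induction xs) (auto simp: algebra_simps)
      have "sqn ?M (\<lambda>z. c * (f z - rk xs z)) = ennreal ((cmod c)\<^sup>2) * sqn ?M (\<lambda>z. f z - rk xs z)"
        by (intro sqn_scale borel_measurable_diff sqint_measurable f sqint_rk xs)
      also have "\<dots> \<le> ennreal ((cmod c)\<^sup>2) * ennreal d"
        using xs by (intro mult_left_mono) auto
      also have "\<dots> \<le> ennreal e" using d by (subst ennreal_mult[symmetric]) (auto intro: ennreal_leI)
      finally have "sqn ?M (\<lambda>z. c * f z - rk ys z) \<le> ennreal e" by (simp add: rk right_diff_distrib)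
      moreover have "\<forall>(a, b)\<in>set ys. sqint lborel a \<and> sqint lborel b"
        using xs(1) by (auto simp: ys_def intro: sqint_scale)
      ultimately show "\<exists>xs. (\<forall>(a, b)\<in>set xs. sqint lborel a \<and> sqint lborel b) \<and>
          sqn ?M (\<lambda>z. c * f z - rk xs z) \<le> ennreal e" by blast
    qed
    show "approx_rk f" if f: "sqint ?M f"
      and lim: "\<And>\<epsilon>. \<epsilon> > 0 \<Longrightarrow> \<exists>h. sqint ?M h \<and> approx_rk h \<and> sqn ?M (\<lambda>x. f x - h x) < \<epsilon>" for f
      unfolding approx_rk_def
    proof (intro allI impI)
      fix e :: real assume e: "e > 0"
      obtain h where h: "sqint ?M h" "approx_rk h" "sqn ?M (\<lambda>x. f x - h x) < ennreal (e/4)"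
        using lim[of "ennreal (e/4)"] e by auto
      obtain xs where xs: "\<And>a b. (a, b) \<in> set xs \<Longrightarrow> sqint lborel a \<and> sqint lborel b"
        "sqn ?M (\<lambda>z. h z - rk xs z) \<le> ennreal (e/4)"
        using approx_rkD[OF h(2), of "e/4"] e by auto
      have "sqn ?M (\<lambda>z. (f z - h z) + (h z - rk xs z)) \<le> 2 * sqn ?M (\<lambda>z. f z - h z) + 2 * sqn ?M (\<lambda>z. h z - rk xs z)"
        by (intro sqn_add_le borel_measurable_diff sqint_measurable f h sqint_rk xs)
      also have "\<dots> \<le> 2 * ennreal (e/4) + 2 * ennreal (e/4)"
        using xs h by (intro add_mono mult_left_mono) auto
      also have "\<dots> = ennreal e" using e by (intro ennreal_half_split) simp
      finally show "\<exists>xs. (\<forall>(a, b)\<in>set xs. sqint lborel a \<and> sqint lborel b) \<and>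
          sqn ?M (\<lambda>z. f z - rk xs z) \<le> ennreal e"
        using xs(1) by (intro exI[of _ xs]) auto
    qed
  qed (rule k)
qed

text \<open>The pairing is bilinear, without conjugation, to match the action of a kernel a(p)
  b(q).\<close>

definition cfun :: "('a::euclidean_space \<Rightarrow> complex) \<Rightarrow> 'a l2 \<Rightarrow> complex" where
  "cfun b F = (\<integral>q. b q * rep_l2 F q \<partial>lborel)"

lemma cfun_abs:
  assumes "sqint lborel b" "sqint lborel f"
  shows "cfun b (abs_l2 f) = (\<integral>q. b q * f q \<partial>lborel)"
  unfolding cfun_def
proof (rule integral_cong_AE)
  show "AE q in lborel. b q * rep_l2 (abs_l2 f) q = b q * f q"
    using rep_abs_l2[OF assms(2)] by eventually_elim simp
qed (use assms sqint_rep_l2[of "abs_l2 f"] in \<open>auto simp: sqint_def\<close>)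

lemma bounded_linear_cfun:
  assumes b: "sqint lborel b"
  shows "bounded_linear (cfun b)"
proof (rule bounded_linear_intro)
  show "cfun b (F + G) = cfun b F + cfun b G" for F G
  proof -
    have "cfun b (abs_l2 (\<lambda>x. rep_l2 F x + rep_l2 G x)) = cfun b F + cfun b G"
      by (subst cfun_abs) (auto simp: b sqint_rep_l2 sqint_add cfun_def distrib_left integrable_mult_sqint)
    then show ?thesis by (simp add: abs_l2_add[symmetric] sqint_rep_l2)
  qed
  show "cfun b (r *\<^sub>R F) = r *\<^sub>R cfun b F" for r F
  proof -
    have "cfun b (abs_l2 (\<lambda>x. of_real r * rep_l2 F x)) = r *\<^sub>R cfun b F"
      by (subst cfun_abs) (auto simp: b sqint_rep_l2 sqint_scale cfun_def mult.left_commute scaleR_conv_of_real)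
    then show ?thesis by (simp add: abs_l2_scaleR[symmetric] sqint_rep_l2)
  qed
  show "norm (cfun b F) \<le> norm F * l2n lborel b" for F
  proof -
    have "(ennreal (cmod (cfun b F)))\<^sup>2 \<le> sqn lborel b * sqn lborel (rep_l2 F)"
      unfolding cfun_def using b sqint_rep_l2[of F] by (intro integral_mult_sq_le sqint_measurable)
    also have "\<dots> = (ennreal (norm F * l2n lborel b))\<^sup>2"
      using b sqint_rep_l2[of F]
      by (simp add: sqn_l2n norm_l2_rep ennreal_power power_mult_distrib ennreal_mult mult.commute)
    finally show ?thesis by (auto dest: ennreal_power2_le_imp_le)
  qed
qed

lemma Kop_add_kernel:
  assumes "sqint (lborel \<Otimes>\<^sub>M lborel) k" "sqint (lborel \<Otimes>\<^sub>M lborel) k'"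
  shows "Kop (\<lambda>z. k z + k' z) F = Kop k F + Kop k' F"
  unfolding Kop_def using assms
  by (simp add: abs_l2_add sqint_kop sqint_rep_l2 abs_l2_eq_iff sqint_add kop_add_kernel)

text \<open>The complex factor \<open>cfun b F\<close> is split into real and imaginary part, which
  yields two real functionals with the directions a and \<i> a.\<close>

lemma Kop_tensor:
  assumes a: "sqint lborel a" and b: "sqint lborel b"
  shows "Kop (\<lambda>z. a (fst z) * b (snd z)) F
    = Re (cfun b F) *\<^sub>R abs_l2 a + Im (cfun b F) *\<^sub>R abs_l2 (\<lambda>x. \<i> * a x)"
proof -
  have "kop (\<lambda>z. a (fst z) * b (snd z)) (rep_l2 F) = (\<lambda>p. cfun b F * a p)"
    by (auto simp: kop_def cfun_def mult.assoc)
  moreover have "cfun b F * a p = of_real (Re (cfun b F)) * a p + of_real (Im (cfun b F)) * (\<i> * a p)" for p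
    by (metis (no_types, lifting) complex_eq distrib_right mult.assoc mult.commute)
  ultimately show ?thesis using a unfolding Kop_def
    by (simp add: abs_l2_scaleR abs_l2_add sqint_scale)
qed

lemma Kop_rk_finite_rank:
  fixes xs :: "(('a::euclidean_space \<Rightarrow> complex) \<times> ('a \<Rightarrow> complex)) list"
  assumes "\<And>a b. (a, b) \<in> set xs \<Longrightarrow> sqint lborel a \<and> sqint lborel b"
  shows "\<exists>n \<alpha> \<beta>. (\<forall>i<n::nat. bounded_linear (\<beta> i :: 'a l2 \<Rightarrow> real)) \<and>
    (\<forall>F. Kop (rk xs) F = (\<Sum>i<n. \<beta> i F *\<^sub>R \<alpha> i))"
  using assms
proof (induction xs)
  case Nil
  have rk0: "rk [] = (\<lambda>z::'a \<times> 'a. 0)" by auto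
  have "Kop (\<lambda>z. 0) F = 0" for F :: "'a l2"
    by (simp add: Kop_def kop_def[abs_def] zero_l2_def)
  then show ?case unfolding rk0 by (intro exI[of _ 0]) simp
next
  case (Cons ab xs)
  obtain a b where ab: "ab = (a, b)" by (cases ab)
  then have s: "sqint lborel a" "sqint lborel b" using Cons.prems[of a b] by auto
  have prems': "\<And>a b. (a, b) \<in> set xs \<Longrightarrow> sqint lborel a \<and> sqint lborel b" using Cons.prems by auto
  obtain n \<alpha> and \<beta> :: "nat \<Rightarrow> 'a l2 \<Rightarrow> real" where IH: "\<forall>i<n. bounded_linear (\<beta> i)"
    "\<forall>F. Kop (rk xs) F = (\<Sum>i<n. \<beta> i F *\<^sub>R \<alpha> i)"
    using Cons.IH[OF prems'] by blast
  define \<beta>' where "\<beta>' = \<beta>(n := (\<lambda>F. Re (cfun b F)), Suc n := (\<lambda>F. Im (cfun b F)))"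
  define \<alpha>' where "\<alpha>' = \<alpha>(n := abs_l2 a, Suc n := abs_l2 (\<lambda>x. \<i> * a x))"
  have "rk (ab # xs) = (\<lambda>z. a (fst z) * b (snd z) + rk xs z)" by (auto simp: ab)
  then have "Kop (rk (ab # xs)) F = Kop (\<lambda>z. a (fst z) * b (snd z)) F + Kop (rk xs) F" for F
    using Kop_add_kernel[OF sqint_tensor[OF s] sqint_rk[of xs]] prems' by (simp only:)
  also have "\<dots> F = (\<Sum>i<Suc (Suc n). \<beta>' i F *\<^sub>R \<alpha>' i)" for F
  proof -
    have "(\<Sum>i<n. \<beta>' i F *\<^sub>R \<alpha>' i) = (\<Sum>i<n. \<beta> i F *\<^sub>R \<alpha> i)"
      by (intro sum.cong) (auto simp: \<beta>'_def \<alpha>'_def)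
    then show ?thesis using IH s by (simp add: Kop_tensor, simp add: \<beta>'_def \<alpha>'_def)
  qed
  finally have "Kop (rk (ab # xs)) F = (\<Sum>i<Suc (Suc n). \<beta>' i F *\<^sub>R \<alpha>' i)" for F .
  moreover have "bounded_linear (\<beta>' i)" if "i < Suc (Suc n)" for i
    using that IH bounded_linear_compose[OF bounded_linear_Re bounded_linear_cfun[OF s(2)]]
      bounded_linear_compose[OF bounded_linear_Im bounded_linear_cfun[OF s(2)]]
    by (auto simp: \<beta>'_def less_Suc_eq)
  ultimately show ?case by blast
qed

section \<open>Second kind equations: the Fredholm lower bound and Volterra kernels\<close>

lemma bd_invertible_small_Kop:
  fixes k :: "'a::euclidean_space \<times> 'a \<Rightarrow> complex"
  assumes k: "sqint (lborel \<Otimes>\<^sub>M lborel) k" and small: "sqn (lborel \<Otimes>\<^sub>M lborel) k \<le> ennreal (1/4)"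
  shows "bd_invertible (\<lambda>F. F - Kop k F)"
proof (rule bd_invertible_contraction[where q="1/2"])
  have "l2n (lborel \<Otimes>\<^sub>M lborel) k \<le> 1/2"
    using small by (intro l2n_leI) (auto simp: power2_eq_square)
  then show "norm (Kop k F) \<le> 1/2 * norm F" for F
    using norm_Kop_le[OF k, of F] mult_left_mono[of "l2n (lborel \<Otimes>\<^sub>M lborel) k" "1/2" "norm F"] by simp
qed (auto intro: bounded_linear_Kop k)

text \<open>The kernel is a small one plus one of finite rank, so I - K is a finite rank
  perturbation of an invertible operator. Being surjective, it has a bounded inverse, and a bound
  for that inverse is the constant C. The lemma is phrased for functions because its users never see
  classes.\<close>

lemma fredholm_kernel_lower_bound:
  fixes k :: "'a::euclidean_space \<times> 'a \<Rightarrow> complex"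
  assumes k: "sqint (lborel \<Otimes>\<^sub>M lborel) k"
    and surj: "\<And>H. sqint lborel H \<Longrightarrow> \<exists>F. sqint lborel F \<and> (AE p in lborel. F p = H p + kop k F p)"
  shows "\<exists>C. \<forall>F. sqint lborel F \<longrightarrow> l2n lborel F \<le> C * l2n lborel (\<lambda>p. F p - kop k F p)"
proof -
  obtain xs where xs: "\<And>a b. (a, b) \<in> set xs \<Longrightarrow> sqint lborel a \<and> sqint lborel b"
    and small: "sqn (lborel \<Otimes>\<^sub>M lborel) (\<lambda>z. k z - rk xs z) \<le> ennreal (1/4)"
    using approx_rkD[OF approx_rk_sqint[OF k], of "1/4"] by auto
  have e: "sqint (lborel \<Otimes>\<^sub>M lborel) (\<lambda>z. k z - rk xs z)"
    by (intro sqint_diff k sqint_rk xs)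
  obtain n \<alpha> and \<beta> :: "nat \<Rightarrow> 'a l2 \<Rightarrow> real" where fr: "\<forall>i<n. bounded_linear (\<beta> i)"
    "\<forall>F. Kop (rk xs) F = (\<Sum>i<n. \<beta> i F *\<^sub>R \<alpha> i)"
    using Kop_rk_finite_rank[OF xs] by blast
  have "Kop k F = Kop (\<lambda>z. k z - rk xs z) F + (\<Sum>i<n. \<beta> i F *\<^sub>R \<alpha> i)" for F
    using Kop_add_kernel[OF e sqint_rk[of xs], where F=F] xs fr by simp
  then have split: "F - Kop k F = (F - Kop (\<lambda>z. k z - rk xs z) F) - (\<Sum>i<n. \<beta> i F *\<^sub>R \<alpha> i)" for F
    by simp
  have "surj (\<lambda>F. F - Kop k F)"
  proof (rule surjI)
    fix H
    define F where "F = (SOME F. sqint lborel F \<and> (AE p in lborel. F p = rep_l2 H p + kop k F p))"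
    have F: "sqint lborel F" "AE p in lborel. F p = rep_l2 H p + kop k F p"
      using someI_ex[OF surj[OF sqint_rep_l2[of H]]] by (auto simp: F_def)
    have "abs_l2 F - Kop k (abs_l2 F) = abs_l2 (\<lambda>p. F p - kop k F p)"
      using F k by (simp add: Kop_abs abs_l2_diff sqint_kop)
    also have "\<dots> = abs_l2 (rep_l2 H)"
      using F k by (subst abs_l2_eq_iff) (auto intro!: sqint_diff sqint_kop sqint_rep_l2 elim: AE_mp)
    finally show "abs_l2 (SOME F. sqint lborel F \<and> (AE p in lborel. F p = rep_l2 H p + kop k F p))
        - Kop k (abs_l2 (SOME F. sqint lborel F \<and> (AE p in lborel. F p = rep_l2 H p + kop k F p))) = H"
      by (simp add: F_def)
  qed
  then have "bd_invertible (\<lambda>F. F - Kop k F)"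
    unfolding split using fr bd_invertible_small_Kop[OF e small]
    by (intro surj_finite_rank_update_imp_bd_invertible) auto
  then obtain S where S: "bounded_linear S" "\<And>F. S (F - Kop k F) = F" by (auto simp: bd_invertible_def)
  obtain C where C: "\<And>F. norm (S F) \<le> norm F * C" using bounded_linear.bounded[OF S(1)] by blast
  have "l2n lborel F \<le> C * l2n lborel (\<lambda>p. F p - kop k F p)" if F: "sqint lborel F" for F
  proof -
    have "abs_l2 F - Kop k (abs_l2 F) = abs_l2 (\<lambda>p. F p - kop k F p)"
      using F k by (simp add: Kop_abs abs_l2_diff sqint_kop)
    with C[of "abs_l2 F - Kop k (abs_l2 F)"] S(2)[of "abs_l2 F"] F k show ?thesis
      by (simp add: norm_abs_l2 sqint_diff sqint_kop mult.commute)
  qed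
  then show ?thesis by blast
qed

text \<open>If the kernel is triangular with respect to a bounded function $\rho$, conjugating with
  $e^{n\rho}$ makes its Hilbert-Schmidt norm arbitrarily small.\<close>
lemma volterra_solvable:
  fixes k :: "'a::euclidean_space \<times> 'a \<Rightarrow> complex" and \<rho> :: "'a \<Rightarrow> real"
  assumes k: "sqint (lborel \<Otimes>\<^sub>M lborel) k" and \<rho>[measurable]: "\<rho> \<in> borel_measurable borel"
    and \<rho>b: "\<And>p. 0 \<le> \<rho> p" "\<And>p. \<rho> p \<le> R"
    and tri: "\<And>p q. \<not> \<rho> q < \<rho> p \<Longrightarrow> k (p, q) = 0" and H: "sqint lborel H"
  shows "\<exists>F. sqint lborel F \<and> (AE p in lborel. F p = H p + kop k F p)"
proof -
  \<comment> \<open>The conjugated kernel e^(-n \<rho>(p)) k(p, q) e^(n \<rho>(q)). Where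
    \<open>k\<close> is nonzero the exponent is negative, so \<open>kn\<close> is dominated by
    \<open>k\<close> and tends to 0 pointwise; dominated convergence makes its norm small.\<close>
  define kn where "kn n z = k z * exp (of_real (real n * (\<rho> (snd z) - \<rho> (fst z))))" for n z
  have [measurable]: "k \<in> borel_measurable (lborel \<Otimes>\<^sub>M lborel)" using k by (simp add: sqint_def)
  have [measurable]: "H \<in> borel_measurable borel" using H by (simp add: sqint_def)
  have knm[measurable]: "kn n \<in> borel_measurable (lborel \<Otimes>\<^sub>M lborel)" for n
    unfolding kn_def[abs_def] by measurable
  have kle: "cmod (kn n z) \<le> cmod (k z)" for n z
  proof (cases "\<rho> (snd z) < \<rho> (fst z)")
    case True
    then have "exp (real n * (\<rho> (snd z) - \<rho> (fst z))) \<le> 1" by (simp add: mult_nonneg_nonpos)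
    then show ?thesis
      using mult_left_mono[of "exp (real n * (\<rho> (snd z) - \<rho> (fst z)))" 1 "cmod (k z)"]
      by (simp add: kn_def norm_mult norm_exp_eq_Re)
  qed (use tri[of "snd z" "fst z"] in \<open>simp add: kn_def\<close>)
  have ks: "sqint (lborel \<Otimes>\<^sub>M lborel) (kn n)" for n
    by (rule sqint_mono[OF knm k kle])
  have "(\<lambda>n. sqn (lborel \<Otimes>\<^sub>M lborel) (kn n)) \<longlonglongrightarrow> 0"
  proof (rule sqn_dominated_tendsto[OF knm k _ kle])
    fix z :: "'a \<times> 'a"
    show "(\<lambda>n. kn n z) \<longlonglongrightarrow> 0"
    proof (cases "\<rho> (snd z) < \<rho> (fst z)")
      case True
      then have "cmod (exp (of_real (\<rho> (snd z) - \<rho> (fst z)))) < 1" by (simp add: norm_exp_eq_Re)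
      from tendsto_mult[OF tendsto_const[of "k z"] LIMSEQ_power_zero[OF this]]
      show ?thesis by (simp add: kn_def exp_of_nat_mult)
    qed (use tri[of "snd z" "fst z"] in \<open>simp add: kn_def\<close>)
  qed
  then have "\<forall>\<^sub>F n in sequentially. sqn (lborel \<Otimes>\<^sub>M lborel) (kn n) < ennreal (1/4)"
    by (rule order_tendstoD) simp
  then obtain n where n: "sqn (lborel \<Otimes>\<^sub>M lborel) (kn n) \<le> ennreal (1/4)"
    by (auto simp: eventually_sequentially intro: less_imp_le)
  \<comment> \<open>If f solves the conjugated equation with source H / w, then w f solves the
    original one. The two bounds on \<rho> keep H / w and w f square integrable.\<close>
  define w where "w p = exp (complex_of_real (real n * \<rho> p))" for p
  have [measurable]: "w \<in> borel_measurable borel" unfolding w_def[abs_def] by measurable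
  have w0: "w p \<noteq> 0" for p by (simp add: w_def)
  have wb: "cmod (w p) \<le> exp (real n * R)" for p
    using \<rho>b(2)[of p] by (simp add: w_def norm_exp_eq_Re mult_left_mono)
  have wb': "cmod (1 / w p) \<le> 1" for p
    using \<rho>b(1)[of p] by (simp add: w_def norm_divide norm_exp_eq_Re)
  have H': "sqint lborel (\<lambda>p. 1 / w p * H p)"
  proof (rule sqint_mono[OF _ H])
    show "cmod (1 / w p * H p) \<le> cmod (H p)" for p
      using mult_right_mono[OF wb'[of p], of "cmod (H p)"] by (simp add: norm_mult norm_divide)
  qed measurable
  obtain S where S: "\<And>F. S F - Kop (kn n) (S F) = F"
    using bd_invertible_small_Kop[OF ks n] by (auto simp: bd_invertible_def)
  define f where "f = rep_l2 (S (abs_l2 (\<lambda>p. 1 / w p * H p)))"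
  have f: "sqint lborel f" by (simp add: f_def sqint_rep_l2)
  have [measurable]: "f \<in> borel_measurable borel" using f by (simp add: sqint_def)
  have "abs_l2 (\<lambda>p. f p - kop (kn n) f p) = abs_l2 (\<lambda>p. 1 / w p * H p)"
    using S[of "abs_l2 (\<lambda>p. 1 / w p * H p)"] abs_l2_diff[OF f sqint_kop[OF ks[of n] f]]
      Kop_abs[OF ks f, of n] by (simp add: f_def)
  then have AE: "AE p in lborel. f p - kop (kn n) f p = 1 / w p * H p"
    by (subst (asm) abs_l2_eq_iff) (intro sqint_diff f sqint_kop ks H')+
  have kw: "w p * kop (kn n) f p = kop k (\<lambda>q. w q * f q) p" for p
  proof -
    have *: "kn n (p, q) = k (p, q) * w q / w p" for q
      by (simp add: kn_def w_def right_diff_distrib exp_diff)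
    have "w p * (\<integral>q. k (p, q) * w q / w p * f q \<partial>lborel) = (\<integral>q. w p * (k (p, q) * w q / w p * f q) \<partial>lborel)"
      by (rule integral_mult_right_zero[symmetric])
    also have "(\<lambda>q. w p * (k (p, q) * w q / w p * f q)) = (\<lambda>q. k (p, q) * (w q * f q))"
      using w0[of p] by (auto simp: fun_eq_iff)
    finally show ?thesis by (simp only: kop_def *)
  qed
  have "sqint lborel (\<lambda>q. w q * f q)"
  proof (rule sqint_mono[OF _ sqint_scale[OF f, of "of_real (exp (real n * R))"]])
    show "cmod (w q * f q) \<le> cmod (of_real (exp (real n * R)) * f q)" for q
      using mult_right_mono[OF wb[of q], of "cmod (f q)"] by (simp add: norm_mult)
  qed measurable
  moreover have "AE p in lborel. w p * f p = H p + kop k (\<lambda>q. w q * f q) p"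
    using AE
  proof eventually_elim
    case (elim p)
    then have "w p * f p - w p * kop (kn n) f p = H p" using w0[of p] by (simp add: field_simps)
    then show ?case unfolding kw by (simp add: algebra_simps)
  qed
  ultimately show ?thesis by blast
qed

section \<open>Borel versions of Lebesgue measurable functions\<close>

text \<open>The problem is posed with Lebesgue measurable functions on a set, whereas Fubini and
  shifts are carried out for Borel functions on the whole space. The zero extension replaces the
  domain; real and imaginary parts are handled separately.\<close>

lemma borel_version:
  fixes f :: "'a::euclidean_space \<Rightarrow> complex"
  assumes S: "S \<in> sets borel" and f: "f \<in> borel_measurable (lebesgue_on S)"
  shows "\<exists>f'\<in>borel_measurable borel. (\<forall>x. x \<notin> S \<longrightarrow> f' x = 0) \<and> (AE x in lborel. x \<in> S \<longrightarrow> f x = f' x)"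
proof -
  have fS: "(\<lambda>x. if x \<in> S then f x else 0) \<in> borel_measurable lebesgue"
    using f S by (intro borel_measurable_if_I) auto
  obtain u where u: "u \<in> borel_measurable lborel" "AE x in lborel. Re (if x \<in> S then f x else 0) = u x"
    using completion_ex_borel_measurable_real[OF borel_measurable_Re[THEN measurable_compose[OF fS]]]
    by (auto simp: o_def)
  obtain v where v: "v \<in> borel_measurable lborel" "AE x in lborel. Im (if x \<in> S then f x else 0) = v x"
    using completion_ex_borel_measurable_real[OF borel_measurable_Im[THEN measurable_compose[OF fS]]]
    by (auto simp: o_def)
  define f' where "f' x = indicator S x * Complex (u x) (v x)" for x
  have [measurable]: "u \<in> borel_measurable borel" "v \<in> borel_measurable borel" "S \<in> sets borel"
    using u v S by auto
  have "f' \<in> borel_measurable borel"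
    unfolding f'_def[abs_def] Complex_eq by measurable
  moreover have "AE x in lborel. x \<in> S \<longrightarrow> f x = f' x"
    using u(2) v(2) by eventually_elim (auto simp: f'_def complex_eq_iff)
  ultimately show ?thesis by (intro bexI[of _ f']) (auto simp: f'_def)
qed

text \<open>Completeness of Lebesgue measure: each preimage changes only by a subset of a null
  set.\<close>

lemma measurable_lebesgue_AE:
  fixes f f' :: "'a::euclidean_space \<Rightarrow> 'b::topological_space"
  assumes f': "f' \<in> borel_measurable lebesgue" and ae: "AE x in lebesgue. f x = f' x"
  shows "f \<in> borel_measurable lebesgue"
proof (rule measurableI)
  fix A :: "'b set" assume "A \<in> sets borel"
  then have "f' -` A \<inter> space lebesgue \<in> sets lebesgue" using f' by (rule measurable_sets[rotated])
  then show "f -` A \<inter> space lebesgue \<in> sets lebesgue"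
    by (rule completion.in_sets_AE[rotated]) (use ae in auto)
qed auto

lemma lebesgue_on_integral_eq:
  fixes f f' :: "'a::euclidean_space \<Rightarrow> 'b::{banach, second_countable_topology}"
  assumes S: "S \<in> sets borel" and f': "f' \<in> borel_measurable borel"
    and ae: "AE x in lborel. x \<in> S \<longrightarrow> f x = f' x"
  shows "integral\<^sup>L (lebesgue_on S) f = (\<integral>x. indicator S x *\<^sub>R f' x \<partial>lborel)"
    and "integrable (lebesgue_on S) f \<longleftrightarrow> integrable lborel (\<lambda>x. indicator S x *\<^sub>R f' x)"
    and "f \<in> borel_measurable (lebesgue_on S)"
proof -
  note [measurable] = S f'
  have ae': "AE x in lebesgue. indicator S x *\<^sub>R f x = indicator S x *\<^sub>R f' x"
    using AE_completion[OF ae] by eventually_elim (auto split: split_indicator)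
  have m': "(\<lambda>x. indicator S x *\<^sub>R f' x) \<in> borel_measurable lborel" by measurable
  have m: "(\<lambda>x. indicator S x *\<^sub>R f x) \<in> borel_measurable lebesgue"
    by (rule measurable_lebesgue_AE[OF measurable_completion[OF m'] ae'])
  show "integral\<^sup>L (lebesgue_on S) f = (\<integral>x. indicator S x *\<^sub>R f' x \<partial>lborel)"
  proof -
    have "integral\<^sup>L (lebesgue_on S) f = (\<integral>x. indicator S x *\<^sub>R f x \<partial>lebesgue)"
      using S by (intro integral_restrict_space) auto
    also have "\<dots> = (\<integral>x. indicator S x *\<^sub>R f' x \<partial>lebesgue)"
      by (rule integral_cong_AE[OF m measurable_completion[OF m'] ae'])
    finally show ?thesis by (simp add: integral_completion)
  qed
  show "integrable (lebesgue_on S) f \<longleftrightarrow> integrable lborel (\<lambda>x. indicator S x *\<^sub>R f' x)"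
  proof -
    have "integrable (lebesgue_on S) f \<longleftrightarrow> integrable lebesgue (\<lambda>x. indicator S x *\<^sub>R f x)"
      using S by (intro integrable_restrict_space) auto
    also have "\<dots> \<longleftrightarrow> integrable lebesgue (\<lambda>x. indicator S x *\<^sub>R f' x)"
      by (rule integrable_cong_AE[OF m measurable_completion[OF m'] ae'])
    finally show ?thesis by (simp add: integrable_completion)
  qed
  show "f \<in> borel_measurable (lebesgue_on S)"
    using S m by (subst borel_measurable_restrict_space_iff) auto
qed

lemma AE_lebesgue_on_iff:
  assumes "S \<in> sets borel"
  shows "(AE x in lebesgue_on S. P x) \<longleftrightarrow> (AE x in lborel. x \<in> S \<longrightarrow> P x)"
  using assms by (subst AE_restrict_space_iff) (auto simp: AE_completion_iff)

text \<open>\<open>f'\<close> is the representative used in computations; \<open>f\<close> is the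
  function as it occurs in the definitions of controllability and stabilizability.\<close>

definition version :: "'a::euclidean_space set \<Rightarrow> ('a \<Rightarrow> complex) \<Rightarrow> ('a \<Rightarrow> complex) \<Rightarrow> bool" where
  "version S f f' \<longleftrightarrow> sqint lborel f' \<and> (\<forall>x. x \<notin> S \<longrightarrow> f' x = 0) \<and> (AE x in lborel. x \<in> S \<longrightarrow> f x = f' x)"

lemma sqint_iff_integrable:
  "sqint M f \<longleftrightarrow> f \<in> borel_measurable M \<and> integrable M (\<lambda>x. (cmod (f x))\<^sup>2)"
proof (cases "f \<in> borel_measurable M")
  case True
  then have "integrable M (\<lambda>x. (cmod (f x))\<^sup>2) \<longleftrightarrow> sqn M f < top"
    by (subst integrable_iff_bounded) (auto simp: sqn_def ennreal_power)
  with True show ?thesis by (simp add: sqint_def)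
qed (simp add: sqint_def)

lemma l2n_sq: "sqint M f \<Longrightarrow> (l2n M f)\<^sup>2 = (\<integral>x. (cmod (f x))\<^sup>2 \<partial>M)"
proof -
  assume "sqint M f"
  then have "ennreal (\<integral>x. (cmod (f x))\<^sup>2 \<partial>M) = sqn M f"
    using nn_integral_eq_integral[of M "\<lambda>x. (cmod (f x))\<^sup>2"]
    by (auto simp: sqint_iff_integrable sqn_def ennreal_power)
  then have "sqn M f = ennreal (\<integral>x. (cmod (f x))\<^sup>2 \<partial>M)" by (rule sym)
  then show ?thesis by (simp add: l2n_def)
qed

lemma L2_on_version_iff:
  assumes S: "S \<in> sets borel"
  shows "L2_on S f \<longleftrightarrow> (\<exists>f'. version S f f')"
proof
  assume f: "L2_on S f"
  obtain f' where [measurable]: "f' \<in> borel_measurable borel" and 0: "\<forall>x. x \<notin> S \<longrightarrow> f' x = 0"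
    and ae: "AE x in lborel. x \<in> S \<longrightarrow> f x = f' x"
    using borel_version[OF S] f by (auto simp: L2_on_def)
  have "integrable (lebesgue_on S) (\<lambda>x. (cmod (f x))\<^sup>2) \<longleftrightarrow> integrable lborel (\<lambda>x. indicator S x *\<^sub>R (cmod (f' x))\<^sup>2)"
    using ae by (intro lebesgue_on_integral_eq(2)[OF S]) auto
  moreover have "(\<lambda>x. indicator S x *\<^sub>R (cmod (f' x))\<^sup>2) = (\<lambda>x. (cmod (f' x))\<^sup>2)"
    using 0 by (auto split: split_indicator)
  ultimately have "sqint lborel f'" using f by (simp add: sqint_iff_integrable L2_on_def)
  with 0 ae show "\<exists>f'. version S f f'" by (auto simp: version_def)
next
  assume "\<exists>f'. version S f f'"
  then obtain f' where f': "sqint lborel f'" and 0: "\<forall>x. x \<notin> S \<longrightarrow> f' x = 0"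
    and ae: "AE x in lborel. x \<in> S \<longrightarrow> f x = f' x" by (auto simp: version_def)
  have [measurable]: "f' \<in> borel_measurable borel" using f' by (simp add: sqint_def)
  have "integrable (lebesgue_on S) (\<lambda>x. (cmod (f x))\<^sup>2) \<longleftrightarrow> integrable lborel (\<lambda>x. indicator S x *\<^sub>R (cmod (f' x))\<^sup>2)"
    using ae by (intro lebesgue_on_integral_eq(2)[OF S]) auto
  moreover have "(\<lambda>x. indicator S x *\<^sub>R (cmod (f' x))\<^sup>2) = (\<lambda>x. (cmod (f' x))\<^sup>2)"
    using 0 by (auto split: split_indicator)
  ultimately show "L2_on S f"
    using f' lebesgue_on_integral_eq(3)[OF S _ ae] by (simp add: sqint_iff_integrable L2_on_def)
qed

lemma version_integral_sq:
  assumes S: "S \<in> sets borel" and v: "version S f f'"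
  shows "integral\<^sup>L (lebesgue_on S) (\<lambda>x. (cmod (f x))\<^sup>2) = (l2n lborel f')\<^sup>2"
proof -
  have [measurable]: "f' \<in> borel_measurable borel" using v by (simp add: version_def sqint_def)
  have "integral\<^sup>L (lebesgue_on S) (\<lambda>x. (cmod (f x))\<^sup>2) = (\<integral>x. indicator S x *\<^sub>R (cmod (f' x))\<^sup>2 \<partial>lborel)"
    using v by (intro lebesgue_on_integral_eq(1)[OF S]) (auto simp: version_def)
  also have "(\<lambda>x. indicator S x *\<^sub>R (cmod (f' x))\<^sup>2) = (\<lambda>x. (cmod (f' x))\<^sup>2)"
    using v by (auto simp: version_def split: split_indicator)
  also have "(\<integral>x. (cmod (f' x))\<^sup>2 \<partial>lborel) = (l2n lborel f')\<^sup>2"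
    using v by (simp add: l2n_sq version_def)
  finally show ?thesis .
qed

lemma version_L2_norm:
  "S \<in> sets borel \<Longrightarrow> version S f f' \<Longrightarrow> L2_norm_on S f = l2n lborel f'"
  unfolding L2_norm_on_def by (simp add: version_integral_sq)

lemma version_add: "version S f f' \<Longrightarrow> version S h h' \<Longrightarrow> version S (\<lambda>x. f x + h x) (\<lambda>x. f' x + h' x)"
  by (auto simp: version_def intro: sqint_add)

lemma version_diff: "version S f f' \<Longrightarrow> version S h h' \<Longrightarrow> version S (\<lambda>x. f x - h x) (\<lambda>x. f' x - h' x)"
  by (auto simp: version_def intro: sqint_diff)

lemma version_scale: "version S f f' \<Longrightarrow> version S (\<lambda>x. c * f x) (\<lambda>x. c * f' x)"
  by (auto simp: version_def intro: sqint_scale)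

section \<open>Fubini and shear transformations in the plane\<close>

lemma borel_measurable_lborel_pair:
  "borel_measurable (lborel \<Otimes>\<^sub>M lborel) = borel_measurable (borel \<Otimes>\<^sub>M borel)"
  by (rule measurable_cong_sets[OF sets_pair_measure_cong[OF sets_lborel sets_lborel] refl])

lemma nn_plane:
  fixes f :: "real \<times> real \<Rightarrow> ennreal"
  assumes [measurable]: "f \<in> borel_measurable (borel \<Otimes>\<^sub>M borel)"
  shows "(\<integral>\<^sup>+z. f z \<partial>lborel) = (\<integral>\<^sup>+t. \<integral>\<^sup>+x. f (t, x) \<partial>lborel \<partial>lborel)"
  unfolding lborel_prod[symmetric]
  by (rule lborel.nn_integral_fst[symmetric]) (unfold borel_measurable_lborel_pair, fact)

lemma nn_swap:
  fixes f :: "real \<Rightarrow> real \<Rightarrow> ennreal"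
  assumes [measurable]: "case_prod f \<in> borel_measurable (borel \<Otimes>\<^sub>M borel)"
  shows "(\<integral>\<^sup>+x. \<integral>\<^sup>+t. f t x \<partial>lborel \<partial>lborel) = (\<integral>\<^sup>+t. \<integral>\<^sup>+x. f t x \<partial>lborel \<partial>lborel)"
  by (rule lborel_pair.Fubini') (unfold borel_measurable_lborel_pair, fact)

lemma nn_shift:
  fixes f :: "real \<Rightarrow> ennreal"
  assumes "f \<in> borel_measurable borel"
  shows "(\<integral>\<^sup>+x. f (x + c) \<partial>lborel) = (\<integral>\<^sup>+x. f x \<partial>lborel)" "(\<integral>\<^sup>+x. f (c + x) \<partial>lborel) = (\<integral>\<^sup>+x. f x \<partial>lborel)"
    "(\<integral>\<^sup>+x. f (x - c) \<partial>lborel) = (\<integral>\<^sup>+x. f x \<partial>lborel)"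
  using nn_integral_real_affine[OF assms, of 1 c, symmetric]
    nn_integral_real_affine[OF assms, of 1 "-c", symmetric]
  by (simp_all add: add.commute)

lemma integral_shift:
  fixes f :: "real \<Rightarrow> complex"
  shows "(\<integral>x. f (x + c) \<partial>lborel) = (\<integral>x. f x \<partial>lborel)" "(\<integral>x. f (x - c) \<partial>lborel) = (\<integral>x. f x \<partial>lborel)"
  using lborel_integral_real_affine[of 1 f c, symmetric] lborel_integral_real_affine[of 1 f "-c", symmetric]
  by (simp_all add: add.commute)

text \<open>Integration over the plane, characteristic by characteristic: c labels the line t + x =
  c and s is the time on it.\<close>

lemma nn_shear:
  fixes f :: "real \<times> real \<Rightarrow> ennreal"
  assumes [measurable]: "f \<in> borel_measurable (borel \<Otimes>\<^sub>M borel)"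
  shows "(\<integral>\<^sup>+c. \<integral>\<^sup>+s. f (s, c - s) \<partial>lborel \<partial>lborel) = (\<integral>\<^sup>+z. f z \<partial>lborel)"
proof -
  have "(\<integral>\<^sup>+c. \<integral>\<^sup>+s. f (s, c - s) \<partial>lborel \<partial>lborel) = (\<integral>\<^sup>+s. \<integral>\<^sup>+c. f (s, c - s) \<partial>lborel \<partial>lborel)"
    by (rule nn_swap) measurable
  also have "\<dots> = (\<integral>\<^sup>+s. \<integral>\<^sup>+c. f (s, c) \<partial>lborel \<partial>lborel)"
    by (intro nn_integral_cong nn_shift) measurable
  also have "\<dots> = (\<integral>\<^sup>+z. f z \<partial>lborel)" by (rule nn_plane[symmetric]) measurable
  finally show ?thesis .
qed

lemma AE_plane_fst:
  fixes P :: "real \<times> real \<Rightarrow> bool"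
  assumes "AE z in lborel. P z"
  shows "AE t in lborel. AE x in lborel. P (t, x)"
  using lborel_pair.AE_pair[of P] assms unfolding lborel_prod by blast

text \<open>Measurability of the exceptional set is what allows Tonelli to conclude from the
  sections that it is null.\<close>

lemma AE_planeI:
  fixes P :: "real \<times> real \<Rightarrow> bool"
  assumes "Measurable.pred (borel \<Otimes>\<^sub>M borel) P" "AE t in lborel. AE x in lborel. P (t, x)"
  shows "AE z in lborel. P z"
proof -
  have "{z \<in> space (lborel \<Otimes>\<^sub>M lborel). P z} \<in> sets (lborel \<Otimes>\<^sub>M lborel)"
    using assms(1) unfolding pred_def lborel_prod borel_prod by simp
  from lborel_pair.AE_pair_measure[OF this assms(2)] show ?thesis unfolding lborel_prod .
qed

lemma AE_lborel_null_set:
  assumes "AE z in lborel. P z"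
  shows "\<exists>N\<in>sets borel. emeasure lborel N = 0 \<and> (\<forall>z. z \<notin> N \<longrightarrow> P z)"
proof -
  obtain N where N: "{z \<in> space lborel. \<not> P z} \<subseteq> N" "emeasure lborel N = 0" "N \<in> sets lborel"
    by (rule AE_E[OF assms])
  then show ?thesis by (intro bexI[of _ N]) auto
qed

text \<open>The exceptional set is enlarged to a Borel null set, whose measure is then computed in
  the other order of integration.\<close>

lemma AE_plane_snd:
  fixes P :: "real \<times> real \<Rightarrow> bool"
  assumes "AE z in lborel. P z"
  shows "AE x in lborel. AE t in lborel. P (t, x)"
proof -
  obtain N where N: "N \<in> sets borel" "emeasure lborel N = 0" "\<forall>z. z \<notin> N \<longrightarrow> P z"
    using AE_lborel_null_set[OF assms] by blast
  have [measurable]: "N \<in> sets (borel \<Otimes>\<^sub>M borel)" using N unfolding borel_prod by simp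
  have "(\<integral>\<^sup>+x. \<integral>\<^sup>+t. indicator N (t, x) \<partial>lborel \<partial>lborel) = (\<integral>\<^sup>+t. \<integral>\<^sup>+x. indicator N (t, x) \<partial>lborel \<partial>lborel)"
    by (rule nn_swap) measurable
  also have "\<dots> = (\<integral>\<^sup>+z. indicator N z \<partial>lborel)" by (rule nn_plane[symmetric]) measurable
  also have "\<dots> = 0" using N by simp
  finally have "AE x in lborel. (\<integral>\<^sup>+t. indicator N (t, x) \<partial>lborel) = 0"
    by (subst (asm) nn_integral_0_iff_AE) auto
  then show ?thesis
  proof eventually_elim
    case (elim x)
    then have "AE t in lborel. indicator N (t, x) = (0::ennreal)"
      by (subst (asm) nn_integral_0_iff_AE) auto
    then show ?case by eventually_elim (auto simp: indicator_eq_0_iff intro: N(3)[rule_format])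
  qed
qed

lemma AE_shift:
  fixes P :: "real \<Rightarrow> bool"
  assumes "AE x in lborel. P x"
  shows "AE x in lborel. P (c + x)"
proof -
  obtain N where N: "N \<in> sets borel" "emeasure lborel N = 0" "\<forall>z. z \<notin> N \<longrightarrow> P z"
    using AE_lborel_null_set[OF assms] by blast
  note [measurable] = N(1)
  have "AE x in lborel. x \<notin> N" using N by (intro AE_not_in) (auto simp: null_sets_def)
  then have "AE x in lborel. c + 1 * x \<notin> N" by (rule AE_borel_affine[rotated 2]) auto
  then show ?thesis by eventually_elim (use N(3) in auto)
qed

lemma sqint_plane_measurable[measurable_dest]:
  "sqint lborel F \<Longrightarrow> F \<in> borel_measurable (borel \<Otimes>\<^sub>M borel)" for F :: "real \<times> real \<Rightarrow> complex"
  unfolding borel_prod by (simp add: sqint_def)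

lemma sqn_plane:
  fixes F :: "real \<times> real \<Rightarrow> complex"
  assumes "F \<in> borel_measurable (borel \<Otimes>\<^sub>M borel)"
  shows "sqn lborel F = (\<integral>\<^sup>+t. sqn lborel (\<lambda>x. F (t, x)) \<partial>lborel)"
  unfolding sqn_def using assms by (intro nn_plane) measurable

lemma AE_sqint_plane_section:
  fixes F :: "real \<times> real \<Rightarrow> complex"
  assumes "sqint lborel F"
  shows "AE t in lborel. sqint lborel (\<lambda>x. F (t, x))"
  using AE_sqint_section[of lborel lborel F] assms unfolding lborel_prod
  by (simp add: lborel.sigma_finite_measure_axioms)

lemma integrable_planeI:
  fixes f :: "real \<Rightarrow> real \<Rightarrow> complex"
  assumes [measurable]: "case_prod f \<in> borel_measurable (borel \<Otimes>\<^sub>M borel)"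
    and fin: "(\<integral>\<^sup>+t. \<integral>\<^sup>+x. ennreal (cmod (f t x)) \<partial>lborel \<partial>lborel) < \<infinity>"
  shows "integrable (lborel \<Otimes>\<^sub>M lborel) (case_prod f)"
proof (rule integrableI_bounded)
  show "case_prod f \<in> borel_measurable (lborel \<Otimes>\<^sub>M lborel)"
    unfolding borel_measurable_lborel_pair by fact
  have "(\<integral>\<^sup>+z. ennreal (cmod (case_prod f z)) \<partial>(lborel \<Otimes>\<^sub>M lborel)) = (\<integral>\<^sup>+t. \<integral>\<^sup>+x. ennreal (cmod (f t x)) \<partial>lborel \<partial>lborel)"
    unfolding lborel_prod by (subst nn_plane) auto
  with fin show "(\<integral>\<^sup>+z. ennreal (cmod (case_prod f z)) \<partial>(lborel \<Otimes>\<^sub>M lborel)) < \<infinity>" by simp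
qed

lemma integral_plane_swap:
  fixes f :: "real \<Rightarrow> real \<Rightarrow> complex"
  assumes "case_prod f \<in> borel_measurable (borel \<Otimes>\<^sub>M borel)"
    and "(\<integral>\<^sup>+t. \<integral>\<^sup>+x. ennreal (cmod (f t x)) \<partial>lborel \<partial>lborel) < \<infinity>"
  shows "(\<integral>t. \<integral>x. f t x \<partial>lborel \<partial>lborel) = (\<integral>x. \<integral>t. f t x \<partial>lborel \<partial>lborel)"
    and "(\<integral>t. \<integral>x. f t x \<partial>lborel \<partial>lborel) = (\<integral>z. f (fst z) (snd z) \<partial>lborel)"
proof -
  note I = integrable_planeI[OF assms]
  show "(\<integral>t. \<integral>x. f t x \<partial>lborel \<partial>lborel) = (\<integral>x. \<integral>t. f t x \<partial>lborel \<partial>lborel)"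
    by (rule lborel_pair.Fubini_integral[OF I, symmetric])
  show "(\<integral>t. \<integral>x. f t x \<partial>lborel \<partial>lborel) = (\<integral>z. f (fst z) (snd z) \<partial>lborel)"
    using lborel_pair.integral_fst[OF I] unfolding lborel_prod by (simp add: case_prod_beta')
qed

text \<open>\<open>g\<close> stands for a Borel representative of the kernel. Since it vanishes off
  the open square, all space integrals can run over the whole line.\<close>

locale transport =
  fixes L :: real and g :: "real \<times> real \<Rightarrow> complex"
  assumes L: "L > 0" and g: "sqint lborel g"
    and g0: "\<And>x y. \<not> (0 < x \<and> x < L \<and> 0 < y \<and> y < L) \<Longrightarrow> g (x, y) = 0"
begin

lemma gm[measurable]: "g \<in> borel_measurable (borel \<Otimes>\<^sub>M borel)"
  using g by measurable

lemma AE_g_section: "AE x in lborel. sqint lborel (\<lambda>y. g (x, y))"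
  by (rule AE_sqint_plane_section[OF g])

section \<open>The integral term as an operator acting on each time slice\<close>

definition Gop :: "(real \<times> real \<Rightarrow> complex) \<Rightarrow> real \<times> real \<Rightarrow> complex" where
  "Gop v z = (\<integral>y. g (snd z, y) * v (fst z, y) \<partial>lborel)"

lemma Gop_measurable[measurable]:
  assumes [measurable]: "v \<in> borel_measurable (borel \<Otimes>\<^sub>M borel)"
  shows "Gop v \<in> borel_measurable (borel \<Otimes>\<^sub>M borel)"
  unfolding Gop_def[abs_def] by measurable

lemma Gop_eq_0: "\<not> (0 < x \<and> x < L) \<Longrightarrow> Gop v (t, x) = 0"
proof -
  assume "\<not> (0 < x \<and> x < L)"
  then have "g (x, y) = 0" for y by (intro g0) auto
  then show ?thesis by (simp add: Gop_def)
qed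

lemma Gop_section_le:
  assumes [measurable]: "v \<in> borel_measurable (borel \<Otimes>\<^sub>M borel)"
  shows "sqn lborel (\<lambda>x. Gop v (t, x)) \<le> sqn lborel g * sqn lborel (\<lambda>y. v (t, y))"
proof -
  have "sqn lborel (\<lambda>x. Gop v (t, x)) \<le> (\<integral>\<^sup>+x. sqn lborel (\<lambda>y. g (x, y)) * sqn lborel (\<lambda>y. v (t, y)) \<partial>lborel)"
    unfolding sqn_def[of lborel "\<lambda>x. Gop v (t, x)"] unfolding Gop_def fst_conv snd_conv
    by (intro nn_integral_mono integral_mult_sq_le) measurable
  also have "\<dots> = sqn lborel g * sqn lborel (\<lambda>y. v (t, y))"
    unfolding sqn_plane[OF gm] by (rule nn_integral_multc) (unfold sqn_def, measurable)
  finally show ?thesis .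
qed

lemma sqn_Gop_le:
  assumes [measurable]: "v \<in> borel_measurable (borel \<Otimes>\<^sub>M borel)"
  shows "sqn lborel (Gop v) \<le> sqn lborel g * sqn lborel v"
proof -
  have "sqn lborel (Gop v) = (\<integral>\<^sup>+t. sqn lborel (\<lambda>x. Gop v (t, x)) \<partial>lborel)"
    by (rule sqn_plane) measurable
  also have "\<dots> \<le> (\<integral>\<^sup>+t. sqn lborel g * sqn lborel (\<lambda>y. v (t, y)) \<partial>lborel)"
    by (rule nn_integral_mono, rule Gop_section_le, rule assms)
  also have "\<dots> = sqn lborel g * sqn lborel v"
    unfolding sqn_plane[OF assms] by (rule nn_integral_cmult) (unfold sqn_def, measurable)
  finally show ?thesis .
qed

lemma sqint_Gop:
  assumes v: "sqint lborel v" shows "sqint lborel (Gop v)"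
proof -
  have m: "v \<in> borel_measurable (borel \<Otimes>\<^sub>M borel)" using v by measurable
  have "sqn lborel g * sqn lborel v < top" using v g by (simp add: sqint_def ennreal_mult_less_top)
  from le_less_trans[OF sqn_Gop_le[OF m] this] Gop_measurable[OF m] show ?thesis
    unfolding borel_prod by (simp add: sqint_def)
qed

text \<open>States that agree almost everywhere have the same image at every x. This is how an
  almost everywhere description of the states turns into an everywhere equation for F.\<close>

lemma Gop_section_cong:
  assumes "AE y in lborel. 0 < y \<longrightarrow> y < L \<longrightarrow> v (t, y) = w (t, y)"
    "v \<in> borel_measurable (borel \<Otimes>\<^sub>M borel)" "w \<in> borel_measurable (borel \<Otimes>\<^sub>M borel)"
  shows "Gop v (t, x) = Gop w (t, x)"
proof -
  note [measurable] = assms(2,3)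
  show ?thesis unfolding Gop_def fst_conv snd_conv
  proof (rule integral_cong_AE)
    show "AE y in lborel. g (x, y) * v (t, y) = g (x, y) * w (t, y)"
      using assms(1)
    proof eventually_elim
      case (elim y)
      then show ?case by (cases "0 < y \<and> y < L") (auto simp: g0)
    qed
  qed measurable
qed

lemma Gop_add:
  assumes v: "sqint lborel v" and w: "sqint lborel w"
  shows "AE z in lborel. Gop (\<lambda>z. v z + w z) z = Gop v z + Gop w z"
proof (rule AE_planeI)
  have [measurable]: "v \<in> borel_measurable (borel \<Otimes>\<^sub>M borel)" "w \<in> borel_measurable (borel \<Otimes>\<^sub>M borel)"
    using v w by measurable
  show "Measurable.pred (borel \<Otimes>\<^sub>M borel) (\<lambda>z. Gop (\<lambda>z. v z + w z) z = Gop v z + Gop w z)" by measurable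
  show "AE t in lborel. AE x in lborel. Gop (\<lambda>z. v z + w z) (t, x) = Gop v (t, x) + Gop w (t, x)"
    using AE_sqint_plane_section[OF v] AE_sqint_plane_section[OF w]
  proof eventually_elim
    case (elim t)
    show ?case using AE_g_section
    proof eventually_elim
      case (elim x)
      with \<open>sqint lborel (\<lambda>x. v (t, x))\<close> \<open>sqint lborel (\<lambda>x. w (t, x))\<close> show ?case
        by (simp add: Gop_def distrib_left integrable_mult_sqint)
    qed
  qed
qed

section \<open>Integrals along characteristics and the kernel of the fixed point equation\<close>

definition strip :: "(real \<times> real \<Rightarrow> complex) \<Rightarrow> bool" where
  "strip F \<longleftrightarrow> (\<forall>t x. \<not> (0 < t \<and> t < L) \<longrightarrow> F (t, x) = 0)"

lemma strip_Gop: "strip v \<Longrightarrow> strip (Gop v)"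
  by (auto simp: strip_def Gop_def)

text \<open>The integral of |F| over the characteristic with label c. It dominates every line
  integral of F with a weight bounded by 1, uniformly in t.\<close>

definition CN :: "(real \<times> real \<Rightarrow> complex) \<Rightarrow> real \<Rightarrow> ennreal" where
  "CN F c = (\<integral>\<^sup>+s. ennreal (cmod (F (s, c - s))) \<partial>lborel)"

lemma CN_measurable[measurable]:
  assumes [measurable]: "F \<in> borel_measurable (borel \<Otimes>\<^sub>M borel)"
  shows "CN F \<in> borel_measurable borel"
  unfolding CN_def[abs_def] by measurable

text \<open>Cauchy-Schwarz on each line costs the length of the time set, and the shear turns the
  remaining integral over all lines into an integral over the plane. A short time set gives a small
  factor, which later yields continuity in time.\<close>

lemma nn_CN_sq_le:
  assumes [measurable]: "F \<in> borel_measurable (borel \<Otimes>\<^sub>M borel)"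
    and I: "I \<in> sets borel" "emeasure lborel I \<le> ennreal d" "\<And>s x. s \<notin> I \<Longrightarrow> F (s, x) = 0"
  shows "(\<integral>\<^sup>+c. (CN F c)\<^sup>2 \<partial>lborel) \<le> ennreal d * sqn lborel F"
proof -
  note [measurable] = I(1)
  have "(CN F c)\<^sup>2 \<le> ennreal d * (\<integral>\<^sup>+s. (ennreal (cmod (F (s, c - s))))\<^sup>2 \<partial>lborel)" for c
  proof -
    have "CN F c = (\<integral>\<^sup>+s. indicator I s * ennreal (cmod (F (s, c - s))) \<partial>lborel)"
      unfolding CN_def using I(3) by (intro nn_integral_cong) (auto split: split_indicator)
    then have "(CN F c)\<^sup>2 \<le> (\<integral>\<^sup>+s. (indicator I s)\<^sup>2 \<partial>lborel) * (\<integral>\<^sup>+s. (ennreal (cmod (F (s, c - s))))\<^sup>2 \<partial>lborel)"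
      by (simp only:) (rule Cauchy_Schwarz_nn_integral, measurable)
    also have "(\<integral>\<^sup>+s. (indicator I s)\<^sup>2 \<partial>lborel) = emeasure lborel I"
    proof -
      have "(\<lambda>s. (indicator I s)\<^sup>2 :: ennreal) = indicator I" by (auto split: split_indicator)
      then show ?thesis by simp
    qed
    also have "emeasure lborel I * (\<integral>\<^sup>+s. (ennreal (cmod (F (s, c - s))))\<^sup>2 \<partial>lborel)
        \<le> ennreal d * (\<integral>\<^sup>+s. (ennreal (cmod (F (s, c - s))))\<^sup>2 \<partial>lborel)"
      using I(2) by (intro mult_right_mono) auto
    finally show ?thesis .
  qed
  then have "(\<integral>\<^sup>+c. (CN F c)\<^sup>2 \<partial>lborel)
      \<le> (\<integral>\<^sup>+c. ennreal d * (\<integral>\<^sup>+s. (ennreal (cmod (F (s, c - s))))\<^sup>2 \<partial>lborel) \<partial>lborel)"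
    by (rule nn_integral_mono)
  also have "\<dots> = ennreal d * (\<integral>\<^sup>+c. \<integral>\<^sup>+s. (ennreal (cmod (F (s, c - s))))\<^sup>2 \<partial>lborel \<partial>lborel)"
    by (rule nn_integral_cmult) measurable
  also have "(\<integral>\<^sup>+c. \<integral>\<^sup>+s. (ennreal (cmod (F (s, c - s))))\<^sup>2 \<partial>lborel \<partial>lborel) = sqn lborel F"
    unfolding sqn_def by (rule nn_shear) measurable
  finally show ?thesis .
qed

lemma nn_CN_sq_strip:
  assumes "F \<in> borel_measurable (borel \<Otimes>\<^sub>M borel)" "strip F"
  shows "(\<integral>\<^sup>+c. (CN F c)\<^sup>2 \<partial>lborel) \<le> ennreal L * sqn lborel F"
  using assms L by (intro nn_CN_sq_le[of F "{0<..<L}"]) (auto simp: strip_def)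

lemma AE_CN_finite:
  assumes F: "sqint lborel F" "strip F"
  shows "AE c in lborel. CN F c < \<infinity>"
proof -
  have [measurable]: "F \<in> borel_measurable (borel \<Otimes>\<^sub>M borel)" using F by measurable
  have "ennreal L * sqn lborel F < \<infinity>" using F by (simp add: sqint_def ennreal_mult_less_top)
  then have "(\<integral>\<^sup>+c. (CN F c)\<^sup>2 \<partial>lborel) \<noteq> \<infinity>"
    using nn_CN_sq_strip[of F] F by auto
  then have "AE c in lborel. (CN F c)\<^sup>2 \<noteq> \<infinity>" by (intro nn_integral_noteq_infinite) auto
  then show ?thesis by eventually_elim (auto simp: less_top power2_eq_square ennreal_mult_eq_top_iff)
qed

lemma integrable_char:
  assumes [measurable]: "F \<in> borel_measurable (borel \<Otimes>\<^sub>M borel)" "w \<in> borel_measurable borel"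
    and w: "\<And>s. cmod (w s) \<le> 1" and c: "CN F c < \<infinity>"
  shows "integrable lborel (\<lambda>s. w s * F (s, c - s))"
proof (rule integrableI_bounded)
  have "(\<integral>\<^sup>+s. ennreal (cmod (w s * F (s, c - s))) \<partial>lborel) \<le> CN F c"
    unfolding CN_def using w
    by (intro nn_integral_mono ennreal_leI) (auto simp: norm_mult mult_left_le_one_le)
  then show "(\<integral>\<^sup>+s. ennreal (cmod (w s * F (s, c - s))) \<partial>lborel) < \<infinity>" using c by (rule le_less_trans)
qed measurable

text \<open>The three arguments are the evaluation time t, the integration time s and the label c of
  the characteristic.\<close>

definition bweight :: "(real \<times> real \<times> real \<Rightarrow> complex) \<Rightarrow> bool" where
  "bweight \<omega> \<longleftrightarrow> \<omega> \<in> borel_measurable (borel \<Otimes>\<^sub>M borel \<Otimes>\<^sub>M borel) \<and> (\<forall>z. cmod (\<omega> z) \<le> 1)"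

lemma bweight_measurable[measurable_dest]: "bweight \<omega> \<Longrightarrow> \<omega> \<in> borel_measurable (borel \<Otimes>\<^sub>M borel \<Otimes>\<^sub>M borel)"
  by (simp add: bweight_def)

definition Rop :: "(real \<times> real \<times> real \<Rightarrow> complex) \<Rightarrow> (real \<times> real \<Rightarrow> complex) \<Rightarrow> real \<times> real \<Rightarrow> complex" where
  "Rop \<omega> F z = (\<integral>s. \<omega> (fst z, s, fst z + snd z) * F (s, fst z + snd z - s) \<partial>lborel)"

lemma Rop_measurable[measurable]:
  assumes [measurable]: "\<omega> \<in> borel_measurable (borel \<Otimes>\<^sub>M borel \<Otimes>\<^sub>M borel)" "F \<in> borel_measurable (borel \<Otimes>\<^sub>M borel)"
  shows "Rop \<omega> F \<in> borel_measurable (borel \<Otimes>\<^sub>M borel)"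
  unfolding Rop_def[abs_def] by measurable

lemma Rop_le_CN:
  assumes "bweight \<omega>"
  shows "ennreal (cmod (Rop \<omega> F (t, y))) \<le> CN F (t + y)"
proof -
  have "ennreal (cmod (Rop \<omega> F (t, y))) \<le> (\<integral>\<^sup>+s. ennreal (cmod (\<omega> (t, s, t + y) * F (s, t + y - s))) \<partial>lborel)"
    unfolding Rop_def fst_conv snd_conv by (rule norm_integral_le_nn)
  also have "\<dots> \<le> CN F (t + y)"
    unfolding CN_def using assms
    by (intro nn_integral_mono ennreal_leI) (auto simp: norm_mult mult_left_le_one_le bweight_def)
  finally show ?thesis .
qed

definition Jop :: "(real \<Rightarrow> complex) \<Rightarrow> real \<times> real \<Rightarrow> complex" where
  "Jop a z = (if 0 < fst z \<and> fst z < L then a (fst z + snd z) else 0)"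

text \<open>The data \<open>a\<close> is indexed by the label of the characteristic: labels below L
  carry initial values, labels above L carry boundary or final values.\<close>

definition traj :: "(real \<times> real \<times> real \<Rightarrow> complex) \<Rightarrow> (real \<Rightarrow> complex) \<Rightarrow> (real \<times> real \<Rightarrow> complex) \<Rightarrow> real \<times> real \<Rightarrow> complex" where
  "traj \<omega> a F z = (if 0 < fst z \<and> fst z < L then a (fst z + snd z) + Rop \<omega> F z else 0)"

lemma Jop_measurable[measurable]:
  assumes [measurable]: "a \<in> borel_measurable borel"
  shows "Jop a \<in> borel_measurable (borel \<Otimes>\<^sub>M borel)"
  unfolding Jop_def[abs_def] by measurable

lemma nn_strip_shear:
  fixes f :: "real \<Rightarrow> ennreal"
  assumes [measurable]: "f \<in> borel_measurable borel"
  shows "(\<integral>\<^sup>+z. (if 0 < fst z \<and> fst z < L then f (fst z + snd z) else 0) \<partial>lborel) = ennreal L * (\<integral>\<^sup>+c. f c \<partial>lborel)"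
proof -
  have "(\<integral>\<^sup>+z. (if 0 < fst z \<and> fst z < L then f (fst z + snd z) else 0) \<partial>lborel)
      = (\<integral>\<^sup>+t. \<integral>\<^sup>+x. (if 0 < t \<and> t < L then f (t + x) else 0) \<partial>lborel \<partial>lborel)"
    by (subst nn_plane) (auto cong: if_cong)
  also have "\<dots> = (\<integral>\<^sup>+t. indicator {0<..<L} t * (\<integral>\<^sup>+c. f c \<partial>lborel) \<partial>lborel)"
    by (intro nn_integral_cong) (auto simp: nn_shift split: split_indicator)
  also have "\<dots> = ennreal L * (\<integral>\<^sup>+c. f c \<partial>lborel)"
    using L by (subst nn_integral_multc) auto
  finally show ?thesis .
qed

lemma sqn_Jop: "a \<in> borel_measurable borel \<Longrightarrow> sqn lborel (Jop a) = ennreal L * sqn lborel a"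
  unfolding sqn_def by (subst nn_strip_shear[symmetric]) (auto simp: Jop_def intro!: nn_integral_cong)

lemma sqint_Jop: "sqint lborel a \<Longrightarrow> sqint lborel (Jop a)"
  using sqn_Jop[of a] Jop_measurable[of a] unfolding borel_prod
  by (auto simp: sqint_def ennreal_mult_less_top)

text \<open>The kernel of \<open>Gop\<close> after \<open>Rop\<close>. The point q = (s, w) lies on
  the characteristic through (t, y) exactly if y = w + s - t, which is the second argument of
  \<open>g\<close>.\<close>

definition kk :: "(real \<times> real \<times> real \<Rightarrow> complex) \<Rightarrow> (real \<times> real) \<times> (real \<times> real) \<Rightarrow> complex" where
  "kk \<omega> z = (if 0 < fst (fst z) \<and> fst (fst z) < L \<and> 0 < fst (snd z) \<and> fst (snd z) < L
     then g (snd (fst z), snd (snd z) + fst (snd z) - fst (fst z)) * \<omega> (fst (fst z), fst (snd z), fst (snd z) + snd (snd z)) else 0)"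

lemma kk_measurable:
  assumes [measurable]: "\<omega> \<in> borel_measurable (borel \<Otimes>\<^sub>M borel \<Otimes>\<^sub>M borel)"
  shows "kk \<omega> \<in> borel_measurable ((borel \<Otimes>\<^sub>M borel) \<Otimes>\<^sub>M (borel \<Otimes>\<^sub>M borel))"
  unfolding kk_def[abs_def] by measurable

lemma lborel_plane2_measurable: "borel_measurable ((lborel :: (real \<times> real) measure) \<Otimes>\<^sub>M lborel)
    = borel_measurable ((borel \<Otimes>\<^sub>M borel) \<Otimes>\<^sub>M (borel \<Otimes>\<^sub>M borel))"
  unfolding borel_measurable_lborel_pair borel_prod ..

text \<open>For fixed t and s the kernel is a translate of the section g(x, .) times a weight of
  modulus at most 1. Integrating over s and t in (0, L) bounds its squared norm by L^2 times that of
  \<open>g\<close>.\<close>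

lemma sqint_kk:
  assumes \<omega>: "bweight \<omega>"
  shows "sqint (lborel \<Otimes>\<^sub>M lborel) (kk \<omega>)"
proof -
  have m[measurable]: "kk \<omega> \<in> borel_measurable ((borel \<Otimes>\<^sub>M borel) \<Otimes>\<^sub>M (borel \<Otimes>\<^sub>M borel))"
    using \<omega> by (intro kk_measurable bweight_measurable)
  have m': "kk \<omega> \<in> borel_measurable (lborel \<Otimes>\<^sub>M lborel)" unfolding lborel_plane2_measurable by fact
  have inner: "sqn lborel (\<lambda>q. kk \<omega> ((t, x), q)) \<le> (if 0 < t \<and> t < L then ennreal L * sqn lborel (\<lambda>y. g (x, y)) else 0)" for t x
  proof (cases "0 < t \<and> t < L")
    case True
    have "sqn lborel (\<lambda>q. kk \<omega> ((t, x), q)) = (\<integral>\<^sup>+s. \<integral>\<^sup>+w. (ennreal (cmod (kk \<omega> ((t, x), (s, w)))))\<^sup>2 \<partial>lborel \<partial>lborel)"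
      unfolding sqn_def by (rule nn_plane) measurable
    also have "\<dots> \<le> (\<integral>\<^sup>+s. indicator {0<..<L} s * sqn lborel (\<lambda>y. g (x, y)) \<partial>lborel)"
    proof (intro nn_integral_mono)
      fix s
      have "(\<integral>\<^sup>+w. (ennreal (cmod (kk \<omega> ((t, x), (s, w)))))\<^sup>2 \<partial>lborel)
          \<le> indicator {0<..<L} s * (\<integral>\<^sup>+w. (ennreal (cmod (g (x, w + (s - t)))))\<^sup>2 \<partial>lborel)"
      proof (cases "0 < s \<and> s < L")
        case True
        have "(ennreal (cmod (kk \<omega> ((t, x), (s, w)))))\<^sup>2 \<le> (ennreal (cmod (g (x, w + (s - t)))))\<^sup>2" for w
        proof -
          have "cmod (kk \<omega> ((t, x), (s, w))) \<le> cmod (g (x, w + (s - t)))"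
            using \<omega> mult_left_mono[of "cmod (\<omega> (t, s, s + w))" 1 "cmod (g (x, w + s - t))"]
            by (auto simp: kk_def norm_mult bweight_def add_diff_eq)
          then show ?thesis by (intro power_mono ennreal_leI) auto
        qed
        then show ?thesis using True by (simp add: nn_integral_mono)
      qed (auto simp: kk_def)
      also have "(\<integral>\<^sup>+w. (ennreal (cmod (g (x, w + (s - t)))))\<^sup>2 \<partial>lborel) = sqn lborel (\<lambda>y. g (x, y))"
        unfolding sqn_def by (rule nn_shift(1)[of "\<lambda>y. (ennreal (cmod (g (x, y))))\<^sup>2"]) measurable
      finally show "(\<integral>\<^sup>+w. (ennreal (cmod (kk \<omega> ((t, x), (s, w)))))\<^sup>2 \<partial>lborel)
          \<le> indicator {0<..<L} s * sqn lborel (\<lambda>y. g (x, y))" .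
    qed
    also have "\<dots> = ennreal L * sqn lborel (\<lambda>y. g (x, y))"
      using L by (subst nn_integral_multc) auto
    finally show ?thesis using True by simp
  next
    case False
    then have "kk \<omega> ((t, x), q) = 0" for q by (auto simp: kk_def)
    then show ?thesis by simp
  qed
  have "sqn (lborel \<Otimes>\<^sub>M lborel) (kk \<omega>) = (\<integral>\<^sup>+p. sqn lborel (\<lambda>q. kk \<omega> (p, q)) \<partial>lborel)"
    by (rule sqn_pair[OF m' lborel.sigma_finite_measure_axioms])
  also have "\<dots> = (\<integral>\<^sup>+t. \<integral>\<^sup>+x. sqn lborel (\<lambda>q. kk \<omega> ((t, x), q)) \<partial>lborel \<partial>lborel)"
  proof (rule nn_plane)
    have "(\<lambda>p. sqn lborel (\<lambda>q. kk \<omega> (p, q))) \<in> borel_measurable (lborel :: (real \<times> real) measure)"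
      unfolding sqn_def using m' by measurable
    then show "(\<lambda>p. sqn lborel (\<lambda>q. kk \<omega> (p, q))) \<in> borel_measurable (borel \<Otimes>\<^sub>M borel)"
      unfolding borel_prod by simp
  qed
  also have "\<dots> \<le> (\<integral>\<^sup>+t. \<integral>\<^sup>+x. (if 0 < t \<and> t < L then ennreal L * sqn lborel (\<lambda>y. g (x, y)) else 0) \<partial>lborel \<partial>lborel)"
    by (intro nn_integral_mono inner)
  also have "\<dots> = (\<integral>\<^sup>+t. indicator {0<..<L} t * (ennreal L * sqn lborel g) \<partial>lborel)"
  proof -
    have "(\<integral>\<^sup>+x. ennreal L * sqn lborel (\<lambda>y. g (x, y)) \<partial>lborel) = ennreal L * sqn lborel g"
      unfolding sqn_plane[OF gm] by (rule nn_integral_cmult) (unfold sqn_def, measurable)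
    then show ?thesis by (intro nn_integral_cong) (auto split: split_indicator)
  qed
  also have "\<dots> = ennreal L * (ennreal L * sqn lborel g)"
    using L by (subst nn_integral_multc) auto
  also have "\<dots> < top" using g by (simp add: sqint_def ennreal_mult_less_top)
  finally show ?thesis using m' by (simp add: sqint_def)
qed

lemma kop_kk_strip:
  "kop (kk \<omega>) F = kop (kk \<omega>) (\<lambda>z. if 0 < fst z \<and> fst z < L then F z else 0)"
  by (rule ext) (auto simp: kop_def kk_def intro!: Bochner_Integration.integral_cong)

text \<open>Fubini in y and s, followed by the shift to the position at time s. Absolute
  integrability holds because the section g(x, .) and \<open>CN F\<close> are both square
  integrable.\<close>

lemma Gop_Rop:
  assumes \<omega>: "bweight \<omega>" and F: "sqint lborel F" "strip F"
    and x: "sqint lborel (\<lambda>y. g (x, y))" and t: "0 < t" "t < L"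
  shows "Gop (Rop \<omega> F) (t, x) = kop (kk \<omega>) F (t, x)"
    and "integrable lborel (\<lambda>y. g (x, y) * Rop \<omega> F (t, y))"
proof -
  have [measurable]: "\<omega> \<in> borel_measurable (borel \<Otimes>\<^sub>M borel \<Otimes>\<^sub>M borel)" using \<omega> by measurable
  have [measurable]: "F \<in> borel_measurable (borel \<Otimes>\<^sub>M borel)" using F by measurable
  define f where "f y s = g (x, y) * (\<omega> (t, s, t + y) * F (s, t + y - s))" for y s
  have fm[measurable]: "case_prod f \<in> borel_measurable (borel \<Otimes>\<^sub>M borel)"
    unfolding f_def[abs_def] by measurable
  have CNf: "(\<integral>\<^sup>+y. ennreal (cmod (g (x, y))) * CN F (t + y) \<partial>lborel) < \<infinity>"
  proof -
    have "(\<integral>\<^sup>+y. ennreal (cmod (g (x, y))) * CN F (t + y) \<partial>lborel)\<^sup>2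
        \<le> (\<integral>\<^sup>+y. (ennreal (cmod (g (x, y))))\<^sup>2 \<partial>lborel) * (\<integral>\<^sup>+y. (CN F (t + y))\<^sup>2 \<partial>lborel)"
      by (rule Cauchy_Schwarz_nn_integral) measurable
    also have "(\<integral>\<^sup>+y. (CN F (t + y))\<^sup>2 \<partial>lborel) = (\<integral>\<^sup>+c. (CN F c)\<^sup>2 \<partial>lborel)"
      by (rule nn_shift(2)[of "\<lambda>c. (CN F c)\<^sup>2"]) measurable
    also have "(\<integral>\<^sup>+y. (ennreal (cmod (g (x, y))))\<^sup>2 \<partial>lborel) * (\<integral>\<^sup>+c. (CN F c)\<^sup>2 \<partial>lborel) < top"
    proof -
      have "ennreal L * sqn lborel F < top" using F by (simp add: sqint_def ennreal_mult_less_top)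
      then have "(\<integral>\<^sup>+c. (CN F c)\<^sup>2 \<partial>lborel) < top"
        by (rule le_less_trans[OF nn_CN_sq_strip, rotated 2]) (use F in auto)
      then show ?thesis using x by (simp add: sqint_def sqn_def ennreal_mult_less_top)
    qed
    finally show ?thesis by (simp add: power_less_top_ennreal)
  qed
  have "(\<integral>\<^sup>+y. \<integral>\<^sup>+s. ennreal (cmod (f y s)) \<partial>lborel \<partial>lborel) \<le> (\<integral>\<^sup>+y. ennreal (cmod (g (x, y))) * CN F (t + y) \<partial>lborel)"
  proof (intro nn_integral_mono)
    fix y
    have "(\<integral>\<^sup>+s. ennreal (cmod (f y s)) \<partial>lborel) \<le> (\<integral>\<^sup>+s. ennreal (cmod (g (x, y))) * ennreal (cmod (F (s, t + y - s))) \<partial>lborel)"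
      unfolding f_def using \<omega>
      by (intro nn_integral_mono) (auto simp: norm_mult ennreal_mult[symmetric] bweight_def intro!: ennreal_leI mult_left_mono mult_left_le_one_le)
    also have "\<dots> = ennreal (cmod (g (x, y))) * CN F (t + y)"
      unfolding CN_def by (rule nn_integral_cmult) measurable
    finally show "(\<integral>\<^sup>+s. ennreal (cmod (f y s)) \<partial>lborel) \<le> ennreal (cmod (g (x, y))) * CN F (t + y)" .
  qed
  then have fin: "(\<integral>\<^sup>+y. \<integral>\<^sup>+s. ennreal (cmod (f y s)) \<partial>lborel \<partial>lborel) < \<infinity>"
    using CNf by (rule le_less_trans)
  define h where "h s w = kk \<omega> ((t, x), (s, w)) * F (s, w)" for s w
  have hf: "h s w = f (w + (s - t)) s" for s w
    using F(2) t by (auto simp: h_def kk_def f_def strip_def algebra_simps)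
  have hm: "case_prod h \<in> borel_measurable (borel \<Otimes>\<^sub>M borel)"
    unfolding hf[abs_def] f_def[abs_def] by measurable
  have fin2: "(\<integral>\<^sup>+s. \<integral>\<^sup>+w. ennreal (cmod (h s w)) \<partial>lborel \<partial>lborel) < \<infinity>"
  proof -
    have "(\<integral>\<^sup>+s. \<integral>\<^sup>+w. ennreal (cmod (h s w)) \<partial>lborel \<partial>lborel) = (\<integral>\<^sup>+s. \<integral>\<^sup>+y. ennreal (cmod (f y s)) \<partial>lborel \<partial>lborel)"
      unfolding hf by (intro nn_integral_cong nn_shift(1)[of "\<lambda>y. ennreal (cmod (f y _))"]) measurable
    also have "\<dots> = (\<integral>\<^sup>+y. \<integral>\<^sup>+s. ennreal (cmod (f y s)) \<partial>lborel \<partial>lborel)"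
      by (rule nn_swap[of "\<lambda>y s. ennreal (cmod (f y s))"]) measurable
    finally show ?thesis using fin by simp
  qed
  have "Gop (Rop \<omega> F) (t, x) = (\<integral>y. \<integral>s. f y s \<partial>lborel \<partial>lborel)"
    unfolding Gop_def Rop_def f_def by simp
  also have "\<dots> = (\<integral>s. \<integral>y. f y s \<partial>lborel \<partial>lborel)" by (rule integral_plane_swap(1)[OF fm fin])
  also have "\<dots> = (\<integral>s. \<integral>w. h s w \<partial>lborel \<partial>lborel)"
    unfolding hf by (intro Bochner_Integration.integral_cong refl integral_shift(1)[symmetric])
  also have "\<dots> = (\<integral>z. h (fst z) (snd z) \<partial>lborel)" by (rule integral_plane_swap(2)[OF hm fin2])
  also have "\<dots> = kop (kk \<omega>) F (t, x)" unfolding kop_def h_def by simp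
  finally show "Gop (Rop \<omega> F) (t, x) = kop (kk \<omega>) F (t, x)" .
  show "integrable lborel (\<lambda>y. g (x, y) * Rop \<omega> F (t, y))"
    using lborel_pair.integrable_fst[OF integrable_planeI[OF fm fin]]
    unfolding f_def Rop_def by simp
qed

text \<open>The line integral is dominated by \<open>CN F\<close> at the label t + x, and a function
  of the label integrates over the strip to L times its integral over the line.\<close>

lemma sqint_traj:
  assumes \<omega>: "bweight \<omega>" and F: "sqint lborel F" "strip F" and a: "sqint lborel a"
  shows "sqint lborel (traj \<omega> a F)"
    and "sqn lborel (\<lambda>z. if 0 < fst z \<and> fst z < L then Rop \<omega> F z else 0) \<le> ennreal L * (ennreal L * sqn lborel F)"
proof -
  have [measurable]: "\<omega> \<in> borel_measurable (borel \<Otimes>\<^sub>M borel \<Otimes>\<^sub>M borel)" using \<omega> by measurable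
  have [measurable]: "F \<in> borel_measurable (borel \<Otimes>\<^sub>M borel)" using F by measurable
  let ?R = "\<lambda>z. if 0 < fst z \<and> fst z < L then Rop \<omega> F z else 0"
  have Rm: "?R \<in> borel_measurable (borel \<Otimes>\<^sub>M borel)" by measurable
  have "sqn lborel ?R \<le> (\<integral>\<^sup>+z. (if 0 < fst z \<and> fst z < L then (CN F (fst z + snd z))\<^sup>2 else 0) \<partial>lborel)"
    unfolding sqn_def
  proof (intro nn_integral_mono)
    fix z :: "real \<times> real"
    show "(ennreal (cmod (?R z)))\<^sup>2 \<le> (if 0 < fst z \<and> fst z < L then (CN F (fst z + snd z))\<^sup>2 else 0)"
      using Rop_le_CN[OF \<omega>, of F "fst z" "snd z"] by (auto intro: power_mono)
  qed
  also have "\<dots> = ennreal L * (\<integral>\<^sup>+c. (CN F c)\<^sup>2 \<partial>lborel)" by (rule nn_strip_shear) measurable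
  also have "\<dots> \<le> ennreal L * (ennreal L * sqn lborel F)"
    using F by (intro mult_left_mono nn_CN_sq_strip) auto
  finally show le: "sqn lborel ?R \<le> ennreal L * (ennreal L * sqn lborel F)" .
  also have "\<dots> < top" using F by (simp add: sqint_def ennreal_mult_less_top)
  finally have "sqint lborel ?R" using Rm unfolding borel_prod by (simp add: sqint_def)
  from sqint_add[OF sqint_Jop[OF a] this] show "sqint lborel (traj \<omega> a F)"
    by (rule back_subst[of "sqint lborel"]) (auto simp: Jop_def traj_def)
qed

text \<open>Identifies the terms of the fixed point equation: H is \<open>Gop (Jop a)\<close>, and K
  has the kernel \<open>kk \<omega>\<close>.\<close>

lemma Gop_traj:
  assumes \<omega>: "bweight \<omega>" and F: "sqint lborel F" "strip F" and a: "sqint lborel a"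
  shows "AE z in lborel. Gop (traj \<omega> a F) z = Gop (Jop a) z + kop (kk \<omega>) F z"
proof (rule AE_planeI)
  have [measurable]: "\<omega> \<in> borel_measurable (borel \<Otimes>\<^sub>M borel \<Otimes>\<^sub>M borel)" using \<omega> by measurable
  have [measurable]: "F \<in> borel_measurable (borel \<Otimes>\<^sub>M borel)" using F by measurable
  have [measurable]: "a \<in> borel_measurable borel" using a by (simp add: sqint_def)
  have [measurable]: "traj \<omega> a F \<in> borel_measurable (borel \<Otimes>\<^sub>M borel)"
    using sqint_traj(1)[OF assms] by measurable
  have [measurable]: "kop (kk \<omega>) F \<in> borel_measurable (borel \<Otimes>\<^sub>M borel)"
    using sqint_kop[OF sqint_kk[OF \<omega>] F(1)] by measurable
  show "Measurable.pred (borel \<Otimes>\<^sub>M borel) (\<lambda>z. Gop (traj \<omega> a F) z = Gop (Jop a) z + kop (kk \<omega>) F z)"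
    by measurable
  show "AE t in lborel. AE x in lborel. Gop (traj \<omega> a F) (t, x) = Gop (Jop a) (t, x) + kop (kk \<omega>) F (t, x)"
    using AE_sqint_plane_section[OF sqint_Jop[OF a]]
  proof eventually_elim
    case (elim t)
    show ?case using AE_g_section
    proof eventually_elim
      case x: (elim x)
      show ?case
      proof (cases "0 < t \<and> t < L")
        case True
        then have "Gop (traj \<omega> a F) (t, x) = (\<integral>y. g (x, y) * Jop a (t, y) + g (x, y) * Rop \<omega> F (t, y) \<partial>lborel)"
          by (simp add: Gop_def traj_def Jop_def distrib_left)
        also have "\<dots> = Gop (Jop a) (t, x) + Gop (Rop \<omega> F) (t, x)"
          using Gop_Rop(2)[OF \<omega> F x] integrable_mult_sqint[OF x elim] True
          by (simp add: Gop_def)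
        finally show ?thesis using Gop_Rop(1)[OF \<omega> F x] True by simp
      next
        case False
        then have "kk \<omega> ((t, x), q) = 0" for q by (auto simp: kk_def)
        moreover have "traj \<omega> a F (t, y) = 0" "Jop a (t, y) = 0" for y
          using False by (auto simp: traj_def Jop_def)
        ultimately show ?thesis by (simp add: Gop_def kop_def)
      qed
    qed
  qed
qed

end

section \<open>Curves in L2\<close>

text \<open>The functions are arbitrary: equality almost everywhere preserves Lebesgue measurability
  in both directions, and a non-measurable integrand has integral 0 by convention. So
  representatives inside the weak formulation can be exchanged freely.\<close>

lemma lebesgue_on_integral_cong_AE:
  fixes f h :: "'a::euclidean_space \<Rightarrow> 'b::{banach, second_countable_topology}"
  assumes S: "S \<in> sets borel" and ae: "AE x in lborel. x \<in> S \<longrightarrow> f x = h x"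
  shows "integral\<^sup>L (lebesgue_on S) f = integral\<^sup>L (lebesgue_on S) h"
proof -
  let ?i = "\<lambda>f x. indicator S x *\<^sub>R (f x :: 'b)"
  have i: "integral\<^sup>L (lebesgue_on S) f = integral\<^sup>L lebesgue (?i f)" for f :: "'a \<Rightarrow> 'b"
    using S by (intro integral_restrict_space) auto
  have ae': "AE x in lebesgue. ?i f x = ?i h x"
    using AE_completion[OF ae] by eventually_elim (auto split: split_indicator)
  have ae'': "AE x in lebesgue. ?i h x = ?i f x" using ae' by eventually_elim (rule sym)
  show ?thesis
  proof (cases "?i f \<in> borel_measurable lebesgue")
    case True
    then have "?i h \<in> borel_measurable lebesgue" by (rule measurable_lebesgue_AE[OF _ ae''])
    then show ?thesis unfolding i using True ae' by (intro integral_cong_AE)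
  next
    case False
    then have "?i h \<notin> borel_measurable lebesgue" using measurable_lebesgue_AE[OF _ ae'] by blast
    with False show ?thesis unfolding i
      by (metis borel_measurable_integrable not_integrable_integral_eq)
  qed
qed

text \<open>The kernel enters only through its integrals over the first argument with x fixed, and
  the result is integrated over x; hence the order of the two quantifiers.\<close>

lemma weak_sol_cong_kernel:
  assumes ae: "AE x in lborel. 0 < x \<longrightarrow> x < L \<longrightarrow> (AE y in lborel. 0 < y \<longrightarrow> y < L \<longrightarrow> g y x = g' y x)"
  shows "weak_sol L g = weak_sol L g'"
proof -
  have *: "integral\<^sup>L (lebesgue_on {0..L}) (\<lambda>x. u t x * cnj (- \<phi>t t x + \<phi>x t x
              - integral\<^sup>L (lebesgue_on {0..L}) (\<lambda>y. cnj (g y x) * \<phi> t y)))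
      = integral\<^sup>L (lebesgue_on {0..L}) (\<lambda>x. u t x * cnj (- \<phi>t t x + \<phi>x t x
              - integral\<^sup>L (lebesgue_on {0..L}) (\<lambda>y. cnj (g' y x) * \<phi> t y)))"
    for t and u \<phi> \<phi>t \<phi>x :: "real \<Rightarrow> real \<Rightarrow> complex"
  proof (rule lebesgue_on_integral_cong_AE)
    show "AE x in lborel. x \<in> {0..L} \<longrightarrow> u t x * cnj (- \<phi>t t x + \<phi>x t x
              - integral\<^sup>L (lebesgue_on {0..L}) (\<lambda>y. cnj (g y x) * \<phi> t y))
       = u t x * cnj (- \<phi>t t x + \<phi>x t x
              - integral\<^sup>L (lebesgue_on {0..L}) (\<lambda>y. cnj (g' y x) * \<phi> t y))"
      using ae AE_lborel_singleton[of 0] AE_lborel_singleton[of L]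
    proof eventually_elim
      case (elim x)
      show ?case
      proof
        assume "x \<in> {0..L}"
        then have ey: "AE y in lborel. 0 < y \<longrightarrow> y < L \<longrightarrow> g y x = g' y x" using elim by auto
        have "AE y in lborel. y \<in> {0..L} \<longrightarrow> cnj (g y x) * \<phi> t y = cnj (g' y x) * \<phi> t y"
          using ey AE_lborel_singleton[of 0] AE_lborel_singleton[of L] by eventually_elim auto
        then have "integral\<^sup>L (lebesgue_on {0..L}) (\<lambda>y. cnj (g y x) * \<phi> t y)
            = integral\<^sup>L (lebesgue_on {0..L}) (\<lambda>y. cnj (g' y x) * \<phi> t y)"
          by (rule lebesgue_on_integral_cong_AE[rotated]) simp
        then show "u t x * cnj (- \<phi>t t x + \<phi>x t x - integral\<^sup>L (lebesgue_on {0..L}) (\<lambda>y. cnj (g y x) * \<phi> t y))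
          = u t x * cnj (- \<phi>t t x + \<phi>x t x - integral\<^sup>L (lebesgue_on {0..L}) (\<lambda>y. cnj (g' y x) * \<phi> t y))"
          by simp
      qed
    qed
  qed simp
  show ?thesis unfolding weak_sol_def * by (rule refl)
qed

lemma version_dist:
  assumes S: "S \<in> sets borel" and f: "version S f f'" and h: "version S h h'"
  shows "integral\<^sup>L (lebesgue_on S) (\<lambda>x. (cmod (f x - h x))\<^sup>2) = (dist (abs_l2 f') (abs_l2 h'))\<^sup>2"
proof -
  have "sqint lborel f'" "sqint lborel h'" using f h by (auto simp: version_def)
  then show ?thesis
    using version_integral_sq[OF S version_diff[OF f h]]
    by (simp add: dist_norm abs_l2_diff norm_abs_l2 sqint_diff)
qed

text \<open>Turns the limit condition into continuity of a curve in a normed space, so that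
  compactness and uniform continuity become available.\<close>

lemma C0_L2_iff_continuous:
  assumes w: "\<And>t. t \<in> {0..T} \<Longrightarrow> version {0..L} (u t) (w t)"
  shows "C0_L2 L T u \<longleftrightarrow> continuous_on {0..T} (\<lambda>t. abs_l2 (w t))"
proof -
  have L2: "L2_on {0..L} (u t)" if "t \<in> {0..T}" for t
    using w[OF that] L2_on_version_iff[of "{0..L}" "u t"] by auto
  have "((\<lambda>s. integral\<^sup>L (lebesgue_on {0..L}) (\<lambda>x. (cmod (u s x - u t x))\<^sup>2)) \<longlongrightarrow> 0) (at t within {0..T})
      \<longleftrightarrow> ((\<lambda>t. abs_l2 (w t)) \<longlongrightarrow> abs_l2 (w t)) (at t within {0..T})" if t: "t \<in> {0..T}" for t
  proof -
    have ev: "\<forall>\<^sub>F s in at t within {0..T}. s \<in> {0..T}" by (auto simp: eventually_at_filter)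
    have "((\<lambda>s. integral\<^sup>L (lebesgue_on {0..L}) (\<lambda>x. (cmod (u s x - u t x))\<^sup>2)) \<longlongrightarrow> 0) (at t within {0..T})
       \<longleftrightarrow> ((\<lambda>s. (dist (abs_l2 (w s)) (abs_l2 (w t)))\<^sup>2) \<longlongrightarrow> 0) (at t within {0..T})"
      by (rule tendsto_cong, use ev in eventually_elim) (use w t in \<open>auto intro!: version_dist\<close>)
    also have "\<dots> \<longleftrightarrow> ((\<lambda>s. dist (abs_l2 (w s)) (abs_l2 (w t))) \<longlongrightarrow> 0) (at t within {0..T})"
    proof
      assume "((\<lambda>s. (dist (abs_l2 (w s)) (abs_l2 (w t)))\<^sup>2) \<longlongrightarrow> 0) (at t within {0..T})"
      from tendsto_real_sqrt[OF this] show "((\<lambda>s. dist (abs_l2 (w s)) (abs_l2 (w t))) \<longlongrightarrow> 0) (at t within {0..T})"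
        by simp
    next
      assume "((\<lambda>s. dist (abs_l2 (w s)) (abs_l2 (w t))) \<longlongrightarrow> 0) (at t within {0..T})"
      from tendsto_power[OF this, of 2] show "((\<lambda>s. (dist (abs_l2 (w s)) (abs_l2 (w t)))\<^sup>2) \<longlongrightarrow> 0) (at t within {0..T})"
        by simp
    qed
    also have "\<dots> \<longleftrightarrow> ((\<lambda>t. abs_l2 (w t)) \<longlongrightarrow> abs_l2 (w t)) (at t within {0..T})"
      by (rule tendsto_dist_iff[symmetric])
    finally show ?thesis .
  qed
  then show ?thesis using L2 unfolding C0_L2_def continuous_on_def by auto
qed

text \<open>A weak solution prescribes each u(t) separately and up to a null set depending on t.
  Fubini in (t, x) requires one function that is Borel in both variables and represents all of
  them.\<close>

definition joint_version :: "real \<Rightarrow> real \<Rightarrow> (real \<Rightarrow> real \<Rightarrow> complex) \<Rightarrow> (real \<times> real \<Rightarrow> complex) \<Rightarrow> bool" where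
  "joint_version L T u v \<longleftrightarrow> v \<in> borel_measurable (borel \<Otimes>\<^sub>M borel) \<and>
     (\<forall>t x. \<not> (0 \<le> t \<and> t \<le> T \<and> 0 \<le> x \<and> x \<le> L) \<longrightarrow> v (t, x) = 0) \<and>
     (\<forall>t\<in>{0..T}. version {0..L} (u t) (\<lambda>x. v (t, x)))"

text \<open>The jointly measurable version is the pointwise limit of a fast sequence of piecewise constant
  interpolations.\<close>
lemma joint_version_exists:
  assumes T: "T \<ge> 0" and u: "C0_L2 L T u"
  shows "\<exists>v. joint_version L T u v"
proof -
  have "\<forall>t\<in>{0..T}. \<exists>f. version {0..L} (u t) f"
    using u L2_on_version_iff[of "{0..L}"] by (auto simp: C0_L2_def)
  then obtain w0 where w0: "\<forall>t\<in>{0..T}. version {0..L} (u t) (w0 t)"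
    by (auto dest: bchoice)
  define w where "w t = (if t \<in> {0..T} then w0 t else (\<lambda>x. 0))" for t
  have w: "version {0..L} (u t) (w t)" if "t \<in> {0..T}" for t using w0 that by (auto simp: w_def)
  have ws: "sqint lborel (w t)" for t
    by (cases "t \<in> {0..T}") (use w0 in \<open>auto simp: w_def version_def\<close>)
  have wm[measurable]: "w t \<in> borel_measurable borel" for t using ws[of t] by (simp add: sqint_def)
  have "continuous_on {0..T} (\<lambda>t. abs_l2 (w t))"
    using C0_L2_iff_continuous[of T L u w] w u by blast
  then have uc: "uniformly_continuous_on {0..T} (\<lambda>t. abs_l2 (w t))"
    by (rule compact_uniformly_continuous) simp
  have "\<exists>N::nat. N > 0 \<and> (\<forall>s\<in>{0..T}. \<forall>t\<in>{0..T}. dist s t \<le> 1 / real N \<longrightarrow> dist (abs_l2 (w s)) (abs_l2 (w t)) < (1/8)^Suc n)" for n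
  proof -
    obtain d where d: "d > 0" "\<forall>t\<in>{0..T}. \<forall>s\<in>{0..T}. dist s t < d \<longrightarrow> dist (abs_l2 (w s)) (abs_l2 (w t)) < (1/8)^Suc n"
      using uc unfolding uniformly_continuous_on_def by (metis zero_less_power zero_less_divide_1_iff zero_less_numeral)
    obtain N where N: "inverse (real (Suc N)) < d" using reals_Archimedean[OF d(1)] by auto
    then show ?thesis using d(2) by (intro exI[of _ "Suc N"]) (fastforce simp: inverse_eq_divide)
  qed
  then obtain N :: "nat \<Rightarrow> nat" where N: "\<And>n. N n > 0"
    "\<And>n s t. s \<in> {0..T} \<Longrightarrow> t \<in> {0..T} \<Longrightarrow> dist s t \<le> 1 / real (N n) \<Longrightarrow> dist (abs_l2 (w s)) (abs_l2 (w t)) < (1/8)^Suc n"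
    by metis
  define rd where "rd n t = real_of_int \<lfloor>t * real (N n)\<rfloor> / real (N n)" for n t
  define f where "f n z = w (rd n (fst z)) (snd z)" for n z
  \<comment> \<open>The interpolant runs through countably many of the slices \<open>w t\<close>, so
    it is jointly measurable although \<open>w\<close> itself need not be.\<close>
  have fm[measurable]: "f n \<in> borel_measurable (borel \<Otimes>\<^sub>M borel)" for n
    unfolding f_def[abs_def] rd_def
    by (rule measurable_compose_countable[where f="\<lambda>k z. w (real_of_int k / real (N n)) (snd z)"
          and g="\<lambda>z. \<lfloor>fst z * real (N n)\<rfloor>"]) measurable
  have close: "sqn lborel (\<lambda>x. f n (t, x) - w t x) \<le> ennreal ((1/8)^Suc n)" if t: "t \<in> {0..T}" for n t
  proof -
    have "real_of_int \<lfloor>t * real (N n)\<rfloor> \<le> t * real (N n)" by simp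
    then have le: "rd n t \<le> t" using N(1)[of n] by (simp add: rd_def field_simps)
    have "0 \<le> \<lfloor>t * real (N n)\<rfloor>" using t by simp
    then have ge: "0 \<le> rd n t" by (simp add: rd_def)
    have "t * real (N n) - real_of_int \<lfloor>t * real (N n)\<rfloor> \<le> 1" by linarith
    then have "(t * real (N n) - real_of_int \<lfloor>t * real (N n)\<rfloor>) / real (N n) \<le> 1 / real (N n)"
      by (rule divide_right_mono) simp
    then have "t - rd n t \<le> 1 / real (N n)" using N(1)[of n] by (simp add: rd_def diff_divide_distrib)
    then have "dist (abs_l2 (w (rd n t))) (abs_l2 (w t)) < (1/8)^Suc n"
      using le ge t by (intro N(2)) (auto simp: dist_real_def)
    then have "l2n lborel (\<lambda>x. w (rd n t) x - w t x) \<le> (1/8)^Suc n"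
      using ws by (simp add: dist_norm abs_l2_diff norm_abs_l2 sqint_diff)
    moreover have "(1/8)^Suc n \<le> (1::real)" by (rule power_le_one) auto
    ultimately have "(l2n lborel (\<lambda>x. w (rd n t) x - w t x))\<^sup>2 \<le> (1/8)^Suc n"
      using power_le_one[of "l2n lborel (\<lambda>x. w (rd n t) x - w t x)" 1]
        mult_mono[of "l2n lborel (\<lambda>x. w (rd n t) x - w t x)" "(1/8)^Suc n" "l2n lborel (\<lambda>x. w (rd n t) x - w t x)" 1]
      by (simp add: power2_eq_square)
    then show ?thesis unfolding f_def fst_conv snd_conv
      by (subst sqn_l2n) (auto intro!: sqint_diff ws ennreal_leI)
  qed
  define v where "v z = (if 0 \<le> fst z \<and> fst z \<le> T \<and> 0 \<le> snd z \<and> snd z \<le> L then lim (\<lambda>n. f n z) else 0)" for z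
  have "v \<in> borel_measurable (borel \<Otimes>\<^sub>M borel)" unfolding v_def[abs_def] by measurable
  moreover have "version {0..L} (u t) (\<lambda>x. v (t, x))" if t: "t \<in> {0..T}" for t
  proof -
    have "AE x in lborel. convergent (\<lambda>n. f n (t, x))"
    proof (rule AE_convergent_of_fast_L2_Cauchy)
      fix n
      have "sqn lborel (\<lambda>x. f (Suc n) (t, x) - f n (t, x)) = sqn lborel (\<lambda>x. (f (Suc n) (t, x) - w t x) - (f n (t, x) - w t x))"
        by simp
      also have "\<dots> \<le> 2 * sqn lborel (\<lambda>x. f (Suc n) (t, x) - w t x) + 2 * sqn lborel (\<lambda>x. f n (t, x) - w t x)"
        by (rule sqn_diff_le) measurable
      \<comment> \<open>Both squared distances to \<open>w t\<close> are at most (1/8)^(n+1), and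
        four times this is (1/8)^n / 2.\<close>
      also have "\<dots> \<le> 2 * ennreal ((1/8)^n * (1/8)) + 2 * ennreal ((1/8)^n * (1/8))"
      proof (intro add_mono mult_left_mono)
        show "sqn lborel (\<lambda>x. f (Suc n) (t, x) - w t x) \<le> ennreal ((1/8)^n * (1/8))"
          by (rule order_trans[OF close[OF t]]) (auto intro!: ennreal_leI)
        show "sqn lborel (\<lambda>x. f n (t, x) - w t x) \<le> ennreal ((1/8)^n * (1/8))"
          using close[OF t, of n] by (simp add: mult.commute)
      qed auto
      also have "\<dots> = ennreal ((1/8)^n / 2)"
        using ennreal_half_split[of "(1/8)^n / 2"] by simp
      also have "\<dots> \<le> ennreal ((1/8)^n)" by (intro ennreal_leI) simp
      finally show "sqn lborel (\<lambda>x. f (Suc n) (t, x) - f n (t, x)) \<le> ennreal ((1/8)^n)" .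
    qed measurable
    then have lim: "AE x in lborel. (\<lambda>n. f n (t, x)) \<longlonglongrightarrow> lim (\<lambda>n. f n (t, x))"
      by eventually_elim (simp add: convergent_LIMSEQ_iff)
    have "sqn lborel (\<lambda>x. lim (\<lambda>n. f n (t, x)) - w t x) \<le> ennreal ((1/8)^m)" for m
    proof (rule sqn_Fatou[where f="\<lambda>n x. f n (t, x) - w t x" and N=m])
      show "AE x in lborel. (\<lambda>n. f n (t, x) - w t x) \<longlonglongrightarrow> lim (\<lambda>n. f n (t, x)) - w t x"
        using lim by eventually_elim (intro tendsto_intros)
      show "sqn lborel (\<lambda>x. f n (t, x) - w t x) \<le> ennreal ((1/8)^m)" if "m \<le> n" for n
      proof -
        have "(1/8)^Suc n \<le> (1/8 :: real)^m" by (rule power_decreasing) (use that in auto)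
        from order_trans[OF close[OF t] ennreal_leI[OF this]] show ?thesis .
      qed
    qed measurable
    then have "sqn lborel (\<lambda>x. lim (\<lambda>n. f n (t, x)) - w t x) = 0"
    proof -
      assume a: "\<And>m. sqn lborel (\<lambda>x. lim (\<lambda>n. f n (t, x)) - w t x) \<le> ennreal ((1/8)^m)"
      have "(\<lambda>m. ennreal ((1/8)^m)) \<longlonglongrightarrow> ennreal 0"
        by (intro tendsto_ennrealI LIMSEQ_power_zero) simp
      then have "sqn lborel (\<lambda>x. lim (\<lambda>n. f n (t, x)) - w t x) \<le> ennreal 0"
        by (rule LIMSEQ_le_const) (use a in auto)
      then show ?thesis by simp
    qed
    then have "AE x in lborel. lim (\<lambda>n. f n (t, x)) = w t x"
      unfolding sqn_def by (subst (asm) nn_integral_0_iff_AE) (auto simp: ennreal_eq_0_iff)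
    then have vw: "AE x in lborel. v (t, x) = w t x"
    proof eventually_elim
      case (elim x)
      then show ?case using t w[OF t] by (auto simp: v_def version_def)
    qed
    have vm: "(\<lambda>x. v (t, x)) \<in> borel_measurable borel"
      using \<open>v \<in> borel_measurable (borel \<Otimes>\<^sub>M borel)\<close> by measurable
    have "sqint lborel (\<lambda>x. v (t, x))"
      using ws[of t] sqn_cong_AE[OF vw] vm by (simp add: sqint_def)
    moreover have "AE x in lborel. x \<in> {0..L} \<longrightarrow> u t x = v (t, x)"
      using vw conjunct2[OF conjunct2[OF w[OF t, unfolded version_def]]] by eventually_elim auto
    ultimately show ?thesis by (auto simp: version_def v_def)
  qed
  ultimately show ?thesis by (intro exI[of _ v]) (auto simp: joint_version_def v_def)
qed

lemma joint_version_continuous: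
  "joint_version L T u v \<Longrightarrow> C0_L2 L T u \<Longrightarrow> continuous_on {0..T} (\<lambda>t. abs_l2 (\<lambda>x. v (t, x)))"
  using C0_L2_iff_continuous[of T L u "\<lambda>t x. v (t, x)"] by (auto simp: joint_version_def)

lemma joint_version_bounded:
  assumes v: "joint_version L T u v" and u: "C0_L2 L T u"
  shows "\<exists>B\<ge>0. \<forall>t. sqn lborel (\<lambda>x. v (t, x)) \<le> ennreal B"
proof -
  have "compact ((\<lambda>t. abs_l2 (\<lambda>x. v (t, x))) ` {0..T})"
    by (intro compact_continuous_image joint_version_continuous[OF v u]) simp
  then have "bounded ((\<lambda>t. abs_l2 (\<lambda>x. v (t, x))) ` {0..T})" by (rule compact_imp_bounded)
  then obtain B where "\<forall>X\<in>(\<lambda>t. abs_l2 (\<lambda>x. v (t, x))) ` {0..T}. norm X \<le> B"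
    unfolding bounded_iff by blast
  then have B: "\<And>t. t \<in> {0..T} \<Longrightarrow> norm (abs_l2 (\<lambda>x. v (t, x))) \<le> B" by blast
  have "sqn lborel (\<lambda>x. v (t, x)) \<le> ennreal (B\<^sup>2)" for t
  proof (cases "t \<in> {0..T}")
    case True
    then have s: "sqint lborel (\<lambda>x. v (t, x))" using v by (auto simp: joint_version_def version_def)
    then have "l2n lborel (\<lambda>x. v (t, x)) \<le> B" using B[OF True] by (simp add: norm_abs_l2)
    then show ?thesis using s by (simp add: sqn_l2n ennreal_leI power_mono)
  next
    case False
    then have "v (t, x) = 0" for x using v by (auto simp: joint_version_def)
    then show ?thesis by simp
  qed
  then show ?thesis by (intro exI[of _ "B\<^sup>2"]) auto
qed

lemma joint_version_sqint:
  assumes T: "T \<ge> 0" and v: "joint_version L T u v" and u: "C0_L2 L T u"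
  shows "sqint lborel v"
proof -
  have [measurable]: "v \<in> borel_measurable (borel \<Otimes>\<^sub>M borel)" using v by (simp add: joint_version_def)
  obtain B where B: "B \<ge> 0" "\<And>t. sqn lborel (\<lambda>x. v (t, x)) \<le> ennreal B"
    using joint_version_bounded[OF v u] by auto
  have "sqn lborel v = (\<integral>\<^sup>+t. sqn lborel (\<lambda>x. v (t, x)) \<partial>lborel)" by (rule sqn_plane) measurable
  also have "\<dots> \<le> (\<integral>\<^sup>+t. ennreal B * indicator {0..T} t \<partial>lborel)"
  proof (intro nn_integral_mono)
    fix t
    show "sqn lborel (\<lambda>x. v (t, x)) \<le> ennreal B * indicator {0..T} t"
    proof (cases "t \<in> {0..T}")
      case False
      then have "v (t, x) = 0" for x using v by (auto simp: joint_version_def)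
      then show ?thesis by simp
    qed (use B in auto)
  qed
  also have "\<dots> < top" using T by (simp add: nn_integral_cmult ennreal_mult_less_top)
  finally show ?thesis
    using v unfolding joint_version_def borel_prod by (simp add: sqint_def)
qed

section \<open>Weak solutions satisfy the mild formulation\<close>

text \<open>Half-lines are an intersection-stable generator of the Borel sets, so the part of D on
  the positive axis has integral zero over every Borel set.\<close>

lemma AE_zero_of_tail_integrals:
  fixes D :: "real \<Rightarrow> complex"
  assumes D: "integrable lborel D"
    and tail: "\<And>c. c \<ge> 0 \<Longrightarrow> (\<integral>x. indicator {c<..} x *\<^sub>R D x \<partial>lborel) = 0"
  shows "AE x in lborel. 0 < x \<longrightarrow> D x = 0"
proof -
  define E where "E x = indicator {0<..} x *\<^sub>R D x" for x
  have E: "integrable lborel E"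
    unfolding E_def[abs_def] by (rule integrable_mult_indicator[OF _ D]) simp
  have zero: "(LINT x:A|lborel. E x) = 0" if "A \<in> sets borel" for A
  proof -
    have IS: "Int_stable (range greaterThan :: real set set)"
    proof (rule Int_stableI)
      fix A B :: "real set" assume "A \<in> range greaterThan" "B \<in> range greaterThan"
      then obtain a b where "A = {a<..}" "B = {b<..}" by auto
      then have "A \<inter> B = {max a b<..}" by auto
      then show "A \<inter> B \<in> range greaterThan" by simp
    qed
    have "A \<in> sigma_sets UNIV (range greaterThan :: real set set)"
      using that by (subst (asm) borel_Ioi) simp
    from IS subset_Pow_Union[of "range greaterThan", THEN order_trans, OF Pow_mono[OF subset_UNIV]] this
    show ?thesis
    proof (induction rule: sigma_sets_induct_disjoint)
      case (basic A)
      then obtain a where A: "A = {a<..}" by auto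
      have "(\<lambda>x. indicator A x *\<^sub>R E x) = (\<lambda>x. indicator {max a 0<..} x *\<^sub>R D x)"
        by (auto simp: A E_def split: split_indicator)
      then show ?case using tail[of "max a 0"] by (simp add: set_lebesgue_integral_def)
    next
      case empty
      then show ?case by (simp add: set_lebesgue_integral_def)
    next
      case (compl A)
      have A: "A \<in> sets borel" using compl.hyps by (subst borel_Ioi) simp
      have "(\<lambda>x. indicator (UNIV - A) x *\<^sub>R E x) = (\<lambda>x. E x - indicator A x *\<^sub>R E x)"
        by (auto split: split_indicator)
      moreover have "(\<integral>x. E x \<partial>lborel) = 0" using tail[of 0] by (simp add: E_def)
      ultimately show ?case using compl.IH E A
        by (simp add: set_lebesgue_integral_def integrable_mult_indicator)
    next
      case (union A)
      have A: "A i \<in> sets lborel" for i using union.hyps by (simp, subst borel_Ioi) (auto)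
      have "(LINT x:(\<Union>i. A i)|lborel. E x) = (\<Sum>i. (LINT x:(A i)|lborel. E x))"
      proof (rule lebesgue_integral_countable_add[OF A])
        show "A i \<inter> A j = {}" if "i \<noteq> j" for i j
          using union.hyps(1) that by (auto simp: disjoint_family_on_def)
        show "set_integrable lborel (\<Union>i. A i) E"
          unfolding set_integrable_def using A by (intro integrable_mult_indicator E) auto
      qed
      then show ?case using union.IH by simp
    qed
  qed
  have "AE x in lborel. E x = 0"
    by (rule sigma_finite_measure.density_zero[OF sigma_finite_lborel E]) (use zero in simp)
  then show ?thesis by eventually_elim (auto simp: E_def)
qed

section \<open>Continuously differentiable approximations of half-line indicators\<close>

definition possq :: "real \<Rightarrow> real" where "possq x = (max 0 x)\<^sup>2"

lemma possq_deriv: "(possq has_real_derivative 2 * max 0 x) (at x)"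
proof -
  consider "x < 0" | "x = 0" | "x > 0" by linarith
  then show ?thesis
  proof cases
    case 1
    have "((\<lambda>x. 0) has_real_derivative 0) (at x)" by simp
    then have "(possq has_real_derivative 0) (at x)"
      by (rule has_field_derivative_transform_within_open[where S="{..<0}"]) (use 1 in \<open>auto simp: possq_def\<close>)
    then show ?thesis using 1 by simp
  next
    case 3
    have "((\<lambda>x. x\<^sup>2) has_real_derivative 2 * x) (at x)" by (auto intro!: derivative_eq_intros)
    then have "(possq has_real_derivative 2 * x) (at x)"
      by (rule has_field_derivative_transform_within_open[where S="{0<..}"]) (use 3 in \<open>auto simp: possq_def\<close>)
    then show ?thesis using 3 by simp
  next
    case 2
    have "((\<lambda>h. (possq (0 + h) - possq 0) / h) \<longlongrightarrow> 0) (at 0)"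
    proof (rule Lim_null_comparison)
      show "\<forall>\<^sub>F h in at 0. norm ((possq (0 + h) - possq 0) / h) \<le> \<bar>h\<bar>"
        by (auto simp: possq_def power2_eq_square abs_mult max_def intro!: always_eventually)
      show "((\<lambda>h::real. \<bar>h\<bar>) \<longlongrightarrow> 0) (at 0)"
        using tendsto_rabs_zero[OF tendsto_ident_at, of UNIV] by simp
    qed
    then show ?thesis using 2 by (simp add: DERIV_def)
  qed
qed

text \<open>n p / (1 + n p) with p the squared positive part of x - c. For c \<ge> 0 it vanishes on
  the negative axis, so that ramp(x + t - \<tau>) satisfies the boundary condition of a test
  function at x = 0 for all t \<le> \<tau>.\<close>

definition ramp :: "real \<Rightarrow> nat \<Rightarrow> real \<Rightarrow> real" where
  "ramp c n x = real n * possq (x - c) / (1 + real n * possq (x - c))"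

definition ramp' :: "real \<Rightarrow> nat \<Rightarrow> real \<Rightarrow> real" where
  "ramp' c n x = real n * (2 * max 0 (x - c)) / (1 + real n * possq (x - c))\<^sup>2"

lemma possq_nonneg[simp]: "0 \<le> possq x" by (simp add: possq_def)

lemma ramp_denom: "1 + real n * possq x > 0" by (simp add: add_pos_nonneg)

lemma ramp_deriv: "(ramp c n has_real_derivative ramp' c n x) (at x)"
proof -
  have p: "((\<lambda>x. possq (x - c)) has_real_derivative 2 * max 0 (x - c)) (at x)"
  proof -
    have "((\<lambda>x. x - c) has_real_derivative 1) (at x)" by (auto intro!: derivative_eq_intros)
    from DERIV_chain2[OF possq_deriv this] show ?thesis by simp
  qed
  have ne: "1 + real n * possq (x - c) \<noteq> 0" using ramp_denom[of n "x - c"] by simp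
  show ?thesis unfolding ramp_def[abs_def] ramp'_def
    by (rule derivative_eq_intros p refl ne | simp)+
      (use ne in \<open>simp add: field_simps power2_eq_square\<close>)
qed

lemma continuous_ramp: "continuous_on UNIV (ramp c n)" "continuous_on UNIV (ramp' c n)"
proof -
  show "continuous_on UNIV (ramp c n)"
    by (rule DERIV_continuous_on) (rule ramp_deriv[THEN has_field_derivative_at_within])
  show "continuous_on UNIV (ramp' c n)"
    unfolding ramp'_def[abs_def] possq_def
    by (intro continuous_intros) (auto simp: add_nonneg_eq_0_iff)
qed

lemma ramp_props: "x \<le> c \<Longrightarrow> ramp c n x = 0" "0 \<le> ramp c n x" "ramp c n x \<le> 1"
  using ramp_denom[of n "x - c"] by (auto simp: ramp_def possq_def divide_simps)

lemma ramp_tendsto: "(\<lambda>n. ramp c n x) \<longlonglongrightarrow> indicator {c<..} x"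
proof (cases "x > c")
  case True
  then have p: "possq (x - c) > 0" by (simp add: possq_def)
  have "(\<lambda>n. 1 - inverse (1 + real n * possq (x - c))) \<longlonglongrightarrow> 1 - 0"
  proof (intro tendsto_intros tendsto_inverse_0_at_top filterlim_tendsto_add_at_top[OF tendsto_const])
    show "filterlim (\<lambda>n. real n * possq (x - c)) at_top sequentially"
      using p by (intro filterlim_at_top_mult_tendsto_pos[OF tendsto_const]) (auto simp: filterlim_real_sequentially mult.commute)
  qed
  moreover have "1 - inverse (1 + real n * possq (x - c)) = ramp c n x" for n
    using ramp_denom[of n "x - c"] by (simp add: ramp_def field_simps)
  ultimately show ?thesis using True by simp
qed (simp add: ramp_props)

lemma sqint_integrable_bounded_support:
  assumes f: "sqint M f" and S: "S \<in> sets M" "emeasure M S < \<infinity>" "\<And>x. x \<notin> S \<Longrightarrow> f x = 0"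
  shows "integrable M f"
proof -
  have "integrable M (\<lambda>x. indicator S x * f x)"
    by (rule integrable_mult_sqint[OF sqint_indicator[OF S(1,2)] f])
  moreover have "(\<lambda>x. indicator S x * f x) = f" using S(3) by (auto split: split_indicator)
  ultimately show ?thesis by simp
qed

context transport
begin

text \<open>Moves the integral operator from the test function to the state. The bounded factor
  \<psi> may be cut to (0, L), where g lives, so Fubini rests on a product of two square integrable
  functions of the plane.\<close>

lemma integral_g_swap:
  assumes w: "sqint lborel w" and \<psi>[measurable]: "\<psi> \<in> borel_measurable borel" and B: "\<And>y. cmod (\<psi> y) \<le> B"
  shows "(\<integral>x. w x * (\<integral>y. g (y, x) * \<psi> y \<partial>lborel) \<partial>lborel) = (\<integral>y. (\<integral>x. g (y, x) * w x \<partial>lborel) * \<psi> y \<partial>lborel)"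
    and "integrable lborel (\<lambda>x. w x * (\<integral>y. g (y, x) * \<psi> y \<partial>lborel))"
proof -
  have [measurable]: "w \<in> borel_measurable borel" using w by (simp add: sqint_def)
  have "sqint (lborel \<Otimes>\<^sub>M lborel) (\<lambda>z. indicator {0<..<L} (fst z) * w (snd z))"
    using L by (intro sqint_tensor w sqint_indicator) auto
  then have "sqint lborel (\<lambda>z::real \<times> real. indicator {0<..<L} (fst z) * w (snd z))" unfolding lborel_prod .
  from integrable_mult_sqint[OF g this]
  have "integrable lborel (\<lambda>z. g z * (indicator {0<..<L} (fst z) * w (snd z)))" .
  then have i1: "integrable (lborel \<Otimes>\<^sub>M lborel) (\<lambda>z. g z * (indicator {0<..<L} (fst z) * w (snd z)))"
    unfolding lborel_prod .
  have i2: "integrable (lborel \<Otimes>\<^sub>M lborel) (\<lambda>(y, x). g (y, x) * w x * \<psi> y)"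
  proof (rule Bochner_Integration.integrable_bound[OF integrable_mult_right[OF i1, of "of_real B"]])
    show "(\<lambda>(y, x). g (y, x) * w x * \<psi> y) \<in> borel_measurable (lborel \<Otimes>\<^sub>M lborel)"
      unfolding borel_measurable_lborel_pair by measurable
    show "AE z in lborel \<Otimes>\<^sub>M lborel. norm (case z of (y, x) \<Rightarrow> g (y, x) * w x * \<psi> y)
        \<le> norm (of_real B * (g z * (indicator {0<..<L} (fst z) * w (snd z))))"
    proof (rule AE_I2, clarify)
      fix y x :: real
      have "cmod (g (y, x) * w x) * cmod (\<psi> y) \<le> cmod (g (y, x) * w x) * B"
        by (intro mult_left_mono B) auto
      moreover have "B \<ge> 0" using B[of 0] norm_ge_zero order_trans by blast
      ultimately show "norm (g (y, x) * w x * \<psi> y)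
          \<le> norm (of_real B * (g (y, x) * (indicator {0<..<L} (fst (y, x)) * w (snd (y, x)))))"
        using g0[of y x] by (auto simp: norm_mult mult_ac split: split_indicator)
    qed
  qed
  have eq: "w x * (\<integral>y. g (y, x) * \<psi> y \<partial>lborel) = (\<integral>y. g (y, x) * w x * \<psi> y \<partial>lborel)" for x
    by (subst integral_mult_right_zero[symmetric]) (auto intro!: Bochner_Integration.integral_cong simp: mult_ac)
  show "integrable lborel (\<lambda>x. w x * (\<integral>y. g (y, x) * \<psi> y \<partial>lborel))"
    unfolding eq by (rule lborel_pair.integrable_snd[OF i2])
  have "(\<integral>x. w x * (\<integral>y. g (y, x) * \<psi> y \<partial>lborel) \<partial>lborel) = (\<integral>x. \<integral>y. g (y, x) * w x * \<psi> y \<partial>lborel \<partial>lborel)"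
    unfolding eq ..
  also have "\<dots> = (\<integral>y. \<integral>x. g (y, x) * w x * \<psi> y \<partial>lborel \<partial>lborel)"
    by (rule lborel_pair.Fubini_integral[OF i2])
  finally show "(\<integral>x. w x * (\<integral>y. g (y, x) * \<psi> y \<partial>lborel) \<partial>lborel)
      = (\<integral>y. (\<integral>x. g (y, x) * w x \<partial>lborel) * \<psi> y \<partial>lborel)" by simp
qed

lemma Gop_integrable:
  assumes v: "sqint lborel v" and T: "\<And>t x. \<not> (0 \<le> t \<and> t \<le> T) \<Longrightarrow> v (t, x) = 0"
  shows "integrable lborel (Gop v)"
proof (rule sqint_integrable_bounded_support[OF sqint_Gop[OF v]])
  show "{0..T} \<times> {0..L} \<in> sets lborel" by (simp add: borel_closed closed_Times)
  show "emeasure lborel ({0..T} \<times> {0..L}) < \<infinity>"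
    by (intro emeasure_bounded_finite bounded_Times) auto
  show "Gop v z = 0" if "z \<notin> {0..T} \<times> {0..L}" for z
  proof (cases z)
    case (Pair t x)
    show ?thesis
    proof (cases "0 \<le> t \<and> t \<le> T")
      case True
      then show ?thesis using that Gop_eq_0[of x v t] by (auto simp: Pair)
    next
      case False
      then show ?thesis using T by (auto simp: Gop_def Pair)
    qed
  qed
qed

text \<open>The test function \<theta>(x + t - \<tau>) is constant along characteristics, so
  -\<phi>_t + \<phi>_x drops out. At time \<tau> it equals \<theta>(x), and shifts bring the
  remaining terms to the same form. \<open>D\<close> is the defect in the mild formulation at time
  \<tau>.\<close>

lemma weak_sol_test:
  assumes T: "T \<ge> 0" and ws: "weak_sol L (\<lambda>x y. g (x, y)) T u0 U u"
    and u0: "version {0..L} u0 u0'" and U: "version {0..T} U U'" and v: "joint_version L T u v"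
    and \<tau>: "\<tau> \<in> {0..T}"
    and \<theta>: "\<And>x. (\<theta> has_real_derivative \<theta>' x) (at x)" "continuous_on UNIV \<theta>'"
      "\<And>x. x \<le> 0 \<Longrightarrow> \<theta> x = 0" "\<And>x. \<bar>\<theta> x\<bar> \<le> 1"
  defines "D \<equiv> \<lambda>x. v (\<tau>, x) - u0' (\<tau> + x) - indicator {..L} x * U' (\<tau> + x - L)
      - (\<integral>s. indicator {0..\<tau>} s * Gop v (s, \<tau> + x - s) \<partial>lborel)"
  shows "integrable lborel D" "(\<integral>x. D x * of_real (\<theta> x) \<partial>lborel) = 0"
proof -
  have vm[measurable]: "v \<in> borel_measurable (borel \<Otimes>\<^sub>M borel)" using v by (simp add: joint_version_def)
  have u: "C0_L2 L T u" using ws by (simp add: weak_sol_def)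
  have vs: "sqint lborel v" by (rule joint_version_sqint[OF T v u])
  have v0: "v (t, x) = 0" if "\<not> (0 \<le> t \<and> t \<le> T \<and> 0 \<le> x \<and> x \<le> L)" for t x
    using v that by (auto simp: joint_version_def)
  have vt: "sqint lborel (\<lambda>x. v (t, x))" "AE x in lborel. x \<in> {0..L} \<longrightarrow> u t x = v (t, x)" if "t \<in> {0..T}" for t
    using v that by (auto simp: joint_version_def version_def)
  have u0s: "sqint lborel u0'" "\<And>x. x \<notin> {0..L} \<Longrightarrow> u0' x = 0" "AE x in lborel. x \<in> {0..L} \<longrightarrow> u0 x = u0' x"
    using u0 by (auto simp: version_def)
  have Us: "sqint lborel U'" "\<And>t. t \<notin> {0..T} \<Longrightarrow> U' t = 0" "AE t in lborel. t \<in> {0..T} \<longrightarrow> U t = U' t"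
    using U by (auto simp: version_def)
  have [measurable]: "u0' \<in> borel_measurable borel" "U' \<in> borel_measurable borel"
    using u0s Us by (auto simp: sqint_def)
  have \<theta>c: "continuous_on UNIV \<theta>"
    by (rule DERIV_continuous_on) (rule \<theta>(1)[THEN has_field_derivative_at_within])
  have [measurable]: "\<theta> \<in> borel_measurable borel" by (rule borel_measurable_continuous_onI[OF \<theta>c])
  have [measurable]: "\<theta>' \<in> borel_measurable borel" by (rule borel_measurable_continuous_onI[OF \<theta>(2)])
  have iG: "integrable lborel (Gop v)" by (rule Gop_integrable[OF vs, of T]) (use v0 in auto)
  have i_u0: "integrable lborel u0'"
    using L u0s by (intro sqint_integrable_bounded_support[of _ _ "{0..L}"]) auto
  have i_U: "integrable lborel U'"
    using T Us by (intro sqint_integrable_bounded_support[of _ _ "{0..T}"]) auto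
  have i_v: "integrable lborel (\<lambda>x. v (\<tau>, x))"
    using L vt[OF \<tau>] v0 by (intro sqint_integrable_bounded_support[of _ _ "{0..L}"]) auto
  define k where "k t x = indicator {0..\<tau>} t * Gop v (t, \<tau> + x - t)" for t x
  have km[measurable]: "case_prod k \<in> borel_measurable (borel \<Otimes>\<^sub>M borel)" unfolding k_def[abs_def] by measurable
  have kfin: "(\<integral>\<^sup>+t. \<integral>\<^sup>+x. ennreal (cmod (k t x)) \<partial>lborel \<partial>lborel) < \<infinity>"
  proof -
    have "(\<integral>\<^sup>+t. \<integral>\<^sup>+x. ennreal (cmod (k t x)) \<partial>lborel \<partial>lborel)
        \<le> (\<integral>\<^sup>+t. \<integral>\<^sup>+x. ennreal (cmod (Gop v (t, x + (\<tau> - t)))) \<partial>lborel \<partial>lborel)"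
      by (intro nn_integral_mono) (auto simp: k_def add.commute add_diff_eq norm_mult split: split_indicator)
    also have "\<dots> = (\<integral>\<^sup>+t. \<integral>\<^sup>+x. ennreal (cmod (Gop v (t, x))) \<partial>lborel \<partial>lborel)"
    proof (rule nn_integral_cong)
      fix t :: real
      show "(\<integral>\<^sup>+x. ennreal (cmod (Gop v (t, x + (\<tau> - t)))) \<partial>lborel) = (\<integral>\<^sup>+x. ennreal (cmod (Gop v (t, x))) \<partial>lborel)"
        by (rule nn_shift(1)[of "\<lambda>x. ennreal (cmod (Gop v (t, x)))"]) measurable
    qed
    also have "\<dots> = (\<integral>\<^sup>+z. ennreal (cmod (Gop v z)) \<partial>lborel)" by (rule nn_plane[symmetric]) measurable
    also have "\<dots> < \<infinity>" using iG by (simp add: integrable_iff_bounded)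
    finally show ?thesis .
  qed
  have i_k: "integrable lborel (\<lambda>x. \<integral>t. k t x \<partial>lborel)"
    by (rule lborel_pair.integrable_snd[OF integrable_planeI[OF km kfin]])
  have i_u0s: "integrable lborel (\<lambda>x. u0' (\<tau> + x))"
    using lborel_integrable_real_affine[OF i_u0, of 1 \<tau>] by simp
  have i_Us: "integrable lborel (\<lambda>x. indicator {..L} x * U' (\<tau> + x - L))"
  proof -
    have "integrable lborel (\<lambda>x. U' ((\<tau> - L) + 1 * x))" by (rule lborel_integrable_real_affine[OF i_U]) simp
    then have "integrable lborel (\<lambda>x. indicator {..L} x *\<^sub>R U' (\<tau> + x - L))"
      by (intro integrable_mult_indicator) (auto simp: algebra_simps)
    then show ?thesis by (rule back_subst[of "integrable lborel"]) (auto split: split_indicator)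
  qed
  show iD: "integrable lborel D"
    unfolding D_def k_def[symmetric] using i_v i_u0s i_Us i_k by (intro Bochner_Integration.integrable_diff)
  have iD': "integrable lborel (\<lambda>x. h x * of_real (\<theta> x))" if "integrable lborel h" for h :: "real \<Rightarrow> complex"
    by (rule Bochner_Integration.integrable_bound[OF that])
      (use that \<theta>(4) in \<open>auto simp: norm_mult intro!: mult_left_le\<close>)
  define \<phi> where "\<phi> t x = complex_of_real (\<theta> (x + t - \<tau>))" for t x
  define \<phi>' where "\<phi>' t x = complex_of_real (\<theta>' (x + t - \<tau>))" for t x
  have C1: "C1_rect \<tau> L \<phi> \<phi>' \<phi>'"
    unfolding C1_rect_def
  proof (intro conjI ballI)
    show "continuous_on ({0..\<tau>} \<times> {0..L}) (\<lambda>(t, x). \<phi> t x)"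
      unfolding \<phi>_def case_prod_beta
      by (intro continuous_intros continuous_on_compose2[OF \<theta>c]) auto
    show "continuous_on ({0..\<tau>} \<times> {0..L}) (\<lambda>(t, x). \<phi>' t x)"
         "continuous_on ({0..\<tau>} \<times> {0..L}) (\<lambda>(t, x). \<phi>' t x)"
      unfolding \<phi>'_def case_prod_beta
      by (intro continuous_intros continuous_on_compose2[OF \<theta>(2)]; auto)+
    fix t x
    have "((\<lambda>s. \<theta> (x + s - \<tau>)) has_real_derivative \<theta>' (x + t - \<tau>)) (at t within {0..\<tau>})"
    proof -
      have "((\<lambda>s. x + s - \<tau>) has_real_derivative 1) (at t within {0..\<tau>})" by (auto intro!: derivative_eq_intros)
      from DERIV_chain2[OF \<theta>(1) this] show ?thesis by simp
    qed
    then show "((\<lambda>s. \<phi> s x) has_vector_derivative \<phi>' t x) (at t within {0..\<tau>})"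
      unfolding \<phi>_def \<phi>'_def by (intro has_vector_derivative_of_real) (simp add: has_real_derivative_iff_has_vector_derivative)
    have "((\<lambda>y. \<theta> (y + t - \<tau>)) has_real_derivative \<theta>' (x + t - \<tau>)) (at x within {0..L})"
    proof -
      have "((\<lambda>y. y + t - \<tau>) has_real_derivative 1) (at x within {0..L})" by (auto intro!: derivative_eq_intros)
      from DERIV_chain2[OF \<theta>(1) this] show ?thesis by simp
    qed
    then show "((\<lambda>y. \<phi> t y) has_vector_derivative \<phi>' t x) (at x within {0..L})"
      unfolding \<phi>_def \<phi>'_def by (intro has_vector_derivative_of_real) (simp add: has_real_derivative_iff_has_vector_derivative)
  qed
  have "\<forall>t\<in>{0..\<tau>}. \<phi> t 0 = 0" using \<theta>(3) by (auto simp: \<phi>_def)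
  with C1 ws \<tau> have id: "integral\<^sup>L (lebesgue_on {0..\<tau>}) (\<lambda>t. integral\<^sup>L (lebesgue_on {0..L}) (\<lambda>x.
           u t x * cnj (- \<phi>' t x + \<phi>' t x
              - integral\<^sup>L (lebesgue_on {0..L}) (\<lambda>y. cnj (g (y, x)) * \<phi> t y))))
       + integral\<^sup>L (lebesgue_on {0..L}) (\<lambda>x. u \<tau> x * cnj (\<phi> \<tau> x))
       - integral\<^sup>L (lebesgue_on {0..L}) (\<lambda>x. u0 x * cnj (\<phi> 0 x))
       - integral\<^sup>L (lebesgue_on {0..\<tau>}) (\<lambda>t. U t * cnj (\<phi> t L)) = 0"
    unfolding weak_sol_def by blast
  have I2: "integral\<^sup>L (lebesgue_on {0..L}) (\<lambda>x. u \<tau> x * cnj (\<phi> \<tau> x)) = (\<integral>x. v (\<tau>, x) * of_real (\<theta> x) \<partial>lborel)"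
  proof -
    have "integral\<^sup>L (lebesgue_on {0..L}) (\<lambda>x. u \<tau> x * cnj (\<phi> \<tau> x)) = (\<integral>x. indicator {0..L} x *\<^sub>R (v (\<tau>, x) * of_real (\<theta> x)) \<partial>lborel)"
    proof (rule lebesgue_on_integral_eq(1))
      show "AE x in lborel. x \<in> {0..L} \<longrightarrow> u \<tau> x * cnj (\<phi> \<tau> x) = v (\<tau>, x) * of_real (\<theta> x)"
        using vt(2)[OF \<tau>] by eventually_elim (auto simp: \<phi>_def)
    qed measurable
    also have "\<dots> = (\<integral>x. v (\<tau>, x) * of_real (\<theta> x) \<partial>lborel)"
      using v0 by (intro Bochner_Integration.integral_cong) (auto split: split_indicator)
    finally show ?thesis .
  qed
  have I3: "integral\<^sup>L (lebesgue_on {0..L}) (\<lambda>x. u0 x * cnj (\<phi> 0 x)) = (\<integral>x. u0' (\<tau> + x) * of_real (\<theta> x) \<partial>lborel)"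
  proof -
    have "integral\<^sup>L (lebesgue_on {0..L}) (\<lambda>x. u0 x * cnj (\<phi> 0 x)) = (\<integral>x. indicator {0..L} x *\<^sub>R (u0' x * of_real (\<theta> (x - \<tau>))) \<partial>lborel)"
    proof (rule lebesgue_on_integral_eq(1))
      show "AE x in lborel. x \<in> {0..L} \<longrightarrow> u0 x * cnj (\<phi> 0 x) = u0' x * of_real (\<theta> (x - \<tau>))"
        using u0s(3) by eventually_elim (auto simp: \<phi>_def)
    qed measurable
    also have "\<dots> = (\<integral>x. u0' x * of_real (\<theta> (x - \<tau>)) \<partial>lborel)"
      using u0s(2) by (intro Bochner_Integration.integral_cong) (auto split: split_indicator)
    also have "\<dots> = (\<integral>x. u0' (x + \<tau>) * of_real (\<theta> (x + \<tau> - \<tau>)) \<partial>lborel)"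
      by (rule integral_shift(1)[symmetric])
    finally show ?thesis by (simp add: add.commute)
  qed
  \<comment> \<open>The substitution x = L + t - \<tau> turns t \<le> \<tau> into x \<le> L, which
    is the cutoff in \<open>D\<close>.\<close>
  have I4: "integral\<^sup>L (lebesgue_on {0..\<tau>}) (\<lambda>t. U t * cnj (\<phi> t L)) = (\<integral>x. indicator {..L} x * U' (\<tau> + x - L) * of_real (\<theta> x) \<partial>lborel)"
  proof -
    have "integral\<^sup>L (lebesgue_on {0..\<tau>}) (\<lambda>t. U t * cnj (\<phi> t L)) = (\<integral>t. indicator {0..\<tau>} t *\<^sub>R (U' t * of_real (\<theta> (L + t - \<tau>))) \<partial>lborel)"
    proof (rule lebesgue_on_integral_eq(1))
      show "AE t in lborel. t \<in> {0..\<tau>} \<longrightarrow> U t * cnj (\<phi> t L) = U' t * of_real (\<theta> (L + t - \<tau>))"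
        using Us(3) by eventually_elim (use \<tau> in \<open>auto simp: \<phi>_def\<close>)
    qed measurable
    also have "\<dots> = (\<integral>t. indicator {..\<tau>} t * U' t * of_real (\<theta> (L + t - \<tau>)) \<partial>lborel)"
      using Us(2) by (intro Bochner_Integration.integral_cong) (auto split: split_indicator)
    also have "\<dots> = (\<integral>x. indicator {..\<tau>} (x + (\<tau> - L)) * U' (x + (\<tau> - L)) * of_real (\<theta> (L + (x + (\<tau> - L)) - \<tau>)) \<partial>lborel)"
      by (rule integral_shift(1)[symmetric])
    also have "\<dots> = (\<integral>x. indicator {..L} x * U' (\<tau> + x - L) * of_real (\<theta> x) \<partial>lborel)"
      by (intro Bochner_Integration.integral_cong) (auto split: split_indicator simp: algebra_simps)
    finally show ?thesis .
  qed
  have I1: "integral\<^sup>L (lebesgue_on {0..\<tau>}) (\<lambda>t. integral\<^sup>L (lebesgue_on {0..L}) (\<lambda>x.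
           u t x * cnj (- \<phi>' t x + \<phi>' t x
              - integral\<^sup>L (lebesgue_on {0..L}) (\<lambda>y. cnj (g (y, x)) * \<phi> t y))))
     = - (\<integral>x. (\<integral>t. k t x \<partial>lborel) * of_real (\<theta> x) \<partial>lborel)"
  proof -
    define m where "m t x = (\<integral>y. g (y, x) * of_real (\<theta> (y + t - \<tau>)) \<partial>lborel)" for t x
    have [measurable]: "m t \<in> borel_measurable borel" for t
      unfolding m_def[abs_def] by measurable
    have inner: "integral\<^sup>L (lebesgue_on {0..L}) (\<lambda>y. cnj (g (y, x)) * \<phi> t y) = cnj (m t x)" for t x
    proof -
      have "integral\<^sup>L (lebesgue_on {0..L}) (\<lambda>y. cnj (g (y, x)) * \<phi> t y) = (\<integral>y. indicator {0..L} y *\<^sub>R (cnj (g (y, x)) * of_real (\<theta> (y + t - \<tau>))) \<partial>lborel)"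
      proof (rule lebesgue_on_integral_eq(1))
        have [measurable]: "cnj \<in> borel_measurable borel"
          by (intro borel_measurable_continuous_onI continuous_intros)
        show "(\<lambda>y. cnj (g (y, x)) * of_real (\<theta> (y + t - \<tau>))) \<in> borel_measurable borel" by measurable
      qed (auto simp: \<phi>_def)
      also have "\<dots> = (\<integral>y. cnj (g (y, x) * of_real (\<theta> (y + t - \<tau>))) \<partial>lborel)"
        using g0 by (intro Bochner_Integration.integral_cong) (auto split: split_indicator)
      also have "\<dots> = cnj (m t x)" unfolding m_def by (rule Bochner_Integration.integral_cnj)
      finally show ?thesis .
    qed
    have mid: "integral\<^sup>L (lebesgue_on {0..L}) (\<lambda>x. u t x * cnj (- \<phi>' t x + \<phi>' t x
              - integral\<^sup>L (lebesgue_on {0..L}) (\<lambda>y. cnj (g (y, x)) * \<phi> t y)))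
        = - (\<integral>y. Gop v (t, y) * of_real (\<theta> (y + t - \<tau>)) \<partial>lborel)" if t: "t \<in> {0..\<tau>}" for t
    proof -
      have tT: "t \<in> {0..T}" using t \<tau> by auto
      have "integral\<^sup>L (lebesgue_on {0..L}) (\<lambda>x. u t x * cnj (- \<phi>' t x + \<phi>' t x
              - integral\<^sup>L (lebesgue_on {0..L}) (\<lambda>y. cnj (g (y, x)) * \<phi> t y)))
          = (\<integral>x. indicator {0..L} x *\<^sub>R (- (v (t, x) * m t x)) \<partial>lborel)"
        unfolding inner
      proof (rule lebesgue_on_integral_eq(1))
        show "AE x in lborel. x \<in> {0..L} \<longrightarrow> u t x * cnj (- \<phi>' t x + \<phi>' t x - cnj (m t x)) = - (v (t, x) * m t x)"
          using vt(2)[OF tT] by eventually_elim auto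
      qed measurable
      also have "\<dots> = (\<integral>x. - (v (t, x) * m t x) \<partial>lborel)"
        using v0 by (intro Bochner_Integration.integral_cong) (auto split: split_indicator)
      also have "\<dots> = - (\<integral>x. v (t, x) * (\<integral>y. g (y, x) * of_real (\<theta> (y + t - \<tau>)) \<partial>lborel) \<partial>lborel)"
        by (simp add: m_def)
      also have "(\<integral>x. v (t, x) * (\<integral>y. g (y, x) * of_real (\<theta> (y + t - \<tau>)) \<partial>lborel) \<partial>lborel)
          = (\<integral>y. (\<integral>x. g (y, x) * v (t, x) \<partial>lborel) * of_real (\<theta> (y + t - \<tau>)) \<partial>lborel)"
        by (rule integral_g_swap(1)[OF vt(1)[OF tT], where B=1]) (use \<theta>(4) in auto)
      finally show ?thesis by (simp add: Gop_def)
    qed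
    have "integral\<^sup>L (lebesgue_on {0..\<tau>}) (\<lambda>t. integral\<^sup>L (lebesgue_on {0..L}) (\<lambda>x.
           u t x * cnj (- \<phi>' t x + \<phi>' t x
              - integral\<^sup>L (lebesgue_on {0..L}) (\<lambda>y. cnj (g (y, x)) * \<phi> t y))))
        = (\<integral>t. indicator {0..\<tau>} t *\<^sub>R (- (\<integral>y. Gop v (t, y) * of_real (\<theta> (y + t - \<tau>)) \<partial>lborel)) \<partial>lborel)"
      by (rule lebesgue_on_integral_eq(1)) (use mid in auto)
    also have "\<dots> = (\<integral>t. - (\<integral>x. k t x * of_real (\<theta> x) \<partial>lborel) \<partial>lborel)"
    proof (rule Bochner_Integration.integral_cong[OF refl])
      fix t :: real
      have "(\<integral>y. Gop v (t, y) * of_real (\<theta> (y + t - \<tau>)) \<partial>lborel)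
          = (\<integral>x. Gop v (t, x + (\<tau> - t)) * of_real (\<theta> (x + (\<tau> - t) + t - \<tau>)) \<partial>lborel)"
        by (rule integral_shift(1)[symmetric])
      then show "indicator {0..\<tau>} t *\<^sub>R (- (\<integral>y. Gop v (t, y) * of_real (\<theta> (y + t - \<tau>)) \<partial>lborel))
          = - (\<integral>x. k t x * of_real (\<theta> x) \<partial>lborel)"
        by (auto simp: k_def algebra_simps split: split_indicator)
    qed
    also have "\<dots> = - (\<integral>t. \<integral>x. k t x * of_real (\<theta> x) \<partial>lborel \<partial>lborel)" by simp
    also have "(\<integral>t. \<integral>x. k t x * of_real (\<theta> x) \<partial>lborel \<partial>lborel) = (\<integral>x. \<integral>t. k t x * of_real (\<theta> x) \<partial>lborel \<partial>lborel)"
    proof (rule integral_plane_swap(1))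
      show "(\<lambda>(t, x). k t x * complex_of_real (\<theta> x)) \<in> borel_measurable (borel \<Otimes>\<^sub>M borel)" by measurable
      have "(\<integral>\<^sup>+t. \<integral>\<^sup>+x. ennreal (cmod (k t x * of_real (\<theta> x))) \<partial>lborel \<partial>lborel) \<le> (\<integral>\<^sup>+t. \<integral>\<^sup>+x. ennreal (cmod (k t x)) \<partial>lborel \<partial>lborel)"
        using \<theta>(4) by (intro nn_integral_mono ennreal_leI) (auto simp: norm_mult intro!: mult_left_le)
      then show "(\<integral>\<^sup>+t. \<integral>\<^sup>+x. ennreal (cmod (k t x * of_real (\<theta> x))) \<partial>lborel \<partial>lborel) < \<infinity>"
        using kfin by (rule le_less_trans)
    qed
    finally show ?thesis by simp
  qed
  have "(\<integral>x. D x * of_real (\<theta> x) \<partial>lborel) = (\<integral>x. v (\<tau>, x) * of_real (\<theta> x) - u0' (\<tau> + x) * of_real (\<theta> x)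
      - indicator {..L} x * U' (\<tau> + x - L) * of_real (\<theta> x) - (\<integral>t. k t x \<partial>lborel) * of_real (\<theta> x) \<partial>lborel)"
    unfolding D_def k_def by (simp add: left_diff_distrib)
  also have "\<dots> = (\<integral>x. v (\<tau>, x) * of_real (\<theta> x) \<partial>lborel) - (\<integral>x. u0' (\<tau> + x) * of_real (\<theta> x) \<partial>lborel)
      - (\<integral>x. indicator {..L} x * U' (\<tau> + x - L) * of_real (\<theta> x) \<partial>lborel)
      - (\<integral>x. (\<integral>t. k t x \<partial>lborel) * of_real (\<theta> x) \<partial>lborel)"
    using iD'[OF i_v] iD'[OF i_u0s] iD'[OF i_Us] iD'[OF i_k] by simp
  also have "\<dots> = 0"
  proof -
    have "- K + V - A - B = 0 \<Longrightarrow> V - A - B - K = 0" for K V A B :: complex by (simp add: algebra_simps)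
    from this[OF id[unfolded I1 I2 I3 I4]] show ?thesis .
  qed
  finally show "(\<integral>x. D x * of_real (\<theta> x) \<partial>lborel) = 0" .
qed

text \<open>The ramps tend to indicators of half-lines, so all tail integrals of the defect with c
  \<ge> 0 vanish, and the defect is zero almost everywhere on the positive axis.\<close>

lemma weak_sol_mild:
  assumes T: "T \<ge> 0" and ws: "weak_sol L (\<lambda>x y. g (x, y)) T u0 U u"
    and u0: "version {0..L} u0 u0'" and U: "version {0..T} U U'" and v: "joint_version L T u v"
    and \<tau>: "\<tau> \<in> {0..T}"
  shows "AE x in lborel. 0 < x \<longrightarrow> x < L \<longrightarrow> v (\<tau>, x) = u0' (\<tau> + x) + U' (\<tau> + x - L)
      + (\<integral>s. indicator {..<\<tau>} s * Gop v (s, \<tau> + x - s) \<partial>lborel)"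
proof -
  define D where "D = (\<lambda>x. v (\<tau>, x) - u0' (\<tau> + x) - indicator {..L} x * U' (\<tau> + x - L)
      - (\<integral>s. indicator {0..\<tau>} s * Gop v (s, \<tau> + x - s) \<partial>lborel))"
  have test: "integrable lborel D" "(\<integral>x. D x * of_real (ramp c n x) \<partial>lborel) = 0" if "c \<ge> 0" for c n
    unfolding D_def
    by (rule weak_sol_test[OF T ws u0 U v \<tau> ramp_deriv continuous_ramp(2), of c n];
        use that ramp_props in \<open>force simp: abs_le_iff\<close>)+
  have [measurable]: "ramp c n \<in> borel_measurable borel" for c n
    by (rule borel_measurable_continuous_onI[OF continuous_ramp(1)])
  have [measurable]: "D \<in> borel_measurable borel" using test(1)[of 0] by auto
  have "AE x in lborel. 0 < x \<longrightarrow> D x = 0"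
  proof (rule AE_zero_of_tail_integrals)
    show "integrable lborel D" using test(1)[of 0] by simp
    fix c :: real assume c: "c \<ge> 0"
    have "(\<lambda>n. \<integral>x. D x * of_real (ramp c n x) \<partial>lborel) \<longlonglongrightarrow> (\<integral>x. D x * of_real (indicator {c<..} x) \<partial>lborel)"
    proof (rule integral_dominated_convergence[where w="\<lambda>x. norm (D x)"])
      show "AE x in lborel. (\<lambda>n. D x * of_real (ramp c n x)) \<longlonglongrightarrow> D x * of_real (indicator {c<..} x)"
        by (intro AE_I2 tendsto_intros ramp_tendsto)
      show "AE x in lborel. norm (D x * of_real (ramp c n x)) \<le> norm (D x)" for n
        using ramp_props by (intro AE_I2) (auto simp: norm_mult abs_le_iff intro!: mult_left_le)
      show "integrable lborel (\<lambda>x. norm (D x))" using test(1)[OF c] by simp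
    qed measurable
    then have "(\<integral>x. D x * of_real (indicator {c<..} x) \<partial>lborel) = 0"
      using test(2)[OF c] by (simp add: LIMSEQ_const_iff)
    then show "(\<integral>x. indicator {c<..} x *\<^sub>R D x \<partial>lborel) = 0"
      by (simp add: scaleR_conv_of_real mult.commute)
  qed
  then show ?thesis
  proof eventually_elim
    case (elim x)
    \<comment> \<open>The time set is rewritten as {..<\<tau>}; the source vanishes at negative
      times, and one point is null.\<close>
    have "(\<integral>s. indicator {0..\<tau>} s * Gop v (s, \<tau> + x - s) \<partial>lborel) = (\<integral>s. indicator {..<\<tau>} s * Gop v (s, \<tau> + x - s) \<partial>lborel)"
    proof (rule integral_cong_AE)
      have [measurable]: "v \<in> borel_measurable (borel \<Otimes>\<^sub>M borel)" using v by (simp add: joint_version_def)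
      show "(\<lambda>s. indicator {0..\<tau>} s * Gop v (s, \<tau> + x - s)) \<in> borel_measurable lborel" by measurable
      show "(\<lambda>s. indicator {..<\<tau>} s * Gop v (s, \<tau> + x - s)) \<in> borel_measurable lborel" by measurable
      have neg: "s \<ge> 0 \<or> Gop v (s, y) = 0" for s y
        using v by (cases "s < 0") (auto simp: Gop_def joint_version_def)
      show "AE s in lborel. indicator {0..\<tau>} s * Gop v (s, \<tau> + x - s) = indicator {..<\<tau>} s * Gop v (s, \<tau> + x - s)"
        using AE_lborel_singleton[of \<tau>]
      proof eventually_elim
        case (elim s)
        then show ?case using neg[of s "\<tau> + x - s"] by (auto split: split_indicator)
      qed
    qed
    with elim show ?case by (auto simp: D_def algebra_simps)
  qed
qed

end

section \<open>Continuity of translations in L2\<close>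

lemma sqn_shift:
  fixes f :: "real \<Rightarrow> complex"
  assumes [measurable]: "f \<in> borel_measurable borel"
  shows "sqn lborel (\<lambda>x. f (x + h)) = sqn lborel f"
  unfolding sqn_def by (rule nn_shift(1)) measurable

lemma sqint_shift:
  fixes f :: "real \<Rightarrow> complex"
  assumes f: "sqint lborel f" shows "sqint lborel (\<lambda>x. f (x + h))"
proof -
  have [measurable]: "f \<in> borel_measurable borel" using f by (simp add: sqint_def)
  have "(\<lambda>x. f (x + h)) \<in> borel_measurable borel" by measurable
  then show ?thesis using f sqn_shift[of f h] by (simp add: sqint_def)
qed

definition trans_cont :: "(real \<Rightarrow> complex) \<Rightarrow> bool" where
  "trans_cont f \<longleftrightarrow> (\<forall>e>0. \<exists>d>0. \<forall>h. \<bar>h\<bar> < d \<longrightarrow> sqn lborel (\<lambda>x. f (x + h) - f x) \<le> ennreal e)"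

lemma trans_contD:
  "trans_cont f \<Longrightarrow> e > 0 \<Longrightarrow> \<exists>d>0. \<forall>h. \<bar>h\<bar> < d \<longrightarrow> sqn lborel (\<lambda>x. f (x + h) - f x) \<le> ennreal e"
  by (simp add: trans_cont_def)

text \<open>The difference lives within |h| of the two end points, a set of measure at most 4|h|;
  hence the choice of e/4.\<close>

lemma trans_cont_interval: "trans_cont (indicator {a<..<b})"
  unfolding trans_cont_def
proof (intro allI impI)
  fix e :: real assume e: "e > 0"
  show "\<exists>d>0. \<forall>h. \<bar>h\<bar> < d \<longrightarrow> sqn lborel (\<lambda>x. indicator {a<..<b} (x + h) - indicator {a<..<b} x) \<le> ennreal e"
  proof (intro exI[of _ "e/4"] conjI allI impI)
    fix h :: real assume h: "\<bar>h\<bar> < e/4"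
    have "sqn lborel (\<lambda>x. indicator {a<..<b} (x + h) - indicator {a<..<b} x)
        \<le> (\<integral>\<^sup>+x. indicator {a - \<bar>h\<bar>..a + \<bar>h\<bar>} x + indicator {b - \<bar>h\<bar>..b + \<bar>h\<bar>} x \<partial>lborel)"
      unfolding sqn_def by (intro nn_integral_mono) (auto split: split_indicator)
    also have "\<dots> = ennreal (2 * \<bar>h\<bar>) + ennreal (2 * \<bar>h\<bar>)"
      by (subst nn_integral_add) (auto simp: algebra_simps)
    also have "\<dots> \<le> ennreal e"
      using h by (subst ennreal_plus[symmetric]) (auto intro!: ennreal_leI)
    finally show "sqn lborel (\<lambda>x. indicator {a<..<b} (x + h) - indicator {a<..<b} x) \<le> ennreal e" .
  qed (use e in auto)
qed

text \<open>Open intervals generate the Borel sets, and the property is linear and closed in L2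
  because translation is an isometry.\<close>

lemma trans_cont_sqint:
  assumes f: "sqint lborel f"
  shows "trans_cont f"
proof -
  define E where "E = range (\<lambda>(a, b). box a b :: real set)"
  define A where "A n = {- real n<..<real n}" for n
  show ?thesis
  proof (rule sqint_induct[where M=lborel and E=E and A=A and P=trans_cont and f=f])
    show "Int_stable E"
    proof (rule Int_stableI)
      fix X Y assume "X \<in> E" "Y \<in> E"
      then obtain a b c d where "X = {a<..<b}" "Y = {c<..<d}" by (auto simp: E_def box_real)
      then have "X \<inter> Y = (case (max a c, min b d) of (a, b) \<Rightarrow> box a b)" by (auto simp: box_real)
      then show "X \<inter> Y \<in> E" unfolding E_def by (rule range_eqI)
    qed
    show "E \<subseteq> Pow (space lborel)" by auto
    show "sets lborel = sigma_sets (space lborel) E"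
      unfolding sets_lborel borel_eq_box E_def by simp
    show "A n \<in> E" for n unfolding A_def E_def by (rule range_eqI[of _ _ "(- real n, real n)"]) (simp add: box_real)
    show "incseq A" by (auto simp: A_def incseq_def)
    show "(\<Union>n. A n) = space lborel"
    proof -
      have "x \<in> (\<Union>n. A n)" for x
      proof -
        obtain n :: nat where "\<bar>x\<bar> < real n" using reals_Archimedean2 by blast
        then show ?thesis by (auto simp: A_def intro!: exI[of _ n])
      qed
      then show ?thesis by auto
    qed
    show "emeasure lborel (A n) < \<infinity>" for n by (simp add: A_def)
    show "trans_cont (\<lambda>x. indicator B x)" if "B \<in> E" for B
      using that trans_cont_interval by (auto simp: E_def box_real)
    show "trans_cont (\<lambda>x. f x + g x)" if f: "sqint lborel f" "trans_cont f" and g: "sqint lborel g" "trans_cont g" for f g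
      unfolding trans_cont_def
    proof (intro allI impI)
      fix e :: real assume e: "e > 0"
      have [measurable]: "f \<in> borel_measurable borel" "g \<in> borel_measurable borel" using f g by (auto simp: sqint_def)
      obtain d1 where d1: "d1 > 0" "\<And>h. \<bar>h\<bar> < d1 \<Longrightarrow> sqn lborel (\<lambda>x. f (x + h) - f x) \<le> ennreal (e/4)"
        using trans_contD[OF f(2), of "e/4"] e by auto
      obtain d2 where d2: "d2 > 0" "\<And>h. \<bar>h\<bar> < d2 \<Longrightarrow> sqn lborel (\<lambda>x. g (x + h) - g x) \<le> ennreal (e/4)"
        using trans_contD[OF g(2), of "e/4"] e by auto
      show "\<exists>d>0. \<forall>h. \<bar>h\<bar> < d \<longrightarrow> sqn lborel (\<lambda>x. f (x + h) + g (x + h) - (f x + g x)) \<le> ennreal e"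
      proof (intro exI[of _ "min d1 d2"] conjI allI impI)
        fix h assume h: "\<bar>h\<bar> < min d1 d2"
        have "sqn lborel (\<lambda>x. f (x + h) + g (x + h) - (f x + g x)) = sqn lborel (\<lambda>x. (f (x + h) - f x) + (g (x + h) - g x))"
          by (simp add: algebra_simps)
        also have "\<dots> \<le> 2 * sqn lborel (\<lambda>x. f (x + h) - f x) + 2 * sqn lborel (\<lambda>x. g (x + h) - g x)"
          by (rule sqn_add_le) measurable
        also have "\<dots> \<le> 2 * ennreal (e/4) + 2 * ennreal (e/4)"
          using d1(2)[of h] d2(2)[of h] h by (intro add_mono mult_left_mono) auto
        also have "\<dots> = ennreal e" using e by (intro ennreal_half_split) simp
        finally show "sqn lborel (\<lambda>x. f (x + h) + g (x + h) - (f x + g x)) \<le> ennreal e" .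
      qed (use d1 d2 in auto)
    qed
    show "trans_cont (\<lambda>x. c * f x)" if f: "sqint lborel f" "trans_cont f" for c f
      unfolding trans_cont_def
    proof (intro allI impI)
      fix e :: real assume e: "e > 0"
      have [measurable]: "f \<in> borel_measurable borel" using f by (auto simp: sqint_def)
      define r where "r = e / ((cmod c)\<^sup>2 + 1)"
      have r: "r > 0" "(cmod c)\<^sup>2 * r \<le> e"
        using e by (auto simp: r_def divide_simps add_pos_nonneg add_nonneg_pos intro!: mult_left_mono)
      obtain d where d: "d > 0" "\<And>h. \<bar>h\<bar> < d \<Longrightarrow> sqn lborel (\<lambda>x. f (x + h) - f x) \<le> ennreal r"
        using trans_contD[OF f(2) r(1)] by auto
      show "\<exists>d>0. \<forall>h. \<bar>h\<bar> < d \<longrightarrow> sqn lborel (\<lambda>x. c * f (x + h) - c * f x) \<le> ennreal e"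
      proof (intro exI[of _ d] conjI allI impI)
        fix h assume h: "\<bar>h\<bar> < d"
        have "sqn lborel (\<lambda>x. c * f (x + h) - c * f x) = sqn lborel (\<lambda>x. c * (f (x + h) - f x))"
          by (simp add: right_diff_distrib)
        also have "\<dots> = ennreal ((cmod c)\<^sup>2) * sqn lborel (\<lambda>x. f (x + h) - f x)"
          by (rule sqn_scale) measurable
        also have "\<dots> \<le> ennreal ((cmod c)\<^sup>2) * ennreal r" using d(2)[OF h] by (intro mult_left_mono) auto
        also have "\<dots> \<le> ennreal e" using r by (subst ennreal_mult[symmetric]) (auto intro: ennreal_leI)
        finally show "sqn lborel (\<lambda>x. c * f (x + h) - c * f x) \<le> ennreal e" .
      qed (rule d)
    qed
    show "trans_cont f" if f: "sqint lborel f"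
      and lim: "\<And>\<epsilon>. \<epsilon> > 0 \<Longrightarrow> \<exists>h. sqint lborel h \<and> trans_cont h \<and> sqn lborel (\<lambda>x. f x - h x) < \<epsilon>" for f
      unfolding trans_cont_def
    proof (intro allI impI)
      fix e :: real assume e: "e > 0"
      have [measurable]: "f \<in> borel_measurable borel" using f by (auto simp: sqint_def)
      \<comment> \<open>The bound e/16 allows two doublings: the two approximation errors together
        cost e/4, and together with the translation error of \<open>k\<close> they cost e.\<close>
      obtain k where k: "sqint lborel k" "trans_cont k" "sqn lborel (\<lambda>x. f x - k x) < ennreal (e/4/4)"
        using lim[of "ennreal (e/4/4)"] e by auto
      have [measurable]: "k \<in> borel_measurable borel" using k by (auto simp: sqint_def)
      obtain d where d: "d > 0" "\<And>h. \<bar>h\<bar> < d \<Longrightarrow> sqn lborel (\<lambda>x. k (x + h) - k x) \<le> ennreal (e/4)"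
        using trans_contD[OF k(2), of "e/4"] e by auto
      show "\<exists>d>0. \<forall>h. \<bar>h\<bar> < d \<longrightarrow> sqn lborel (\<lambda>x. f (x + h) - f x) \<le> ennreal e"
      proof (intro exI[of _ d] conjI allI impI)
        fix h assume h: "\<bar>h\<bar> < d"
        have sh: "sqn lborel (\<lambda>x. f (x + h) - k (x + h)) = sqn lborel (\<lambda>x. f x - k x)"
          by (rule sqn_shift[of "\<lambda>x. f x - k x"]) measurable
        have "sqn lborel (\<lambda>x. (f (x + h) - k (x + h)) - (f x - k x))
            \<le> 2 * sqn lborel (\<lambda>x. f (x + h) - k (x + h)) + 2 * sqn lborel (\<lambda>x. f x - k x)"
          by (rule sqn_diff_le) measurable
        also have "\<dots> \<le> 2 * ennreal (e/4/4) + 2 * ennreal (e/4/4)"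
          unfolding sh using k(3) by (intro add_mono mult_left_mono) auto
        also have "\<dots> = ennreal (e/4)" using e by (intro ennreal_half_split) simp
        finally have 1: "sqn lborel (\<lambda>x. (f (x + h) - k (x + h)) - (f x - k x)) \<le> ennreal (e/4)" .
        have "sqn lborel (\<lambda>x. f (x + h) - f x) = sqn lborel (\<lambda>x. ((f (x + h) - k (x + h)) - (f x - k x)) + (k (x + h) - k x))"
          by (simp add: algebra_simps)
        also have "\<dots> \<le> 2 * sqn lborel (\<lambda>x. (f (x + h) - k (x + h)) - (f x - k x)) + 2 * sqn lborel (\<lambda>x. k (x + h) - k x)"
          by (rule sqn_add_le) measurable
        also have "\<dots> \<le> 2 * ennreal (e/4) + 2 * ennreal (e/4)"
          using 1 d(2)[OF h] by (intro add_mono mult_left_mono) auto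
        also have "\<dots> = ennreal e" using e by (intro ennreal_half_split) simp
        finally show "sqn lborel (\<lambda>x. f (x + h) - f x) \<le> ennreal e" .
      qed (rule d)
    qed
  qed (rule f)
qed

section \<open>Test functions along characteristics\<close>

lemma chain_C1_rect:
  assumes C: "C1_rect \<tau> L \<psi> \<psi>t \<psi>x" and s: "s \<in> {p..q}"
    and sub: "\<And>s. s \<in> {p..q} \<Longrightarrow> s \<in> {0..\<tau>} \<and> c - s \<in> {0..L}"
  shows "((\<lambda>s. \<psi> s (c - s)) has_vector_derivative \<psi>t s (c - s) - \<psi>x s (c - s)) (at s within {p..q})"
proof -
  let ?R = "{0..\<tau>} \<times> {0..L}"
  have mem: "s \<in> {0..\<tau>}" "c - s \<in> {0..L}" using sub[OF s] by auto
  have "((\<lambda>(t, x). \<psi> t x) has_derivative (\<lambda>(h, k). h *\<^sub>R \<psi>t s (c - s) + blinfun_scaleR_left (\<psi>x s (c - s)) k)) (at (s, c - s) within ?R)"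
  proof (rule has_derivative_partialsI)
    show "((\<lambda>t. \<psi> t (c - s)) has_derivative (\<lambda>h. h *\<^sub>R \<psi>t s (c - s))) (at s within {0..\<tau>})"
      using C mem by (auto simp: C1_rect_def has_vector_derivative_def)
    show "((\<lambda>y. \<psi> t y) has_derivative blinfun_apply (blinfun_scaleR_left (\<psi>x t x))) (at x within {0..L})"
      if "t \<in> {0..\<tau>}" "x \<in> {0..L}" for t x
      using C that by (auto simp: C1_rect_def has_vector_derivative_def)
    have "continuous_on ?R (\<lambda>z. blinfun_scaleR_left ((\<lambda>(t, x). \<psi>x t x) z))"
      using C by (intro bounded_linear.continuous_on[OF bounded_linear_blinfun_scaleR_left]) (auto simp: C1_rect_def)
    then show "continuous (at (s, c - s) within ?R) (\<lambda>(t, x). blinfun_scaleR_left (\<psi>x t x))"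
      using mem by (auto simp: continuous_on_eq_continuous_within case_prod_unfold)
  qed (use mem in auto)
  then have d1: "((\<lambda>(t, x). \<psi> t x) has_derivative (\<lambda>(h, k). h *\<^sub>R \<psi>t s (c - s) + k *\<^sub>R \<psi>x s (c - s)))
      (at (s, c - s) within (\<lambda>s. (s, c - s)) ` {p..q})"
    unfolding blinfun_scaleR_left.rep_eq by (rule has_derivative_subset) (use sub in auto)
  have d2: "((\<lambda>s. (s, c - s)) has_derivative (\<lambda>h. (h, - h))) (at s within {p..q})"
    by (auto intro!: derivative_eq_intros)
  from diff_chain_within[OF d2 d1] show ?thesis
    by (simp add: has_vector_derivative_def o_def case_prod_beta algebra_simps)
qed

text \<open>One common bound, by compactness of the closed rectangle, for the two functions that are
  paired with trajectories.\<close>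

lemma C1_rect_bounded:
  assumes C: "C1_rect \<tau> L \<psi> \<psi>t \<psi>x"
  shows "\<exists>M\<ge>0. \<forall>t\<in>{0..\<tau>}. \<forall>x\<in>{0..L}. cmod (\<psi> t x) \<le> M \<and> cmod (\<psi>x t x - \<psi>t t x) \<le> M"
proof -
  have K: "compact ({0..\<tau>} \<times> {0..L})" by (intro compact_Times) auto
  have "bounded ((\<lambda>(t, x). \<psi> t x) ` ({0..\<tau>} \<times> {0..L}))"
    using C K by (intro compact_imp_bounded compact_continuous_image) (auto simp: C1_rect_def)
  then obtain M1 where M1: "\<And>t x. t \<in> {0..\<tau>} \<Longrightarrow> x \<in> {0..L} \<Longrightarrow> cmod (\<psi> t x) \<le> M1"
    unfolding bounded_iff by fast
  have "continuous_on ({0..\<tau>} \<times> {0..L}) (\<lambda>z. (\<lambda>(t, x). \<psi>x t x) z - (\<lambda>(t, x). \<psi>t t x) z)"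
    using C by (intro continuous_on_diff) (auto simp: C1_rect_def)
  from compact_imp_bounded[OF compact_continuous_image[OF this K]]
  obtain M2 where M2: "\<And>t x. t \<in> {0..\<tau>} \<Longrightarrow> x \<in> {0..L} \<Longrightarrow> cmod (\<psi>x t x - \<psi>t t x) \<le> M2"
    unfolding bounded_iff by fastforce
  show ?thesis
    by (rule exI[of _ "max 0 (max M1 M2)"]) (use M1 M2 in \<open>auto simp: le_max_iff_disj\<close>)
qed

lemma C1_rect_cnj:
  assumes "C1_rect \<tau> L \<phi> \<phi>t \<phi>x"
  shows "C1_rect \<tau> L (\<lambda>t x. cnj (\<phi> t x)) (\<lambda>t x. cnj (\<phi>t t x)) (\<lambda>t x. cnj (\<phi>x t x))"
  using assms unfolding C1_rect_def
  by (auto simp: case_prod_beta intro!: continuous_intros bounded_linear.has_vector_derivative[OF bounded_linear_cnj])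

lemma C1_rect_measurable:
  assumes C: "C1_rect \<tau> L \<psi> \<psi>t \<psi>x"
  shows "(\<lambda>z. indicator ({0..\<tau>} \<times> {0..L}) z *\<^sub>R \<psi> (fst z) (snd z)) \<in> borel_measurable (borel \<Otimes>\<^sub>M borel)"
    "(\<lambda>z. indicator ({0..\<tau>} \<times> {0..L}) z *\<^sub>R (\<psi>x (fst z) (snd z) - \<psi>t (fst z) (snd z))) \<in> borel_measurable (borel \<Otimes>\<^sub>M borel)"
  unfolding borel_prod using C
  by (auto intro!: borel_measurable_continuous_on_indicator borel_closed closed_Times continuous_intros
      simp: C1_rect_def case_prod_beta)

lemma integral_shear:
  fixes h :: "real \<times> real \<Rightarrow> complex"
  assumes h: "integrable lborel h"
  shows "integrable lborel (\<lambda>c. \<integral>s. h (s, c - s) \<partial>lborel)"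
    and "(\<integral>c. \<integral>s. h (s, c - s) \<partial>lborel \<partial>lborel) = (\<integral>t. \<integral>x. h (t, x) \<partial>lborel \<partial>lborel)"
    and "AE c in lborel. integrable lborel (\<lambda>s. h (s, c - s))"
proof -
  have [measurable]: "h \<in> borel_measurable (borel \<Otimes>\<^sub>M borel)"
    using h unfolding borel_prod by auto
  define k where "k s c = h (s, c - s)" for s c
  have km: "case_prod k \<in> borel_measurable (borel \<Otimes>\<^sub>M borel)" unfolding k_def[abs_def] by measurable
  have "(\<integral>\<^sup>+s. \<integral>\<^sup>+c. ennreal (cmod (k s c)) \<partial>lborel \<partial>lborel) = (\<integral>\<^sup>+s. \<integral>\<^sup>+x. ennreal (cmod (h (s, x))) \<partial>lborel \<partial>lborel)"
    unfolding k_def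
  proof (rule nn_integral_cong)
    fix s :: real
    show "(\<integral>\<^sup>+c. ennreal (cmod (h (s, c - s))) \<partial>lborel) = (\<integral>\<^sup>+x. ennreal (cmod (h (s, x))) \<partial>lborel)"
      by (rule nn_shift(3)[of "\<lambda>x. ennreal (cmod (h (s, x)))"]) measurable
  qed
  also have "\<dots> = (\<integral>\<^sup>+z. ennreal (cmod (h z)) \<partial>lborel)" by (rule nn_plane[symmetric]) measurable
  also have "\<dots> < \<infinity>" using h by (simp add: integrable_iff_bounded)
  finally have fin: "(\<integral>\<^sup>+s. \<integral>\<^sup>+c. ennreal (cmod (k s c)) \<partial>lborel \<partial>lborel) < \<infinity>" .
  note I = integrable_planeI[OF km fin]
  show "integrable lborel (\<lambda>c. \<integral>s. h (s, c - s) \<partial>lborel)"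
    using lborel_pair.integrable_snd[OF I] by (simp add: k_def)
  show "AE c in lborel. integrable lborel (\<lambda>s. h (s, c - s))"
    using lborel_pair.AE_integrable_snd[OF I] by (simp add: k_def)
  have "(\<integral>c. \<integral>s. k s c \<partial>lborel \<partial>lborel) = (\<integral>s. \<integral>c. k s c \<partial>lborel \<partial>lborel)"
    by (rule integral_plane_swap(1)[OF km fin, symmetric])
  also have "\<dots> = (\<integral>s. \<integral>x. h (s, x) \<partial>lborel \<partial>lborel)"
    unfolding k_def by (intro Bochner_Integration.integral_cong refl integral_shift(2))
  finally show "(\<integral>c. \<integral>s. h (s, c - s) \<partial>lborel \<partial>lborel) = (\<integral>t. \<integral>x. h (t, x) \<partial>lborel \<partial>lborel)"
    by (simp add: k_def)
qed

section \<open>Mild solutions are weak solutions\<close>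

context transport
begin

definition fwd :: "real \<times> real \<times> real \<Rightarrow> complex" where
  "fwd z = (if fst (snd z) < fst z then 1 else 0)"

lemma fwd_simp[simp]: "fwd (t, s, c) = (if s < t then 1 else 0)" by (simp add: fwd_def)

lemma bweight_fwd: "bweight fwd"
  unfolding bweight_def fwd_def[abs_def] by auto

lemma fwd_measurable[measurable]: "fwd \<in> borel_measurable (borel \<Otimes>\<^sub>M borel \<Otimes>\<^sub>M borel)"
  by (rule bweight_measurable[OF bweight_fwd])

text \<open>The formula of \<open>traj fwd\<close> without the cutoff in t, so that it is meaningful
  at the end times 0 and L.\<close>

definition mild :: "(real \<Rightarrow> complex) \<Rightarrow> (real \<times> real \<Rightarrow> complex) \<Rightarrow> real \<Rightarrow> real \<Rightarrow> complex" where
  "mild a F t x = a (t + x) + Rop fwd F (t, x)"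

definition quad :: "(real \<times> real \<Rightarrow> complex) \<Rightarrow> bool" where
  "quad F \<longleftrightarrow> (\<forall>t x. \<not> (0 < t \<and> t < L \<and> 0 < x \<and> x < L) \<longrightarrow> F (t, x) = 0)"

lemma quad_strip: "quad F \<Longrightarrow> strip F" by (auto simp: quad_def strip_def)

lemma quad_Gop: "strip v \<Longrightarrow> quad (Gop v)"
  using strip_Gop[of v] Gop_eq_0 by (auto simp: quad_def strip_def)

definition cI :: "(real \<Rightarrow> complex) \<Rightarrow> (real \<times> real \<Rightarrow> complex) \<Rightarrow> real \<Rightarrow> complex" where
  "cI w F c = (\<integral>s. w s * F (s, c - s) \<partial>lborel)"

lemma cI_measurable[measurable]:
  assumes [measurable]: "w \<in> borel_measurable borel" "F \<in> borel_measurable (borel \<Otimes>\<^sub>M borel)"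
  shows "cI w F \<in> borel_measurable borel"
  unfolding cI_def[abs_def] by measurable

lemma sqn_cI_le:
  assumes wm[measurable]: "w \<in> borel_measurable borel" and w: "\<And>s. cmod (w s) \<le> 1"
    and F: "F \<in> borel_measurable (borel \<Otimes>\<^sub>M borel)"
    and I: "I \<in> sets borel" "emeasure lborel I \<le> ennreal d" "\<And>s x. s \<notin> I \<Longrightarrow> w s * F (s, x) = 0"
  shows "sqn lborel (cI w F) \<le> ennreal d * sqn lborel F"
proof -
  note [measurable] = F
  define G where "G z = w (fst z) * F z" for z
  have [measurable]: "G \<in> borel_measurable (borel \<Otimes>\<^sub>M borel)" unfolding G_def[abs_def] by measurable
  have "sqn lborel (cI w F) \<le> (\<integral>\<^sup>+c. (CN G c)\<^sup>2 \<partial>lborel)"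
    unfolding sqn_def
  proof (intro nn_integral_mono power_mono)
    fix c show "ennreal (cmod (cI w F c)) \<le> CN G c"
      unfolding cI_def CN_def G_def fst_conv by (rule norm_integral_le_nn)
  qed simp
  also have "\<dots> \<le> ennreal d * sqn lborel G"
    by (rule nn_CN_sq_le[OF _ I(1,2)]) (use I(3) in \<open>auto simp: G_def\<close>)
  also have "\<dots> \<le> ennreal d * sqn lborel F"
    using w by (intro mult_left_mono sqn_mono) (auto simp: G_def norm_mult mult_left_le_one_le)
  finally show ?thesis .
qed

lemma sqint_cI:
  assumes "w \<in> borel_measurable borel" "\<And>s. cmod (w s) \<le> 1" and F: "sqint lborel F" "strip F"
  shows "sqint lborel (cI w F)"
proof -
  have Fm: "F \<in> borel_measurable (borel \<Otimes>\<^sub>M borel)" using F by measurable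
  have "sqn lborel (cI w F) \<le> ennreal L * sqn lborel F"
    using assms L by (intro sqn_cI_le[where I="{0<..<L}"] Fm) (auto simp: strip_def)
  also have "\<dots> < top" using F by (simp add: sqint_def ennreal_mult_less_top)
  finally show ?thesis using cI_measurable[OF assms(1) Fm] by (simp add: sqint_def)
qed

lemma mild_eq: "mild a F t x = a (t + x) + cI (\<lambda>s. fwd (t, s, 0)) F (t + x)"
  by (simp add: mild_def Rop_def cI_def)

lemma sqint_mild_line:
  assumes a: "sqint lborel a" and F: "sqint lborel F" "strip F"
  shows "sqint lborel (\<lambda>c. a c + cI (\<lambda>s. fwd (t, s, 0)) F c)"
  by (intro sqint_add a sqint_cI F) auto

lemma sqint_mild:
  assumes a: "sqint lborel a" and F: "sqint lborel F" "strip F"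
  shows "sqint lborel (mild a F t)"
  unfolding mild_eq[abs_def] using sqint_shift[OF sqint_mild_line[OF assms], of t t]
  by (simp add: add.commute)

lemma version_mild:
  assumes a: "sqint lborel a" and F: "sqint lborel F" "strip F"
  shows "version {0..L} (mild a F t) (\<lambda>x. indicator {0..L} x * mild a F t x)"
proof -
  have s: "sqint lborel (mild a F t)" by (rule sqint_mild[OF assms])
  have [measurable]: "mild a F t \<in> borel_measurable borel" using s by (simp add: sqint_def)
  have "sqint lborel (\<lambda>x. indicator {0..L} x * mild a F t x)"
    by (rule sqint_mono[OF _ s]) (auto split: split_indicator)
  then show ?thesis by (auto simp: version_def intro!: AE_I2)
qed

text \<open>As a function of the label, the state changes between t and t' by line integrals over
  the times in between, which are small by \<open>sqn_cI_le\<close>. The state itself is this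
  function translated by t, so continuity of translations does the rest.\<close>

lemma C0_L2_mild:
  assumes a: "sqint lborel a" and F: "sqint lborel F" "strip F"
  shows "C0_L2 L T (mild a F)"
proof -
  define m where "m t c = a c + cI (\<lambda>s. fwd (t, s, 0)) F c" for t c
  have ms: "sqint lborel (m t)" for t unfolding m_def[abs_def] by (rule sqint_mild_line[OF assms])
  have mm[measurable]: "m t \<in> borel_measurable borel" for t using ms by (simp add: sqint_def)
  have Fm[measurable]: "F \<in> borel_measurable (borel \<Otimes>\<^sub>M borel)" using F by measurable
  define w where "w t x = indicator {0..L} x * mild a F t x" for t x
  have wv: "version {0..L} (mild a F t) (w t)" for t
    unfolding w_def[abs_def] by (rule version_mild[OF assms])
  have ws: "sqint lborel (w t)" for t using wv[of t] by (simp add: version_def)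
  have close: "sqn lborel (\<lambda>c. m t c - m t' c) \<le> ennreal \<bar>t - t'\<bar> * sqn lborel F" for t t'
  proof -
    define k :: "real \<Rightarrow> complex" where "k s = fwd (t, s, 0) - fwd (t', s, 0)" for s
    have "AE c in lborel. m t c - m t' c = cI k F c"
      using AE_CN_finite[OF F]
    proof eventually_elim
      case (elim c)
      have "integrable lborel (\<lambda>s. fwd (t, s, 0) * F (s, c - s))" "integrable lborel (\<lambda>s. fwd (t', s, 0) * F (s, c - s))"
        by (rule integrable_char[OF Fm _ _ elim]; auto)+
      then show ?case unfolding m_def cI_def k_def by (simp add: left_diff_distrib)
    qed
    then have "sqn lborel (\<lambda>c. m t c - m t' c) = sqn lborel (cI k F)" by (rule sqn_cong_AE)
    also have "\<dots> \<le> ennreal \<bar>t - t'\<bar> * sqn lborel F"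
    proof (rule sqn_cI_le[where I="{min t t'..max t t'}"])
      show "emeasure lborel {min t t'..max t t'} \<le> ennreal \<bar>t - t'\<bar>" by (auto simp: min_def max_def)
      show "cmod (k s) \<le> 1" for s by (auto simp: k_def)
      show "s \<notin> {min t t'..max t t'} \<Longrightarrow> k s * F (s, x) = 0" for s x by (auto simp: k_def)
    qed (auto simp: k_def[abs_def])
    finally show ?thesis .
  qed
  have "continuous_on {0..T} (\<lambda>t. abs_l2 (w t))"
  proof (rule continuous_on_subset[of UNIV], rule continuous_at_imp_continuous_on, rule ballI)
    fix t :: real
    show "isCont (\<lambda>t. abs_l2 (w t)) t"
      unfolding continuous_at_eps_delta
    proof (intro allI impI)
      fix e :: real assume e: "e > 0"
      \<comment> \<open>\<open>r\<close> controls the source and \<open>d\<close> the translation,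
        each with squared error e^2/16; doubled and added they give (e/2)^2.\<close>
      obtain r where r: "r > 0" "ennreal r * sqn lborel F \<le> ennreal (e\<^sup>2/4/4)"
      proof -
        define N where "N = (l2n lborel F)\<^sup>2"
        define r where "r = (e\<^sup>2/4/4) / (N + 1)"
        have N: "N \<ge> 0" "sqn lborel F = ennreal N" using sqn_l2n[OF F(1)] by (auto simp: N_def)
        have "r > 0" using e N by (simp add: r_def add_nonneg_pos)
        moreover have "r * N \<le> e\<^sup>2/4/4"
          unfolding r_def using N e by (simp add: divide_simps mult_left_mono add_nonneg_pos)
        ultimately show ?thesis using N by (intro that[of r]) (auto simp: ennreal_mult[symmetric] intro: ennreal_leI)
      qed
      obtain d where d: "d > 0" "\<And>h. \<bar>h\<bar> < d \<Longrightarrow> sqn lborel (\<lambda>x. m t (x + h) - m t x) \<le> ennreal (e\<^sup>2/4/4)"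
        using trans_contD[OF trans_cont_sqint[OF ms], of "e\<^sup>2/4/4" t] e by auto
      show "\<exists>d>0. \<forall>t'. dist t' t < d \<longrightarrow> dist (abs_l2 (w t')) (abs_l2 (w t)) < e"
      proof (intro exI[of _ "min r d"] conjI allI impI)
        fix t' assume "dist t' t < min r d"
        then have t': "\<bar>t' - t\<bar> < r" "\<bar>t' - t\<bar> < d" by (auto simp: dist_real_def)
        have 1: "sqn lborel (\<lambda>x. m t' (x + t') - m t (x + t')) \<le> ennreal (e\<^sup>2/4/4)"
        proof -
          have "sqn lborel (\<lambda>x. m t' (x + t') - m t (x + t')) = sqn lborel (\<lambda>x. m t' x - m t x)"
            by (rule sqn_shift[of "\<lambda>x. m t' x - m t x"]) measurable
          also have "\<dots> \<le> ennreal \<bar>t' - t\<bar> * sqn lborel F" by (rule close)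
          also have "\<dots> \<le> ennreal r * sqn lborel F" using t' by (intro mult_right_mono ennreal_leI) auto
          finally show ?thesis using r(2) by (rule order_trans)
        qed
        have 2: "sqn lborel (\<lambda>x. m t (x + t') - m t (x + t)) \<le> ennreal (e\<^sup>2/4/4)"
        proof -
          have "sqn lborel (\<lambda>x. m t (x + t') - m t (x + t)) = sqn lborel (\<lambda>x. m t ((x + t) + (t' - t)) - m t (x + t))"
            by (simp add: algebra_simps)
          also have "\<dots> = sqn lborel (\<lambda>x. m t (x + (t' - t)) - m t x)"
            by (rule sqn_shift[of "\<lambda>x. m t (x + (t' - t)) - m t x"]) measurable
          also have "\<dots> \<le> ennreal (e\<^sup>2/4/4)" by (rule d(2)[OF t'(2)])
          finally show ?thesis .
        qed
        have "sqn lborel (\<lambda>x. w t' x - w t x) \<le> sqn lborel (\<lambda>x. (m t' (x + t') - m t (x + t')) + (m t (x + t') - m t (x + t)))"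
        proof (rule sqn_mono)
          show "cmod (w t' x - w t x) \<le> cmod (m t' (x + t') - m t (x + t') + (m t (x + t') - m t (x + t)))" for x
            unfolding w_def mild_eq m_def[symmetric] by (auto simp: add.commute split: split_indicator)
        qed
        also have "\<dots> \<le> 2 * sqn lborel (\<lambda>x. m t' (x + t') - m t (x + t')) + 2 * sqn lborel (\<lambda>x. m t (x + t') - m t (x + t))"
          by (rule sqn_add_le) measurable
        also have "\<dots> \<le> 2 * ennreal (e\<^sup>2/4/4) + 2 * ennreal (e\<^sup>2/4/4)"
          using 1 2 by (intro add_mono mult_left_mono) auto
        also have "\<dots> = ennreal ((e/2)\<^sup>2)"
          using ennreal_half_split[of "e\<^sup>2/4"] by (simp add: power_divide)
        finally have "l2n lborel (\<lambda>x. w t' x - w t x) \<le> e / 2" using e by (intro l2n_leI) auto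
        then show "dist (abs_l2 (w t')) (abs_l2 (w t)) < e"
          using e ws by (simp add: dist_norm abs_l2_diff norm_abs_l2 sqint_diff)
      qed (use r d in auto)
    qed
  qed simp
  then show ?thesis using C0_L2_iff_continuous[of T L "mild a F" w] wv by blast
qed

text \<open>Along the characteristic $t + x = c$, the function \<open>mild a F\<close> is absolutely continuous with
  derivative $F$, so this is integration by parts on each characteristic.\<close>
lemma transport_identity:
  assumes \<tau>: "0 \<le> \<tau>" "\<tau> \<le> L" and C: "C1_rect \<tau> L \<psi> \<psi>t \<psi>x" and \<psi>0: "\<And>t. t \<in> {0..\<tau>} \<Longrightarrow> \<psi> t 0 = 0"
    and a: "sqint lborel a" and F: "sqint lborel F" "quad F"
  defines "A \<equiv> \<lambda>t. indicator {0<..<\<tau>} t *\<^sub>R (\<integral>x. indicator {0..L} x *\<^sub>R (mild a F t x * (\<psi>x t x - \<psi>t t x)) \<partial>lborel)"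
    and "B \<equiv> \<lambda>t. indicator {0<..<\<tau>} t *\<^sub>R (\<integral>y. F (t, y) * (indicator {0..L} y *\<^sub>R \<psi> t y) \<partial>lborel)"
  shows "integrable lborel A" "integrable lborel B"
    "(\<integral>t. A t \<partial>lborel) = - (\<integral>x. indicator {0..L} x *\<^sub>R (mild a F \<tau> x * \<psi> \<tau> x) \<partial>lborel)
       + (\<integral>x. indicator {0..L} x *\<^sub>R (a x * \<psi> 0 x) \<partial>lborel)
       + (\<integral>t. indicator {0..\<tau>} t *\<^sub>R (a (t + L) * \<psi> t L) \<partial>lborel) + (\<integral>t. B t \<partial>lborel)"
proof -
  let ?R = "{0..\<tau>} \<times> {0..L}"
  note Fs = quad_strip[OF F(2)]
  have Fm[measurable]: "F \<in> borel_measurable (borel \<Otimes>\<^sub>M borel)" using F by measurable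
  have am[measurable]: "a \<in> borel_measurable borel" using a by (simp add: sqint_def)
  have Ct: "continuous_on ?R (\<lambda>(t, x). \<psi>t t x)" and Cx: "continuous_on ?R (\<lambda>(t, x). \<psi>x t x)"
    using C by (simp_all add: C1_rect_def)
  obtain M where M: "M \<ge> 0" "\<And>t x. t \<in> {0..\<tau>} \<Longrightarrow> x \<in> {0..L} \<Longrightarrow> cmod (\<psi> t x) \<le> M"
    "\<And>t x. t \<in> {0..\<tau>} \<Longrightarrow> x \<in> {0..L} \<Longrightarrow> cmod (\<psi>x t x - \<psi>t t x) \<le> M"
    using C1_rect_bounded[OF C] by auto
  define P where "P z = indicator ?R z *\<^sub>R \<psi> (fst z) (snd z)" for z
  define Q where "Q z = indicator ?R z *\<^sub>R (\<psi>x (fst z) (snd z) - \<psi>t (fst z) (snd z))" for z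
  have Pm[measurable]: "P \<in> borel_measurable (borel \<Otimes>\<^sub>M borel)" and Qm[measurable]: "Q \<in> borel_measurable (borel \<Otimes>\<^sub>M borel)"
    unfolding P_def[abs_def] Q_def[abs_def] by (rule C1_rect_measurable[OF C])+
  have PR: "P (t, x) = (if 0 \<le> t \<and> t \<le> \<tau> \<and> 0 \<le> x \<and> x \<le> L then \<psi> t x else 0)" for t x by (auto simp: P_def)
  have QR: "Q (t, x) = (if 0 \<le> t \<and> t \<le> \<tau> \<and> 0 \<le> x \<and> x \<le> L then \<psi>x t x - \<psi>t t x else 0)" for t x by (auto simp: Q_def)
  have PM: "cmod (P z) \<le> M" and QM: "cmod (Q z) \<le> M" for z
    using M by (auto simp: P_def Q_def split: split_indicator)
  have Rind: "sqint lborel (\<lambda>z. indicator ?R z)"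
    by (intro sqint_indicator emeasure_bounded_finite bounded_Times) (auto simp: borel_closed closed_Times)
  have bdd_sqint: "sqint lborel f" if "f \<in> borel_measurable (borel \<Otimes>\<^sub>M borel)" "\<And>z. cmod (f z) \<le> M" "\<And>z. z \<notin> ?R \<Longrightarrow> f z = 0" for f
  proof (rule sqint_mono[OF _ sqint_scale[OF Rind, of "of_real M"]])
    show "f \<in> borel_measurable lborel" using that(1) unfolding borel_prod by simp
    show "cmod (f z) \<le> cmod (of_real M * indicator ?R z)" for z
      using that(2,3)[of z] M(1) by (auto simp: norm_mult split: split_indicator)
  qed
  have bdd_sqint1: "sqint lborel f" if "f \<in> borel_measurable borel" "\<And>z. cmod (f z) \<le> M" "\<And>z. z \<notin> {p..q} \<Longrightarrow> f z = 0" for f and p q :: real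
  proof (rule sqint_mono[OF _ sqint_scale[OF sqint_indicator[of "{p..q}" lborel], where c="of_real M"]])
    show "f \<in> borel_measurable lborel" using that(1) by simp
    show "cmod (f z) \<le> cmod (of_real M * indicator {p..q} z)" for z
      using that(2,3)[of z] M(1) by (auto simp: norm_mult split: split_indicator)
    show "emeasure lborel {p..q} < \<infinity>" by (rule emeasure_bounded_finite) simp
  qed simp
  define h where "h z = traj fwd a F z * (indicator {0<..<\<tau>} (fst z) * Q z)" for z
  have hi: "integrable lborel h"
    unfolding h_def
  proof (rule integrable_mult_sqint[OF sqint_traj(1)[OF bweight_fwd F(1) Fs a] bdd_sqint])
    show "(\<lambda>z. indicator {0<..<\<tau>} (fst z) * Q z) \<in> borel_measurable (borel \<Otimes>\<^sub>M borel)" by measurable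
    show "cmod (indicator {0<..<\<tau>} (fst z) * Q z) \<le> M" for z
      using QM[of z] M(1) by (auto split: split_indicator)
    show "z \<notin> ?R \<Longrightarrow> indicator {0<..<\<tau>} (fst z) * Q z = 0" for z by (simp add: Q_def)
  qed
  have Ah: "A t = (\<integral>x. h (t, x) \<partial>lborel)" for t
  proof (cases "0 < t \<and> t < \<tau>")
    case True
    then show ?thesis using \<tau> unfolding A_def
      by (auto intro!: Bochner_Integration.integral_cong simp: h_def QR traj_def mild_def split: split_indicator)
  next
    case False
    then have "h (t, x) = 0" for x by (auto simp: h_def)
    then show ?thesis using False by (auto simp: A_def)
  qed
  have hi': "integrable (lborel \<Otimes>\<^sub>M lborel) (case_prod (\<lambda>t x. h (t, x)))" using hi unfolding lborel_prod by simp
  show "integrable lborel A" unfolding Ah by (rule lborel_pair.integrable_fst[OF hi'])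
  define f where "f z = fwd (\<tau>, fst z, 0) * F z * P z" for z
  have fi: "integrable lborel f"
  proof -
    have "integrable lborel (\<lambda>z. F z * (fwd (\<tau>, fst z, 0) * P z))"
    proof (rule integrable_mult_sqint[OF F(1) bdd_sqint])
      show "(\<lambda>z. fwd (\<tau>, fst z, 0) * P z) \<in> borel_measurable (borel \<Otimes>\<^sub>M borel)" by measurable
      show "cmod (fwd (\<tau>, fst z, 0) * P z) \<le> M" for z using PM[of z] M(1) by auto
      show "z \<notin> ?R \<Longrightarrow> fwd (\<tau>, fst z, 0) * P z = 0" for z by (simp add: P_def)
    qed
    then show ?thesis by (simp add: f_def[abs_def] mult_ac)
  qed
  have Bf: "B t = (\<integral>y. f (t, y) \<partial>lborel)" for t
  proof (cases "0 < t \<and> t < \<tau>")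
    case True
    then show ?thesis unfolding B_def
      by (auto intro!: Bochner_Integration.integral_cong simp: f_def PR split: split_indicator)
  next
    case False
    then have "f (t, y) = 0" for y using F(2) by (auto simp: f_def quad_def)
    then show ?thesis using False by (auto simp: B_def)
  qed
  have fi': "integrable (lborel \<Otimes>\<^sub>M lborel) (case_prod (\<lambda>t x. f (t, x)))" using fi unfolding lborel_prod by simp
  show "integrable lborel B" unfolding Bf by (rule lborel_pair.integrable_fst[OF fi'])
  \<comment> \<open>\<open>\<Psi>1\<close> is the test function at time \<tau> on the
    characteristic, \<open>\<Psi>0\<close> its value where the characteristic enters: at t = 0 if c
    \<le> L, and otherwise at x = L at time c - L.\<close>
  define \<Psi>1 where "\<Psi>1 c = P (\<tau>, c - \<tau>)" for c
  define \<Psi>0 where "\<Psi>0 c = (if c \<le> L then P (0, c) else P (c - L, L))" for c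
  define q where "q c s = indicator {0<..<\<tau>} s * Q (s, c - s)" for c s
  have [measurable]: "\<Psi>1 \<in> borel_measurable borel" "\<Psi>0 \<in> borel_measurable borel" "q c \<in> borel_measurable borel" for c
    unfolding \<Psi>1_def[abs_def] \<Psi>0_def[abs_def] q_def[abs_def] by measurable
  \<comment> \<open>The fundamental theorem along the characteristic from time p to its exit time
    min \<tau> c. A characteristic with c < \<tau> leaves through x = 0, where the test function
    vanishes, so the exit value is \<open>\<Psi>1 c\<close> in either case.\<close>
  have tail: "(\<integral>s. (if p < s then q c s else 0) \<partial>lborel) = P (p, c - p) - \<Psi>1 c" if p: "0 \<le> p" "p \<le> \<tau>" "0 \<le> c - p" "c - p \<le> L" for p c
  proof -
    define \<beta> where "\<beta> = min \<tau> c"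
    have p\<beta>: "p \<le> \<beta>" using p by (auto simp: \<beta>_def)
    have sub: "s \<in> {0..\<tau>} \<and> c - s \<in> {0..L}" if "s \<in> {p..\<beta>}" for s using that p by (auto simp: \<beta>_def)
    have img: "(\<lambda>s. (s, c - s)) ` {p..\<beta>} \<subseteq> ?R" using sub by auto
    have line: "continuous_on {p..\<beta>} (\<lambda>s. (s, c - s))" by (intro continuous_intros)
    have cont: "continuous_on {p..\<beta>} (\<lambda>s. \<psi>t s (c - s) - \<psi>x s (c - s))"
      using continuous_on_diff[OF continuous_on_compose2[OF Ct line img] continuous_on_compose2[OF Cx line img]] by simp
    have "(\<integral>s. indicator {p..\<beta>} s *\<^sub>R (\<psi>t s (c - s) - \<psi>x s (c - s)) \<partial>lborel) = \<psi> \<beta> (c - \<beta>) - \<psi> p (c - p)"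
    proof (rule integral_FTC_Icc[where F="\<lambda>s. \<psi> s (c - s)", OF p\<beta>])
      show "((\<lambda>s. \<psi> s (c - s)) has_vector_derivative \<psi>t s (c - s) - \<psi>x s (c - s)) (at s within {p..\<beta>})" if "p \<le> s" "s \<le> \<beta>" for s
        using that by (intro chain_C1_rect[OF C _ sub]) auto
      show "continuous_on {p..\<beta>} (\<lambda>s. \<psi>t s (c - s) - \<psi>x s (c - s))" by (rule cont)
    qed
    moreover have "\<psi> \<beta> (c - \<beta>) = \<Psi>1 c" using p \<psi>0[of c] by (auto simp: \<Psi>1_def PR \<beta>_def min_def)
    moreover have "\<psi> p (c - p) = P (p, c - p)" using p by (simp add: PR)
    moreover have "(\<integral>s. (if p < s then q c s else 0) \<partial>lborel) = (\<integral>s. - (indicator {p..\<beta>} s *\<^sub>R (\<psi>t s (c - s) - \<psi>x s (c - s))) \<partial>lborel)"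
    proof (rule integral_cong_AE)
      have "AE s in lborel. s \<noteq> p" "AE s in lborel. s \<noteq> \<tau>" by (rule AE_lborel_singleton)+
      then show ae: "AE s in lborel. (if p < s then q c s else 0) = - (indicator {p..\<beta>} s *\<^sub>R (\<psi>t s (c - s) - \<psi>x s (c - s)))"
      proof eventually_elim
        case (elim s)
        then show ?case using p by (auto simp: q_def QR \<beta>_def split: split_indicator)
      qed
      show "(\<lambda>s. if p < s then q c s else 0) \<in> borel_measurable lborel" by measurable
      have "(\<lambda>s. indicator {p..\<beta>} s *\<^sub>R (\<psi>t s (c - s) - \<psi>x s (c - s))) \<in> borel_measurable borel"
        by (intro borel_measurable_continuous_on_indicator cont) simp
      then show "(\<lambda>s. - (indicator {p..\<beta>} s *\<^sub>R (\<psi>t s (c - s) - \<psi>x s (c - s)))) \<in> borel_measurable lborel" by simp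
    qed
    ultimately show ?thesis by simp
  qed
  have K1: "(\<integral>s. q c s \<partial>lborel) = \<Psi>0 c - \<Psi>1 c" for c
  proof (cases "0 \<le> c \<and> c \<le> \<tau> + L")
    case True
    define p where "p = max 0 (c - L)"
    have "(\<integral>s. q c s \<partial>lborel) = (\<integral>s. (if p < s then q c s else 0) \<partial>lborel)"
    proof (rule integral_cong_AE)
      show "AE s in lborel. q c s = (if p < s then q c s else 0)"
        using AE_lborel_singleton[of p] by eventually_elim (auto simp: q_def QR p_def)
    qed measurable
    also have "\<dots> = P (p, c - p) - \<Psi>1 c" by (rule tail) (use True L \<tau> in \<open>auto simp: p_def\<close>)
    also have "P (p, c - p) = \<Psi>0 c" by (auto simp: p_def \<Psi>0_def)
    finally show ?thesis .
  next
    case False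
    then have "q c s = 0" for s by (auto simp: q_def QR)
    moreover have "\<Psi>0 c = 0" "\<Psi>1 c = 0" using False L \<tau> by (auto simp: \<Psi>0_def \<Psi>1_def PR)
    ultimately show ?thesis by simp
  qed
  \<comment> \<open>The source at time r acts on the trajectory at all later times s, so its partner
    is the integral of \<open>q\<close> over s > r. The factor F restricts attention to points of
    the open square, where \<open>tail\<close> applies.\<close>
  have K2: "F (r, c - r) * (\<integral>s. fwd (s, r, c) * q c s \<partial>lborel) = F (r, c - r) * (fwd (\<tau>, r, c) * (P (r, c - r) - \<Psi>1 c))" for r c
  proof (cases "F (r, c - r) = 0")
    case False
    then have r: "0 < r" "r < L" "0 < c - r" "c - r < L" using F(2) unfolding quad_def by metis+
    have eq: "(\<lambda>s. fwd (s, r, c) * q c s) = (\<lambda>s. if r < s then q c s else 0)" by auto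
    show ?thesis
    proof (cases "r < \<tau>")
      case True
      then show ?thesis unfolding eq using tail[of r c] r by simp
    next
      case False
      then have "(if r < s then q c s else 0) = 0" for s by (auto simp: q_def)
      then show ?thesis unfolding eq using False by simp
    qed
  qed simp
  \<comment> \<open>The identity on one characteristic. The data \<open>a\<close> is constant there
    and uses \<open>K1\<close>; for the source, s and r are exchanged and \<open>K2\<close> is
    applied.\<close>
  have K3: "(\<integral>s. h (s, c - s) \<partial>lborel) = a c * \<Psi>0 c - \<Psi>1 c * (a c + cI (\<lambda>r. fwd (\<tau>, r, 0)) F c) + (\<integral>r. f (r, c - r) \<partial>lborel)"
    if c: "CN F c < \<infinity>" and fic: "integrable lborel (\<lambda>r. f (r, c - r))" for c
  proof -
    have qM: "cmod (q c s) \<le> M * indicator {0..\<tau>} s" for s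
      using QM[of "(s, c - s)"] M(1) by (auto simp: q_def split: split_indicator)
    have qi: "integrable lborel (q c)"
    proof (rule Bochner_Integration.integrable_bound[of _ "\<lambda>s. M * indicator {0..\<tau>} s"])
      show "integrable lborel (\<lambda>s. M * indicator {0..\<tau>} s :: real)"
        by (intro integrable_mult_right integrable_real_indicator emeasure_bounded_finite) auto
      show "AE s in lborel. norm (q c s) \<le> norm (M * indicator {0..\<tau>} s :: real)" using qM M(1) by (auto split: split_indicator)
    qed measurable
    have hq: "h (s, c - s) = a c * q c s + (\<integral>r. fwd (s, r, c) * F (r, c - r) \<partial>lborel) * q c s" for s
      using \<tau> by (auto simp: h_def q_def traj_def Rop_def distrib_right split: split_indicator)
    define k where "k s r = fwd (s, r, c) * F (r, c - r) * q c s" for s r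
    have km: "case_prod k \<in> borel_measurable (borel \<Otimes>\<^sub>M borel)" unfolding k_def[abs_def] by measurable
    have "(\<integral>\<^sup>+s. \<integral>\<^sup>+r. ennreal (cmod (k s r)) \<partial>lborel \<partial>lborel) \<le> (\<integral>\<^sup>+s. ennreal (M * indicator {0..\<tau>} s) * CN F c \<partial>lborel)"
    proof (intro nn_integral_mono)
      fix s
      have "(\<integral>\<^sup>+r. ennreal (cmod (k s r)) \<partial>lborel) \<le> (\<integral>\<^sup>+r. ennreal (M * indicator {0..\<tau>} s) * ennreal (cmod (F (r, c - r))) \<partial>lborel)"
      proof (intro nn_integral_mono)
        fix r
        have "cmod (k s r) \<le> cmod (F (r, c - r)) * cmod (q c s)" by (simp add: k_def norm_mult)
        also have "\<dots> \<le> M * indicator {0..\<tau>} s * cmod (F (r, c - r))"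
          using mult_left_mono[OF qM[of s], of "cmod (F (r, c - r))"] by (simp add: mult_ac)
        finally show "ennreal (cmod (k s r)) \<le> ennreal (M * indicator {0..\<tau>} s) * ennreal (cmod (F (r, c - r)))"
          using M(1) by (subst ennreal_mult[symmetric]) (auto intro!: ennreal_leI)
      qed
      also have "\<dots> = ennreal (M * indicator {0..\<tau>} s) * CN F c"
        unfolding CN_def by (rule nn_integral_cmult) measurable
      finally show "(\<integral>\<^sup>+r. ennreal (cmod (k s r)) \<partial>lborel) \<le> ennreal (M * indicator {0..\<tau>} s) * CN F c" .
    qed
    also have "\<dots> = (\<integral>\<^sup>+s. ennreal (M * indicator {0..\<tau>} s) \<partial>lborel) * CN F c" by (rule nn_integral_multc) measurable
    also have "(\<integral>\<^sup>+s. ennreal (M * indicator {0..\<tau>} s) \<partial>lborel) = ennreal M * ennreal \<tau>"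
      using M(1) \<tau> by (simp add: ennreal_mult nn_integral_cmult ennreal_indicator)
    also have "ennreal M * ennreal \<tau> * CN F c < \<infinity>" using c by (simp add: ennreal_mult_less_top)
    finally have kfin: "(\<integral>\<^sup>+s. \<integral>\<^sup>+r. ennreal (cmod (k s r)) \<partial>lborel \<partial>lborel) < \<infinity>" .
    have ki: "integrable lborel (\<lambda>s. (\<integral>r. fwd (s, r, c) * F (r, c - r) \<partial>lborel) * q c s)"
      using lborel_pair.integrable_fst[OF integrable_planeI[OF km kfin]] by (simp add: k_def)
    have "(\<integral>s. (\<integral>r. fwd (s, r, c) * F (r, c - r) \<partial>lborel) * q c s \<partial>lborel) = (\<integral>s. \<integral>r. k s r \<partial>lborel \<partial>lborel)"
      by (simp add: k_def)
    also have "\<dots> = (\<integral>r. \<integral>s. k s r \<partial>lborel \<partial>lborel)" by (rule integral_plane_swap(1)[OF km kfin])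
    also have "\<dots> = (\<integral>r. F (r, c - r) * (\<integral>s. fwd (s, r, c) * q c s \<partial>lborel) \<partial>lborel)"
    proof (rule Bochner_Integration.integral_cong[OF refl])
      fix r
      have "(\<lambda>s. k s r) = (\<lambda>s. F (r, c - r) * (fwd (s, r, c) * q c s))" by (auto simp: k_def)
      then show "(\<integral>s. k s r \<partial>lborel) = F (r, c - r) * (\<integral>s. fwd (s, r, c) * q c s \<partial>lborel)"
        by (simp only: integral_mult_right_zero)
    qed
    also have "\<dots> = (\<integral>r. f (r, c - r) - \<Psi>1 c * (fwd (\<tau>, r, 0) * F (r, c - r)) \<partial>lborel)"
      unfolding K2 by (intro Bochner_Integration.integral_cong) (auto simp: f_def algebra_simps)
    also have "\<dots> = (\<integral>r. f (r, c - r) \<partial>lborel) - \<Psi>1 c * cI (\<lambda>r. fwd (\<tau>, r, 0)) F c"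
    proof -
      have "integrable lborel (\<lambda>r. fwd (\<tau>, r, 0) * F (r, c - r))"
        by (rule integrable_char[OF Fm _ _ c]) auto
      then show ?thesis using fic unfolding cI_def
        by (subst Bochner_Integration.integral_diff) (auto simp only: integral_mult_right_zero integrable_mult_right)
    qed
    finally have "(\<integral>s. (\<integral>r. fwd (s, r, c) * F (r, c - r) \<partial>lborel) * q c s \<partial>lborel) = (\<integral>r. f (r, c - r) \<partial>lborel) - \<Psi>1 c * cI (\<lambda>r. fwd (\<tau>, r, 0)) F c" .
    then have "(\<integral>s. h (s, c - s) \<partial>lborel) = a c * (\<Psi>0 c - \<Psi>1 c) + ((\<integral>r. f (r, c - r) \<partial>lborel) - \<Psi>1 c * cI (\<lambda>r. fwd (\<tau>, r, 0)) F c)"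
      unfolding hq using qi ki K1[of c] by (subst Bochner_Integration.integral_add) (auto simp only: integral_mult_right_zero integrable_mult_right)
    then show ?thesis by (simp add: algebra_simps)
  qed
  have i0: "integrable lborel (\<lambda>c. a c * \<Psi>0 c)"
  proof (rule integrable_mult_sqint[OF a bdd_sqint1])
    show "cmod (\<Psi>0 c) \<le> M" for c using PM by (auto simp: \<Psi>0_def)
    show "c \<notin> {0..\<tau> + L} \<Longrightarrow> \<Psi>0 c = 0" for c using \<tau> L by (auto simp: \<Psi>0_def PR)
  qed measurable
  have i1: "integrable lborel (\<lambda>c. \<Psi>1 c * (a c + cI (\<lambda>r. fwd (\<tau>, r, 0)) F c))"
  proof (rule integrable_mult_sqint[OF bdd_sqint1 sqint_mild_line[OF a F(1) Fs]])
    show "cmod (\<Psi>1 c) \<le> M" for c using PM by (auto simp: \<Psi>1_def)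
    show "c \<notin> {\<tau>..\<tau> + L} \<Longrightarrow> \<Psi>1 c = 0" for c by (auto simp: \<Psi>1_def PR)
  qed measurable
  note shf = integral_shear[OF fi]
  have "(\<integral>t. A t \<partial>lborel) = (\<integral>c. \<integral>s. h (s, c - s) \<partial>lborel \<partial>lborel)"
    unfolding Ah by (rule integral_shear(2)[OF hi, symmetric])
  also have "\<dots> = (\<integral>c. a c * \<Psi>0 c - \<Psi>1 c * (a c + cI (\<lambda>r. fwd (\<tau>, r, 0)) F c) + (\<integral>r. f (r, c - r) \<partial>lborel) \<partial>lborel)"
  proof (rule integral_cong_AE)
    show "AE c in lborel. (\<integral>s. h (s, c - s) \<partial>lborel) = a c * \<Psi>0 c - \<Psi>1 c * (a c + cI (\<lambda>r. fwd (\<tau>, r, 0)) F c) + (\<integral>r. f (r, c - r) \<partial>lborel)"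
      using AE_CN_finite[OF F(1) Fs] shf(3) by eventually_elim (rule K3)
    show "(\<lambda>c. \<integral>s. h (s, c - s) \<partial>lborel) \<in> borel_measurable lborel"
      using integral_shear(1)[OF hi] by (rule borel_measurable_integrable)
    show "(\<lambda>c. a c * \<Psi>0 c - \<Psi>1 c * (a c + cI (\<lambda>r. fwd (\<tau>, r, 0)) F c) + (\<integral>r. f (r, c - r) \<partial>lborel)) \<in> borel_measurable lborel"
      using i0 i1 shf(1) by (intro borel_measurable_integrable) auto
  qed
  also have "\<dots> = (\<integral>c. a c * \<Psi>0 c \<partial>lborel) - (\<integral>c. \<Psi>1 c * (a c + cI (\<lambda>r. fwd (\<tau>, r, 0)) F c) \<partial>lborel) + (\<integral>c. \<integral>r. f (r, c - r) \<partial>lborel \<partial>lborel)"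
    using i0 i1 shf(1) by simp
  also have "(\<integral>c. \<integral>r. f (r, c - r) \<partial>lborel \<partial>lborel) = (\<integral>t. B t \<partial>lborel)"
    unfolding Bf by (rule shf(2))
  also have "(\<integral>c. \<Psi>1 c * (a c + cI (\<lambda>r. fwd (\<tau>, r, 0)) F c) \<partial>lborel) = (\<integral>x. indicator {0..L} x *\<^sub>R (mild a F \<tau> x * \<psi> \<tau> x) \<partial>lborel)"
  proof -
    have "(\<integral>c. \<Psi>1 c * (a c + cI (\<lambda>r. fwd (\<tau>, r, 0)) F c) \<partial>lborel)
        = (\<integral>x. \<Psi>1 (x + \<tau>) * (a (x + \<tau>) + cI (\<lambda>r. fwd (\<tau>, r, 0)) F (x + \<tau>)) \<partial>lborel)"
      by (rule integral_shift(1)[symmetric])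
    also have "\<dots> = (\<integral>x. indicator {0..L} x *\<^sub>R (mild a F \<tau> x * \<psi> \<tau> x) \<partial>lborel)"
      unfolding mild_eq using \<tau>
      by (intro Bochner_Integration.integral_cong) (auto simp: \<Psi>1_def PR add.commute mult.commute split: split_indicator)
    finally show ?thesis .
  qed
  \<comment> \<open>Labels up to L give the term of the initial state, larger labels the boundary
    term after the shift c = t + L.\<close>
  also have "(\<integral>c. a c * \<Psi>0 c \<partial>lborel) = (\<integral>x. indicator {0..L} x *\<^sub>R (a x * \<psi> 0 x) \<partial>lborel)
       + (\<integral>t. indicator {0..\<tau>} t *\<^sub>R (a (t + L) * \<psi> t L) \<partial>lborel)"
  proof -
    have j1: "integrable lborel (\<lambda>c. indicator {0..L} c *\<^sub>R (a c * \<Psi>0 c))"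
      by (intro integrable_mult_indicator i0) auto
    have j2: "integrable lborel (\<lambda>c. indicator {L<..} c *\<^sub>R (a c * \<Psi>0 c))"
      by (intro integrable_mult_indicator i0) auto
    have "(\<integral>c. a c * \<Psi>0 c \<partial>lborel) = (\<integral>c. indicator {0..L} c *\<^sub>R (a c * \<Psi>0 c) + indicator {L<..} c *\<^sub>R (a c * \<Psi>0 c) \<partial>lborel)"
      by (intro Bochner_Integration.integral_cong) (auto simp: \<Psi>0_def PR split: split_indicator)
    also have "\<dots> = (\<integral>c. indicator {0..L} c *\<^sub>R (a c * \<Psi>0 c) \<partial>lborel) + (\<integral>c. indicator {L<..} c *\<^sub>R (a c * \<Psi>0 c) \<partial>lborel)"
      using j1 j2 by simp
    also have "(\<integral>c. indicator {0..L} c *\<^sub>R (a c * \<Psi>0 c) \<partial>lborel) = (\<integral>x. indicator {0..L} x *\<^sub>R (a x * \<psi> 0 x) \<partial>lborel)"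
      using \<tau> by (intro Bochner_Integration.integral_cong) (auto simp: \<Psi>0_def PR split: split_indicator)
    also have "(\<integral>c. indicator {L<..} c *\<^sub>R (a c * \<Psi>0 c) \<partial>lborel) = (\<integral>t. indicator {L<..} (t + L) *\<^sub>R (a (t + L) * \<Psi>0 (t + L)) \<partial>lborel)"
      by (rule integral_shift(1)[symmetric])
    also have "\<dots> = (\<integral>t. indicator {0..\<tau>} t *\<^sub>R (a (t + L) * \<psi> t L) \<partial>lborel)"
    proof (rule integral_cong_AE)
      show "AE t in lborel. indicator {L<..} (t + L) *\<^sub>R (a (t + L) * \<Psi>0 (t + L)) = indicator {0..\<tau>} t *\<^sub>R (a (t + L) * \<psi> t L)"
        using AE_lborel_singleton[of 0]
      proof eventually_elim
        case (elim t)
        then show ?case using L by (auto simp: \<Psi>0_def PR split: split_indicator)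
      qed
      show "(\<lambda>t. indicator {L<..} (t + L) *\<^sub>R (a (t + L) * \<Psi>0 (t + L))) \<in> borel_measurable lborel" by measurable
      have "(\<lambda>t. indicator {0..\<tau>} t *\<^sub>R (a (t + L) * \<psi> t L)) = (\<lambda>t. a (t + L) * P (t, L))"
        using L by (auto simp: PR fun_eq_iff split: split_indicator)
      then show "(\<lambda>t. indicator {0..\<tau>} t *\<^sub>R (a (t + L) * \<psi> t L)) \<in> borel_measurable lborel" by simp
    qed
    finally show ?thesis .
  qed
  finally show "(\<integral>t. A t \<partial>lborel) = - (\<integral>x. indicator {0..L} x *\<^sub>R (mild a F \<tau> x * \<psi> \<tau> x) \<partial>lborel)
       + (\<integral>x. indicator {0..L} x *\<^sub>R (a x * \<psi> 0 x) \<partial>lborel)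
       + (\<integral>t. indicator {0..\<tau>} t *\<^sub>R (a (t + L) * \<psi> t L) \<partial>lborel) + (\<integral>t. B t \<partial>lborel)"
    by simp
qed

end

text \<open>On the test side the kernel is integrated over its first argument. The transposed kernel
  makes the estimates for \<open>Gop\<close> available there.\<close>

lemma transport_transpose:
  assumes "transport L g"
  shows "transport L (\<lambda>z. g (snd z, fst z))"
proof -
  interpret transport L g by fact
  have m: "(\<lambda>z. g (snd z, fst z)) \<in> borel_measurable (borel \<Otimes>\<^sub>M borel)" by measurable
  have "sqn lborel (\<lambda>z::real \<times> real. g (snd z, fst z)) = (\<integral>\<^sup>+t. \<integral>\<^sup>+x. (ennreal (cmod (g (x, t))))\<^sup>2 \<partial>lborel \<partial>lborel)"
    unfolding sqn_def by (subst nn_plane) auto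
  also have "\<dots> = (\<integral>\<^sup>+x. \<integral>\<^sup>+t. (ennreal (cmod (g (x, t))))\<^sup>2 \<partial>lborel \<partial>lborel)"
    by (rule nn_swap[of "\<lambda>x t. (ennreal (cmod (g (x, t))))\<^sup>2"]) measurable
  also have "\<dots> = sqn lborel g" unfolding sqn_def by (rule nn_plane[symmetric]) measurable
  finally have "sqint lborel (\<lambda>z::real \<times> real. g (snd z, fst z))"
    using g m unfolding borel_prod by (simp add: sqint_def)
  then show ?thesis using L g0 by unfold_locales auto
qed

section \<open>Linearity of the weak formulation\<close>

context transport
begin

interpretation tr: transport L "\<lambda>z. g (snd z, fst z)"
  by (rule transport_transpose) (rule transport_axioms)

definition testP :: "real \<Rightarrow> (real \<Rightarrow> real \<Rightarrow> complex) \<Rightarrow> real \<times> real \<Rightarrow> complex" where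
  "testP \<tau> \<phi> z = indicator ({0..\<tau>} \<times> {0..L}) z *\<^sub>R cnj (\<phi> (fst z) (snd z))"

definition testQ :: "real \<Rightarrow> (real \<Rightarrow> real \<Rightarrow> complex) \<Rightarrow> (real \<Rightarrow> real \<Rightarrow> complex) \<Rightarrow> real \<times> real \<Rightarrow> complex" where
  "testQ \<tau> \<phi>t \<phi>x z = indicator ({0..\<tau>} \<times> {0..L}) z *\<^sub>R (cnj (\<phi>x (fst z) (snd z)) - cnj (\<phi>t (fst z) (snd z)))"

lemma test_measurable:
  assumes "C1_rect \<tau> L \<phi> \<phi>t \<phi>x"
  shows "testP \<tau> \<phi> \<in> borel_measurable (borel \<Otimes>\<^sub>M borel)" "testQ \<tau> \<phi>t \<phi>x \<in> borel_measurable (borel \<Otimes>\<^sub>M borel)"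
  using C1_rect_measurable[OF C1_rect_cnj[OF assms]] by (simp_all add: testP_def[abs_def] testQ_def[abs_def])

lemma test_bounded:
  assumes C: "C1_rect \<tau> L \<phi> \<phi>t \<phi>x"
  shows "\<exists>M\<ge>0. \<forall>z. cmod (testP \<tau> \<phi> z) \<le> M \<and> cmod (testQ \<tau> \<phi>t \<phi>x z) \<le> M"
proof -
  obtain M where "M \<ge> 0" "\<forall>t\<in>{0..\<tau>}. \<forall>x\<in>{0..L}. cmod (cnj (\<phi> t x)) \<le> M \<and> cmod (cnj (\<phi>x t x) - cnj (\<phi>t t x)) \<le> M"
    using C1_rect_bounded[OF C1_rect_cnj[OF C]] by auto
  then show ?thesis by (intro exI[of _ M]) (auto simp: testP_def testQ_def split: split_indicator)
qed

lemma sqint_bounded_plane: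
  fixes \<tau> :: real
  assumes f: "f \<in> borel_measurable (borel \<Otimes>\<^sub>M borel)" and M: "\<And>z. cmod (f z) \<le> M" and R: "\<And>z. z \<notin> {0..\<tau>} \<times> {0..L} \<Longrightarrow> f z = 0"
  shows "sqint lborel f"
proof -
  have M0: "M \<ge> 0" using M[of undefined] norm_ge_zero order_trans by blast
  have Rind: "sqint lborel (\<lambda>z. indicator ({0..\<tau>} \<times> {0..L}) z)"
    by (intro sqint_indicator emeasure_bounded_finite bounded_Times) (auto simp: borel_closed closed_Times)
  show ?thesis
  proof (rule sqint_mono[OF _ sqint_scale[OF Rind, where c="of_real M"]])
    show "f \<in> borel_measurable lborel" using f unfolding borel_prod by simp
    show "cmod (f z) \<le> cmod (of_real M * indicator ({0..\<tau>} \<times> {0..L}) z)" for z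
      using M[of z] R[of z] M0 by (auto simp: norm_mult split: split_indicator)
  qed
qed

lemma sqint_bounded_line:
  fixes f :: "real \<Rightarrow> complex"
  assumes f: "f \<in> borel_measurable borel" and M: "\<And>z. cmod (f z) \<le> M" and R: "\<And>z. z \<notin> {p..q} \<Longrightarrow> f z = 0"
  shows "sqint lborel f"
proof -
  have M0: "M \<ge> 0" using M[of undefined] norm_ge_zero order_trans by blast
  have Rind: "sqint lborel (\<lambda>z. indicator {p..q} z)"
    by (intro sqint_indicator emeasure_bounded_finite) auto
  show ?thesis
  proof (rule sqint_mono[OF _ sqint_scale[OF Rind, where c="of_real M"]])
    show "f \<in> borel_measurable lborel" using f by simp
    show "cmod (f z) \<le> cmod (of_real M * indicator {p..q} z)" for z
      using M[of z] R[of z] M0 by (auto simp: norm_mult split: split_indicator)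
  qed
qed

lemma sqint_test:
  assumes C: "C1_rect \<tau> L \<phi> \<phi>t \<phi>x"
  shows "sqint lborel (testP \<tau> \<phi>)" "sqint lborel (testQ \<tau> \<phi>t \<phi>x)"
    "sqint lborel (\<lambda>x. testP \<tau> \<phi> (t, x))" "sqint lborel (\<lambda>x. testQ \<tau> \<phi>t \<phi>x (t, x))" "sqint lborel (\<lambda>s. testP \<tau> \<phi> (s, x))"
proof -
  obtain M where M: "\<And>z. cmod (testP \<tau> \<phi> z) \<le> M" "\<And>z. cmod (testQ \<tau> \<phi>t \<phi>x z) \<le> M"
    using test_bounded[OF C] by auto
  note [measurable] = test_measurable[OF C]
  show "sqint lborel (testP \<tau> \<phi>)" "sqint lborel (testQ \<tau> \<phi>t \<phi>x)"
    by (rule sqint_bounded_plane[OF test_measurable(1)[OF C] M(1), where \<tau>=\<tau>], simp add: testP_def)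
      (rule sqint_bounded_plane[OF test_measurable(2)[OF C] M(2), where \<tau>=\<tau>], simp add: testQ_def)
  show "sqint lborel (\<lambda>x. testP \<tau> \<phi> (t, x))"
    by (rule sqint_bounded_line[OF _ M(1), where p=0 and q=L]) (measurable, auto simp: testP_def)
  show "sqint lborel (\<lambda>x. testQ \<tau> \<phi>t \<phi>x (t, x))"
    by (rule sqint_bounded_line[OF _ M(2), where p=0 and q=L]) (measurable, auto simp: testQ_def)
  show "sqint lborel (\<lambda>s. testP \<tau> \<phi> (s, x))"
    by (rule sqint_bounded_line[OF _ M(1), where p=0 and q=\<tau>]) (measurable, auto simp: testP_def)
qed

text \<open>The test side of the weak formulation: \<open>testX\<close> is
  $\overline{-\varphi_t + \varphi_x - \int \overline{g(y,x)}\varphi(t,y)\,dy}$ on the rectangle.\<close>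
definition testX :: "real \<Rightarrow> (real \<Rightarrow> real \<Rightarrow> complex) \<Rightarrow> (real \<Rightarrow> real \<Rightarrow> complex) \<Rightarrow> (real \<Rightarrow> real \<Rightarrow> complex) \<Rightarrow> real \<times> real \<Rightarrow> complex" where
  "testX \<tau> \<phi> \<phi>t \<phi>x z = testQ \<tau> \<phi>t \<phi>x z - tr.Gop (testP \<tau> \<phi>) z"

lemma testX_eq:
  assumes C: "C1_rect \<tau> L \<phi> \<phi>t \<phi>x" and t: "t \<in> {0..\<tau>}" "x \<in> {0..L}"
  shows "cnj (- \<phi>t t x + \<phi>x t x - integral\<^sup>L (lebesgue_on {0..L}) (\<lambda>y. cnj (g (y, x)) * \<phi> t y)) = testX \<tau> \<phi> \<phi>t \<phi>x (t, x)"
proof -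
  note [measurable] = test_measurable[OF C]
  have [measurable]: "cnj \<in> borel_measurable borel" by (intro borel_measurable_continuous_onI continuous_intros)
  have "integral\<^sup>L (lebesgue_on {0..L}) (\<lambda>y. cnj (g (y, x)) * \<phi> t y) = (\<integral>y. indicator {0..L} y *\<^sub>R (cnj (g (y, x) * testP \<tau> \<phi> (t, y))) \<partial>lborel)"
  proof (rule lebesgue_on_integral_eq(1))
    show "(\<lambda>y. cnj (g (y, x) * testP \<tau> \<phi> (t, y))) \<in> borel_measurable borel" by measurable
  qed (use t in \<open>auto simp: testP_def\<close>)
  also have "\<dots> = (\<integral>y. cnj (g (y, x) * testP \<tau> \<phi> (t, y)) \<partial>lborel)"
    using g0 by (intro Bochner_Integration.integral_cong) (auto split: split_indicator)
  also have "\<dots> = cnj (\<integral>y. g (y, x) * testP \<tau> \<phi> (t, y) \<partial>lborel)" by (rule Bochner_Integration.integral_cnj)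
  finally show ?thesis using t by (simp add: testX_def testQ_def tr.Gop_def)
qed

lemma sqint_testX:
  assumes C: "C1_rect \<tau> L \<phi> \<phi>t \<phi>x"
  shows "sqint lborel (testX \<tau> \<phi> \<phi>t \<phi>x)" "sqint lborel (\<lambda>x. testX \<tau> \<phi> \<phi>t \<phi>x (t, x))"
proof -
  note [measurable] = test_measurable[OF C]
  show "sqint lborel (testX \<tau> \<phi> \<phi>t \<phi>x)"
    unfolding testX_def[abs_def] by (intro sqint_diff sqint_test[OF C] tr.sqint_Gop)
  have "sqn lborel (\<lambda>x. tr.Gop (testP \<tau> \<phi>) (t, x)) \<le> sqn lborel (\<lambda>z. g (snd z, fst z)) * sqn lborel (\<lambda>y. testP \<tau> \<phi> (t, y))"
    by (rule tr.Gop_section_le) measurable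
  also have "\<dots> < top" using tr.g sqint_test(3)[OF C, of t] by (simp add: sqint_def ennreal_mult_less_top)
  finally have "sqint lborel (\<lambda>x. tr.Gop (testP \<tau> \<phi>) (t, x))" by (simp add: sqint_def)
  then show "sqint lborel (\<lambda>x. testX \<tau> \<phi> \<phi>t \<phi>x (t, x))"
    unfolding testX_def by (intro sqint_diff sqint_test(4)[OF C])
qed

text \<open>Splitting the double integral of a sum requires integrability in x at each time and then
  in t. The joint version supplies it, as a product of two square integrable functions of the
  plane.\<close>

lemma weak_term_integrable:
  assumes C: "C1_rect \<tau> L \<phi> \<phi>t \<phi>x" and u: "C0_L2 L T u" and \<tau>: "0 \<le> \<tau>" "\<tau> \<le> T"
  shows "t \<in> {0..\<tau>} \<Longrightarrow> integrable (lebesgue_on {0..L}) (\<lambda>x. u t x * cnj (- \<phi>t t x + \<phi>x t x - integral\<^sup>L (lebesgue_on {0..L}) (\<lambda>y. cnj (g (y, x)) * \<phi> t y)))"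
    and "integrable (lebesgue_on {0..\<tau>}) (\<lambda>t. integral\<^sup>L (lebesgue_on {0..L}) (\<lambda>x. u t x * cnj (- \<phi>t t x + \<phi>x t x - integral\<^sup>L (lebesgue_on {0..L}) (\<lambda>y. cnj (g (y, x)) * \<phi> t y))))"
proof -
  obtain v where v: "joint_version L T u v" using joint_version_exists[OF _ u] \<tau> by auto
  note [measurable] = test_measurable[OF C]
  have vm[measurable]: "v \<in> borel_measurable (borel \<Otimes>\<^sub>M borel)" using v by (simp add: joint_version_def)
  have Xm[measurable]: "testX \<tau> \<phi> \<phi>t \<phi>x \<in> borel_measurable (borel \<Otimes>\<^sub>M borel)"
    using sqint_testX(1)[OF C] by measurable
  have v0: "x \<notin> {0..L} \<Longrightarrow> v (t, x) = 0" for t x using v by (auto simp: joint_version_def)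
  have ae: "AE x in lborel. x \<in> {0..L} \<longrightarrow> u t x * cnj (- \<phi>t t x + \<phi>x t x - integral\<^sup>L (lebesgue_on {0..L}) (\<lambda>y. cnj (g (y, x)) * \<phi> t y))
      = v (t, x) * testX \<tau> \<phi> \<phi>t \<phi>x (t, x)" if t: "t \<in> {0..\<tau>}" for t
  proof -
    have "AE x in lborel. x \<in> {0..L} \<longrightarrow> u t x = v (t, x)"
      using v t \<tau> by (auto simp: joint_version_def version_def)
    then show ?thesis by eventually_elim (use testX_eq[OF C t] in simp)
  qed
  have vt: "sqint lborel (\<lambda>x. v (t, x))" if "t \<in> {0..\<tau>}" for t
    using v that \<tau> by (auto simp: joint_version_def version_def)
  have ind: "(\<lambda>x. indicator {0..L} x *\<^sub>R (v (t, x) * testX \<tau> \<phi> \<phi>t \<phi>x (t, x))) = (\<lambda>x. v (t, x) * testX \<tau> \<phi> \<phi>t \<phi>x (t, x))" for t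
    using v0 by (auto simp: fun_eq_iff split: split_indicator)
  show "integrable (lebesgue_on {0..L}) (\<lambda>x. u t x * cnj (- \<phi>t t x + \<phi>x t x - integral\<^sup>L (lebesgue_on {0..L}) (\<lambda>y. cnj (g (y, x)) * \<phi> t y)))"
    if t: "t \<in> {0..\<tau>}"
  proof -
    have "integrable lborel (\<lambda>x. indicator {0..L} x *\<^sub>R (v (t, x) * testX \<tau> \<phi> \<phi>t \<phi>x (t, x)))"
      unfolding ind by (rule integrable_mult_sqint[OF vt[OF t] sqint_testX(2)[OF C]])
    then show ?thesis by (subst lebesgue_on_integral_eq(2)[OF _ _ ae[OF t]]) auto
  qed
  have mid: "integral\<^sup>L (lebesgue_on {0..L}) (\<lambda>x. u t x * cnj (- \<phi>t t x + \<phi>x t x - integral\<^sup>L (lebesgue_on {0..L}) (\<lambda>y. cnj (g (y, x)) * \<phi> t y)))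
      = (\<integral>x. v (t, x) * testX \<tau> \<phi> \<phi>t \<phi>x (t, x) \<partial>lborel)" if t: "t \<in> {0..\<tau>}" for t
    using lebesgue_on_integral_eq(1)[OF _ _ ae[OF t]] unfolding ind by auto
  have "integrable lborel (\<lambda>z. v z * testX \<tau> \<phi> \<phi>t \<phi>x z)"
    using \<tau> by (intro integrable_mult_sqint joint_version_sqint[OF _ v u] sqint_testX[OF C]) auto
  then have "integrable (lborel \<Otimes>\<^sub>M lborel) (case_prod (\<lambda>t x. v (t, x) * testX \<tau> \<phi> \<phi>t \<phi>x (t, x)))"
    unfolding lborel_prod by (simp add: case_prod_unfold)
  from lborel_pair.integrable_fst[OF this]
  have "integrable lborel (\<lambda>t. indicator {0..\<tau>} t *\<^sub>R (\<integral>x. v (t, x) * testX \<tau> \<phi> \<phi>t \<phi>x (t, x) \<partial>lborel))"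
    by (intro integrable_mult_indicator) auto
  then show "integrable (lebesgue_on {0..\<tau>}) (\<lambda>t. integral\<^sup>L (lebesgue_on {0..L}) (\<lambda>x. u t x * cnj (- \<phi>t t x + \<phi>x t x - integral\<^sup>L (lebesgue_on {0..L}) (\<lambda>y. cnj (g (y, x)) * \<phi> t y))))"
    by (subst lebesgue_on_integral_eq(2)[where f'="\<lambda>t. \<integral>x. v (t, x) * testX \<tau> \<phi> \<phi>t \<phi>x (t, x) \<partial>lborel"]) (use mid in auto)
qed

lemma L2_on_test_integrable:
  assumes C: "C1_rect \<tau> L \<phi> \<phi>t \<phi>x" and \<tau>: "0 \<le> \<tau>" "\<tau> \<le> T"
  shows "t \<in> {0..\<tau>} \<Longrightarrow> L2_on {0..L} f \<Longrightarrow> integrable (lebesgue_on {0..L}) (\<lambda>x. f x * cnj (\<phi> t x))"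
    and "L2_on {0..T} U \<Longrightarrow> integrable (lebesgue_on {0..\<tau>}) (\<lambda>t. U t * cnj (\<phi> t L))"
proof -
  note [measurable] = test_measurable[OF C]
  show "integrable (lebesgue_on {0..L}) (\<lambda>x. f x * cnj (\<phi> t x))" if t: "t \<in> {0..\<tau>}" and f: "L2_on {0..L} f"
  proof -
    obtain f' where f': "version {0..L} f f'" using f L2_on_version_iff[of "{0..L}" f] by auto
    then have [measurable]: "f' \<in> borel_measurable borel" by (simp add: version_def sqint_def)
    have "AE x in lborel. x \<in> {0..L} \<longrightarrow> f x = f' x" using f' by (simp add: version_def)
    then have ae: "AE x in lborel. x \<in> {0..L} \<longrightarrow> f x * cnj (\<phi> t x) = f' x * testP \<tau> \<phi> (t, x)"
      by eventually_elim (use t in \<open>auto simp: testP_def\<close>)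
    have "integrable lborel (\<lambda>x. f' x * testP \<tau> \<phi> (t, x))"
      using f' by (intro integrable_mult_sqint sqint_test(3)[OF C]) (simp add: version_def)
    then have "integrable lborel (\<lambda>x. indicator {0..L} x *\<^sub>R (f' x * testP \<tau> \<phi> (t, x)))"
      by (intro integrable_mult_indicator) auto
    then show ?thesis by (subst lebesgue_on_integral_eq(2)[OF _ _ ae]) auto
  qed
  show "integrable (lebesgue_on {0..\<tau>}) (\<lambda>t. U t * cnj (\<phi> t L))" if U: "L2_on {0..T} U"
  proof -
    obtain U' where U': "version {0..T} U U'" using U L2_on_version_iff[of "{0..T}" U] by auto
    then have [measurable]: "U' \<in> borel_measurable borel" by (simp add: version_def sqint_def)
    have "AE t in lborel. t \<in> {0..T} \<longrightarrow> U t = U' t" using U' by (simp add: version_def)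
    then have ae: "AE t in lborel. t \<in> {0..\<tau>} \<longrightarrow> U t * cnj (\<phi> t L) = U' t * testP \<tau> \<phi> (t, L)"
      by eventually_elim (use L \<tau> in \<open>auto simp: testP_def\<close>)
    have "integrable lborel (\<lambda>t. U' t * testP \<tau> \<phi> (t, L))"
      using U' by (intro integrable_mult_sqint sqint_test(5)[OF C]) (simp add: version_def)
    then have "integrable lborel (\<lambda>t. indicator {0..\<tau>} t *\<^sub>R (U' t * testP \<tau> \<phi> (t, L)))"
      by (intro integrable_mult_indicator) auto
    then show ?thesis by (subst lebesgue_on_integral_eq(2)[OF _ _ ae]) auto
  qed
qed

lemma C0_L2_lin:
  assumes u: "C0_L2 L T u" and w: "C0_L2 L T w"
  shows "C0_L2 L T (\<lambda>t x. u t x + r *\<^sub>R w t x)"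
proof -
  have "\<exists>f. \<forall>t\<in>{0..T}. version {0..L} (u t) (f t)" "\<exists>f. \<forall>t\<in>{0..T}. version {0..L} (w t) (f t)"
    using u w L2_on_version_iff[of "{0..L}"] by (auto simp: C0_L2_def intro!: bchoice)
  then obtain u' w' where "\<forall>t\<in>{0..T}. version {0..L} (u t) (u' t)" "\<forall>t\<in>{0..T}. version {0..L} (w t) (w' t)"
    by blast
  then have u': "\<And>t. t \<in> {0..T} \<Longrightarrow> version {0..L} (u t) (u' t)" and w': "\<And>t. t \<in> {0..T} \<Longrightarrow> version {0..L} (w t) (w' t)"
    by blast+
  have v: "version {0..L} (\<lambda>x. u t x + r *\<^sub>R w t x) (\<lambda>x. u' t x + of_real r * w' t x)" if "t \<in> {0..T}" for t
    using version_add[OF u'[OF that] version_scale[OF w'[OF that], of "of_real r"]] by (simp add: scaleR_conv_of_real)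
  have c: "continuous_on {0..T} (\<lambda>t. abs_l2 (u' t))" "continuous_on {0..T} (\<lambda>t. abs_l2 (w' t))"
    using C0_L2_iff_continuous[of T L u u'] C0_L2_iff_continuous[of T L w w'] u' w' u w by auto
  have "continuous_on {0..T} (\<lambda>t. abs_l2 (u' t) + r *\<^sub>R abs_l2 (w' t))" by (intro continuous_intros c)
  moreover have "abs_l2 (u' t) + r *\<^sub>R abs_l2 (w' t) = abs_l2 (\<lambda>x. u' t x + of_real r * w' t x)" if "t \<in> {0..T}" for t
    using u'[OF that] w'[OF that] by (simp add: version_def abs_l2_scaleR abs_l2_add sqint_scale)
  ultimately have "continuous_on {0..T} (\<lambda>t. abs_l2 (\<lambda>x. u' t x + of_real r * w' t x))"
    by (rule continuous_on_eq)
  then show ?thesis using C0_L2_iff_continuous[of T L "\<lambda>t x. u t x + r *\<^sub>R w t x" "\<lambda>t x. u' t x + of_real r * w' t x"] v by blast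
qed

text \<open>The factor r covers the two combinations that occur: a sum of trajectories in the
  passage to controllability, a difference in the uniqueness of the closed loop.\<close>

lemma weak_sol_lin:
  assumes T: "T \<ge> 0"
    and u: "weak_sol L (\<lambda>x y. g (x, y)) T u0 U u" "L2_on {0..L} u0" "L2_on {0..T} U"
    and w: "weak_sol L (\<lambda>x y. g (x, y)) T w0 W w" "L2_on {0..L} w0" "L2_on {0..T} W"
  shows "weak_sol L (\<lambda>x y. g (x, y)) T (\<lambda>x. u0 x + r *\<^sub>R w0 x) (\<lambda>t. U t + r *\<^sub>R W t) (\<lambda>t x. u t x + r *\<^sub>R w t x)"
  unfolding weak_sol_def
proof (intro conjI ballI allI impI)
  have uC: "C0_L2 L T u" and wC: "C0_L2 L T w" using u w by (auto simp: weak_sol_def)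
  then show "C0_L2 L T (\<lambda>t x. u t x + r *\<^sub>R w t x)" by (rule C0_L2_lin)
  fix \<tau> \<phi> \<phi>t \<phi>x assume \<tau>: "\<tau> \<in> {0..T}" and H: "C1_rect \<tau> L \<phi> \<phi>t \<phi>x \<and> (\<forall>t\<in>{0..\<tau>}. \<phi> t 0 = 0)"
  then have C: "C1_rect \<tau> L \<phi> \<phi>t \<phi>x" and \<tau>': "0 \<le> \<tau>" "\<tau> \<le> T" by auto
  define X where "X t x = cnj (- \<phi>t t x + \<phi>x t x - integral\<^sup>L (lebesgue_on {0..L}) (\<lambda>y. cnj (g (y, x)) * \<phi> t y))" for t x
  note iu = weak_term_integrable[OF C uC \<tau>', folded X_def] and iw = weak_term_integrable[OF C wC \<tau>', folded X_def]
  have t1: "integral\<^sup>L (lebesgue_on {0..\<tau>}) (\<lambda>t. integral\<^sup>L (lebesgue_on {0..L}) (\<lambda>x. (u t x + r *\<^sub>R w t x) * X t x))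
      = integral\<^sup>L (lebesgue_on {0..\<tau>}) (\<lambda>t. integral\<^sup>L (lebesgue_on {0..L}) (\<lambda>x. u t x * X t x))
        + r *\<^sub>R integral\<^sup>L (lebesgue_on {0..\<tau>}) (\<lambda>t. integral\<^sup>L (lebesgue_on {0..L}) (\<lambda>x. w t x * X t x))"
  proof -
    have "integral\<^sup>L (lebesgue_on {0..\<tau>}) (\<lambda>t. integral\<^sup>L (lebesgue_on {0..L}) (\<lambda>x. (u t x + r *\<^sub>R w t x) * X t x))
        = integral\<^sup>L (lebesgue_on {0..\<tau>}) (\<lambda>t. integral\<^sup>L (lebesgue_on {0..L}) (\<lambda>x. u t x * X t x) + r *\<^sub>R integral\<^sup>L (lebesgue_on {0..L}) (\<lambda>x. w t x * X t x))"
    proof (rule Bochner_Integration.integral_cong[OF refl])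
      fix t assume "t \<in> space (lebesgue_on {0..\<tau>})"
      then have t: "t \<in> {0..\<tau>}" by simp
      show "integral\<^sup>L (lebesgue_on {0..L}) (\<lambda>x. (u t x + r *\<^sub>R w t x) * X t x)
          = integral\<^sup>L (lebesgue_on {0..L}) (\<lambda>x. u t x * X t x) + r *\<^sub>R integral\<^sup>L (lebesgue_on {0..L}) (\<lambda>x. w t x * X t x)"
        using iu(1)[OF t] iw(1)[OF t] by (simp add: distrib_right)
    qed
    also have "\<dots> = integral\<^sup>L (lebesgue_on {0..\<tau>}) (\<lambda>t. integral\<^sup>L (lebesgue_on {0..L}) (\<lambda>x. u t x * X t x))
        + r *\<^sub>R integral\<^sup>L (lebesgue_on {0..\<tau>}) (\<lambda>t. integral\<^sup>L (lebesgue_on {0..L}) (\<lambda>x. w t x * X t x))"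
      using iu(2) iw(2) by simp
    finally show ?thesis .
  qed
  have t2: "integral\<^sup>L (lebesgue_on {0..L}) (\<lambda>x. (f x + r *\<^sub>R h x) * cnj (\<phi> t x))
      = integral\<^sup>L (lebesgue_on {0..L}) (\<lambda>x. f x * cnj (\<phi> t x)) + r *\<^sub>R integral\<^sup>L (lebesgue_on {0..L}) (\<lambda>x. h x * cnj (\<phi> t x))"
    if "L2_on {0..L} f" "L2_on {0..L} h" "t \<in> {0..\<tau>}" for f h t
    using L2_on_test_integrable(1)[OF C \<tau>' that(3)] that by (simp add: distrib_right)
  have t4: "integral\<^sup>L (lebesgue_on {0..\<tau>}) (\<lambda>t. (U t + r *\<^sub>R W t) * cnj (\<phi> t L))
      = integral\<^sup>L (lebesgue_on {0..\<tau>}) (\<lambda>t. U t * cnj (\<phi> t L)) + r *\<^sub>R integral\<^sup>L (lebesgue_on {0..\<tau>}) (\<lambda>t. W t * cnj (\<phi> t L))"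
    using L2_on_test_integrable(2)[OF C \<tau>'] u w by (simp add: distrib_right)
  have Lu: "L2_on {0..L} (u \<tau>)" "L2_on {0..L} (w \<tau>)" using uC wC \<tau> by (auto simp: C0_L2_def)
  have e1: "integral\<^sup>L (lebesgue_on {0..\<tau>}) (\<lambda>t. integral\<^sup>L (lebesgue_on {0..L}) (\<lambda>x. u t x * X t x))
       + integral\<^sup>L (lebesgue_on {0..L}) (\<lambda>x. u \<tau> x * cnj (\<phi> \<tau> x))
       - integral\<^sup>L (lebesgue_on {0..L}) (\<lambda>x. u0 x * cnj (\<phi> 0 x))
       - integral\<^sup>L (lebesgue_on {0..\<tau>}) (\<lambda>t. U t * cnj (\<phi> t L)) = 0"
    using u(1) \<tau> H unfolding weak_sol_def X_def by blast
  have e2: "integral\<^sup>L (lebesgue_on {0..\<tau>}) (\<lambda>t. integral\<^sup>L (lebesgue_on {0..L}) (\<lambda>x. w t x * X t x))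
       + integral\<^sup>L (lebesgue_on {0..L}) (\<lambda>x. w \<tau> x * cnj (\<phi> \<tau> x))
       - integral\<^sup>L (lebesgue_on {0..L}) (\<lambda>x. w0 x * cnj (\<phi> 0 x))
       - integral\<^sup>L (lebesgue_on {0..\<tau>}) (\<lambda>t. W t * cnj (\<phi> t L)) = 0"
    using w(1) \<tau> H unfolding weak_sol_def X_def by blast
  have alg: "A + B - C - D = 0 \<Longrightarrow> A' + B' - C' - D' = 0 \<Longrightarrow>
      (A + r *\<^sub>R A') + (B + r *\<^sub>R B') - (C + r *\<^sub>R C') - (D + r *\<^sub>R D') = 0" for A B C D A' B' C' D' :: complex
  proof -
    assume a: "A + B - C - D = 0" "A' + B' - C' - D' = 0"
    have "(A + r *\<^sub>R A') + (B + r *\<^sub>R B') - (C + r *\<^sub>R C') - (D + r *\<^sub>R D') = (A + B - C - D) + r *\<^sub>R (A' + B' - C' - D')"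
      by (simp add: algebra_simps)
    then show ?thesis using a by simp
  qed
  have 0: "0 \<in> {0..\<tau>}" "\<tau> \<in> {0..\<tau>}" using \<tau>' by auto
  show "integral\<^sup>L (lebesgue_on {0..\<tau>}) (\<lambda>t. integral\<^sup>L (lebesgue_on {0..L}) (\<lambda>x. (u t x + r *\<^sub>R w t x) *
          cnj (- \<phi>t t x + \<phi>x t x - integral\<^sup>L (lebesgue_on {0..L}) (\<lambda>y. cnj (g (y, x)) * \<phi> t y))))
       + integral\<^sup>L (lebesgue_on {0..L}) (\<lambda>x. (u \<tau> x + r *\<^sub>R w \<tau> x) * cnj (\<phi> \<tau> x))
       - integral\<^sup>L (lebesgue_on {0..L}) (\<lambda>x. (u0 x + r *\<^sub>R w0 x) * cnj (\<phi> 0 x))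
       - integral\<^sup>L (lebesgue_on {0..\<tau>}) (\<lambda>t. (U t + r *\<^sub>R W t) * cnj (\<phi> t L)) = 0"
    unfolding X_def[symmetric] t1 t2[OF Lu 0(2)] t2[OF u(2) w(2) 0(1)] t4 by (rule alg[OF e1 e2])
qed

text \<open>The converse of \<open>weak_sol_mild\<close>. \<open>transport_identity\<close> is
  applied to the conjugated test function; its source term \<open>B\<close> cancels the integral
  term once the kernel has been transposed. The control is read off from the labels above L.\<close>

lemma mild_weak_sol:
  assumes a: "sqint lborel a" and F: "sqint lborel F" "quad F" and eq: "AE z in lborel. F z = Gop (traj fwd a F) z"
  shows "weak_sol L (\<lambda>x y. g (x, y)) L a (\<lambda>t. a (t + L)) (mild a F)"
  unfolding weak_sol_def
proof (intro conjI ballI allI impI)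
  note Fs = quad_strip[OF F(2)]
  show "C0_L2 L L (mild a F)" by (rule C0_L2_mild[OF a F(1) Fs])
  fix \<tau> \<phi> \<phi>t \<phi>x assume \<tau>: "\<tau> \<in> {0..L}" and H: "C1_rect \<tau> L \<phi> \<phi>t \<phi>x \<and> (\<forall>t\<in>{0..\<tau>}. \<phi> t 0 = 0)"
  then have C: "C1_rect \<tau> L \<phi> \<phi>t \<phi>x" and \<tau>': "0 \<le> \<tau>" "\<tau> \<le> L" by auto
  note C' = C1_rect_cnj[OF C]
  note [measurable] = test_measurable[OF C]
  have am[measurable]: "a \<in> borel_measurable borel" using a by (simp add: sqint_def)
  have Fm[measurable]: "F \<in> borel_measurable (borel \<Otimes>\<^sub>M borel)" using F by measurable
  have ms: "sqint lborel (mild a F t)" for t by (rule sqint_mild[OF a F(1) Fs])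
  have mm[measurable]: "mild a F t \<in> borel_measurable borel" for t using ms[of t] by (simp add: sqint_def)
  have trm[measurable]: "traj fwd a F \<in> borel_measurable (borel \<Otimes>\<^sub>M borel)"
    using sqint_traj(1)[OF bweight_fwd F(1) Fs a] by measurable
  obtain M where M: "M \<ge> 0" "\<And>z. cmod (testP \<tau> \<phi> z) \<le> M" using test_bounded[OF C] by auto
  define A where "A t = indicator {0<..<\<tau>} t *\<^sub>R (\<integral>x. indicator {0..L} x *\<^sub>R (mild a F t x * (cnj (\<phi>x t x) - cnj (\<phi>t t x))) \<partial>lborel)" for t
  define B where "B t = indicator {0<..<\<tau>} t *\<^sub>R (\<integral>y. F (t, y) * (indicator {0..L} y *\<^sub>R cnj (\<phi> t y)) \<partial>lborel)" for t
  have id: "integrable lborel A" "integrable lborel B"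
    "(\<integral>t. A t \<partial>lborel) = - (\<integral>x. indicator {0..L} x *\<^sub>R (mild a F \<tau> x * cnj (\<phi> \<tau> x)) \<partial>lborel)
       + (\<integral>x. indicator {0..L} x *\<^sub>R (a x * cnj (\<phi> 0 x)) \<partial>lborel)
       + (\<integral>t. indicator {0..\<tau>} t *\<^sub>R (a (t + L) * cnj (\<phi> t L)) \<partial>lborel) + (\<integral>t. B t \<partial>lborel)"
    unfolding A_def[abs_def] B_def[abs_def] using transport_identity[OF \<tau>' C' _ a F] H by auto
  have inner: "AE t in lborel. t \<in> {0..\<tau>} \<longrightarrow> integral\<^sup>L (lebesgue_on {0..L}) (\<lambda>x. mild a F t x * cnj (- \<phi>t t x + \<phi>x t x
      - integral\<^sup>L (lebesgue_on {0..L}) (\<lambda>y. cnj (g (y, x)) * \<phi> t y))) = A t - B t"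
    using AE_plane_fst[OF eq] AE_lborel_singleton[of 0] AE_lborel_singleton[of \<tau>]
  proof eventually_elim
    case (elim t)
    show ?case
    proof
      assume "t \<in> {0..\<tau>}"
      with elim have t: "0 < t" "t < \<tau>" "t \<in> {0..\<tau>}" by auto
      define w where "w x = indicator {0..L} x * mild a F t x" for x
      have ws: "sqint lborel w" using version_mild[OF a F(1) Fs, of t] by (simp add: version_def w_def[abs_def])
      have [measurable]: "w \<in> borel_measurable borel" using ws by (simp add: sqint_def)
      have "integral\<^sup>L (lebesgue_on {0..L}) (\<lambda>x. mild a F t x * cnj (- \<phi>t t x + \<phi>x t x
          - integral\<^sup>L (lebesgue_on {0..L}) (\<lambda>y. cnj (g (y, x)) * \<phi> t y)))
        = (\<integral>x. indicator {0..L} x *\<^sub>R (mild a F t x * testX \<tau> \<phi> \<phi>t \<phi>x (t, x)) \<partial>lborel)"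
      proof (rule lebesgue_on_integral_eq(1))
        show "(\<lambda>x. mild a F t x * testX \<tau> \<phi> \<phi>t \<phi>x (t, x)) \<in> borel_measurable borel"
          using sqint_testX(2)[OF C, of t] by (auto simp: sqint_def)
      qed (use testX_eq[OF C t(3)] in auto)
      also have "\<dots> = (\<integral>x. w x * testQ \<tau> \<phi>t \<phi>x (t, x) - w x * (\<integral>y. g (y, x) * testP \<tau> \<phi> (t, y) \<partial>lborel) \<partial>lborel)"
        by (intro Bochner_Integration.integral_cong) (auto simp: w_def testX_def tr.Gop_def right_diff_distrib split: split_indicator)
      also have "\<dots> = (\<integral>x. w x * testQ \<tau> \<phi>t \<phi>x (t, x) \<partial>lborel) - (\<integral>x. w x * (\<integral>y. g (y, x) * testP \<tau> \<phi> (t, y) \<partial>lborel) \<partial>lborel)"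
        using integrable_mult_sqint[OF ws sqint_test(4)[OF C]] integral_g_swap(2)[OF ws _ M(2)]
        by (intro Bochner_Integration.integral_diff) auto
      also have "(\<integral>x. w x * testQ \<tau> \<phi>t \<phi>x (t, x) \<partial>lborel) = A t"
        using t by (auto intro!: Bochner_Integration.integral_cong simp: A_def w_def testQ_def split: split_indicator)
      also have "(\<integral>x. w x * (\<integral>y. g (y, x) * testP \<tau> \<phi> (t, y) \<partial>lborel) \<partial>lborel) = (\<integral>y. (\<integral>x. g (y, x) * w x \<partial>lborel) * testP \<tau> \<phi> (t, y) \<partial>lborel)"
        by (rule integral_g_swap(1)[OF ws _ M(2)]) measurable
      also have "\<dots> = (\<integral>y. F (t, y) * testP \<tau> \<phi> (t, y) \<partial>lborel)"
      proof (rule integral_cong_AE)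
        have "(\<integral>x. g (y, x) * w x \<partial>lborel) = Gop (traj fwd a F) (t, y)" for y
          unfolding Gop_def using t \<tau>' g0
          by (auto intro!: Bochner_Integration.integral_cong simp: w_def traj_def mild_def split: split_indicator)
        then show "AE y in lborel. (\<integral>x. g (y, x) * w x \<partial>lborel) * testP \<tau> \<phi> (t, y) = F (t, y) * testP \<tau> \<phi> (t, y)"
          using elim(1) by auto
      qed measurable
      also have "\<dots> = B t"
        using t by (auto intro!: Bochner_Integration.integral_cong simp: B_def testP_def split: split_indicator)
      finally show "integral\<^sup>L (lebesgue_on {0..L}) (\<lambda>x. mild a F t x * cnj (- \<phi>t t x + \<phi>x t x
          - integral\<^sup>L (lebesgue_on {0..L}) (\<lambda>y. cnj (g (y, x)) * \<phi> t y))) = A t - B t" .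
    qed
  qed
  have "integral\<^sup>L (lebesgue_on {0..\<tau>}) (\<lambda>t. integral\<^sup>L (lebesgue_on {0..L}) (\<lambda>x. mild a F t x * cnj (- \<phi>t t x + \<phi>x t x
      - integral\<^sup>L (lebesgue_on {0..L}) (\<lambda>y. cnj (g (y, x)) * \<phi> t y)))) = (\<integral>t. indicator {0..\<tau>} t *\<^sub>R (A t - B t) \<partial>lborel)"
    using id(1,2) by (intro lebesgue_on_integral_eq(1)[OF _ _ inner]) auto
  also have "\<dots> = (\<integral>t. A t - B t \<partial>lborel)"
    by (intro Bochner_Integration.integral_cong) (auto simp: A_def B_def split: split_indicator)
  also have "\<dots> = (\<integral>t. A t \<partial>lborel) - (\<integral>t. B t \<partial>lborel)" using id(1,2) by simp
  finally have T1: "integral\<^sup>L (lebesgue_on {0..\<tau>}) (\<lambda>t. integral\<^sup>L (lebesgue_on {0..L}) (\<lambda>x. mild a F t x * cnj (- \<phi>t t x + \<phi>x t x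
      - integral\<^sup>L (lebesgue_on {0..L}) (\<lambda>y. cnj (g (y, x)) * \<phi> t y)))) = (\<integral>t. A t \<partial>lborel) - (\<integral>t. B t \<partial>lborel)" .
  have sect: "integral\<^sup>L (lebesgue_on {0..L}) (\<lambda>x. f x * cnj (\<phi> t x)) = (\<integral>x. indicator {0..L} x *\<^sub>R (f x * cnj (\<phi> t x)) \<partial>lborel)"
    if "t \<in> {0..\<tau>}" and [measurable]: "f \<in> borel_measurable borel" for f t
  proof -
    have "integral\<^sup>L (lebesgue_on {0..L}) (\<lambda>x. f x * cnj (\<phi> t x)) = (\<integral>x. indicator {0..L} x *\<^sub>R (f x * testP \<tau> \<phi> (t, x)) \<partial>lborel)"
    proof (rule lebesgue_on_integral_eq(1))
      show "(\<lambda>x. f x * testP \<tau> \<phi> (t, x)) \<in> borel_measurable borel" by measurable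
    qed (use that in \<open>auto simp: testP_def\<close>)
    also have "\<dots> = (\<integral>x. indicator {0..L} x *\<^sub>R (f x * cnj (\<phi> t x)) \<partial>lborel)"
      using that by (intro Bochner_Integration.integral_cong) (auto simp: testP_def split: split_indicator)
    finally show ?thesis .
  qed
  have T4: "integral\<^sup>L (lebesgue_on {0..\<tau>}) (\<lambda>t. a (t + L) * cnj (\<phi> t L)) = (\<integral>t. indicator {0..\<tau>} t *\<^sub>R (a (t + L) * cnj (\<phi> t L)) \<partial>lborel)"
  proof -
    have "integral\<^sup>L (lebesgue_on {0..\<tau>}) (\<lambda>t. a (t + L) * cnj (\<phi> t L)) = (\<integral>t. indicator {0..\<tau>} t *\<^sub>R (a (t + L) * testP \<tau> \<phi> (t, L)) \<partial>lborel)"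
    proof (rule lebesgue_on_integral_eq(1))
      show "(\<lambda>t. a (t + L) * testP \<tau> \<phi> (t, L)) \<in> borel_measurable borel" by measurable
    qed (use L in \<open>auto simp: testP_def\<close>)
    also have "\<dots> = (\<integral>t. indicator {0..\<tau>} t *\<^sub>R (a (t + L) * cnj (\<phi> t L)) \<partial>lborel)"
      using L by (intro Bochner_Integration.integral_cong) (auto simp: testP_def split: split_indicator)
    finally show ?thesis .
  qed
  have 0: "0 \<in> {0..\<tau>}" "\<tau> \<in> {0..\<tau>}" using \<tau>' by auto
  show "integral\<^sup>L (lebesgue_on {0..\<tau>}) (\<lambda>t. integral\<^sup>L (lebesgue_on {0..L}) (\<lambda>x. mild a F t x * cnj (- \<phi>t t x + \<phi>x t x
      - integral\<^sup>L (lebesgue_on {0..L}) (\<lambda>y. cnj (g (y, x)) * \<phi> t y))))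
    + integral\<^sup>L (lebesgue_on {0..L}) (\<lambda>x. mild a F \<tau> x * cnj (\<phi> \<tau> x))
    - integral\<^sup>L (lebesgue_on {0..L}) (\<lambda>x. a x * cnj (\<phi> 0 x))
    - integral\<^sup>L (lebesgue_on {0..\<tau>}) (\<lambda>t. a (t + L) * cnj (\<phi> t L)) = 0"
    unfolding T1 T4 sect[OF 0(2) mm] sect[OF 0(1) am] id(3) by simp
qed

end

section \<open>Finite time stabilizability implies exact controllability\<close>

lemma L2_on_add:
  assumes S: "S \<in> sets borel" and "L2_on S f" "L2_on S h"
  shows "L2_on S (\<lambda>x. f x + h x)"
  using assms version_add unfolding L2_on_version_iff[OF S] by blast

lemma L2_on_diff:
  assumes S: "S \<in> sets borel" and "L2_on S f" "L2_on S h"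
  shows "L2_on S (\<lambda>x. f x - h x)"
  using assms version_diff unfolding L2_on_version_iff[OF S] by blast

lemma L2_on_scale:
  assumes S: "S \<in> sets borel" and "L2_on S f"
  shows "L2_on S (\<lambda>x. c * f x)"
  using assms version_scale unfolding L2_on_version_iff[OF S] by blast

lemma continuous_L2_on:
  fixes f :: "real \<Rightarrow> complex"
  assumes f: "continuous_on {0..T} f"
  shows "L2_on {0..T} f"
proof -
  define f' where "f' x = indicator {0..T} x *\<^sub>R f x" for x
  have m: "f' \<in> borel_measurable borel"
    unfolding f'_def[abs_def] by (rule borel_measurable_continuous_on_indicator[OF _ f]) simp
  have "bounded (f ` {0..T})" by (intro compact_imp_bounded compact_continuous_image[OF f]) simp
  then obtain M where M: "\<forall>y\<in>f ` {0..T}. cmod y \<le> M" unfolding bounded_iff by blast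
  have "cmod (f' x) \<le> max M 0" for x using M by (auto simp: f'_def le_max_iff_disj split: split_indicator)
  then have "sqint lborel f'"
  proof -
    assume b: "\<And>x. cmod (f' x) \<le> max M 0"
    have i: "sqint lborel (\<lambda>x. indicator {0..T} x)"
      by (intro sqint_indicator emeasure_bounded_finite) auto
    show ?thesis
    proof (rule sqint_mono[OF _ sqint_scale[OF i, where c="of_real (max M 0)"]])
      show "f' \<in> borel_measurable lborel" using m by simp
      show "cmod (f' x) \<le> cmod (of_real (max M 0) * indicator {0..T} x)" for x
        using b[of x] by (auto simp: norm_mult f'_def split: split_indicator)
    qed
  qed
  then have "version {0..T} f f'" by (auto simp: version_def f'_def)
  then show ?thesis using L2_on_version_iff[of "{0..T}" f] by auto
qed

lemma bdd_lin_L2_diff: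
  assumes \<Gamma>: "bdd_lin_L2 L \<Gamma>" and f: "L2_on {0..L} f" and h: "L2_on {0..L} h"
  shows "\<Gamma> (\<lambda>x. f x - h x) = \<Gamma> f - \<Gamma> h"
proof -
  have "L2_on {0..L} (\<lambda>x. (-1) * h x)"
    by (rule L2_on_scale[OF _ h]) simp
  then have "\<Gamma> (\<lambda>x. f x + (-1) * h x) = \<Gamma> f + \<Gamma> (\<lambda>x. (-1) * h x)"
    using \<Gamma> f unfolding bdd_lin_L2_def by blast
  also have "\<Gamma> (\<lambda>x. (-1) * h x) = (-1) * \<Gamma> h" using \<Gamma> h unfolding bdd_lin_L2_def by blast
  finally show ?thesis by simp
qed

text \<open>The feedback control is therefore square integrable in time, as the linearity and mild
  formulation lemmas require.\<close>

lemma bdd_lin_L2_continuous: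
  assumes \<Gamma>: "bdd_lin_L2 L \<Gamma>" and u: "C0_L2 L T u"
  shows "continuous_on {0..T} (\<lambda>t. \<Gamma> (u t))"
  unfolding continuous_on_def
proof
  fix t assume t: "t \<in> {0..T}"
  obtain C where C: "\<And>f. L2_on {0..L} f \<Longrightarrow> cmod (\<Gamma> f) \<le> C * L2_norm_on {0..L} f"
    using \<Gamma> unfolding bdd_lin_L2_def by blast
  have L2: "L2_on {0..L} (u s)" if "s \<in> {0..T}" for s using u that by (simp add: C0_L2_def)
  have L2d: "L2_on {0..L} (\<lambda>x. u s x - u t x)" if "s \<in> {0..T}" for s
    by (rule L2_on_diff[OF _ L2[OF that] L2[OF t]]) simp
  have lim: "((\<lambda>s. C * sqrt (integral\<^sup>L (lebesgue_on {0..L}) (\<lambda>x. (cmod (u s x - u t x))\<^sup>2))) \<longlongrightarrow> C * sqrt 0) (at t within {0..T})"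
    using u t by (intro tendsto_intros) (simp add: C0_L2_def)
  have ev: "\<forall>\<^sub>F s in at t within {0..T}. s \<in> {0..T}" by (auto simp: eventually_at_filter)
  have "((\<lambda>s. \<Gamma> (u s) - \<Gamma> (u t)) \<longlongrightarrow> 0) (at t within {0..T})"
  proof (rule Lim_null_comparison)
    show "\<forall>\<^sub>F s in at t within {0..T}. norm (\<Gamma> (u s) - \<Gamma> (u t)) \<le> C * sqrt (integral\<^sup>L (lebesgue_on {0..L}) (\<lambda>x. (cmod (u s x - u t x))\<^sup>2))"
      using ev
    proof eventually_elim
      case (elim s)
      then show ?case using C[OF L2d[OF elim]] bdd_lin_L2_diff[OF \<Gamma> L2[OF elim] L2[OF t]]
        by (simp add: L2_norm_on_def)
    qed
    show "((\<lambda>s. C * sqrt (integral\<^sup>L (lebesgue_on {0..L}) (\<lambda>x. (cmod (u s x - u t x))\<^sup>2))) \<longlongrightarrow> 0) (at t within {0..T})"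
      using lim by simp
  qed
  then show "((\<lambda>t. \<Gamma> (u t)) \<longlongrightarrow> \<Gamma> (u t)) (at t within {0..T})" by (rule LIM_zero_cancel)
qed

context transport
begin

lemma Gop_cong_sections:
  assumes "v \<in> borel_measurable (borel \<Otimes>\<^sub>M borel)" "w \<in> borel_measurable (borel \<Otimes>\<^sub>M borel)"
    and "\<And>t. AE y in lborel. 0 < y \<longrightarrow> y < L \<longrightarrow> v (t, y) = w (t, y)"
  shows "Gop v = Gop w"
proof (rule ext)
  fix z show "Gop v z = Gop w z"
    using Gop_section_cong[OF assms(3) assms(1,2), of "fst z" "snd z"] by simp
qed

text \<open>The representative is obtained by applying the right-hand side once more: its values lie
  in the range of \<open>Gop\<close>, so it vanishes off the square. The cut to times in (0, L) is
  invisible to the kernel.\<close>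

lemma fixed_point_regular:
  assumes \<omega>: "bweight \<omega>" and A: "sqint lborel A" and F0: "sqint lborel F0"
    and eq: "AE z in lborel. F0 z = Gop (Jop A) z + kop (kk \<omega>) F0 z"
  shows "\<exists>F. sqint lborel F \<and> quad F \<and> (AE z in lborel. F z = F0 z) \<and> (AE z in lborel. F z = Gop (traj \<omega> A F) z)"
proof -
  define F1 where "F1 z = (if 0 < fst z \<and> fst z < L then F0 z else 0)" for z
  have [measurable]: "F0 \<in> borel_measurable (borel \<Otimes>\<^sub>M borel)" using F0 by measurable
  have F1m: "F1 \<in> borel_measurable (borel \<Otimes>\<^sub>M borel)" unfolding F1_def[abs_def] by measurable
  have F1: "sqint lborel F1"
    by (rule sqint_mono[OF _ F0]) (use F1m in \<open>auto simp: borel_prod F1_def\<close>)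
  have s1: "strip F1" by (auto simp: strip_def F1_def)
  have k1: "kop (kk \<omega>) F0 = kop (kk \<omega>) F1" by (subst kop_kk_strip) (simp add: F1_def[abs_def])
  define F where "F = Gop (traj \<omega> A F1)"
  have F: "sqint lborel F" unfolding F_def by (intro sqint_Gop sqint_traj(1)[OF \<omega> F1 s1 A])
  have q: "quad F" unfolding F_def by (rule quad_Gop) (auto simp: strip_def traj_def)
  have FF0: "AE z in lborel. F z = F0 z"
    using Gop_traj[OF \<omega> F1 s1 A] eq by eventually_elim (simp add: F_def k1)
  then have FF1: "AE z in lborel. F1 z = F z"
  proof eventually_elim
    case (elim z)
    then show ?case using q by (cases z) (auto simp: F1_def quad_def)
  qed
  have k2: "kop (kk \<omega>) F1 = kop (kk \<omega>) F"
    using FF1 F1 F sqint_kk[OF \<omega>] by (intro kop_cong) (auto simp: sqint_def)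
  have "AE z in lborel. F z = Gop (traj \<omega> A F) z"
    using Gop_traj[OF \<omega> F quad_strip[OF q] A] FF0 eq by eventually_elim (simp add: k1 k2)
  with F q FF0 show ?thesis by blast
qed

text \<open>The weight of the final value problem: the state at time t is the final datum minus the
  source over later times.\<close>

definition bwd :: "real \<times> real \<times> real \<Rightarrow> complex" where
  "bwd z = (if fst z < fst (snd z) then - 1 else 0)"

lemma bwd_simp[simp]: "bwd (t, s, c) = (if t < s then - 1 else 0)" by (simp add: bwd_def)

lemma bweight_bwd: "bweight bwd"
  unfolding bweight_def bwd_def[abs_def] by auto

text \<open>The weights \<open>fwd\<close> and \<open>bwd\<close> differ by the constant 1 off s =
  t. Subtracting the full line integral of F from the final data thus gives data for the forward
  formula with the same trajectory, and the initial state need not be prescribed.\<close>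

lemma backward_solution:
  assumes A: "sqint lborel A"
  shows "\<exists>a F. sqint lborel a \<and> sqint lborel F \<and> quad F \<and> (AE z in lborel. F z = Gop (traj fwd a F) z) \<and> (\<forall>x. mild a F L x = A (L + x))"
proof -
  have "\<exists>F0. sqint lborel F0 \<and> (AE z in lborel. F0 z = Gop (Jop A) z + kop (kk bwd) F0 z)"
  \<comment> \<open>Reversed time, clipped to [0, L] so that it is bounded on the whole
    plane.\<close>
  proof (rule volterra_solvable[where \<rho>="\<lambda>z. L - max 0 (min (fst z) L)" and R=L])
    show "sqint (lborel \<Otimes>\<^sub>M lborel) (kk bwd)" by (rule sqint_kk[OF bweight_bwd])
    show "(\<lambda>z::real \<times> real. L - max 0 (min (fst z) L)) \<in> borel_measurable borel"
      unfolding borel_prod[symmetric] by measurable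
    show "kk bwd (p, q) = 0" if "\<not> L - max 0 (min (fst q) L) < L - max 0 (min (fst p) L)" for p q
      using that by (auto simp: kk_def)
    show "sqint lborel (Gop (Jop A))" by (intro sqint_Gop sqint_Jop A)
  qed (use L in auto)
  then obtain F0 where F0: "sqint lborel F0" "AE z in lborel. F0 z = Gop (Jop A) z + kop (kk bwd) F0 z" by blast
  obtain F where F: "sqint lborel F" "quad F" and eq: "AE z in lborel. F z = Gop (traj bwd A F) z"
    using fixed_point_regular[OF bweight_bwd A F0] by blast
  note Fs = quad_strip[OF F(2)]
  have Fm[measurable]: "F \<in> borel_measurable (borel \<Otimes>\<^sub>M borel)" using F by measurable
  define a where "a c = A c - cI (\<lambda>s. 1) F c" for c
  have a: "sqint lborel a" unfolding a_def[abs_def] by (intro sqint_diff A sqint_cI F Fs) auto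
  have "Gop (traj fwd a F) = Gop (traj bwd A F)"
  proof (rule Gop_cong_sections)
    show "traj fwd a F \<in> borel_measurable (borel \<Otimes>\<^sub>M borel)" "traj bwd A F \<in> borel_measurable (borel \<Otimes>\<^sub>M borel)"
      using sqint_traj(1)[OF bweight_fwd F(1) Fs a] sqint_traj(1)[OF bweight_bwd F(1) Fs A] by measurable
    fix t
    have "AE y in lborel. CN F (t + y) < \<infinity>" by (rule AE_shift[OF AE_CN_finite[OF F(1) Fs]])
    then show "AE y in lborel. 0 < y \<longrightarrow> y < L \<longrightarrow> traj fwd a F (t, y) = traj bwd A F (t, y)"
    proof eventually_elim
      case (elim y)
      have i1: "integrable lborel (\<lambda>s. (if s < t then 1 else 0) * F (s, t + y - s))"
        by (rule integrable_char[OF Fm _ _ elim]) auto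
      have i2: "integrable lborel (\<lambda>s. 1 * F (s, t + y - s))"
        by (rule integrable_char[OF Fm _ _ elim]) auto
      have "Rop fwd F (t, y) - cI (\<lambda>s. 1) F (t + y) = (\<integral>s. (if s < t then 1 else 0) * F (s, t + y - s) - 1 * F (s, t + y - s) \<partial>lborel)"
        using i1 i2 by (simp add: Rop_def cI_def)
      also have "\<dots> = Rop bwd F (t, y)"
        unfolding Rop_def fst_conv snd_conv
      proof (rule integral_cong_AE)
        show "AE s in lborel. (if s < t then 1 else 0) * F (s, t + y - s) - 1 * F (s, t + y - s) = bwd (t, s, t + y) * F (s, t + y - s)"
          using AE_lborel_singleton[of t] by eventually_elim auto
        show "(\<lambda>s. bwd (t, s, t + y) * F (s, t + y - s)) \<in> borel_measurable lborel" by simp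
      qed measurable
      finally show ?case by (auto simp: traj_def a_def algebra_simps)
    qed
  qed
  moreover have "mild a F L x = A (L + x)" for x
  proof -
    have "fwd (L, s, L + x) * F (s, L + x - s) = 1 * F (s, L + x - s)" for s using F(2) by (auto simp: quad_def)
    then have "Rop fwd F (L, x) = cI (\<lambda>s. 1) F (L + x)" unfolding Rop_def cI_def fst_conv snd_conv by presburger
    then show ?thesis by (simp add: mild_def a_def)
  qed
  ultimately show ?thesis using a F eq by metis
qed

lemma stabilizable_imp_controllable:
  assumes "stabilizable_finite_time L (\<lambda>x y. g (x, y)) L"
  shows "exactly_controllable L (\<lambda>x y. g (x, y)) L"
  unfolding exactly_controllable_def
proof (intro allI impI)
  fix u0 u1 assume "L2_on {0..L} u0 \<and> L2_on {0..L} u1"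
  then have u0: "L2_on {0..L} u0" and u1: "L2_on {0..L} u1" by auto
  obtain \<Gamma> where \<Gamma>: "bdd_lin_L2 L \<Gamma>" and cl: "\<And>u0. L2_on {0..L} u0 \<Longrightarrow>
       (\<exists>u. closed_loop_sol L (\<lambda>x y. g (x, y)) \<Gamma> u0 u) \<and>
       (\<forall>u. closed_loop_sol L (\<lambda>x y. g (x, y)) \<Gamma> u0 u \<longrightarrow> (\<forall>t\<ge>L. AE x in lebesgue_on {0..L}. u t x = 0))"
    using assms unfolding stabilizable_finite_time_def by blast
  obtain u1' where u1': "version {0..L} u1 u1'" using u1 L2_on_version_iff[of "{0..L}" u1] by auto
  \<comment> \<open>At time L the point x lies on the characteristic with label L + x, so the target
    enters as data shifted by L.\<close>
  then have "sqint lborel (\<lambda>c. u1' (c + (- L)))" by (intro sqint_shift) (simp add: version_def)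
  then obtain a F where a: "sqint lborel a" and F: "sqint lborel F" "quad F" and eq: "AE z in lborel. F z = Gop (traj fwd a F) z"
    and fin: "\<And>x. mild a F L x = u1' (L + x + (- L))"
    using backward_solution by blast
  have w: "weak_sol L (\<lambda>x y. g (x, y)) L a (\<lambda>t. a (t + L)) (mild a F)" by (rule mild_weak_sol[OF a F eq])
  have L2cut: "L2_on {0..L} f" if "sqint lborel f" for f
  proof -
    have [measurable]: "f \<in> borel_measurable borel" using that by (simp add: sqint_def)
    have "version {0..L} f (\<lambda>x. indicator {0..L} x * f x)"
      using that by (auto simp: version_def intro!: sqint_mono[OF _ that] split: split_indicator)
    then show ?thesis using L2_on_version_iff[of "{0..L}" f] by auto
  qed
  have aL: "L2_on {0..L} a" by (rule L2cut[OF a])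
  have WL: "L2_on {0..L} (\<lambda>t. a (t + L))" by (rule L2cut[OF sqint_shift[OF a]])
  have v0: "L2_on {0..L} (\<lambda>x. u0 x - a x)"
    by (rule L2_on_diff[OF _ u0 aL]) simp
  obtain v where v: "closed_loop_sol L (\<lambda>x y. g (x, y)) \<Gamma> (\<lambda>x. u0 x - a x) v" and vL: "AE x in lebesgue_on {0..L}. v L x = 0"
    using cl[OF v0] by blast
  have vw: "weak_sol L (\<lambda>x y. g (x, y)) L (\<lambda>x. u0 x - a x) (\<lambda>t. \<Gamma> (v t)) v"
    using v L by (simp add: closed_loop_sol_def)
  then have "C0_L2 L L v" by (simp add: weak_sol_def)
  then have VL: "L2_on {0..L} (\<lambda>t. \<Gamma> (v t))" by (intro continuous_L2_on bdd_lin_L2_continuous[OF \<Gamma>])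
  have sum: "weak_sol L (\<lambda>x y. g (x, y)) L (\<lambda>x. (u0 x - a x) + 1 *\<^sub>R a x) (\<lambda>t. \<Gamma> (v t) + 1 *\<^sub>R a (t + L)) (\<lambda>t x. v t x + 1 *\<^sub>R mild a F t x)"
    using L by (intro weak_sol_lin vw v0 VL w aL WL) auto
  have UL: "L2_on {0..L} (\<lambda>t. \<Gamma> (v t) + a (t + L))"
    by (rule L2_on_add[OF _ VL WL]) simp
  have "AE x in lborel. x \<in> {0..L} \<longrightarrow> v L x = 0" using vL by (simp add: AE_lebesgue_on_iff)
  moreover have "AE x in lborel. x \<in> {0..L} \<longrightarrow> u1 x = u1' x" using u1' by (simp add: version_def)
  ultimately have "AE x in lborel. x \<in> {0..L} \<longrightarrow> v L x + mild a F L x = u1 x"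
    by eventually_elim (simp add: fin)
  then have "AE x in lebesgue_on {0..L}. v L x + mild a F L x = u1 x" by (simp add: AE_lebesgue_on_iff)
  with sum UL show "\<exists>U u. L2_on {0..L} U \<and> weak_sol L (\<lambda>x y. g (x, y)) L u0 U u \<and> (AE x in lebesgue_on {0..L}. u L x = u1 x)"
    by (intro exI[of _ "\<lambda>t. \<Gamma> (v t) + a (t + L)"] exI[of _ "\<lambda>t x. v t x + mild a F t x"]) simp
qed

end

section \<open>Trajectories steered by a control\<close>

lemma ennreal_add_sq_le:
  fixes x y :: ennreal
  shows "(x + y)\<^sup>2 \<le> 2 * x\<^sup>2 + 2 * y\<^sup>2"
proof (cases "x = top \<or> y = top")
  case True
  then show ?thesis by (auto simp: power2_eq_square ennreal_mult_top)
next
  case False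
  then obtain a b where ab: "x = ennreal a" "0 \<le> a" "y = ennreal b" "0 \<le> b" by (cases x; cases y) auto
  have "(a + b)\<^sup>2 \<le> 2 * a\<^sup>2 + 2 * b\<^sup>2" using sum_squares_bound[of a b] by (simp add: power2_sum)
  then have "ennreal ((a + b)\<^sup>2) \<le> ennreal (2 * a\<^sup>2 + 2 * b\<^sup>2)" by (rule ennreal_leI)
  also have "\<dots> = 2 * x\<^sup>2 + 2 * y\<^sup>2" using ab by (simp add: ennreal_power ennreal_mult ennreal_plus)
  also have "ennreal ((a + b)\<^sup>2) = (x + y)\<^sup>2" using ab by (simp add: ennreal_power flip: ennreal_plus)
  finally show ?thesis .
qed

context transport
begin

text \<open>For $t + y > L$ the characteristic through $(t,y)$ carries the control, which the final condition
  determines as the final value minus the integral of $F$ over the whole characteristic. This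
  is the origin of the second term.\<close>
definition mix :: "real \<times> real \<times> real \<Rightarrow> complex" where
  "mix z = (if fst (snd z) < fst z then 1 else 0) - (if L < snd (snd z) then 1 else 0)"

lemma mix_simp: "mix (t, s, c) = (if s < t then 1 else 0) - (if L < c then 1 else 0)" by (simp add: mix_def)

lemma bweight_mix: "bweight mix"
  unfolding bweight_def mix_def[abs_def] by auto

lemma mix_measurable[measurable]: "mix \<in> borel_measurable (borel \<Otimes>\<^sub>M borel \<Otimes>\<^sub>M borel)"
  by (rule bweight_measurable[OF bweight_mix])

lemma strip_traj: "strip (traj \<omega> b F)" by (auto simp: strip_def traj_def)

lemma Rop_mix:
  assumes Fm: "F \<in> borel_measurable (borel \<Otimes>\<^sub>M borel)" and c: "CN F (t + y) < \<infinity>"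
  shows "Rop mix F (t, y) = cI (\<lambda>s. fwd (t, s, 0)) F (t + y) - (if L < t + y then cI (\<lambda>s. 1) F (t + y) else 0)"
proof -
  have i1: "integrable lborel (\<lambda>s. fwd (t, s, 0) * F (s, t + y - s))" by (rule integrable_char[OF Fm _ _ c]) auto
  have i2: "integrable lborel (\<lambda>s. 1 * F (s, t + y - s))" by (rule integrable_char[OF Fm _ _ c]) auto
  have "Rop mix F (t, y) = (\<integral>s. fwd (t, s, 0) * F (s, t + y - s) - (if L < t + y then 1 else 0) * (1 * F (s, t + y - s)) \<partial>lborel)"
    unfolding Rop_def fst_conv snd_conv by (intro Bochner_Integration.integral_cong) (auto simp: mix_simp)
  also have "\<dots> = (\<integral>s. fwd (t, s, 0) * F (s, t + y - s) \<partial>lborel) - (if L < t + y then 1 else 0) * (\<integral>s. 1 * F (s, t + y - s) \<partial>lborel)"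
    using i1 i2 by (subst Bochner_Integration.integral_diff) auto
  finally show ?thesis by (simp add: cI_def)
qed

lemma AE_CN_section:
  assumes "sqint lborel F" "strip F"
  shows "AE y in lborel. CN F (t + y) < \<infinity>"
  by (rule AE_shift[OF AE_CN_finite[OF assms]])

text \<open>The mild formulation at time L, together with the final condition, expresses the control
  as b1 minus a full line integral of F. Inserted at the other times, this gives a trajectory with
  weight \<open>mix\<close> whose data are b0 on labels below L and the shifted b1 above. The
  control has disappeared from the equation.\<close>

lemma controlled_trajectory:
  assumes ctrl: "exactly_controllable L (\<lambda>x y. g (x, y)) L"
    and b0: "sqint lborel b0" "\<And>x. \<not> (0 < x \<and> x < L) \<Longrightarrow> b0 x = 0"
    and b1: "sqint lborel b1" "\<And>x. \<not> (0 < x \<and> x < L) \<Longrightarrow> b1 x = 0"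
  defines "b \<equiv> \<lambda>c. b0 c + b1 (c - L)"
  shows "\<exists>U u v F. L2_on {0..L} U \<and> weak_sol L (\<lambda>x y. g (x, y)) L b0 U u \<and>
     (AE x in lborel. x \<in> {0..L} \<longrightarrow> u L x = b1 x) \<and> joint_version L L u v \<and>
     sqint lborel F \<and> quad F \<and> F = Gop (traj mix b F) \<and>
     (\<forall>t. 0 < t \<longrightarrow> t < L \<longrightarrow> (AE x in lborel. 0 < x \<longrightarrow> x < L \<longrightarrow> v (t, x) = traj mix b F (t, x))) \<and>
     (AE t in lborel. 0 < t \<longrightarrow> t < L \<longrightarrow> U t = b1 t - cI (\<lambda>s. 1) F (L + t))"
proof -
  have v0: "version {0..L} b0 b0" using b0 L by (auto simp: version_def)
  have v1: "version {0..L} b1 b1" using b1 L by (auto simp: version_def)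
  have "L2_on {0..L} b0" "L2_on {0..L} b1" using v0 v1 L2_on_version_iff[of "{0..L}"] by auto
  then obtain U u where U: "L2_on {0..L} U" and ws: "weak_sol L (\<lambda>x y. g (x, y)) L b0 U u"
    and fin: "AE x in lebesgue_on {0..L}. u L x = b1 x"
    using ctrl unfolding exactly_controllable_def by blast
  have fin': "AE x in lborel. x \<in> {0..L} \<longrightarrow> u L x = b1 x" using fin by (simp add: AE_lebesgue_on_iff)
  obtain U' where U': "version {0..L} U U'" using U L2_on_version_iff[of "{0..L}" U] by auto
  have uC: "C0_L2 L L u" using ws by (simp add: weak_sol_def)
  obtain v where v: "joint_version L L u v" using joint_version_exists[OF _ uC] L by auto
  have vm[measurable]: "v \<in> borel_measurable (borel \<Otimes>\<^sub>M borel)" using v by (simp add: joint_version_def)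
  have vs: "sqint lborel v" using L by (intro joint_version_sqint[OF _ v uC]) simp
  define F where "F z = (if 0 < fst z \<and> fst z < L then Gop v z else 0)" for z
  have Fm[measurable]: "F \<in> borel_measurable (borel \<Otimes>\<^sub>M borel)" unfolding F_def[abs_def] by measurable
  have Fs: "sqint lborel F"
    by (rule sqint_mono[OF _ sqint_Gop[OF vs]]) (use Fm in \<open>auto simp: borel_prod F_def\<close>)
  have Fq: "quad F" using Gop_eq_0 by (auto simp: quad_def F_def)
  note Fst = quad_strip[OF Fq]
  have bm[measurable]: "b0 \<in> borel_measurable borel" "b1 \<in> borel_measurable borel" using b0 b1 by (auto simp: sqint_def)
  have bs: "sqint lborel b"
    unfolding b_def using sqint_shift[OF b1(1), of "- L"] by (intro sqint_add b0) simp
  have mild: "AE x in lborel. 0 < x \<longrightarrow> x < L \<longrightarrow> v (\<tau>, x) = b0 (\<tau> + x) + U' (\<tau> + x - L) + cI (\<lambda>s. fwd (\<tau>, s, 0)) F (\<tau> + x)"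
    if \<tau>: "\<tau> \<in> {0..L}" for \<tau>
  proof -
    have "(\<integral>s. indicator {..<\<tau>} s * Gop v (s, c - s) \<partial>lborel) = cI (\<lambda>s. fwd (\<tau>, s, 0)) F c" for c
      unfolding cI_def
    proof (rule integral_cong_AE)
      have neg: "s \<ge> 0 \<or> Gop v (s, y) = 0" for s y
        using v by (cases "s < 0") (auto simp: Gop_def joint_version_def)
      show "AE s in lborel. indicator {..<\<tau>} s * Gop v (s, c - s) = fwd (\<tau>, s, 0) * F (s, c - s)"
        using AE_lborel_singleton[of 0]
      proof eventually_elim
        case (elim s)
        then show ?case using \<tau> neg[of s "c - s"] by (auto simp: F_def split: split_indicator)
      qed
    qed measurable
    then show ?thesis using weak_sol_mild[OF _ ws v0 U' v \<tau>] L by simp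
  qed
  have U'eq: "AE x in lborel. 0 < x \<longrightarrow> x < L \<longrightarrow> U' x = b1 x - cI (\<lambda>s. 1) F (L + x)"
  proof -
    have "L \<in> {0..L}" using L by simp
    then have "AE x in lborel. x \<in> {0..L} \<longrightarrow> u L x = v (L, x)" using v by (simp add: joint_version_def version_def)
    with mild[OF \<open>L \<in> {0..L}\<close>] fin' show ?thesis
    proof eventually_elim
      case (elim x)
      have "fwd (L, s, 0) * F (s, L + x - s) = 1 * F (s, L + x - s)" for s using Fq by (auto simp: quad_def)
      then have "cI (\<lambda>s. fwd (L, s, 0)) F (L + x) = cI (\<lambda>s. 1) F (L + x)" unfolding cI_def by presburger
      with elim show ?case using b0(2)[of "L + x"] by auto
    qed
  qed
  have vtraj: "AE x in lborel. 0 < x \<longrightarrow> x < L \<longrightarrow> v (t, x) = traj mix b F (t, x)" if t: "0 < t" "t < L" for t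
  proof -
    have tm: "t \<in> {0..L}" using t by simp
    have "AE x in lborel. 0 < (t - L) + x \<longrightarrow> (t - L) + x < L \<longrightarrow> U' ((t - L) + x) = b1 ((t - L) + x) - cI (\<lambda>s. 1) F (L + ((t - L) + x))"
      by (rule AE_shift[OF U'eq])
    with mild[OF tm] AE_CN_section[OF Fs Fst, of t] AE_lborel_singleton[of "L - t"] show ?thesis
    proof eventually_elim
      case (elim x)
      show ?case
      proof (intro impI)
        assume x: "0 < x" "x < L"
        have tr: "traj mix b F (t, x) = b (t + x) + (cI (\<lambda>s. fwd (t, s, 0)) F (t + x) - (if L < t + x then cI (\<lambda>s. 1) F (t + x) else 0))"
          using t Rop_mix[OF Fm elim(2)] by (simp add: traj_def)
        show "v (t, x) = traj mix b F (t, x)"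
        proof (cases "t + x < L")
          case True
          then have "U' (t + x - L) = 0" "b1 (t + x - L) = 0" using U' b1(2)[of "t + x - L"] by (auto simp: version_def)
          then show ?thesis unfolding tr using elim x True by (simp add: b_def)
        next
          case False
          then have c: "L < t + x" using elim(3) by auto
          then have "U' (t + x - L) = b1 (t + x - L) - cI (\<lambda>s. 1) F (t + x)"
            using elim(4) x t by (simp add: algebra_simps)
          moreover have "b0 (t + x) = 0" using c b0(2)[of "t + x"] by simp
          ultimately show ?thesis unfolding tr using elim(1) x c by (simp add: b_def)
        qed
      qed
    qed
  qed
  have trm: "traj mix b F \<in> borel_measurable (borel \<Otimes>\<^sub>M borel)"
    using sqint_traj(1)[OF bweight_mix Fs Fst bs] by measurable
  \<comment> \<open>At every time the state and the trajectory formula agree for almost every x, and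
    the integral operator turns this into equality at every point.\<close>
  have "F = Gop (traj mix b F)"
  proof (rule ext)
    fix z :: "real \<times> real"
    obtain t x where z: "z = (t, x)" by (cases z)
    show "F z = Gop (traj mix b F) z"
    proof (cases "0 < t \<and> t < L")
      case True
      then have "Gop v (t, x) = Gop (traj mix b F) (t, x)"
        by (intro Gop_section_cong[OF _ vm trm] vtraj) auto
      then show ?thesis using True by (simp add: F_def z)
    next
      case False
      then show ?thesis using strip_Gop[OF strip_traj, of mix b F] by (auto simp: F_def z strip_def)
    qed
  qed
  moreover have "AE t in lborel. 0 < t \<longrightarrow> t < L \<longrightarrow> U t = b1 t - cI (\<lambda>s. 1) F (L + t)"
  proof -
    have "AE t in lborel. t \<in> {0..L} \<longrightarrow> U t = U' t" using U' by (simp add: version_def)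
    with U'eq show ?thesis by eventually_elim auto
  qed
  ultimately show ?thesis using U ws fin' v Fs Fq vtraj by blast
qed

lemma Gop_minus: "Gop (\<lambda>z. - v z) z = - Gop v z"
  by (simp add: Gop_def)

lemma Gop_scale: "Gop (\<lambda>z. r * v z) z = r * Gop v z"
  by (simp add: Gop_def mult.left_commute)

text \<open>Solve the forward Volterra problem with the given source and
  correct its final state by a controlled trajectory.\<close>
lemma mix_surjective:
  assumes ctrl: "exactly_controllable L (\<lambda>x y. g (x, y)) L" and H: "sqint lborel H"
  shows "\<exists>F. sqint lborel F \<and> (AE z in lborel. F z = H z + kop (kk mix) F z)"
proof -
  have "\<exists>F1. sqint lborel F1 \<and> (AE z in lborel. F1 z = H z + kop (kk fwd) F1 z)"
  proof (rule volterra_solvable[where \<rho>="\<lambda>z. max 0 (min (fst z) L)" and R=L])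
    show "sqint (lborel \<Otimes>\<^sub>M lborel) (kk fwd)" by (rule sqint_kk[OF bweight_fwd])
    show "(\<lambda>z::real \<times> real. max 0 (min (fst z) L)) \<in> borel_measurable borel"
      unfolding borel_prod[symmetric] by measurable
    show "kk fwd (p, q) = 0" if "\<not> max 0 (min (fst q) L) < max 0 (min (fst p) L)" for p q
      using that by (auto simp: kk_def)
  qed (use L H in auto)
  then obtain F0 where F0: "sqint lborel F0" "AE z in lborel. F0 z = H z + kop (kk fwd) F0 z" by blast
  define F1 where "F1 z = (if 0 < fst z \<and> fst z < L then F0 z else 0)" for z
  have [measurable]: "F0 \<in> borel_measurable (borel \<Otimes>\<^sub>M borel)" using F0 by measurable
  have F1m[measurable]: "F1 \<in> borel_measurable (borel \<Otimes>\<^sub>M borel)" unfolding F1_def[abs_def] by measurable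
  have F1: "sqint lborel F1"
    by (rule sqint_mono[OF _ F0(1)]) (use F1m in \<open>auto simp: borel_prod F1_def\<close>)
  have s1: "strip F1" by (auto simp: strip_def F1_def)
  have k1: "kop (kk \<omega>) F0 = kop (kk \<omega>) F1" for \<omega> by (subst kop_kk_strip) (simp add: F1_def[abs_def])
  \<comment> \<open>With zero data, the forward trajectory driven by \<open>F1\<close> ends in the
    full line integral; its negative is the final state of the correction \<open>F2\<close>.\<close>
  define b1 where "b1 x = (if 0 < x \<and> x < L then - cI (\<lambda>s. 1) F1 (L + x) else 0)" for x
  have cIs: "sqint lborel (cI (\<lambda>s. 1) F1)" by (rule sqint_cI[OF _ _ F1 s1]) auto
  have cIm[measurable]: "cI (\<lambda>s. 1) F1 \<in> borel_measurable borel" using cIs by (simp add: sqint_def)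
  have b1s: "sqint lborel b1"
  proof (rule sqint_mono[OF _ sqint_shift[OF cIs, of L]])
    show "b1 \<in> borel_measurable lborel" unfolding b1_def[abs_def] by measurable
    show "cmod (b1 x) \<le> cmod (cI (\<lambda>s. 1) F1 (x + L))" for x by (auto simp: b1_def add.commute)
  qed
  define b where "b c = 0 + b1 (c - L)" for c
  have bs: "sqint lborel b" using sqint_shift[OF b1s, of "- L"] by (simp add: b_def[abs_def])
  have b10: "\<And>x. \<not> (0 < x \<and> x < L) \<Longrightarrow> b1 x = 0" by (auto simp: b1_def)
  have b_eq: "b = (\<lambda>c. 0 + b1 (c - L))" by (auto simp: b_def)
  obtain F2 where F2: "sqint lborel F2" "quad F2" "F2 = Gop (traj mix b F2)"
    using controlled_trajectory[OF ctrl sqint_zero refl b1s b10, folded b_eq] by blast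
  have eq2: "AE z in lborel. F2 z = Gop (Jop b) z + kop (kk mix) F2 z"
    using Gop_traj[OF bweight_mix F2(1) quad_strip[OF F2(2)] bs] F2(3) by (metis (mono_tags, lifting) AE_cong)
  have bms: "sqint lborel (\<lambda>c. - b c)" by (rule sqint_minus[OF bs])
  \<comment> \<open>On labels above L the weights \<open>fwd\<close> and \<open>mix\<close> differ
    by the full line integral of \<open>F1\<close>, which is -b there; below L they agree. This
    exchanges the forward kernel for the mixed one.\<close>
  have "Gop (traj fwd (\<lambda>c. 0) F1) = Gop (traj mix (\<lambda>c. - b c) F1)"
  proof (rule Gop_cong_sections)
    show "traj fwd (\<lambda>c. 0) F1 \<in> borel_measurable (borel \<Otimes>\<^sub>M borel)" "traj mix (\<lambda>c. - b c) F1 \<in> borel_measurable (borel \<Otimes>\<^sub>M borel)"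
      using sqint_traj(1)[OF bweight_fwd F1 s1 sqint_zero] sqint_traj(1)[OF bweight_mix F1 s1 bms] by measurable
    fix t
    show "AE y in lborel. 0 < y \<longrightarrow> y < L \<longrightarrow> traj fwd (\<lambda>c. 0) F1 (t, y) = traj mix (\<lambda>c. - b c) F1 (t, y)"
      using AE_CN_section[OF F1 s1, of t] AE_lborel_singleton[of "L - t"]
    proof eventually_elim
      case (elim y)
      have "Rop fwd F1 (t, y) = cI (\<lambda>s. fwd (t, s, 0)) F1 (t + y)" by (simp add: Rop_def cI_def)
      then show ?case using Rop_mix[OF F1m elim(1)] elim(2) by (auto simp: traj_def b_def b1_def)
    qed
  qed
  moreover have "Gop (Jop (\<lambda>c. - b c)) z = - Gop (Jop b) z" for z
  proof -
    have "Jop (\<lambda>c. - b c) = (\<lambda>z. - Jop b z)" by (auto simp: Jop_def)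
    then show ?thesis by (simp add: Gop_minus)
  qed
  moreover have "Gop (Jop (\<lambda>c. 0)) z = 0" for z by (simp add: Gop_def Jop_def cong: if_cong)
  ultimately have k2: "AE z in lborel. kop (kk fwd) F1 z = kop (kk mix) F1 z - Gop (Jop b) z"
    using Gop_traj[OF bweight_fwd F1 s1 sqint_zero] Gop_traj[OF bweight_mix F1 s1 bms]
    by (auto elim!: AE_mp)
  have add: "AE z in lborel. kop (kk mix) (\<lambda>z. F0 z + F2 z) z = kop (kk mix) F0 z + kop (kk mix) F2 z"
    by (rule kop_add[OF sqint_kk[OF bweight_mix] F0(1) F2(1)])
  \<comment> \<open>The source produced by b in the equation for \<open>F2\<close> cancels the one
    left over from the change of kernel in \<open>k2\<close>.\<close>
  have "AE z in lborel. F0 z + F2 z = H z + kop (kk mix) (\<lambda>z. F0 z + F2 z) z"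
    using F0(2) eq2 k2 add by eventually_elim (simp add: k1)
  then show ?thesis using sqint_add[OF F0(1) F2(1)] by (intro exI[of _ "\<lambda>z. F0 z + F2 z"]) auto
qed

section \<open>The feedback functional\<close>

text \<open>The equation is asked almost everywhere so that admissible pairs are stable under linear
  combinations; on exceptional points \<open>Gop\<close> may fail to be additive.\<close>

definition admissible :: "(real \<Rightarrow> complex) \<Rightarrow> (real \<times> real \<Rightarrow> complex) \<Rightarrow> bool" where
  "admissible b F \<longleftrightarrow> sqint lborel b \<and> sqint lborel F \<and> quad F \<and> (AE z in lborel. F z = Gop (traj mix b F) z)"

text \<open>For an exact fixed point this is the integral of F over the line s + x = L, see
  \<open>Phi_exact\<close>. When b is supported in (0, L), this is minus the initial value of the
  control steering b to zero.\<close>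

definition Phi :: "(real \<Rightarrow> complex) \<Rightarrow> (real \<times> real \<Rightarrow> complex) \<Rightarrow> complex" where
  "Phi b F = (\<integral>z. g (L - fst z, snd z) * traj mix b F z \<partial>lborel)"

text \<open>The kernel $g(L - s, y)$ is only square integrable, but \<open>traj mix b F\<close> is dominated by a
  function of $s + y$; integrating along characteristics first pairs two square integrable
  functions of $s + y$.\<close>
lemma Phi_bounds:
  assumes b: "sqint lborel b" and F: "sqint lborel F" "strip F"
  shows "integrable lborel (\<lambda>z. g (L - fst z, snd z) * traj mix b F z)"
    and "(ennreal (cmod (Phi b F)))\<^sup>2 \<le> (ennreal L * sqn lborel g) * (2 * sqn lborel b + 2 * (ennreal L * sqn lborel F))"
proof -
  define h where "h z = g (L - fst z, snd z)" for z
  have [measurable]: "b \<in> borel_measurable borel" using b by (simp add: sqint_def)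
  have Fm[measurable]: "F \<in> borel_measurable (borel \<Otimes>\<^sub>M borel)" using F by measurable
  have hm[measurable]: "h \<in> borel_measurable (borel \<Otimes>\<^sub>M borel)" unfolding h_def[abs_def] by measurable
  have trm[measurable]: "traj mix b F \<in> borel_measurable (borel \<Otimes>\<^sub>M borel)"
    using sqint_traj(1)[OF bweight_mix F b] by measurable
  have hs: "strip h" using g0 by (auto simp: strip_def h_def)
  have hg: "sqn lborel h = sqn lborel g"
  proof -
    have "sqn lborel h = (\<integral>\<^sup>+s. sqn lborel (\<lambda>y. g (L + (-1) * s, y)) \<partial>lborel)"
      by (subst sqn_plane[OF hm]) (simp add: h_def)
    also have "\<dots> = (\<integral>\<^sup>+s. sqn lborel (\<lambda>y. g (s, y)) \<partial>lborel)"
      using nn_integral_real_affine[of "\<lambda>s. sqn lborel (\<lambda>y. g (s, y))" "-1" L] by (simp add: sqn_def)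
    also have "\<dots> = sqn lborel g" by (rule sqn_plane[OF gm, symmetric])
    finally show ?thesis .
  qed
  define m where "m c = ennreal (cmod (b c)) + CN F c" for c
  have [measurable]: "m \<in> borel_measurable borel" unfolding m_def[abs_def] by measurable
  have trle: "ennreal (cmod (traj mix b F (s, y))) \<le> m (s + y)" for s y
  proof -
    have "ennreal (cmod (traj mix b F (s, y))) \<le> ennreal (cmod (b (s + y)) + cmod (Rop mix F (s, y)))"
      by (intro ennreal_leI) (auto simp: traj_def norm_triangle_ineq)
    also have "\<dots> \<le> m (s + y)"
      using Rop_le_CN[OF bweight_mix, of F s y] by (auto simp: m_def ennreal_plus intro: add_left_mono)
    finally show ?thesis .
  qed
  have "(\<integral>\<^sup>+z. ennreal (cmod (h z * traj mix b F z)) \<partial>lborel) \<le> (\<integral>\<^sup>+z. ennreal (cmod (h z)) * m (fst z + snd z) \<partial>lborel)"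
  proof (intro nn_integral_mono)
    fix z :: "real \<times> real"
    show "ennreal (cmod (h z * traj mix b F z)) \<le> ennreal (cmod (h z)) * m (fst z + snd z)"
      using trle[of "fst z" "snd z"] by (auto simp: norm_mult ennreal_mult intro: mult_left_mono)
  qed
  \<comment> \<open>In the coordinates s and c = s + y the factor m depends on c only, so the inner
    integral is \<open>CN h c\<close>.\<close>
  also have "\<dots> = (\<integral>\<^sup>+c. \<integral>\<^sup>+s. ennreal (cmod (h (s, c - s))) * m c \<partial>lborel \<partial>lborel)"
    by (subst nn_shear[symmetric]) auto
  also have "\<dots> = (\<integral>\<^sup>+c. CN h c * m c \<partial>lborel)"
    unfolding CN_def by (intro nn_integral_cong nn_integral_multc) measurable
  finally have le1: "(\<integral>\<^sup>+z. ennreal (cmod (h z * traj mix b F z)) \<partial>lborel) \<le> (\<integral>\<^sup>+c. CN h c * m c \<partial>lborel)" .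
  have "(\<integral>\<^sup>+c. CN h c * m c \<partial>lborel)\<^sup>2 \<le> (\<integral>\<^sup>+c. (CN h c)\<^sup>2 \<partial>lborel) * (\<integral>\<^sup>+c. (m c)\<^sup>2 \<partial>lborel)"
    by (rule Cauchy_Schwarz_nn_integral) measurable
  also have "\<dots> \<le> (ennreal L * sqn lborel g) * (2 * sqn lborel b + 2 * (ennreal L * sqn lborel F))"
  proof (rule mult_mono)
    show "(\<integral>\<^sup>+c. (CN h c)\<^sup>2 \<partial>lborel) \<le> ennreal L * sqn lborel g"
      using nn_CN_sq_strip[OF hm hs] by (simp add: hg)
    have "(\<integral>\<^sup>+c. (m c)\<^sup>2 \<partial>lborel) \<le> (\<integral>\<^sup>+c. 2 * (ennreal (cmod (b c)))\<^sup>2 + 2 * (CN F c)\<^sup>2 \<partial>lborel)"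
      unfolding m_def by (intro nn_integral_mono ennreal_add_sq_le)
    also have "\<dots> = 2 * sqn lborel b + 2 * (\<integral>\<^sup>+c. (CN F c)\<^sup>2 \<partial>lborel)"
      by (simp add: nn_integral_add nn_integral_cmult sqn_def)
    also have "\<dots> \<le> 2 * sqn lborel b + 2 * (ennreal L * sqn lborel F)"
      by (intro add_left_mono mult_left_mono nn_CN_sq_strip[OF Fm F(2)]) auto
    finally show "(\<integral>\<^sup>+c. (m c)\<^sup>2 \<partial>lborel) \<le> 2 * sqn lborel b + 2 * (ennreal L * sqn lborel F)" .
  qed auto
  finally have le2: "(\<integral>\<^sup>+c. CN h c * m c \<partial>lborel)\<^sup>2 \<le> (ennreal L * sqn lborel g) * (2 * sqn lborel b + 2 * (ennreal L * sqn lborel F))" .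
  have sq: "(\<integral>\<^sup>+z. ennreal (cmod (h z * traj mix b F z)) \<partial>lborel)\<^sup>2 \<le> (ennreal L * sqn lborel g) * (2 * sqn lborel b + 2 * (ennreal L * sqn lborel F))"
    using power_mono[OF le1, of 2] le2 by (auto intro: order_trans)
  show "integrable lborel (\<lambda>z. g (L - fst z, snd z) * traj mix b F z)"
    unfolding h_def[symmetric]
  proof (rule integrableI_bounded)
    have "(\<lambda>z. h z * traj mix b F z) \<in> borel_measurable (borel \<Otimes>\<^sub>M borel)" by measurable
    then show "(\<lambda>z. h z * traj mix b F z) \<in> borel_measurable lborel" unfolding borel_prod by simp
    have "(ennreal L * sqn lborel g) * (2 * sqn lborel b + 2 * (ennreal L * sqn lborel F)) < top"
      using g b F by (simp add: sqint_def ennreal_mult_less_top)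
    from le_less_trans[OF sq this] show "(\<integral>\<^sup>+z. ennreal (cmod (h z * traj mix b F z)) \<partial>lborel) < \<infinity>"
      by (simp add: power_less_top_ennreal)
  qed
  have "ennreal (cmod (Phi b F)) \<le> (\<integral>\<^sup>+z. ennreal (cmod (h z * traj mix b F z)) \<partial>lborel)"
    unfolding Phi_def h_def[symmetric] by (rule norm_integral_le_nn)
  from power_mono[OF this, of 2] sq show "(ennreal (cmod (Phi b F)))\<^sup>2 \<le> (ennreal L * sqn lborel g) * (2 * sqn lborel b + 2 * (ennreal L * sqn lborel F))"
    by (auto intro: order_trans)
qed

text \<open>The Fredholm lower bound controls F by its source \<open>Gop (Jop b)\<close>, which is
  controlled by b; \<open>Phi_bounds\<close> then leaves only the norm of b. The constant is
  independent of the chosen F.\<close>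

lemma Phi_bounded:
  assumes ctrl: "exactly_controllable L (\<lambda>x y. g (x, y)) L"
  shows "\<exists>K. \<forall>b F. admissible b F \<longrightarrow> cmod (Phi b F) \<le> K * l2n lborel b"
proof -
  obtain C where C: "\<And>F. sqint lborel F \<Longrightarrow> l2n lborel F \<le> C * l2n lborel (\<lambda>z. F z - kop (kk mix) F z)"
    using fredholm_kernel_lower_bound[OF sqint_kk[OF bweight_mix] mix_surjective[OF ctrl]] by blast
  define G where "G = l2n lborel g"
  have G: "sqn lborel g = ennreal (G\<^sup>2)" unfolding G_def by (rule sqn_l2n[OF g])
  \<comment> \<open>This is the bound of \<open>Phi_bounds\<close> after inserting that the squared
    norm of F is at most C^2 G^2 L times that of b.\<close>
  define K where "K = sqrt (L * G\<^sup>2 * (2 + 2 * (L * (C\<^sup>2 * (G\<^sup>2 * L)))))"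
  have "cmod (Phi b F) \<le> K * l2n lborel b" if "admissible b F" for b F
  proof -
    have b: "sqint lborel b" and F: "sqint lborel F" "quad F" and eq: "AE z in lborel. F z = Gop (traj mix b F) z"
      using that by (auto simp: admissible_def)
    note Fs = quad_strip[OF F(2)]
    define B where "B = l2n lborel b"
    have B: "sqn lborel b = ennreal (B\<^sup>2)" "B \<ge> 0" unfolding B_def by (auto simp: sqn_l2n[OF b])
    have "AE z in lborel. F z - kop (kk mix) F z = Gop (Jop b) z"
      using eq Gop_traj[OF bweight_mix F(1) Fs b] by eventually_elim simp
    then have "l2n lborel (\<lambda>z. F z - kop (kk mix) F z) = l2n lborel (Gop (Jop b))"
      unfolding l2n_def by (simp add: sqn_cong_AE)
    with C[OF F(1)] have le: "l2n lborel F \<le> C * l2n lborel (Gop (Jop b))" by simp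
    have "b \<in> borel_measurable borel" using b by (simp add: sqint_def)
    then have "sqn lborel (Gop (Jop b)) \<le> sqn lborel g * (ennreal L * sqn lborel b)"
      using sqn_Gop_le[of "Jop b"] sqn_Jop[of b] by simp
    also have "\<dots> = ennreal (G\<^sup>2 * (L * B\<^sup>2))" using G B L by (simp add: ennreal_mult)
    finally have "(l2n lborel (Gop (Jop b)))\<^sup>2 \<le> G\<^sup>2 * (L * B\<^sup>2)"
      using sqn_l2n[OF sqint_Gop[OF sqint_Jop[OF b]]] L by simp
    moreover have "(l2n lborel F)\<^sup>2 \<le> (C * l2n lborel (Gop (Jop b)))\<^sup>2" using le by (intro power_mono) auto
    ultimately have F2: "(l2n lborel F)\<^sup>2 \<le> C\<^sup>2 * (G\<^sup>2 * (L * B\<^sup>2))"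
      by (smt (verit) mult_left_mono power_mult_distrib zero_le_power2)
    have "(ennreal (cmod (Phi b F)))\<^sup>2 \<le> (ennreal L * sqn lborel g) * (2 * sqn lborel b + 2 * (ennreal L * sqn lborel F))"
      by (rule Phi_bounds(2)[OF b F(1) Fs])
    also have "\<dots> = ennreal (L * G\<^sup>2 * (2 * B\<^sup>2 + 2 * (L * (l2n lborel F)\<^sup>2)))"
      using G B L sqn_l2n[OF F(1)] by (simp add: ennreal_mult ennreal_plus)
    finally have "(cmod (Phi b F))\<^sup>2 \<le> L * G\<^sup>2 * (2 * B\<^sup>2 + 2 * (L * (l2n lborel F)\<^sup>2))"
      using L by (simp add: ennreal_power)
    also have "\<dots> \<le> L * G\<^sup>2 * (2 * B\<^sup>2 + 2 * (L * (C\<^sup>2 * (G\<^sup>2 * (L * B\<^sup>2)))))"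
      using F2 L by (intro mult_left_mono add_left_mono) auto
    also have "\<dots> = (K * B)\<^sup>2"
    proof -
      have "K\<^sup>2 = L * G\<^sup>2 * (2 + 2 * (L * (C\<^sup>2 * (G\<^sup>2 * L))))" unfolding K_def using L by (intro real_sqrt_pow2) auto
      then show ?thesis by (simp add: power_mult_distrib algebra_simps)
    qed
    finally have "(cmod (Phi b F))\<^sup>2 \<le> (K * B)\<^sup>2" .
    moreover have "K * B \<ge> 0" using B L by (simp add: K_def)
    ultimately show ?thesis unfolding B_def by (rule power2_le_imp_le)
  qed
  then show ?thesis by blast
qed

text \<open>Line integrals are additive on labels where both \<open>CN\<close> values are finite,
  which is almost every label; hence the almost everywhere form throughout. No support condition on
  the data is imposed, so differences of pairs are covered.\<close>

lemma admissible_lin: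
  assumes 1: "admissible b F" and 2: "admissible b' F'"
  shows "admissible (\<lambda>c. b c + r * b' c) (\<lambda>z. F z + r * F' z)"
    and "Phi (\<lambda>c. b c + r * b' c) (\<lambda>z. F z + r * F' z) = Phi b F + r * Phi b' F'"
proof -
  have b: "sqint lborel b" "sqint lborel b'" and F: "sqint lborel F" "sqint lborel F'" and q: "quad F" "quad F'"
    and eq: "AE z in lborel. F z = Gop (traj mix b F) z" "AE z in lborel. F' z = Gop (traj mix b' F') z"
    using 1 2 by (auto simp: admissible_def)
  note s = quad_strip[OF q(1)] quad_strip[OF q(2)]
  have [measurable]: "F \<in> borel_measurable (borel \<Otimes>\<^sub>M borel)" "F' \<in> borel_measurable (borel \<Otimes>\<^sub>M borel)" using F by measurable
  let ?b = "\<lambda>c. b c + r * b' c" and ?F = "\<lambda>z. F z + r * F' z"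
  have b3: "sqint lborel ?b" by (intro sqint_add sqint_scale b)
  have F3: "sqint lborel ?F" by (intro sqint_add sqint_scale F)
  have q3: "quad ?F" using q by (auto simp: quad_def)
  have t1: "sqint lborel (traj mix b F)" and t2: "sqint lborel (traj mix b' F')" and t3: "sqint lborel (traj mix ?b ?F)"
    by (intro sqint_traj(1)[OF bweight_mix] F s b F3 quad_strip[OF q3] b3)+
  have [measurable]: "traj mix b F \<in> borel_measurable (borel \<Otimes>\<^sub>M borel)" "traj mix b' F' \<in> borel_measurable (borel \<Otimes>\<^sub>M borel)"
    "traj mix ?b ?F \<in> borel_measurable (borel \<Otimes>\<^sub>M borel)" using t1 t2 t3 by measurable
  have sec: "AE y in lborel. traj mix ?b ?F (t, y) = traj mix b F (t, y) + r * traj mix b' F' (t, y)" for t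
    using AE_CN_section[OF F(1) s(1), of t] AE_CN_section[OF F(2) s(2), of t]
  proof eventually_elim
    case (elim y)
    have "integrable lborel (\<lambda>s. mix (t, s, t + y) * F (s, t + y - s))" "integrable lborel (\<lambda>s. mix (t, s, t + y) * F' (s, t + y - s))"
      by (rule integrable_char[OF _ _ _ elim(1)] integrable_char[OF _ _ _ elim(2)];
          use bweight_mix in \<open>auto simp: bweight_def\<close>)+
    then have "Rop mix ?F (t, y) = Rop mix F (t, y) + r * Rop mix F' (t, y)"
      unfolding Rop_def fst_conv snd_conv by (simp add: distrib_left mult.left_commute)
    then show ?case by (simp add: traj_def algebra_simps)
  qed
  have "Gop (traj mix ?b ?F) = Gop (\<lambda>z. traj mix b F z + r * traj mix b' F' z)"
  proof (rule Gop_cong_sections)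
    show "traj mix ?b ?F \<in> borel_measurable (borel \<Otimes>\<^sub>M borel)" by fact
    show "(\<lambda>z. traj mix b F z + r * traj mix b' F' z) \<in> borel_measurable (borel \<Otimes>\<^sub>M borel)" by measurable
    show "AE y in lborel. 0 < y \<longrightarrow> y < L \<longrightarrow> traj mix ?b ?F (t, y) = traj mix b F (t, y) + r * traj mix b' F' (t, y)" for t
      using sec[of t] by eventually_elim simp
  qed
  moreover have "AE z in lborel. Gop (\<lambda>z. traj mix b F z + r * traj mix b' F' z) z = Gop (traj mix b F) z + Gop (\<lambda>z. r * traj mix b' F' z) z"
    by (rule Gop_add[OF t1 sqint_scale[OF t2]])
  ultimately have "AE z in lborel. Gop (traj mix ?b ?F) z = Gop (traj mix b F) z + r * Gop (traj mix b' F') z"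
    by (simp add: Gop_scale)
  then have "AE z in lborel. ?F z = Gop (traj mix ?b ?F) z" using eq by eventually_elim simp
  with b3 F3 q3 show "admissible ?b ?F" by (simp add: admissible_def)
  have ae: "AE z in lborel. traj mix ?b ?F z = traj mix b F z + r * traj mix b' F' z"
  proof (rule AE_planeI)
    show "Measurable.pred (borel \<Otimes>\<^sub>M borel) (\<lambda>z. traj mix ?b ?F z = traj mix b F z + r * traj mix b' F' z)"
      by measurable
  qed (use sec in auto)
  have "Phi ?b ?F = (\<integral>z. g (L - fst z, snd z) * traj mix b F z + r * (g (L - fst z, snd z) * traj mix b' F' z) \<partial>lborel)"
    unfolding Phi_def
  proof (rule integral_cong_AE)
    show "AE z in lborel. g (L - fst z, snd z) * traj mix ?b ?F z = g (L - fst z, snd z) * traj mix b F z + r * (g (L - fst z, snd z) * traj mix b' F' z)"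
      using ae by eventually_elim (simp add: algebra_simps)
    show "(\<lambda>z. g (L - fst z, snd z) * traj mix ?b ?F z) \<in> borel_measurable lborel"
      using Phi_bounds(1)[OF b3 F3 quad_strip[OF q3]] by (rule borel_measurable_integrable)
    show "(\<lambda>z. g (L - fst z, snd z) * traj mix b F z + r * (g (L - fst z, snd z) * traj mix b' F' z)) \<in> borel_measurable lborel"
      using Phi_bounds(1)[OF b(1) F(1) s(1)] Phi_bounds(1)[OF b(2) F(2) s(2)] by (intro borel_measurable_integrable) auto
  qed
  also have "\<dots> = Phi b F + r * Phi b' F'"
    unfolding Phi_def using Phi_bounds(1)[OF b(1) F(1) s(1)] Phi_bounds(1)[OF b(2) F(2) s(2)] by simp
  finally show "Phi ?b ?F = Phi b F + r * Phi b' F'" .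
qed

text \<open>Fubini with s outermost: the inner integral is the source at the point (s, L - s), and
  the everywhere equation identifies it with F on that line, although the line is null.\<close>

lemma Phi_exact:
  assumes b: "sqint lborel b" and F: "sqint lborel F" "quad F" "F = Gop (traj mix b F)"
  shows "Phi b F = cI (\<lambda>s. 1) F L"
proof -
  have "integrable (lborel \<Otimes>\<^sub>M lborel) (case_prod (\<lambda>s y. g (L - s, y) * traj mix b F (s, y)))"
    using Phi_bounds(1)[OF b F(1) quad_strip[OF F(2)]] unfolding lborel_prod by (simp add: case_prod_unfold)
  from lborel_pair.integral_fst[OF this]
  have "Phi b F = (\<integral>s. \<integral>y. g (L - s, y) * traj mix b F (s, y) \<partial>lborel \<partial>lborel)"
    unfolding Phi_def lborel_prod by (simp add: case_prod_unfold)
  also have "\<dots> = (\<integral>s. Gop (traj mix b F) (s, L - s) \<partial>lborel)" by (simp add: Gop_def)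
  also have "\<dots> = cI (\<lambda>s. 1) F L" unfolding cI_def F(3)[symmetric] by simp
  finally show ?thesis .
qed

text \<open>The restart property: it makes the control at time $t$ a function of the state at time $t$ alone.\<close>
lemma shift_exact:
  assumes b: "sqint lborel b" "\<And>x. \<not> (0 < x \<and> x < L) \<Longrightarrow> b x = 0"
    and F: "sqint lborel F" "quad F" "F = Gop (traj mix b F)" and t: "0 < t" "t < L"
  defines "bt \<equiv> \<lambda>x. if 0 < x \<and> x < L then traj mix b F (t, x) else 0"
    and "Ft \<equiv> \<lambda>z. if 0 < fst z then F (t + fst z, snd z) else 0"
  shows "sqint lborel bt" "sqint lborel Ft" "quad Ft" "Ft = Gop (traj mix bt Ft)"
    "cI (\<lambda>s. 1) Ft L = cI (\<lambda>s. 1) F (L + t)"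
proof -
  note Fs = quad_strip[OF F(2)]
  have [measurable]: "b \<in> borel_measurable borel" using b by (simp add: sqint_def)
  have Fm[measurable]: "F \<in> borel_measurable (borel \<Otimes>\<^sub>M borel)" using F(1) by measurable
  have Vm[measurable]: "traj mix b F \<in> borel_measurable (borel \<Otimes>\<^sub>M borel)"
    using sqint_traj(1)[OF bweight_mix F(1) Fs b(1)] by measurable
  show bts: "sqint lborel bt"
  proof -
    have m: "bt \<in> borel_measurable borel" unfolding bt_def by measurable
    have "sqn lborel bt \<le> (\<integral>\<^sup>+x. 2 * (ennreal (cmod (b (t + x))))\<^sup>2 + 2 * (CN F (t + x))\<^sup>2 \<partial>lborel)"
      unfolding sqn_def
    proof (intro nn_integral_mono)
      fix x
      have "ennreal (cmod (bt x)) \<le> ennreal (cmod (b (t + x)) + cmod (Rop mix F (t, x)))"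
        by (intro ennreal_leI) (auto simp: bt_def traj_def norm_triangle_ineq)
      also have "\<dots> \<le> ennreal (cmod (b (t + x))) + CN F (t + x)"
        using Rop_le_CN[OF bweight_mix, of F t x] by (auto simp: ennreal_plus intro: add_left_mono)
      finally have "(ennreal (cmod (bt x)))\<^sup>2 \<le> (ennreal (cmod (b (t + x))) + CN F (t + x))\<^sup>2"
        by (intro power_mono) auto
      also have "\<dots> \<le> 2 * (ennreal (cmod (b (t + x))))\<^sup>2 + 2 * (CN F (t + x))\<^sup>2" by (rule ennreal_add_sq_le)
      finally show "(ennreal (cmod (bt x)))\<^sup>2 \<le> 2 * (ennreal (cmod (b (t + x))))\<^sup>2 + 2 * (CN F (t + x))\<^sup>2" .
    qed
    also have "\<dots> = (\<integral>\<^sup>+x. 2 * (ennreal (cmod (b x)))\<^sup>2 + 2 * (CN F x)\<^sup>2 \<partial>lborel)"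
      by (rule nn_shift(2)[of "\<lambda>x. 2 * (ennreal (cmod (b x)))\<^sup>2 + 2 * (CN F x)\<^sup>2"]) measurable
    also have "\<dots> = 2 * sqn lborel b + 2 * (\<integral>\<^sup>+c. (CN F c)\<^sup>2 \<partial>lborel)"
      by (simp add: nn_integral_add nn_integral_cmult sqn_def)
    also have "\<dots> \<le> 2 * sqn lborel b + 2 * (ennreal L * sqn lborel F)"
      by (intro add_left_mono mult_left_mono nn_CN_sq_strip[OF Fm Fs]) auto
    also have "\<dots> < top" using b F(1) by (simp add: sqint_def ennreal_mult_less_top)
    finally show ?thesis using m by (simp add: sqint_def)
  qed
  have Ftm[measurable]: "Ft \<in> borel_measurable (borel \<Otimes>\<^sub>M borel)" unfolding Ft_def by measurable
  show Fts: "sqint lborel Ft"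
  proof -
    have "sqn lborel Ft = (\<integral>\<^sup>+s. sqn lborel (\<lambda>x. Ft (s, x)) \<partial>lborel)" by (rule sqn_plane) measurable
    also have "\<dots> \<le> (\<integral>\<^sup>+s. sqn lborel (\<lambda>x. F (t + s, x)) \<partial>lborel)"
      by (intro nn_integral_mono sqn_mono) (auto simp: Ft_def)
    also have "\<dots> = (\<integral>\<^sup>+s. sqn lborel (\<lambda>x. F (s, x)) \<partial>lborel)"
      by (rule nn_shift(2)[of "\<lambda>s. sqn lborel (\<lambda>x. F (s, x))"]) (unfold sqn_def, measurable)
    also have "\<dots> = sqn lborel F" by (rule sqn_plane[symmetric]) measurable
    also have "\<dots> < top" using F(1) by (simp add: sqint_def)
    finally show ?thesis using Ftm unfolding borel_prod by (simp add: sqint_def)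
  qed
  show Ftq: "quad Ft" using F(2) t by (auto simp: quad_def Ft_def)
  have trm[measurable]: "traj mix bt Ft \<in> borel_measurable (borel \<Otimes>\<^sub>M borel)"
    using sqint_traj(1)[OF bweight_mix Fts quad_strip[OF Ftq] bts] by measurable
  have F0: "F (r, y) = 0" if "L \<le> r" for r y using F(2) that by (simp add: quad_def)
  have sec: "AE y in lborel. 0 < y \<longrightarrow> y < L \<longrightarrow> traj mix bt Ft (s, y) = traj mix b F (t + s, y)" if s: "0 < s" "s < L" for s
    using AE_CN_section[OF F(1) Fs, of "t + s"] AE_lborel_singleton[of "L - s"]
  proof eventually_elim
    case (elim y)
    show ?case
    proof (intro impI)
      assume y: "0 < y" "y < L"
      \<comment> \<open>\<open>c\<close> and \<open>e\<close> label the same characteristic, in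
        restarted and in original time.\<close>
      define c where "c = s + y"
      define e where "e = t + s + y"
      have ce: "c \<noteq> L" "e = t + c" using elim(2) by (auto simp: c_def e_def)
      have CNe: "CN F e < \<infinity>" using elim(1) by (simp add: e_def)
      \<comment> \<open>In the original time r, \<open>w1\<close> weighs the source in the restarted
        trajectory, \<open>w2\<close> in the state at time t and \<open>w3\<close> in the state at
        time t + s. For c < L one has w1 + w2 = w3 off r = t. For c > L the restarted data vanish
        and w1 = w3.\<close>
      define w1 :: "real \<Rightarrow> complex" where "w1 r = ((if r < t + s then 1 else 0) - (if L < c then 1 else 0)) * (if t < r then 1 else 0)" for r
      define w2 :: "real \<Rightarrow> complex" where "w2 r = (if r < t then 1 else 0) - (if L < e then 1 else 0)" for r
      define w3 :: "real \<Rightarrow> complex" where "w3 r = (if r < t + s then 1 else 0) - (if L < e then 1 else 0)" for r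
      have wm[measurable]: "w1 \<in> borel_measurable borel" "w2 \<in> borel_measurable borel" "w3 \<in> borel_measurable borel"
        unfolding w1_def[abs_def] w2_def[abs_def] w3_def[abs_def] by measurable
      have i1: "integrable lborel (\<lambda>r. w1 r * F (r, e - r))" and i2: "integrable lborel (\<lambda>r. w2 r * F (r, e - r))"
        by (rule integrable_char[OF Fm _ _ CNe]; auto simp: w1_def w2_def)+
      have R1: "Rop mix Ft (s, y) = cI w1 F e"
      proof -
        have "Rop mix Ft (s, y) = (\<integral>r. w1 (r + t) * F (r + t, e - (r + t)) \<partial>lborel)"
          unfolding Rop_def fst_conv snd_conv
          by (intro Bochner_Integration.integral_cong) (auto simp: mix_simp Ft_def w1_def c_def e_def algebra_simps)
        also have "\<dots> = cI w1 F e" unfolding cI_def by (rule integral_shift(1))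
        finally show ?thesis .
      qed
      have tr1: "traj mix bt Ft (s, y) = bt c + cI w1 F e" using s R1 by (simp add: traj_def c_def)
      have V2: "traj mix b F (t, c) = b e + cI w2 F e"
        using t ce by (simp add: traj_def Rop_def cI_def mix_simp w2_def)
      have V3: "traj mix b F (t + s, y) = (if t + s < L then b e + cI w3 F e else 0)"
        using t s by (simp add: traj_def Rop_def cI_def mix_simp w3_def e_def)
      \<comment> \<open>Beyond time L the trajectory formula itself gives zero: \<open>w3\<close>
        vanishes for r < t + s, and F vanishes for r \<ge> L. So continuation by zero is consistent
        with the fixed point equation.\<close>
      have late: "b e + cI w3 F e = 0" if "t + s \<ge> L"
      proof -
        have "L < e" using that y by (simp add: e_def)
        have z: "(\<lambda>r. w3 r * F (r, e - r)) = (\<lambda>r. 0)"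
        proof
          fix r
          show "w3 r * F (r, e - r) = 0"
            using that F0[of r "e - r"] \<open>L < e\<close> by (cases "r < t + s") (auto simp: w3_def)
        qed
        have "cI w3 F e = 0" unfolding cI_def z by simp
        then show ?thesis using b(2)[of e] \<open>L < e\<close> by simp
      qed
      have "bt c + cI w1 F e = b e + cI w3 F e"
      proof (cases "c < L")
        case True
        have "cI w1 F e + cI w2 F e = (\<integral>r. w1 r * F (r, e - r) + w2 r * F (r, e - r) \<partial>lborel)"
          unfolding cI_def using i1 i2 by simp
        also have "\<dots> = cI w3 F e"
          unfolding cI_def
        proof (rule integral_cong_AE)
          show "AE r in lborel. w1 r * F (r, e - r) + w2 r * F (r, e - r) = w3 r * F (r, e - r)"
            using AE_lborel_singleton[of t]
          proof eventually_elim
            case (elim r)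
            then have "w1 r + w2 r = w3 r" using True s by (auto simp: w1_def w2_def w3_def)
            then show ?case by (simp add: distrib_right[symmetric])
          qed
        qed measurable
        finally have "cI w1 F e + cI w2 F e = cI w3 F e" .
        moreover have "bt c = b e + cI w2 F e" using V2 True s y by (simp add: bt_def c_def)
        ultimately show ?thesis by (simp add: algebra_simps)
      next
        case False
        then have c: "L < c" "L < e" using ce t by auto
        have "w1 = w3" using c s by (auto simp: w1_def w3_def fun_eq_iff)
        moreover have "bt c = 0" "b e = 0" using c b(2)[of e] by (auto simp: bt_def)
        ultimately show ?thesis by simp
      qed
      then show "traj mix bt Ft (s, y) = traj mix b F (t + s, y)" using late by (simp add: tr1 V3)
    qed
  qed
  show "Ft = Gop (traj mix bt Ft)"
  proof (rule ext)
    fix z :: "real \<times> real"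
    obtain s x where z: "z = (s, x)" by (cases z)
    show "Ft z = Gop (traj mix bt Ft) z"
    proof (cases "0 < s \<and> s < L")
      case True
      have "Gop (traj mix bt Ft) (s, x) = Gop (\<lambda>z. traj mix b F (t + fst z, snd z)) (s, x)"
        by (rule Gop_section_cong) (use sec[of s] True in auto)
      also have "\<dots> = Gop (traj mix b F) (t + s, x)" by (simp add: Gop_def)
      also have "\<dots> = F (t + s, x)" using F(3) by simp
      finally show ?thesis using True by (simp add: z Ft_def)
    next
      case False
      then have "Gop (traj mix bt Ft) (s, x) = 0" using strip_Gop[OF strip_traj] by (auto simp: strip_def)
      moreover have "Ft (s, x) = 0" using False F0[of "t + s"] t by (auto simp: Ft_def)
      ultimately show ?thesis by (simp add: z)
    qed
  qed
  have "cI (\<lambda>s. 1) F (L + t) = (\<integral>s. 1 * F (s + t, L + t - (s + t)) \<partial>lborel)"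
    unfolding cI_def by (rule integral_shift(1)[of "\<lambda>r. 1 * F (r, L + t - r)", symmetric])
  also have "\<dots> = cI (\<lambda>s. 1) Ft L"
    unfolding cI_def
  proof (rule Bochner_Integration.integral_cong[OF refl])
    fix s
    have "F (s + t, L - s) = 0" if "\<not> 0 < s" using F(2) that by (simp add: quad_def)
    then show "1 * F (s + t, L + t - (s + t)) = 1 * Ft (s, L - s)" by (simp add: Ft_def add.commute)
  qed
  finally show "cI (\<lambda>s. 1) Ft L = cI (\<lambda>s. 1) F (L + t)" by simp
qed

text \<open>Unlike \<open>version\<close>, this also fixes the value 0 at the end points, as
  \<open>controlled_trajectory\<close> and \<open>shift_exact\<close> demand; initial and final data
  then occupy disjoint sets of labels.\<close>

definition repr :: "(real \<Rightarrow> complex) \<Rightarrow> (real \<Rightarrow> complex) \<Rightarrow> bool" where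
  "repr f b \<longleftrightarrow> version {0..L} f b \<and> (\<forall>x. \<not> (0 < x \<and> x < L) \<longrightarrow> b x = 0)"

lemma repr_exists:
  assumes "L2_on {0..L} f" shows "\<exists>b. repr f b"
proof -
  obtain f' where f': "version {0..L} f f'" using assms L2_on_version_iff[of "{0..L}" f] by auto
  have [measurable]: "f' \<in> borel_measurable borel" using f' by (simp add: version_def sqint_def)
  define b where "b x = (if 0 < x \<and> x < L then f' x else 0)" for x
  have "sqint lborel b"
  proof (rule sqint_mono)
    show "b \<in> borel_measurable lborel" unfolding b_def[abs_def] by measurable
    show "sqint lborel f'" using f' by (simp add: version_def)
  qed (auto simp: b_def)
  moreover have "AE x in lborel. x \<in> {0..L} \<longrightarrow> f x = f' x" using f' by (simp add: version_def)
  then have "AE x in lborel. x \<in> {0..L} \<longrightarrow> f x = b x"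
    using AE_lborel_singleton[of 0] AE_lborel_singleton[of L] by eventually_elim (auto simp: b_def)
  ultimately show ?thesis by (intro exI[of _ b]) (auto simp: repr_def version_def b_def)
qed

text \<open>The choice is immaterial under exact controllability, see \<open>Gam_eq\<close>; without it the predicate
  may be empty.\<close>
definition Gam :: "(real \<Rightarrow> complex) \<Rightarrow> complex" where
  "Gam f = - (case (SOME p. repr f (fst p) \<and> admissible (fst p) (snd p)) of (b, F) \<Rightarrow> Phi b F)"

lemma admissible_exact:
  assumes "sqint lborel b" "sqint lborel F" "quad F" "F = Gop (traj mix b F)"
  shows "admissible b F"
proof -
  have "F z = Gop (traj mix b F) z" for z by (rule fun_cong[OF assms(4)])
  then have "AE z in lborel. F z = Gop (traj mix b F) z" by (intro AE_I2)
  then show ?thesis unfolding admissible_def using assms(1,2,3) by blast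
qed

lemma admissible_exists:
  assumes ctrl: "exactly_controllable L (\<lambda>x y. g (x, y)) L" and b: "repr f b"
  shows "\<exists>F. admissible b F"
proof -
  have b': "sqint lborel b" "\<And>x. \<not> (0 < x \<and> x < L) \<Longrightarrow> b x = 0" using b by (auto simp: repr_def version_def)
  obtain F where "sqint lborel F" "quad F" "F = Gop (traj mix (\<lambda>c. b c + 0) F)"
    using controlled_trajectory[OF ctrl b' sqint_zero refl] by blast
  then show ?thesis using admissible_exact[OF b'(1)] by (intro exI[of _ F]) simp
qed

text \<open>Two pairs for the same f have data that agree almost everywhere. Their difference is an
  admissible pair with data of norm zero, and \<open>Phi_bounded\<close> forces its value to be
  zero.\<close>

lemma Gam_eq:
  assumes ctrl: "exactly_controllable L (\<lambda>x y. g (x, y)) L" and b: "repr f b" and F: "admissible b F"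
  shows "Gam f = - Phi b F"
proof -
  obtain K where K: "\<And>b F. admissible b F \<Longrightarrow> cmod (Phi b F) \<le> K * l2n lborel b"
    using Phi_bounded[OF ctrl] by blast
  define p where "p = (SOME p. repr f (fst p) \<and> admissible (fst p) (snd p))"
  have "repr f (fst p) \<and> admissible (fst p) (snd p)"
    unfolding p_def by (rule someI[of _ "(b, F)"]) (simp add: b F)
  then have p: "repr f (fst p)" "admissible (fst p) (snd p)" by auto
  have "AE x in lborel. b x + (- 1) * fst p x = 0"
  proof -
    have "AE x in lborel. x \<in> {0..L} \<longrightarrow> f x = b x" "AE x in lborel. x \<in> {0..L} \<longrightarrow> f x = fst p x"
      using b p by (auto simp: repr_def version_def)
    then show ?thesis
    proof eventually_elim
      case (elim x)
      then show ?case using b p by (cases "x \<in> {0..L}") (auto simp: repr_def version_def)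
    qed
  qed
  then have "sqn lborel (\<lambda>x. b x + (- 1) * fst p x) = sqn lborel (\<lambda>x::real. 0)" by (rule sqn_cong_AE)
  then have "l2n lborel (\<lambda>x. b x + (- 1) * fst p x) = 0" by (simp add: l2n_def)
  with K[OF admissible_lin(1)[OF F p(2), of "-1"]] admissible_lin(2)[OF F p(2), of "-1"]
  have "Phi b F + (- 1) * Phi (fst p) (snd p) = 0" by simp
  then show ?thesis by (simp add: Gam_def p_def[symmetric] case_prod_unfold)
qed

lemma repr_add: "repr f b \<Longrightarrow> repr h d \<Longrightarrow> repr (\<lambda>x. f x + h x) (\<lambda>x. b x + 1 * d x)"
  using version_add[of "{0..L}" f b h d] by (auto simp: repr_def)

text \<open>The form 0 + c b matches \<open>admissible_lin\<close>, applied to the zero pair and (b,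
  F).\<close>

lemma repr_scale: "repr f b \<Longrightarrow> repr (\<lambda>x. c * f x) (\<lambda>x. 0 + c * b x)"
  using version_scale[of "{0..L}" f b c] by (auto simp: repr_def)

lemma Phi_zero: "admissible (\<lambda>x. 0) (\<lambda>z. 0)" "Phi (\<lambda>x. 0) (\<lambda>z. 0) = 0"
proof -
  have "traj mix (\<lambda>x. 0) (\<lambda>z. 0) = (\<lambda>z. 0)" by (auto simp: traj_def Rop_def)
  then show "admissible (\<lambda>x. 0) (\<lambda>z. 0)" "Phi (\<lambda>x. 0) (\<lambda>z. 0) = 0"
    by (simp_all add: admissible_def Phi_def quad_def Gop_def)
qed

lemma bdd_lin_Gam:
  assumes ctrl: "exactly_controllable L (\<lambda>x y. g (x, y)) L"
  shows "bdd_lin_L2 L Gam"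
  unfolding bdd_lin_L2_def
proof (intro conjI allI impI)
  fix f h assume "L2_on {0..L} f \<and> L2_on {0..L} h"
  then obtain b d where b: "repr f b" and d: "repr h d" using repr_exists by blast
  obtain F G where F: "admissible b F" and G: "admissible d G" using admissible_exists[OF ctrl] b d by blast
  show "Gam (\<lambda>x. f x + h x) = Gam f + Gam h"
    using Gam_eq[OF ctrl repr_add[OF b d] admissible_lin(1)[OF F G]] Gam_eq[OF ctrl b F] Gam_eq[OF ctrl d G]
      admissible_lin(2)[OF F G, of 1] by simp
next
  fix c f assume "L2_on {0..L} f"
  then obtain b where b: "repr f b" using repr_exists by blast
  obtain F where F: "admissible b F" using admissible_exists[OF ctrl b] by blast
  show "Gam (\<lambda>x. c * f x) = c * Gam f"
    using Gam_eq[OF ctrl repr_scale[OF b] admissible_lin(1)[OF Phi_zero(1) F]] Gam_eq[OF ctrl b F]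
      admissible_lin(2)[OF Phi_zero(1) F, of c] Phi_zero(2) by simp
next
  obtain K where K: "\<And>b F. admissible b F \<Longrightarrow> cmod (Phi b F) \<le> K * l2n lborel b"
    using Phi_bounded[OF ctrl] by blast
  have "cmod (Gam f) \<le> K * L2_norm_on {0..L} f" if f: "L2_on {0..L} f" for f
  proof -
    obtain b where b: "repr f b" using repr_exists[OF f] by blast
    obtain F where F: "admissible b F" using admissible_exists[OF ctrl b] by blast
    have "L2_norm_on {0..L} f = l2n lborel b" using b version_L2_norm[of "{0..L}" f b] by (simp add: repr_def)
    then show ?thesis using Gam_eq[OF ctrl b F] K[OF F] by simp
  qed
  then show "\<exists>C. \<forall>f. L2_on {0..L} f \<longrightarrow> cmod (Gam f) \<le> C * L2_norm_on {0..L} f" by blast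
qed

end

section \<open>Extension of trajectories by zero\<close>

lemma weak_sol_cong_data:
  assumes "AE x in lborel. x \<in> {0..L} \<longrightarrow> u0 x = w0 x" "AE t in lborel. t \<in> {0..T} \<longrightarrow> U t = W t"
    and u: "weak_sol L g T u0 U u"
  shows "weak_sol L g T w0 W u"
proof -
  have 1: "integral\<^sup>L (lebesgue_on {0..L}) (\<lambda>x. u0 x * cnj (\<phi> 0 x)) = integral\<^sup>L (lebesgue_on {0..L}) (\<lambda>x. w0 x * cnj (\<phi> 0 x))" for \<phi> :: "real \<Rightarrow> real \<Rightarrow> complex"
  proof (rule lebesgue_on_integral_cong_AE)
    show "AE x in lborel. x \<in> {0..L} \<longrightarrow> u0 x * cnj (\<phi> 0 x) = w0 x * cnj (\<phi> 0 x)"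
      using assms(1) by eventually_elim simp
  qed simp
  have 2: "integral\<^sup>L (lebesgue_on {0..\<tau>}) (\<lambda>t. U t * cnj (\<phi> t L)) = integral\<^sup>L (lebesgue_on {0..\<tau>}) (\<lambda>t. W t * cnj (\<phi> t L))"
    if "\<tau> \<in> {0..T}" for \<tau> and \<phi> :: "real \<Rightarrow> real \<Rightarrow> complex"
  proof (rule lebesgue_on_integral_cong_AE)
    show "AE t in lborel. t \<in> {0..\<tau>} \<longrightarrow> U t * cnj (\<phi> t L) = W t * cnj (\<phi> t L)"
      using assms(2) by eventually_elim (use that in auto)
  qed simp
  show ?thesis using u unfolding weak_sol_def by (simp add: 1 2)
qed

text \<open>Both sides are integrals over the line of functions that differ at most at t = L, so
  \<open>f\<close> may be arbitrary.\<close>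

lemma integral_cut:
  fixes f :: "real \<Rightarrow> complex"
  shows "integral\<^sup>L (lebesgue_on {0..\<tau>}) (\<lambda>t. if t < L then f t else 0) = integral\<^sup>L (lebesgue_on {0..min \<tau> L}) f"
proof -
  have "integral\<^sup>L (lebesgue_on {0..\<tau>}) (\<lambda>t. if t < L then f t else 0) = integral\<^sup>L (lebesgue_on UNIV) (\<lambda>t. indicator {0..\<tau>} t *\<^sub>R (if t < L then f t else 0))"
    unfolding lebesgue_on_UNIV_eq by (rule integral_restrict_space) simp
  also have "\<dots> = integral\<^sup>L (lebesgue_on UNIV) (\<lambda>t. indicator {0..min \<tau> L} t *\<^sub>R f t)"
  proof (rule lebesgue_on_integral_cong_AE)
    show "AE t in lborel. t \<in> UNIV \<longrightarrow> indicator {0..\<tau>} t *\<^sub>R (if t < L then f t else 0) = indicator {0..min \<tau> L} t *\<^sub>R f t"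
      using AE_lborel_singleton[of L] by eventually_elim (auto split: split_indicator)
  qed simp
  also have "\<dots> = integral\<^sup>L (lebesgue_on {0..min \<tau> L}) f"
    unfolding lebesgue_on_UNIV_eq by (rule integral_restrict_space[symmetric]) simp
  finally show ?thesis .
qed

lemma C1_rect_restrict:
  assumes "C1_rect \<tau> L \<phi> \<phi>t \<phi>x" "\<sigma> \<le> \<tau>"
  shows "C1_rect \<sigma> L \<phi> \<phi>t \<phi>x"
proof -
  have sub: "{0..\<sigma>} \<times> {0..L} \<subseteq> {0..\<tau>} \<times> {0..L}" "{0..\<sigma>} \<subseteq> {0..\<tau>}" using assms(2) by auto
  show ?thesis using assms(1) sub unfolding C1_rect_def
    by (auto intro: continuous_on_subset has_vector_derivative_within_subset[OF _ sub(2)])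
qed

text \<open>Since u(L) = 0, the extended curve is continuous. For \<tau> > L every term of the weak
  identity reduces to its value at time L, where the final term vanishes, so the identity is the one
  at min \<tau> L.\<close>

lemma weak_sol_extend_zero:
  assumes L: "L > 0" and ws: "weak_sol L g L u0 U u" and fin: "AE x in lborel. x \<in> {0..L} \<longrightarrow> u L x = 0" and T: "T \<ge> 0"
  shows "weak_sol L g T u0 (\<lambda>t. if t < L then U t else 0) (\<lambda>t x. if t < L then u t x else 0)"
  unfolding weak_sol_def
proof (intro conjI ballI allI impI)
  have uC: "C0_L2 L L u" using ws by (simp add: weak_sol_def)
  obtain v where v: "joint_version L L u v" using joint_version_exists[OF _ uC] L by auto
  define w where "w t = (if t < L then (\<lambda>x. v (t, x)) else (\<lambda>x. 0))" for t
  have wv: "version {0..L} (\<lambda>x. if t < L then u t x else 0) (w t)" if "t \<in> {0..T}" for t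
    using v that by (auto simp: w_def joint_version_def version_def)
  have "continuous_on ({0..L} \<union> {L..}) (\<lambda>t. if t \<le> L then abs_l2 (\<lambda>x. v (t, x)) else 0)"
  proof (rule continuous_on_If)
    show "continuous_on {0..L} (\<lambda>t. abs_l2 (\<lambda>x. v (t, x)))" by (rule joint_version_continuous[OF v uC])
    show "abs_l2 (\<lambda>x. v (t, x)) = 0" if "t \<in> {L..}" "t \<le> L" for t
    proof -
      have t: "t = L" using that by auto
      have vv: "version {0..L} (u L) (\<lambda>x. v (L, x))" using v L by (auto simp: joint_version_def)
      then have "AE x in lborel. x \<in> {0..L} \<longrightarrow> u L x = v (L, x)" by (simp add: version_def)
      with fin have "AE x in lborel. v (L, x) = 0"
      proof eventually_elim
        case (elim x)
        then show ?case using vv by (cases "x \<in> {0..L}") (auto simp: version_def)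
      qed
      then show ?thesis using vv unfolding t zero_l2_def by (subst abs_l2_eq_iff) (auto simp: version_def)
    qed
  qed auto
  then have "continuous_on {0..T} (\<lambda>t. if t \<le> L then abs_l2 (\<lambda>x. v (t, x)) else 0)"
    by (rule continuous_on_subset) auto
  moreover have "(if t \<le> L then abs_l2 (\<lambda>x. v (t, x)) else 0) = abs_l2 (w t)" if "t \<in> {0..T}" for t
  proof (cases "t = L")
    case True
    have vv: "version {0..L} (u L) (\<lambda>x. v (L, x))" using v L by (auto simp: joint_version_def)
    then have "AE x in lborel. x \<in> {0..L} \<longrightarrow> u L x = v (L, x)" by (simp add: version_def)
    with fin have "AE x in lborel. v (L, x) = 0"
    proof eventually_elim
      case (elim x)
      then show ?case using vv by (cases "x \<in> {0..L}") (auto simp: version_def)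
    qed
    then have "abs_l2 (\<lambda>x. v (L, x)) = abs_l2 (\<lambda>x. 0)" using vv by (subst abs_l2_eq_iff) (auto simp: version_def)
    then show ?thesis using True by (simp add: w_def)
  qed (auto simp: w_def zero_l2_def)
  ultimately have "continuous_on {0..T} (\<lambda>t. abs_l2 (w t))" by (rule continuous_on_eq)
  then show "C0_L2 L T (\<lambda>t x. if t < L then u t x else 0)"
    using C0_L2_iff_continuous[of T L "\<lambda>t x. if t < L then u t x else 0" w] wv by blast
  fix \<tau> \<phi> \<phi>t \<phi>x assume \<tau>: "\<tau> \<in> {0..T}" and H: "C1_rect \<tau> L \<phi> \<phi>t \<phi>x \<and> (\<forall>t\<in>{0..\<tau>}. \<phi> t 0 = 0)"
  define \<sigma> where "\<sigma> = min \<tau> L"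
  have \<sigma>: "\<sigma> \<in> {0..L}" "\<sigma> \<le> \<tau>" using \<tau> L by (auto simp: \<sigma>_def)
  define X where "X t x = cnj (- \<phi>t t x + \<phi>x t x - integral\<^sup>L (lebesgue_on {0..L}) (\<lambda>y. cnj (g y x) * \<phi> t y))" for t x
  have "C1_rect \<sigma> L \<phi> \<phi>t \<phi>x \<and> (\<forall>t\<in>{0..\<sigma>}. \<phi> t 0 = 0)" using H C1_rect_restrict[OF _ \<sigma>(2)] \<sigma> by auto
  then have id: "integral\<^sup>L (lebesgue_on {0..\<sigma>}) (\<lambda>t. integral\<^sup>L (lebesgue_on {0..L}) (\<lambda>x. u t x * X t x))
       + integral\<^sup>L (lebesgue_on {0..L}) (\<lambda>x. u \<sigma> x * cnj (\<phi> \<sigma> x))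
       - integral\<^sup>L (lebesgue_on {0..L}) (\<lambda>x. u0 x * cnj (\<phi> 0 x))
       - integral\<^sup>L (lebesgue_on {0..\<sigma>}) (\<lambda>t. U t * cnj (\<phi> t L)) = 0"
    using ws \<sigma>(1) unfolding weak_sol_def X_def by blast
  have e1: "integral\<^sup>L (lebesgue_on {0..\<tau>}) (\<lambda>t. integral\<^sup>L (lebesgue_on {0..L}) (\<lambda>x. (if t < L then u t x else 0) * X t x))
      = integral\<^sup>L (lebesgue_on {0..\<sigma>}) (\<lambda>t. integral\<^sup>L (lebesgue_on {0..L}) (\<lambda>x. u t x * X t x))"
  proof -
    have "(\<lambda>t. integral\<^sup>L (lebesgue_on {0..L}) (\<lambda>x. (if t < L then u t x else 0) * X t x))
        = (\<lambda>t. if t < L then integral\<^sup>L (lebesgue_on {0..L}) (\<lambda>x. u t x * X t x) else 0)" by auto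
    then show ?thesis unfolding \<sigma>_def by (simp only: integral_cut)
  qed
  have e4: "integral\<^sup>L (lebesgue_on {0..\<tau>}) (\<lambda>t. (if t < L then U t else 0) * cnj (\<phi> t L))
      = integral\<^sup>L (lebesgue_on {0..\<sigma>}) (\<lambda>t. U t * cnj (\<phi> t L))"
  proof -
    have "(\<lambda>t. (if t < L then U t else 0) * cnj (\<phi> t L)) = (\<lambda>t. if t < L then U t * cnj (\<phi> t L) else 0)" by auto
    then show ?thesis unfolding \<sigma>_def by (simp only: integral_cut)
  qed
  have e2: "integral\<^sup>L (lebesgue_on {0..L}) (\<lambda>x. (if \<tau> < L then u \<tau> x else 0) * cnj (\<phi> \<tau> x)) = integral\<^sup>L (lebesgue_on {0..L}) (\<lambda>x. u \<sigma> x * cnj (\<phi> \<sigma> x))"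
  proof (cases "\<tau> < L")
    case True
    then show ?thesis by (simp add: \<sigma>_def)
  next
    case False
    then have "\<sigma> = L" by (simp add: \<sigma>_def)
    have "integral\<^sup>L (lebesgue_on {0..L}) (\<lambda>x. u L x * cnj (\<phi> L x)) = integral\<^sup>L (lebesgue_on {0..L}) (\<lambda>x. 0 :: complex)"
    proof (rule lebesgue_on_integral_cong_AE)
      show "AE x in lborel. x \<in> {0..L} \<longrightarrow> u L x * cnj (\<phi> L x) = 0" using fin by eventually_elim simp
    qed simp
    then show ?thesis using False \<open>\<sigma> = L\<close> by simp
  qed
  show "integral\<^sup>L (lebesgue_on {0..\<tau>}) (\<lambda>t. integral\<^sup>L (lebesgue_on {0..L}) (\<lambda>x. (if t < L then u t x else 0) *
           cnj (- \<phi>t t x + \<phi>x t x - integral\<^sup>L (lebesgue_on {0..L}) (\<lambda>y. cnj (g y x) * \<phi> t y))))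
       + integral\<^sup>L (lebesgue_on {0..L}) (\<lambda>x. (if \<tau> < L then u \<tau> x else 0) * cnj (\<phi> \<tau> x))
       - integral\<^sup>L (lebesgue_on {0..L}) (\<lambda>x. u0 x * cnj (\<phi> 0 x))
       - integral\<^sup>L (lebesgue_on {0..\<tau>}) (\<lambda>t. (if t < L then U t else 0) * cnj (\<phi> t L)) = 0"
    unfolding X_def[symmetric] e1 e2 e4 by (rule id)
qed

context transport
begin

lemma closed_loop_exists:
  assumes ctrl: "exactly_controllable L (\<lambda>x y. g (x, y)) L" and u0: "L2_on {0..L} u0"
  shows "\<exists>u. closed_loop_sol L (\<lambda>x y. g (x, y)) Gam u0 u \<and> (\<forall>t\<ge>L. \<forall>x. u t x = 0)"
proof -
  obtain b where b: "repr u0 b" using repr_exists[OF u0] by blast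
  have b': "sqint lborel b" "\<And>x. \<not> (0 < x \<and> x < L) \<Longrightarrow> b x = 0"
    and bae: "AE x in lborel. x \<in> {0..L} \<longrightarrow> b x = u0 x"
    using b by (auto simp: repr_def version_def)
  obtain U u v F where ws: "weak_sol L (\<lambda>x y. g (x, y)) L b U u"
    and fin: "AE x in lborel. x \<in> {0..L} \<longrightarrow> u L x = 0" and v: "joint_version L L u v"
    and F: "sqint lborel F" "quad F" "F = Gop (traj mix (\<lambda>c. b c + 0) F)"
    and tr: "\<forall>t. 0 < t \<longrightarrow> t < L \<longrightarrow> (AE x in lborel. 0 < x \<longrightarrow> x < L \<longrightarrow> v (t, x) = traj mix (\<lambda>c. b c + 0) F (t, x))"
    and U: "AE t in lborel. 0 < t \<longrightarrow> t < L \<longrightarrow> U t = 0 - cI (\<lambda>s. 1) F (L + t)"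
    using controlled_trajectory[OF ctrl b' sqint_zero refl] by blast
  have F3: "F = Gop (traj mix b F)" using F(3) by simp
  \<comment> \<open>The restarted pair is an exact fixed point with data u(t), so \<open>Gam\<close>
    is minus its line integral over the label L. In original time this is the label L + t, and the
    value is the one found for U(t).\<close>
  have feedback: "Gam (u t) = - cI (\<lambda>s. 1) F (L + t)" if t: "0 < t" "t < L" for t
  proof -
    define bt where "bt = (\<lambda>x. if 0 < x \<and> x < L then traj mix b F (t, x) else 0)"
    define Ft where "Ft = (\<lambda>z. if 0 < fst z then F (t + fst z, snd z) else 0)"
    note S = shift_exact[OF b' F(1,2) F3 t, folded bt_def Ft_def]
    have tv: "AE x in lborel. 0 < x \<longrightarrow> x < L \<longrightarrow> v (t, x) = traj mix b F (t, x)" using tr t by simp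
    have "AE x in lborel. x \<in> {0..L} \<longrightarrow> u t x = v (t, x)"
      using v t by (auto simp: joint_version_def version_def)
    then have "AE x in lborel. x \<in> {0..L} \<longrightarrow> u t x = bt x"
      using tv AE_lborel_singleton[of 0] AE_lborel_singleton[of L]
      by eventually_elim (auto simp: bt_def)
    then have r: "repr (u t) bt" using S(1) by (auto simp: repr_def version_def bt_def)
    show ?thesis
      using Gam_eq[OF ctrl r admissible_exact[OF S(1-4)]] Phi_exact[OF S(1-4)] S(5) by simp
  qed
  have Gam0: "Gam (\<lambda>x. 0) = 0"
  proof -
    have "L2_on {0..L} (\<lambda>x. 0)" using continuous_L2_on[of L "\<lambda>x. 0"] by simp
    then have "Gam (\<lambda>x. 0 * 0) = 0 * Gam (\<lambda>x. 0)" using bdd_lin_Gam[OF ctrl] unfolding bdd_lin_L2_def by blast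
    then show ?thesis by simp
  qed
  define w where "w = (\<lambda>t x. if t < L then u t x else 0)"
  have "weak_sol L (\<lambda>x y. g (x, y)) T u0 (\<lambda>t. Gam (w t)) w" if T: "T \<ge> 0" for T
  proof (rule weak_sol_cong_data[OF bae])
    show "weak_sol L (\<lambda>x y. g (x, y)) T b (\<lambda>t. if t < L then U t else 0) w"
      unfolding w_def by (rule weak_sol_extend_zero[OF L ws fin T])
    show "AE t in lborel. t \<in> {0..T} \<longrightarrow> (if t < L then U t else 0) = Gam (w t)"
      using U AE_lborel_singleton[of 0]
    proof eventually_elim
      case (elim t)
      show ?case
      proof
        assume t: "t \<in> {0..T}"
        show "(if t < L then U t else 0) = Gam (w t)"
        proof (cases "t < L")
          case True
          then have "w t = u t" by (auto simp: w_def)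
          then show ?thesis using True elim t feedback[of t] by auto
        next
          case False
          then have "w t = (\<lambda>x. 0)" by (auto simp: w_def)
          then show ?thesis using False Gam0 by simp
        qed
      qed
    qed
  qed
  then show ?thesis by (intro exI[of _ w]) (auto simp: closed_loop_sol_def w_def)
qed

end

section \<open>Exact controllability implies finite time stabilizability\<close>

text \<open>Evaluate the inequality at a maximum point of e^(-l t) N(t). With l = A + 1 > A the
  integral gains a factor 1/l, and the inequality can hold only if the maximum is zero.\<close>

lemma gronwall_zero:
  fixes N :: "real \<Rightarrow> real"
  assumes N: "continuous_on {0..T} N" "\<And>t. t \<in> {0..T} \<Longrightarrow> 0 \<le> N t" and A: "A \<ge> 0"
    and le: "\<And>t. t \<in> {0..T} \<Longrightarrow> ennreal (N t) \<le> ennreal A * (\<integral>\<^sup>+s. ennreal (N s) * indicator {0..t} s \<partial>lborel)"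
    and t: "t \<in> {0..T}"
  shows "N t = 0"
proof -
  define l where "l = A + 1"
  have l: "l > 0" using A by (simp add: l_def)
  have "continuous_on {0..T} (\<lambda>t. exp (- l * t) * N t)" by (intro continuous_intros N)
  then obtain \<tau> where \<tau>: "\<tau> \<in> {0..T}" and mx: "\<And>s. s \<in> {0..T} \<Longrightarrow> exp (- l * s) * N s \<le> exp (- l * \<tau>) * N \<tau>"
    using continuous_attains_sup[of "{0..T}" "\<lambda>t. exp (- l * t) * N t"] t by auto
  define M where "M = exp (- l * \<tau>) * N \<tau>"
  have M0: "M \<ge> 0" using N(2)[OF \<tau>] by (simp add: M_def)
  have Nle: "N s \<le> M * exp (l * s)" if "s \<in> {0..T}" for s
    using mx[OF that] by (simp add: M_def exp_minus field_simps)
  have "(\<integral>\<^sup>+s. ennreal (N s) * indicator {0..\<tau>} s \<partial>lborel) \<le> (\<integral>\<^sup>+s. ennreal (M * exp (l * s)) * indicator {0..\<tau>} s \<partial>lborel)"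
    using \<tau> Nle by (intro nn_integral_mono) (auto intro!: ennreal_leI split: split_indicator)
  also have "\<dots> = ennreal (M * exp (l * \<tau>) / l - M * exp (l * 0) / l)"
    using \<tau> l M0 by (intro nn_integral_FTC_Icc) (auto intro!: derivative_eq_intros)
  finally have "ennreal (N \<tau>) \<le> ennreal A * ennreal (M * exp (l * \<tau>) / l - M * exp (l * 0) / l)"
    using le[OF \<tau>] by (meson mult_left_mono order_trans zero_le)
  also have "\<dots> = ennreal (A * (M * exp (l * \<tau>) / l - M * exp (l * 0) / l))" using A by (simp add: ennreal_mult')
  finally have "N \<tau> \<le> A * (M * exp (l * \<tau>) / l - M * exp (l * 0) / l)"
  proof (subst (asm) ennreal_le_iff)
    have "M * 1 \<le> M * exp (l * \<tau>)" using \<tau> l M0 by (intro mult_left_mono) auto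
    then show "0 \<le> A * (M * exp (l * \<tau>) / l - M * exp (l * 0) / l)"
      using A l by (intro mult_nonneg_nonneg) (auto simp: divide_simps)
  qed
  moreover have "N \<tau> = M * exp (l * \<tau>)" by (simp add: M_def exp_minus)
  ultimately have "l * (M * exp (l * \<tau>)) \<le> A * (M * exp (l * \<tau>) - M)" using l by (simp add: field_simps)
  moreover have "0 \<le> A * M" using A M0 by simp
  ultimately have "M * exp (l * \<tau>) \<le> 0" by (simp add: l_def algebra_simps)
  then have "M \<le> 0" by (simp add: mult_le_0_iff)
  then have "N t \<le> 0" using Nle[OF t] M0 by simp
  then show ?thesis using N(2)[OF t] by simp
qed

context transport
begin

text \<open>With zero initial state the mild formulation leaves a boundary part, bounded through the
  feedback by the state norm, and a source part, bounded by the kernel.\<close>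

lemma feedback_energy_estimate:
  assumes \<Gamma>: "\<And>f. L2_on {0..L} f \<Longrightarrow> cmod (\<Gamma> f) \<le> C * L2_norm_on {0..L} f" and C: "C \<ge> 0"
    and \<Gamma>L: "L2_on {0..T} (\<lambda>t. \<Gamma> (z t))" and T: "T \<ge> 0"
    and ws: "weak_sol L (\<lambda>x y. g (x, y)) T (\<lambda>x. 0) (\<lambda>t. \<Gamma> (z t)) z" and v: "joint_version L T z v"
    and \<tau>: "\<tau> \<in> {0..T}"
  shows "sqn lborel (\<lambda>x. v (\<tau>, x)) \<le> (2 * ennreal (C\<^sup>2) + 2 * (ennreal T * sqn lborel g))
      * (\<integral>\<^sup>+s. sqn lborel (\<lambda>x. v (s, x)) * indicator {0..\<tau>} s \<partial>lborel)"
proof -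
  have vm[measurable]: "v \<in> borel_measurable (borel \<Otimes>\<^sub>M borel)" using v by (simp add: joint_version_def)
  have v0: "v (s, x) = 0" if "\<not> (0 \<le> s \<and> s \<le> T \<and> 0 \<le> x \<and> x \<le> L)" for s x
    using v that by (simp add: joint_version_def)
  have nm[measurable]: "(\<lambda>s. sqn lborel (\<lambda>x. v (s, x))) \<in> borel_measurable borel" unfolding sqn_def by measurable
  have zL: "L2_on {0..L} (z t)" if "t \<in> {0..T}" for t using ws that by (simp add: weak_sol_def C0_L2_def)
  obtain U where U: "version {0..T} (\<lambda>t. \<Gamma> (z t)) U" using \<Gamma>L L2_on_version_iff[of "{0..T}"] by auto
  have Um[measurable]: "U \<in> borel_measurable borel" using U by (simp add: version_def sqint_def)
  have 00: "version {0..L} (\<lambda>x. 0) (\<lambda>x. 0)" by (simp add: version_def)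
  define w :: "real \<Rightarrow> complex" where "w = indicator {..<\<tau>}"
  \<comment> \<open>Source and control are cut off after \<tau>. For 0 < x < L this changes nothing
    in the formula, and it leaves only the energy up to \<tau> on the right, as the Gronwall
    argument requires.\<close>
  define F where "F = (\<lambda>z. if fst z \<le> \<tau> then Gop v z else 0)"
  define V where "V = (\<lambda>s. if s \<le> \<tau> then U s else 0)"
  have Fm[measurable]: "F \<in> borel_measurable (borel \<Otimes>\<^sub>M borel)" unfolding F_def by measurable
  have wm[measurable]: "w \<in> borel_measurable borel" unfolding w_def by measurable
  have Vm[measurable]: "V \<in> borel_measurable borel" unfolding V_def by measurable
  have mild: "AE x in lborel. 0 < x \<longrightarrow> x < L \<longrightarrow> v (\<tau>, x) = V (\<tau> - L + x) + cI w F (\<tau> + x)"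
    using weak_sol_mild[OF T ws 00 U v \<tau>]
  proof eventually_elim
    case (elim x)
    have "(\<integral>s. indicator {..<\<tau>} s * Gop v (s, \<tau> + x - s) \<partial>lborel) = cI w F (\<tau> + x)"
      unfolding cI_def by (intro Bochner_Integration.integral_cong) (auto simp: w_def F_def split: split_indicator)
    then show ?case using elim by (auto simp: V_def algebra_simps)
  qed
  have "sqn lborel (\<lambda>x. v (\<tau>, x)) \<le> (\<integral>\<^sup>+x. 2 * (ennreal (cmod (V (\<tau> - L + x))))\<^sup>2 + 2 * (ennreal (cmod (cI w F (\<tau> + x))))\<^sup>2 \<partial>lborel)"
    unfolding sqn_def
  proof (rule nn_integral_mono_AE)
    show "AE x in lborel. (ennreal (cmod (v (\<tau>, x))))\<^sup>2 \<le> 2 * (ennreal (cmod (V (\<tau> - L + x))))\<^sup>2 + 2 * (ennreal (cmod (cI w F (\<tau> + x))))\<^sup>2"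
      using mild AE_lborel_singleton[of 0] AE_lborel_singleton[of L]
    proof eventually_elim
      case (elim x)
      show ?case
      proof (cases "0 < x \<and> x < L")
        case True
        then have "ennreal (cmod (v (\<tau>, x))) \<le> ennreal (cmod (V (\<tau> - L + x)) + cmod (cI w F (\<tau> + x)))"
          using elim(1) by (intro ennreal_leI) (simp add: norm_triangle_ineq)
        also have "\<dots> = ennreal (cmod (V (\<tau> - L + x))) + ennreal (cmod (cI w F (\<tau> + x)))" by (simp add: ennreal_plus)
        finally have "(ennreal (cmod (v (\<tau>, x))))\<^sup>2 \<le> (ennreal (cmod (V (\<tau> - L + x))) + ennreal (cmod (cI w F (\<tau> + x))))\<^sup>2"
          by (intro power_mono) auto
        also note ennreal_add_sq_le
        finally show ?thesis .
      next
        case False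
        then have "v (\<tau>, x) = 0" using elim by (intro v0) auto
        then show ?thesis by simp
      qed
    qed
  qed
  also have "\<dots> = 2 * (\<integral>\<^sup>+x. (ennreal (cmod (V (\<tau> - L + x))))\<^sup>2 \<partial>lborel) + 2 * (\<integral>\<^sup>+x. (ennreal (cmod (cI w F (\<tau> + x))))\<^sup>2 \<partial>lborel)"
    by (simp add: nn_integral_add nn_integral_cmult)
  also have "(\<integral>\<^sup>+x. (ennreal (cmod (V (\<tau> - L + x))))\<^sup>2 \<partial>lborel) = sqn lborel V"
    unfolding sqn_def by (rule nn_shift(2)[of "\<lambda>x. (ennreal (cmod (V x)))\<^sup>2"]) measurable
  also have "(\<integral>\<^sup>+x. (ennreal (cmod (cI w F (\<tau> + x))))\<^sup>2 \<partial>lborel) = sqn lborel (cI w F)"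
    unfolding sqn_def by (rule nn_shift(2)[of "\<lambda>x. (ennreal (cmod (cI w F x)))\<^sup>2"]) measurable
  finally have 1: "sqn lborel (\<lambda>x. v (\<tau>, x)) \<le> 2 * sqn lborel V + 2 * sqn lborel (cI w F)" .
  let ?E = "\<integral>\<^sup>+s. sqn lborel (\<lambda>x. v (s, x)) * indicator {0..\<tau>} s \<partial>lborel"
  have 2: "sqn lborel V \<le> ennreal (C\<^sup>2) * ?E"
  proof -
    have "sqn lborel V \<le> (\<integral>\<^sup>+s. ennreal (C\<^sup>2) * (sqn lborel (\<lambda>x. v (s, x)) * indicator {0..\<tau>} s) \<partial>lborel)"
      unfolding sqn_def[of _ V]
    proof (rule nn_integral_mono_AE)
      have "AE t in lborel. t \<in> {0..T} \<longrightarrow> \<Gamma> (z t) = U t" using U by (simp add: version_def)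
      then show "AE s in lborel. (ennreal (cmod (V s)))\<^sup>2 \<le> ennreal (C\<^sup>2) * (sqn lborel (\<lambda>x. v (s, x)) * indicator {0..\<tau>} s)"
      proof eventually_elim
        case (elim s)
        show ?case
        proof (cases "s \<in> {0..\<tau>}")
          case True
          then have s: "s \<in> {0..T}" using \<tau> by auto
          then have vv: "version {0..L} (z s) (\<lambda>x. v (s, x))" using v by (simp add: joint_version_def)
          have "cmod (V s) \<le> C * l2n lborel (\<lambda>x. v (s, x))"
            using \<Gamma>[OF zL[OF s]] version_L2_norm[OF _ vv] elim s True by (simp add: V_def)
          then have "(cmod (V s))\<^sup>2 \<le> (C * l2n lborel (\<lambda>x. v (s, x)))\<^sup>2" by (intro power_mono) auto
          then have "ennreal ((cmod (V s))\<^sup>2) \<le> ennreal (C\<^sup>2 * (l2n lborel (\<lambda>x. v (s, x)))\<^sup>2)"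
            by (intro ennreal_leI) (simp add: power_mult_distrib)
          also have "\<dots> = ennreal (C\<^sup>2) * sqn lborel (\<lambda>x. v (s, x))"
            using vv by (subst sqn_l2n) (auto simp: version_def ennreal_mult)
          finally show ?thesis using True by (simp add: ennreal_power)
        next
          case False
          then have "V s = 0" using U by (auto simp: V_def version_def)
          then show ?thesis by simp
        qed
      qed
    qed
    then show ?thesis by (simp add: nn_integral_cmult)
  qed
  have 3: "sqn lborel (cI w F) \<le> ennreal T * (sqn lborel g * ?E)"
  proof -
    have neg: "F (s, x) = 0" if "s \<notin> {0..\<tau>}" for s x
      using that v0[of s] by (auto simp: F_def Gop_def)
    have "sqn lborel (cI w F) \<le> ennreal T * sqn lborel F"
    proof (rule sqn_cI_le[where I="{0..\<tau>}"])
      show "emeasure lborel {0..\<tau>} \<le> ennreal T" using \<tau> by (simp add: ennreal_leI)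
      show "w s * F (s, x) = 0" if "s \<notin> {0..\<tau>}" for s x using neg[OF that] by simp
    qed (auto simp: w_def split: split_indicator)
    also have "sqn lborel F = (\<integral>\<^sup>+s. sqn lborel (\<lambda>x. F (s, x)) \<partial>lborel)" by (rule sqn_plane) measurable
    also have "\<dots> \<le> (\<integral>\<^sup>+s. sqn lborel g * (sqn lborel (\<lambda>x. v (s, x)) * indicator {0..\<tau>} s) \<partial>lborel)"
    proof (rule nn_integral_mono)
      fix s
      show "sqn lborel (\<lambda>x. F (s, x)) \<le> sqn lborel g * (sqn lborel (\<lambda>x. v (s, x)) * indicator {0..\<tau>} s)"
      proof (cases "s \<in> {0..\<tau>}")
        case True
        then show ?thesis using Gop_section_le[OF vm, of s] by (simp add: F_def)
      next
        case False
        then show ?thesis using neg[OF False] by (simp add: sqn_def)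
      qed
    qed
    also have "\<dots> = sqn lborel g * ?E" by (simp add: nn_integral_cmult)
    finally show ?thesis by (simp add: mult_left_mono)
  qed
  have "sqn lborel (\<lambda>x. v (\<tau>, x)) \<le> 2 * (ennreal (C\<^sup>2) * ?E) + 2 * (ennreal T * (sqn lborel g * ?E))"
    by (rule order_trans[OF 1]) (intro add_mono mult_left_mono 2 3, auto)
  then show ?thesis by (simp add: algebra_simps)
qed

lemma feedback_unique:
  assumes \<Gamma>: "bdd_lin_L2 L \<Gamma>" and T: "T \<ge> 0"
    and ws: "weak_sol L (\<lambda>x y. g (x, y)) T (\<lambda>x. 0) (\<lambda>t. \<Gamma> (z t)) z" and t: "t \<in> {0..T}"
  shows "AE x in lborel. x \<in> {0..L} \<longrightarrow> z t x = 0"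
proof -
  have zC: "C0_L2 L T z" using ws by (simp add: weak_sol_def)
  obtain v where v: "joint_version L T z v" using joint_version_exists[OF T zC] by blast
  obtain C0 where C0: "\<And>f. L2_on {0..L} f \<Longrightarrow> cmod (\<Gamma> f) \<le> C0 * L2_norm_on {0..L} f"
    using \<Gamma> unfolding bdd_lin_L2_def by blast
  have C: "cmod (\<Gamma> f) \<le> \<bar>C0\<bar> * L2_norm_on {0..L} f" if "L2_on {0..L} f" for f
    by (rule order_trans[OF C0[OF that]]) (intro mult_right_mono, auto simp: L2_norm_on_def)
  have \<Gamma>L: "L2_on {0..T} (\<lambda>t. \<Gamma> (z t))" by (rule continuous_L2_on[OF bdd_lin_L2_continuous[OF \<Gamma> zC]])
  define G where "G = enn2real (sqn lborel g)"
  have G: "sqn lborel g = ennreal G" "G \<ge> 0" using g by (auto simp: G_def sqint_def ennreal_enn2real)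
  define A where "A = 2 * \<bar>C0\<bar>\<^sup>2 + 2 * (T * G)"
  have A0: "A \<ge> 0" using T G by (simp add: A_def)
  have Aeq: "2 * ennreal (\<bar>C0\<bar>\<^sup>2) + 2 * (ennreal T * sqn lborel g) = ennreal A"
    using T G(2) unfolding A_def G(1) by (simp add: ennreal_plus ennreal_mult)
  define N where "N t = (norm (abs_l2 (\<lambda>x. v (t, x))))\<^sup>2" for t
  have vs: "sqint lborel (\<lambda>x. v (s, x))" if "s \<in> {0..T}" for s
    using v that by (auto simp: joint_version_def version_def)
  have Neq: "sqn lborel (\<lambda>x. v (s, x)) = ennreal (N s)" if "s \<in> {0..T}" for s
    using vs[OF that] by (simp add: N_def norm_abs_l2 sqn_l2n)
  have "N t = 0"
  proof (rule gronwall_zero[OF _ _ A0 _ t])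
    show "continuous_on {0..T} N" unfolding N_def
      by (intro continuous_intros joint_version_continuous[OF v zC])
    show "0 \<le> N t" for t by (simp add: N_def)
    fix \<tau> assume \<tau>: "\<tau> \<in> {0..T}"
    have "(\<integral>\<^sup>+s. sqn lborel (\<lambda>x. v (s, x)) * indicator {0..\<tau>} s \<partial>lborel) = (\<integral>\<^sup>+s. ennreal (N s) * indicator {0..\<tau>} s \<partial>lborel)"
      using \<tau> Neq by (intro nn_integral_cong) (auto split: split_indicator)
    then show "ennreal (N \<tau>) \<le> ennreal A * (\<integral>\<^sup>+s. ennreal (N s) * indicator {0..\<tau>} s \<partial>lborel)"
      using feedback_energy_estimate[OF C _ \<Gamma>L T ws v \<tau>] unfolding Aeq Neq[OF \<tau>] by simp
  qed
  then have "abs_l2 (\<lambda>x. v (t, x)) = abs_l2 (\<lambda>x. 0)" by (simp add: N_def zero_l2_def)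
  then have "AE x in lborel. v (t, x) = 0" using vs[OF t] by (simp add: abs_l2_eq_iff)
  moreover have "AE x in lborel. x \<in> {0..L} \<longrightarrow> z t x = v (t, x)" using v t by (auto simp: joint_version_def version_def)
  ultimately show ?thesis by eventually_elim auto
qed

text \<open>The definition asks that every closed-loop solution vanish from time L on. The
  difference between an arbitrary one and the constructed one is a closed-loop solution with zero
  initial state.\<close>

lemma controllable_imp_stabilizable:
  assumes ctrl: "exactly_controllable L (\<lambda>x y. g (x, y)) L"
  shows "stabilizable_finite_time L (\<lambda>x y. g (x, y)) L"
  unfolding stabilizable_finite_time_def
proof (intro exI[of _ Gam] conjI allI impI)
  show \<Gamma>: "bdd_lin_L2 L Gam" by (rule bdd_lin_Gam[OF ctrl])
  fix u0 assume u0: "L2_on {0..L} u0"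
  obtain u where u: "closed_loop_sol L (\<lambda>x y. g (x, y)) Gam u0 u" and u_end: "\<And>t x. t \<ge> L \<Longrightarrow> u t x = 0"
    using closed_loop_exists[OF ctrl u0] by blast
  then show "\<exists>u. closed_loop_sol L (\<lambda>x y. g (x, y)) Gam u0 u" by blast
  fix w t assume w: "closed_loop_sol L (\<lambda>x y. g (x, y)) Gam u0 w" and t: "L \<le> t"
  have t0: "t \<ge> 0" using t L by simp
  have us: "weak_sol L (\<lambda>x y. g (x, y)) t u0 (\<lambda>t. Gam (u t)) u" and wws: "weak_sol L (\<lambda>x y. g (x, y)) t u0 (\<lambda>t. Gam (w t)) w"
    using u w t0 by (auto simp: closed_loop_sol_def)
  have uC: "C0_L2 L t u" and wC: "C0_L2 L t w" using us wws by (auto simp: weak_sol_def)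
  have sec: "L2_on {0..L} (u s)" "L2_on {0..L} (w s)" if "s \<in> {0..t}" for s using uC wC that by (auto simp: C0_L2_def)
  have cu: "L2_on {0..t} (\<lambda>s. Gam (u s))" "L2_on {0..t} (\<lambda>s. Gam (w s))"
    by (rule continuous_L2_on[OF bdd_lin_L2_continuous[OF \<Gamma> uC]], rule continuous_L2_on[OF bdd_lin_L2_continuous[OF \<Gamma> wC]])
  define z where "z = (\<lambda>t x. w t x + (- 1) *\<^sub>R u t x)"
  have "weak_sol L (\<lambda>x y. g (x, y)) t (\<lambda>x. 0) (\<lambda>s. Gam (z s)) z"
  proof (rule weak_sol_cong_data)
    show "weak_sol L (\<lambda>x y. g (x, y)) t (\<lambda>x. u0 x + (- 1) *\<^sub>R u0 x) (\<lambda>s. Gam (w s) + (- 1) *\<^sub>R Gam (u s)) z"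
      unfolding z_def by (rule weak_sol_lin[OF t0 wws u0 cu(2) us u0 cu(1)])
    show "AE s in lborel. s \<in> {0..t} \<longrightarrow> Gam (w s) + (- 1) *\<^sub>R Gam (u s) = Gam (z s)"
      using bdd_lin_L2_diff[OF \<Gamma> sec(2) sec(1)] by (intro AE_I2) (simp add: z_def)
  qed simp
  then have "AE x in lborel. x \<in> {0..L} \<longrightarrow> z t x = 0"
    by (rule feedback_unique[OF \<Gamma> t0]) (use t0 in simp)
  then show "AE x in lebesgue_on {0..L}. w t x = 0"
    by (simp add: AE_lebesgue_on_iff z_def u_end[OF t])
qed

end

theorem theorem1:
  fixes L :: real and g :: "real \<Rightarrow> real \<Rightarrow> complex"
  assumes "L > 0"
    and "L2_on ({0<..<L} \<times> {0<..<L}) (\<lambda>(x, y). g x y)"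
    and "H1_on (tri_minus L) (\<lambda>(x, y). g x y)"
    and "H1_on (tri_plus L) (\<lambda>(x, y). g x y)"
  shows "stabilizable_finite_time L g L \<longleftrightarrow> exactly_controllable L g L"
proof -
  let ?S = "{0<..<L} \<times> {0<..<L}"
  have "?S \<in> sets borel" by (intro borel_open open_Times) auto
  then obtain h where h: "version ?S (\<lambda>(x, y). g x y) h" using assms(2) L2_on_version_iff[of ?S] by blast
  have 0: "z \<notin> ?S \<Longrightarrow> h z = 0" for z using h unfolding version_def by blast
  interpret transport L h
  proof
    show "L > 0" by (rule assms(1))
    show "sqint lborel h" using h by (simp add: version_def)
    show "h (x, y) = 0" if "\<not> (0 < x \<and> x < L \<and> 0 < y \<and> y < L)" for x y using 0[of "(x, y)"] that by auto
  qed
  have "AE z in lborel. z \<in> ?S \<longrightarrow> (case z of (x, y) \<Rightarrow> g x y) = h z" using h by (simp add: version_def)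
  \<comment> \<open>The first argument is the inner variable here, because the weak formulation
    integrates the kernel over it.\<close>
  from AE_plane_snd[OF this]
  have "AE x in lborel. 0 < x \<longrightarrow> x < L \<longrightarrow> (AE y in lborel. 0 < y \<longrightarrow> y < L \<longrightarrow> g y x = h (y, x))"
  proof eventually_elim
    case (elim x)
    show ?case
    proof (intro impI)
      assume x: "0 < x" "x < L"
      from elim show "AE y in lborel. 0 < y \<longrightarrow> y < L \<longrightarrow> g y x = h (y, x)"
        by eventually_elim (use x in auto)
    qed
  qed
  then have eq: "weak_sol L g = weak_sol L (\<lambda>x y. h (x, y))" by (rule weak_sol_cong_kernel)
  have "stabilizable_finite_time L g L \<longleftrightarrow> stabilizable_finite_time L (\<lambda>x y. h (x, y)) L"
    unfolding stabilizable_finite_time_def closed_loop_sol_def eq ..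
  moreover have "exactly_controllable L g L \<longleftrightarrow> exactly_controllable L (\<lambda>x y. h (x, y)) L"
    unfolding exactly_controllable_def eq ..
  ultimately show ?thesis using stabilizable_imp_controllable controllable_imp_stabilizable by blast
qed

end
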